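(* Let $(G_i)_{i\in I}$ be a family of Lie groups over a valued field $(\mathbb{K},|\cdot|)$. Then there exists a unique $\mathbb{K}$-Lie group structure on the weak direct product $$\prod_{i\in I}^{*}G_i:=\Bigl\{(g_i)_{i\in I}\in\prod_{i\in I}G_i:\ g_i=1\text{ for all but finitely many }i\Bigr\},$$ modeled on $\bigoplus_{i\in I}L(G_i)$ equipped with the box topology, such that, for certain charts $\kappa_i\colon U_i\to V_i\subseteq L(G_i)$ of $G_i$ defined on an identity neighbourhood $U_i\subseteq G_i$ and taking $1$ to $0$, the mapping $$\bigoplus_{i\in I}V_i\to\prod_{i\in I}^{*}G_i,\qquad(x_i)_{i\in I}\mapsto(\kappa_i^{-1}(x_i))_{i\in I}$$ is a diffeomorphism of smooth $\mathbb{K}$-manifolds onto an open subset of $\prod^{*}_{i\in I}G_i$.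
   Context: All topological spaces and topological vector spaces are Hausdorff. A valued field is a field with an absolute value defining a non-discrete topology. Box topology: the direct sum $\bigoplus_{i\in I}E_i$ of topological $\mathbb{K}$-vector spaces is given the vector topology for which the sets $\bigl(\bigoplus_iE_i\bigr)\cap\prod_iW_i$, with $W_i\subseteq E_i$ open zero-neighbourhoods, form a basis of zero-neighbourhoods. For open zero-neighbourhoods $V_i\subseteq E_i$, $\bigoplus_iV_i:=\bigl(\bigoplus_iE_i\bigr)\cap\prod_iV_i$, which is open. Differential calculus over $\mathbb{K}$: For a topological $\mathbb{K}$-vector space $E$ and $U\subseteq E$ open, put $U^{[0]}:=U$, $U^{[1]}:=\{(x,y,t)\in U\times E\times\mathbb{K}: x+ty\in U\}$ and $U^{[j+1]}:=(U^{[j]})^{[1]}$. A map $f\colon U\to F$ into a topological $\mathbb{K}$-vector space is $C^0_{\mathbb{K}}$ if it is continuous ($f^{[0]}:=f$); it is $C^1_{\mathbb{K}}$ if it is continuous and there is a (necessarily unique) continuous map $f^{[1]}\colon U^{[1]}\to F$ with $f^{[1]}(x,y,t)=\frac1t(f(x+ty)-f(x))$ for all $(x,y,t)\in U^{[1]}$ with $t\neq0$; for $k\ge2$ it is $C^k_{\mathbb{K}}$ if it is $C^{k-1}_{\mathbb{K}}$ and $f^{[k-1]}$ is $C^1_{\mathbb{K}}$, and then $f^{[k]}:=(f^{[k-1]})^{[1]}$; it is $C^\infty_{\mathbb{K}}$ (smooth) if it is $C^k_{\mathbb{K}}$ for all $k$. Manifolds modeled on topological $\mathbb{K}$-vector spaces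 are defined as usual via charts. A $\mathbb{K}$-Lie group is a group with a $C^\infty_{\mathbb{K}}$-manifold structure modeled on a topological $\mathbb{K}$-vector space making multiplication and inversion $C^\infty_{\mathbb{K}}$; $L(G)=T_1(G)$ is its tangent space at the identity. *)

theory Defs
  imports "HOL-Analysis.Abstract_Metric_Spaces" "HOL-Analysis.Function_Topology"
    "HOL-Algebra.Module" "HOL-Algebra.Product_Groups"
begin

section \<open>Valued fields\<close>

record 'k vfield = "'k ring" +
  absval :: "'k \<Rightarrow> real"

text \<open>Off the carrier the distance is set to 0, because the locale \<^locale>\<open>Metric_space\<close> wants a
  distance that is symmetric and nonnegative on the whole type.\<close>

definition kdist :: "'k vfield \<Rightarrow> 'k \<Rightarrow> 'k \<Rightarrow> real" where
  "kdist K x y =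
     (if x \<in> carrier K \<and> y \<in> carrier K then absval K (x \<ominus>\<^bsub>K\<^esub> y) else 0)"

definition ktop :: "'k vfield \<Rightarrow> 'k topology" where
  "ktop K = Metric_space.mtopology (carrier K) (kdist K)"

locale valued_field = Ring.field K for K :: "'k vfield" (structure) +
  assumes absval_nonneg: "x \<in> carrier K \<Longrightarrow> 0 \<le> absval K x"
    and absval_eq_0_iff: "x \<in> carrier K \<Longrightarrow> absval K x = 0 \<longleftrightarrow> x = \<zero>"
    and absval_mult:
      "\<lbrakk>x \<in> carrier K; y \<in> carrier K\<rbrakk> \<Longrightarrow> absval K (x \<otimes> y) = absval K x * absval K y"
    and absval_triangle:
      "\<lbrakk>x \<in> carrier K; y \<in> carrier K\<rbrakk> \<Longrightarrow> absval K (x \<oplus> y) \<le> absval K x + absval K y"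
    and nondiscrete: "ktop K \<noteq> discrete_topology (carrier K)"

section \<open>Topological vector spaces\<close>

text \<open>The record of modules in HOL-Algebra extends that of rings. As usual for modules, the fields
  \<^term>\<open>mult\<close> and \<^term>\<open>one\<close> are not used; the constructions below leave them undefined.\<close>

record ('k, 'e) tvs = "('k, 'e) module" +
  vtop :: "'e topology"

locale topological_vector_space =
  valued_field K + Module.module K E for K :: "'k vfield" and E :: "('k, 'e) tvs" +
  assumes topspace_vtop: "topspace (vtop E) = carrier E"
    and Hausdorff_vtop: "Hausdorff_space (vtop E)"
    and continuous_add:
      "continuous_map (prod_topology (vtop E) (vtop E)) (vtop E) (\<lambda>(x, y). x \<oplus>\<^bsub>E\<^esub> y)"
    and continuous_smult:
      "continuous_map (prod_topology (ktop K) (vtop E)) (vtop E) (\<lambda>(c, x). c \<odot>\<^bsub>E\<^esub> x)"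

definition scalar_tvs :: "'k vfield \<Rightarrow> ('k, 'k) tvs" where
  "scalar_tvs K =
     \<lparr>carrier = carrier K, mult = undefined, one = undefined,
      zero = \<zero>\<^bsub>K\<^esub>, add = (\<oplus>\<^bsub>K\<^esub>), smult = (\<otimes>\<^bsub>K\<^esub>), vtop = ktop K\<rparr>"

definition prod_tvs :: "('k, 'e) tvs \<Rightarrow> ('k, 'f) tvs \<Rightarrow> ('k, 'e \<times> 'f) tvs" where
  "prod_tvs E F =
     \<lparr>carrier = carrier E \<times> carrier F, mult = undefined, one = undefined,
      zero = (\<zero>\<^bsub>E\<^esub>, \<zero>\<^bsub>F\<^esub>),
      add = (\<lambda>(x, y) (x', y'). (x \<oplus>\<^bsub>E\<^esub> x', y \<oplus>\<^bsub>F\<^esub> y')),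
      smult = (\<lambda>c (x, y). (c \<odot>\<^bsub>E\<^esub> x, c \<odot>\<^bsub>F\<^esub> y)),
      vtop = prod_topology (vtop E) (vtop F)\<rparr>"

text \<open>Transport of structure along a map \<open>h\<close> that is injective on the whole type.\<close>

definition image_tvs :: "('e \<Rightarrow> 'f) \<Rightarrow> ('k, 'e) tvs \<Rightarrow> ('k, 'f) tvs" where
  "image_tvs h E =
     \<lparr>carrier = h ` carrier E, mult = undefined, one = undefined,
      zero = h \<zero>\<^bsub>E\<^esub>,
      add = (\<lambda>x y. h (inv_into UNIV h x \<oplus>\<^bsub>E\<^esub> inv_into UNIV h y)),
      smult = (\<lambda>c x. h (c \<odot>\<^bsub>E\<^esub> inv_into UNIV h x)),
      vtop = pullback_topology (h ` carrier E) (inv_into UNIV h) (vtop E)\<rparr>"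

text \<open>Direct sum with the box topology: the translation-invariant topology for which the sets
  \<open>(\<Oplus>\<^sub>i E\<^sub>i) \<inter> (\<Prod>\<^sub>i W\<^sub>i)\<close>, with \<open>W\<^sub>i\<close> open zero-neighbourhoods, are a basis of
  zero-neighbourhoods.\<close>

definition sum_carrier :: "'i set \<Rightarrow> ('i \<Rightarrow> ('k, 'e) tvs) \<Rightarrow> ('i \<Rightarrow> 'e) set" where
  "sum_carrier I E =
     {x \<in> \<Pi>\<^sub>E i\<in>I. carrier (E i). finite {i \<in> I. x i \<noteq> \<zero>\<^bsub>E i\<^esub>}}"

definition sum_add :: "'i set \<Rightarrow> ('i \<Rightarrow> ('k, 'e) tvs) \<Rightarrow> ('i \<Rightarrow> 'e) \<Rightarrow> ('i \<Rightarrow> 'e) \<Rightarrow> 'i \<Rightarrow> 'e" where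
  "sum_add I E x y = (\<lambda>i\<in>I. x i \<oplus>\<^bsub>E i\<^esub> y i)"

definition box_topology :: "'i set \<Rightarrow> ('i \<Rightarrow> ('k, 'e) tvs) \<Rightarrow> ('i \<Rightarrow> 'e) topology" where
  "box_topology I E = topology (\<lambda>X.
     X \<subseteq> sum_carrier I E \<and>
     (\<forall>x\<in>X. \<exists>W. (\<forall>i\<in>I. openin (vtop (E i)) (W i) \<and> \<zero>\<^bsub>E i\<^esub> \<in> W i) \<and>
        (\<forall>y \<in> sum_carrier I E \<inter> (\<Pi>\<^sub>E i\<in>I. W i). sum_add I E x y \<in> X)))"

definition box_sum :: "'i set \<Rightarrow> ('i \<Rightarrow> ('k, 'e) tvs) \<Rightarrow> ('k, 'i \<Rightarrow> 'e) tvs" where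
  "box_sum I E =
     \<lparr>carrier = sum_carrier I E, mult = undefined, one = undefined,
      zero = (\<lambda>i\<in>I. \<zero>\<^bsub>E i\<^esub>),
      add = sum_add I E,
      smult = (\<lambda>c x. \<lambda>i\<in>I. c \<odot>\<^bsub>E i\<^esub> x i),
      vtop = box_topology I E\<rparr>"

section \<open>Differential calculus\<close>

definition dq_dom :: "'k vfield \<Rightarrow> ('k, 'e) tvs \<Rightarrow> 'e set \<Rightarrow> ('e \<times> 'e \<times> 'k) set" where
  "dq_dom K E U =
     {(x, y, t). x \<in> U \<and> y \<in> carrier E \<and> t \<in> carrier K \<and> x \<oplus>\<^bsub>E\<^esub> t \<odot>\<^bsub>E\<^esub> y \<in> U}"

definition is_dq :: "'k vfield \<Rightarrow> ('k, 'e) tvs \<Rightarrow> ('k, 'f) tvs \<Rightarrow> 'e set \<Rightarrow> ('e \<Rightarrow> 'f)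
    \<Rightarrow> ('e \<times> 'e \<times> 'k \<Rightarrow> 'f) \<Rightarrow> bool" where
  "is_dq K E F U f g \<longleftrightarrow>
     continuous_map
       (subtopology (vtop (prod_tvs E (prod_tvs E (scalar_tvs K)))) (dq_dom K E U)) (vtop F) g \<and>
     (\<forall>(x, y, t) \<in> dq_dom K E U. t \<noteq> \<zero>\<^bsub>K\<^esub> \<longrightarrow>
        g (x, y, t) = inv\<^bsub>K\<^esub> t \<odot>\<^bsub>F\<^esub> (f (x \<oplus>\<^bsub>E\<^esub> t \<odot>\<^bsub>E\<^esub> y) \<ominus>\<^bsub>F\<^esub> f x))"

definition C1_on :: "'k vfield \<Rightarrow> ('k, 'e) tvs \<Rightarrow> ('k, 'f) tvs \<Rightarrow> 'e set \<Rightarrow> ('e \<Rightarrow> 'f) \<Rightarrow> bool" where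
  "C1_on K E F U f \<longleftrightarrow>
     continuous_map (subtopology (vtop E) U) (vtop F) f \<and> (\<exists>g. is_dq K E F U f g)"

text \<open>If \<open>f\<close> is \<open>C\<^sup>1\<close> on an open set \<open>U\<close>, this is \<open>f\<^sup>[\<^sup>1\<^sup>]\<close>; it is unique on \<^term>\<open>dq_dom K E U\<close>
  and arbitrary elsewhere.\<close>

definition dq :: "'k vfield \<Rightarrow> ('k, 'e) tvs \<Rightarrow> ('k, 'f) tvs \<Rightarrow> 'e set \<Rightarrow> ('e \<Rightarrow> 'f)
    \<Rightarrow> 'e \<times> 'e \<times> 'k \<Rightarrow> 'f" where
  "dq K E F U f = (SOME g. is_dq K E F U f g)"

text \<open>The iterated domains \<open>U\<^sup>[\<^sup>j\<^sup>]\<close> live in the spaces \<open>E\<^sup>[\<^sup>j\<^sup>]\<close> with \<open>E\<^sup>[\<^sup>0\<^sup>] = E\<close> and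
  \<open>E\<^sup>[\<^sup>j\<^sup>+\<^sup>1\<^sup>] = E\<^sup>[\<^sup>j\<^sup>] \<times> E\<^sup>[\<^sup>j\<^sup>] \<times> K\<close>. To have all of them in one type, points of
  \<open>E\<^sup>[\<^sup>j\<^sup>]\<close> are written as trees of depth \<open>j\<close>, where \<open>Base x\<close> stands for \<open>x\<close> and \<open>Br x y t\<close> for
  \<open>(x, y, t)\<close>.\<close>

datatype ('e, 'k) itree = Base 'e | Br "('e, 'k) itree" "('e, 'k) itree" 'k

primrec iter_tvs :: "'k vfield \<Rightarrow> ('k, 'e) tvs \<Rightarrow> nat \<Rightarrow> ('k, ('e, 'k) itree) tvs" where
  "iter_tvs K E 0 = image_tvs Base E"
| "iter_tvs K E (Suc j) =
     image_tvs (\<lambda>(x, y, t). Br x y t)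
       (prod_tvs (iter_tvs K E j) (prod_tvs (iter_tvs K E j) (scalar_tvs K)))"

primrec iter_dom :: "'k vfield \<Rightarrow> ('k, 'e) tvs \<Rightarrow> 'e set \<Rightarrow> nat \<Rightarrow> ('e, 'k) itree set" where
  "iter_dom K E U 0 = Base ` U"
| "iter_dom K E U (Suc j) =
     (\<lambda>(x, y, t). Br x y t) ` dq_dom K (iter_tvs K E j) (iter_dom K E U j)"

text \<open>\<^term>\<open>iter_dq K E F U f j\<close> is \<open>f\<^sup>[\<^sup>j\<^sup>]\<close>.\<close>

primrec iter_dq :: "'k vfield \<Rightarrow> ('k, 'e) tvs \<Rightarrow> ('k, 'f) tvs \<Rightarrow> 'e set \<Rightarrow> ('e \<Rightarrow> 'f)
    \<Rightarrow> nat \<Rightarrow> ('e, 'k) itree \<Rightarrow> 'f" where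
  "iter_dq K E F U f 0 = (\<lambda>p. case p of Base x \<Rightarrow> f x | Br _ _ _ \<Rightarrow> undefined)"
| "iter_dq K E F U f (Suc j) = (\<lambda>p. case p of
       Base _ \<Rightarrow> undefined
     | Br x y t \<Rightarrow>
         dq K (iter_tvs K E j) F (iter_dom K E U j) (iter_dq K E F U f j) (x, y, t))"

primrec Ck_on :: "'k vfield \<Rightarrow> ('k, 'e) tvs \<Rightarrow> ('k, 'f) tvs \<Rightarrow> 'e set \<Rightarrow> ('e \<Rightarrow> 'f)
    \<Rightarrow> nat \<Rightarrow> bool" where
  "Ck_on K E F U f 0 \<longleftrightarrow> continuous_map (subtopology (vtop E) U) (vtop F) f"
| "Ck_on K E F U f (Suc k) \<longleftrightarrow>
     Ck_on K E F U f k \<and>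
     C1_on K (iter_tvs K E k) F (iter_dom K E U k) (iter_dq K E F U f k)"

definition smooth_on :: "'k vfield \<Rightarrow> ('k, 'e) tvs \<Rightarrow> ('k, 'f) tvs \<Rightarrow> 'e set \<Rightarrow> ('e \<Rightarrow> 'f) \<Rightarrow> bool"
  where
  "smooth_on K E F U f \<longleftrightarrow> openin (vtop E) U \<and> (\<forall>k. Ck_on K E F U f k)"

section \<open>Manifolds\<close>

text \<open>A chart is a pair of its domain and a map which is \<^term>\<open>undefined\<close> off the domain. Smooth
  structures are maximal atlases, so that equality of records is equality of manifold
  structures.\<close>

type_synonym ('m, 'e) chart = "'m set \<times> ('m \<Rightarrow> 'e)"

record ('m, 'e) mfd =
  mtop :: "'m topology"
  atlas :: "('m, 'e) chart set"

definition top_chart :: "('k, 'e) tvs \<Rightarrow> 'm topology \<Rightarrow> ('m, 'e) chart \<Rightarrow> bool" where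
  "top_chart E T = (\<lambda>(U, \<phi>).
     openin T U \<and> \<phi> \<in> extensional U \<and> openin (vtop E) (\<phi> ` U) \<and>
     homeomorphic_map (subtopology T U) (subtopology (vtop E) (\<phi> ` U)) \<phi>)"

definition transition :: "('m, 'e) chart \<Rightarrow> ('m, 'e) chart \<Rightarrow> 'e \<Rightarrow> 'e" where
  "transition c d = snd d \<circ> inv_into (fst c) (snd c)"

definition transition_dom :: "('m, 'e) chart \<Rightarrow> ('m, 'e) chart \<Rightarrow> 'e set" where
  "transition_dom c d = snd c ` (fst c \<inter> fst d)"

definition compatible :: "'k vfield \<Rightarrow> ('k, 'e) tvs \<Rightarrow> ('m, 'e) chart \<Rightarrow> ('m, 'e) chart \<Rightarrow> bool" where
  "compatible K E c d \<longleftrightarrow>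
     smooth_on K E E (transition_dom c d) (transition c d) \<and>
     smooth_on K E E (transition_dom d c) (transition d c)"

definition max_atlas :: "'k vfield \<Rightarrow> ('k, 'e) tvs \<Rightarrow> 'm topology \<Rightarrow> ('m, 'e) chart set
    \<Rightarrow> ('m, 'e) chart set" where
  "max_atlas K E T A = {c. top_chart E T c \<and> (\<forall>d\<in>A. compatible K E c d)}"

definition manifold :: "'k vfield \<Rightarrow> ('k, 'e) tvs \<Rightarrow> ('m, 'e) mfd \<Rightarrow> bool" where
  "manifold K E M \<longleftrightarrow>
     topological_vector_space K E \<and>
     Hausdorff_space (mtop M) \<and>
     (\<Union>c\<in>atlas M. fst c) = topspace (mtop M) \<and>
     atlas M = max_atlas K E (mtop M) (atlas M)"

definition smooth_map :: "'k vfield \<Rightarrow> ('k, 'e) tvs \<Rightarrow> ('m, 'e) mfd \<Rightarrow> ('k, 'f) tvs \<Rightarrow> ('n, 'f) mfd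
    \<Rightarrow> ('m \<Rightarrow> 'n) \<Rightarrow> bool" where
  "smooth_map K E M F N f \<longleftrightarrow>
     continuous_map (mtop M) (mtop N) f \<and>
     (\<forall>(U, \<phi>) \<in> atlas M. \<forall>(V, \<psi>) \<in> atlas N.
        smooth_on K E F (\<phi> ` (U \<inter> f -` V)) (\<psi> \<circ> f \<circ> inv_into U \<phi>))"

definition diffeomorphism :: "'k vfield \<Rightarrow> ('k, 'e) tvs \<Rightarrow> ('m, 'e) mfd \<Rightarrow> ('k, 'f) tvs
    \<Rightarrow> ('n, 'f) mfd \<Rightarrow> ('m \<Rightarrow> 'n) \<Rightarrow> bool" where
  "diffeomorphism K E M F N f \<longleftrightarrow>
     bij_betw f (topspace (mtop M)) (topspace (mtop N)) \<and>
     smooth_map K E M F N f \<and>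
     smooth_map K F N E M (inv_into (topspace (mtop M)) f)"

definition open_submfd :: "('m, 'e) mfd \<Rightarrow> 'm set \<Rightarrow> ('m, 'e) mfd" where
  "open_submfd M W = \<lparr>mtop = subtopology (mtop M) W, atlas = {c \<in> atlas M. fst c \<subseteq> W}\<rparr>"

definition tvs_mfd :: "'k vfield \<Rightarrow> ('k, 'e) tvs \<Rightarrow> ('e, 'e) mfd" where
  "tvs_mfd K E =
     \<lparr>mtop = vtop E,
      atlas = max_atlas K E (vtop E) {(carrier E, \<lambda>x\<in>carrier E. x)}\<rparr>"

text \<open>The product, modeled on \<^term>\<open>prod_tvs E F\<close>.\<close>

definition prod_mfd :: "'k vfield \<Rightarrow> ('k, 'e) tvs \<Rightarrow> ('m, 'e) mfd \<Rightarrow> ('k, 'f) tvs \<Rightarrow> ('n, 'f) mfd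
    \<Rightarrow> ('m \<times> 'n, 'e \<times> 'f) mfd" where
  "prod_mfd K E M F N =
     \<lparr>mtop = prod_topology (mtop M) (mtop N),
      atlas = max_atlas K (prod_tvs E F) (prod_topology (mtop M) (mtop N))
        {(U \<times> V, \<lambda>(x, y)\<in>U \<times> V. (\<phi> x, \<psi> y)) | U \<phi> V \<psi>. (U, \<phi>) \<in> atlas M \<and> (V, \<psi>) \<in> atlas N}\<rparr>"

text \<open>A tangent vector at \<open>p\<close> is a family of vectors of \<open>E\<close>, indexed by the charts around \<open>p\<close>,
  which transforms by the differentials \<open>dh(x, y) = h\<^sup>[\<^sup>1\<^sup>](x, y, 0)\<close> of the transition maps \<open>h\<close>.
  The evaluation at each single chart is a bijection onto \<open>E\<close>. The vector space structure and the
  topology are those which make all evaluations isomorphisms of topological vector spaces: since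
  the differentials are, the initial topology for all evaluations is the one for any single
  evaluation.\<close>

type_synonym ('m, 'e) tangent = "('m, 'e) chart \<Rightarrow> 'e"

definition charts_at :: "('m, 'e) mfd \<Rightarrow> 'm \<Rightarrow> ('m, 'e) chart set" where
  "charts_at M p = {c \<in> atlas M. p \<in> fst c}"

definition tangent_carrier :: "'k vfield \<Rightarrow> ('k, 'e) tvs \<Rightarrow> ('m, 'e) mfd \<Rightarrow> 'm
    \<Rightarrow> ('m, 'e) tangent set" where
  "tangent_carrier K E M p =
     {v \<in> charts_at M p \<rightarrow>\<^sub>E carrier E.
        \<forall>c\<in>charts_at M p. \<forall>d\<in>charts_at M p.
          v d = dq K E E (transition_dom c d) (transition c d) (snd c p, v c, \<zero>\<^bsub>K\<^esub>)}"

definition tangent_space :: "'k vfield \<Rightarrow> ('k, 'e) tvs \<Rightarrow> ('m, 'e) mfd \<Rightarrow> 'm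
    \<Rightarrow> ('k, ('m, 'e) tangent) tvs" where
  "tangent_space K E M p =
     \<lparr>carrier = tangent_carrier K E M p, mult = undefined, one = undefined,
      zero = (\<lambda>c\<in>charts_at M p. \<zero>\<^bsub>E\<^esub>),
      add = (\<lambda>v w. \<lambda>c\<in>charts_at M p. v c \<oplus>\<^bsub>E\<^esub> w c),
      smult = (\<lambda>a v. \<lambda>c\<in>charts_at M p. a \<odot>\<^bsub>E\<^esub> v c),
      vtop = subtopology (product_topology (\<lambda>c. vtop E) (charts_at M p)) (tangent_carrier K E M p)\<rparr>"

section \<open>Lie groups\<close>

text \<open>\<open>lie_group K E G M\<close>: \<open>M\<close> is a Lie group structure on the group \<open>G\<close>, modeled on \<open>E\<close>.\<close>

definition lie_group :: "'k vfield \<Rightarrow> ('k, 'e) tvs \<Rightarrow> 'g monoid \<Rightarrow> ('g, 'e) mfd \<Rightarrow> bool" where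
  "lie_group K E G M \<longleftrightarrow>
     group G \<and> manifold K E M \<and> topspace (mtop M) = carrier G \<and>
     smooth_map K (prod_tvs E E) (prod_mfd K E M E M) E M (\<lambda>(x, y). x \<otimes>\<^bsub>G\<^esub> y) \<and>
     smooth_map K E M E M (\<lambda>x. inv\<^bsub>G\<^esub> x)"

definition lie_alg :: "'k vfield \<Rightarrow> ('k, 'e) tvs \<Rightarrow> 'g monoid \<Rightarrow> ('g, 'e) mfd
    \<Rightarrow> ('k, ('g, 'e) tangent) tvs" where
  "lie_alg K E G M = tangent_space K E M \<one>\<^bsub>G\<^esub>"

text \<open>A chart \<open>\<kappa>: U \<rightarrow> V\<close> of \<open>M\<close> with values in an open subset \<open>V\<close> of a space \<open>L\<close> which need not
  be the modeling space \<open>E\<close> itself (but is isomorphic to it, such as a tangent space).\<close>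

definition chart_into :: "'k vfield \<Rightarrow> ('k, 'e) tvs \<Rightarrow> ('m, 'e) mfd \<Rightarrow> ('k, 'l) tvs
    \<Rightarrow> 'm set \<Rightarrow> 'l set \<Rightarrow> ('m \<Rightarrow> 'l) \<Rightarrow> bool" where
  "chart_into K E M L U V \<kappa> \<longleftrightarrow>
     openin (mtop M) U \<and> openin (vtop L) V \<and>
     diffeomorphism K E (open_submfd M U) L (open_submfd (tvs_mfd K L) V) \<kappa>"

end

theory Submission
  imports Defs
begin

text \<open>The key fact is that a box sum of smooth maps \<open>f\<^sub>i\<close> with \<open>f\<^sub>i 0 = 0\<close> for almost all \<open>i\<close> is smooth
  for the box topology. A point of the sum has zero components at almost all \<open>i\<close>, where continuity is needed
  only at \<open>0\<close>, but the scalars in the iterated difference quotients are common to all \<open>i\<close> and need not be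
  small. The homogeneity of difference quotients allows one to shrink them by factors which depend on \<open>i\<close>.
  Consequently the box sums of charts, almost all of which take \<open>1\<close> to \<open>0\<close>, form a smooth atlas, and in
  these charts the group operations are box sums of the operations of the groups \<open>G\<^sub>i\<close>. Box sums of two
  families of charts around the identities differ by a box sum of transition maps, so that the
  requirement determines the structure near the identity and, by translations, everywhere.\<close>

section \<open>Valued fields and topological vector spaces\<close>

text \<open>The iterated domain \<open>U^[k]\<close> of a box sum is not the box sum of the domains
  \<open>U_i^[k]\<close>, so an induction over difference quotients cannot stay among box sums. It
  runs in the larger class \<open>box_map\<close>: the argument lies in a space with linear
  projections onto the factors, and component \<open>i\<close> of the value depends on the
  projection to factor \<open>i\<close> alone. A member of this class carries a supply of rescalings
  under which its components are homogeneous, and this supply makes it continuous. The class is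
  closed under difference quotients. To exploit this, smoothness needs a matching principle of
  coinduction, over spaces that vary while their type does not; hence the encoding of all stages by
  trees. The other choice that shapes the proof is to work with germs. Box charts around two group
  elements and around their product agree at almost all indices only if they are chosen together, so
  the group operations are examined near one point at a time, and smoothness of maps between
  manifolds is recast as a property \<open>sat\<close> of each point.\<close>

lemma (in valued_field) absval_zero [simp]: "absval K \<zero> = 0"
  by (simp add: absval_eq_0_iff)

lemma (in valued_field) absval_pos: "x \<in> carrier K \<Longrightarrow> x \<noteq> \<zero> \<Longrightarrow> 0 < absval K x"
  using absval_nonneg absval_eq_0_iff by (metis order_le_less)

lemma (in valued_field) absval_one [simp]: "absval K \<one> = 1"
proof -
  have "absval K \<one> * absval K \<one> = absval K \<one>" using absval_mult[of \<one> \<one>] by simp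
  then show ?thesis using absval_pos[of \<one>] one_not_zero by simp
qed

text \<open>\<open>\<ominus> \<one>\<close> squares to \<open>\<one>\<close>, so its absolute value
  is a nonnegative square root of 1; multiplicativity does the rest.\<close>

lemma (in valued_field) absval_minus [simp]:
  assumes "x \<in> carrier K" shows "absval K (\<ominus> x) = absval K x"
proof -
  have "absval K (\<ominus> \<one>) * absval K (\<ominus> \<one>) = 1"
    using absval_mult[of "\<ominus> \<one>" "\<ominus> \<one>"] by (simp add: l_minus)
  then have "absval K (\<ominus> \<one>) = 1"
    using absval_nonneg[of "\<ominus> \<one>"] by (simp add: square_eq_1_iff)
  then show ?thesis using absval_mult[of "\<ominus> \<one>" x] assms by (simp add: l_minus)
qed

lemma (in valued_field) absval_inv:
  assumes "x \<in> carrier K" "x \<noteq> \<zero>" shows "absval K (inv x) = 1 / absval K x"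
proof -
  have "x \<in> Units K" using assms by (simp add: field_Units)
  then have "absval K x * absval K (inv x) = 1" using absval_mult[of x "inv x"] assms by simp
  moreover have "absval K x \<noteq> 0" using assms absval_eq_0_iff by simp
  ultimately show ?thesis by (simp add: field_simps)
qed

lemma (in valued_field) inv_closed0 [simp]: "x \<in> carrier K \<Longrightarrow> x \<noteq> \<zero> \<Longrightarrow> inv x \<in> carrier K"
  by (simp add: field_Units)

lemma (in valued_field) r_inv0 [simp]: "x \<in> carrier K \<Longrightarrow> x \<noteq> \<zero> \<Longrightarrow> x \<otimes> inv x = \<one>"
  by (simp add: field_Units)

lemma (in valued_field) l_inv0 [simp]: "x \<in> carrier K \<Longrightarrow> x \<noteq> \<zero> \<Longrightarrow> inv x \<otimes> x = \<one>"
  by (simp add: field_Units)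

lemma (in valued_field) mult_nonzero:
  "x \<in> carrier K \<Longrightarrow> x \<noteq> \<zero> \<Longrightarrow> y \<in> carrier K \<Longrightarrow> y \<noteq> \<zero> \<Longrightarrow> x \<otimes> y \<noteq> \<zero>"
  using integral by blast

lemma (in valued_field) inv_unique0:
  assumes "x \<in> carrier K" "y \<in> carrier K" "x \<otimes> y = \<one>" shows "inv x = y"
  using assms by (metis comm_inv_char)

lemma (in valued_field) minus_eq_0_iff:
  "x \<in> carrier K \<Longrightarrow> y \<in> carrier K \<Longrightarrow> x \<ominus> y = \<zero> \<longleftrightarrow> x = y"
proof
  assume xy: "x \<in> carrier K" "y \<in> carrier K" and e: "x \<ominus> y = \<zero>"
  have "x = (x \<ominus> y) \<oplus> y" using xy by algebra
  then show "x = y" using e xy by simp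
next
  assume xy: "x \<in> carrier K" "y \<in> carrier K" and e: "x = y"
  show "x \<ominus> y = \<zero>" unfolding e using xy by algebra
qed

section \<open>The absolute value as a metric, and limits at the scalar zero\<close>

sublocale valued_field \<subseteq> kmetric: Metric_space "carrier K" "kdist K"
proof
  fix x y z
  show "0 \<le> kdist K x y" by (simp add: kdist_def absval_nonneg)
  show "kdist K x y = kdist K y x"
  proof (cases "x \<in> carrier K \<and> y \<in> carrier K")
    case True
    then have "x \<ominus> y = \<ominus> (y \<ominus> x)" by algebra
    then show ?thesis using True by (simp add: kdist_def)
  qed (auto simp: kdist_def)
  assume xy: "x \<in> carrier K" "y \<in> carrier K"
  show "kdist K x y = 0 \<longleftrightarrow> x = y" using xy
    by (simp add: kdist_def absval_eq_0_iff minus_eq_0_iff)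
  assume z: "z \<in> carrier K"
  have "x \<ominus> z = (x \<ominus> y) \<oplus> (y \<ominus> z)" using xy z by algebra
  then show "kdist K x z \<le> kdist K x y + kdist K y z"
    using xy z by (simp add: kdist_def absval_triangle)
qed

context valued_field begin

lemma topspace_ktop [simp]: "topspace (ktop K) = carrier K"
  by (simp add: ktop_def)

lemma openin_ktop:
  "openin (ktop K) S \<longleftrightarrow> S \<subseteq> carrier K \<and>
     (\<forall>x\<in>S. \<exists>r>0. \<forall>y\<in>carrier K. absval K (y \<ominus> x) < r \<longrightarrow> y \<in> S)"
proof -
  have "kmetric.mball x r \<subseteq> S \<longleftrightarrow> (\<forall>y\<in>carrier K. absval K (y \<ominus> x) < r \<longrightarrow> y \<in> S)"
    if "x \<in> carrier K" for x r
  proof -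
    have "kdist K x y = absval K (y \<ominus> x)" if "y \<in> carrier K" for y
      using \<open>x \<in> carrier K\<close> that kmetric.commute[of x y] by (simp add: kdist_def)
    with that show ?thesis by (auto simp: kmetric.mball_def)
  qed
  then show ?thesis unfolding ktop_def kmetric.openin_mtopology by (meson subset_eq)
qed

lemma openin_kball: "openin (ktop K) {t \<in> carrier K. absval K t < r}"
  unfolding openin_ktop
proof (intro conjI ballI)
  fix x assume x: "x \<in> {t \<in> carrier K. absval K t < r}"
  show "\<exists>e>0. \<forall>y\<in>carrier K. absval K (y \<ominus> x) < e \<longrightarrow> y \<in> {t \<in> carrier K. absval K t < r}"
  proof (intro exI[of _ "r - absval K x"] conjI ballI impI)
    show "0 < r - absval K x" using x by simp
    fix y assume y: "y \<in> carrier K" "absval K (y \<ominus> x) < r - absval K x"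
    have xc: "x \<in> carrier K" using x by simp
    then have "y = (y \<ominus> x) \<oplus> x" using y by algebra
    moreover have "absval K ((y \<ominus> x) \<oplus> x) \<le> absval K (y \<ominus> x) + absval K x"
      using xc y by (simp add: absval_triangle)
    ultimately have "absval K y \<le> absval K (y \<ominus> x) + absval K x" by simp
    then show "y \<in> {t \<in> carrier K. absval K t < r}" using y by simp
  qed
qed auto

lemma continuous_into_ktop:
  "continuous_map Z (ktop K) f \<longleftrightarrow> f \<in> topspace Z \<rightarrow> carrier K \<and>
     (\<forall>z\<in>topspace Z. \<forall>e>0. \<exists>A. openin Z A \<and> z \<in> A \<and> (\<forall>a\<in>A. absval K (f a \<ominus> f z) < e))"
proof -
  have mb: "f a \<in> kmetric.mball (f z) e \<longleftrightarrow> absval K (f a \<ominus> f z) < e"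
    if "f a \<in> carrier K" "f z \<in> carrier K" for a z e
    using that kmetric.commute[of "f z" "f a"] by (simp add: kmetric.mball_def kdist_def)
  show ?thesis
    unfolding ktop_def kmetric.continuous_map_to_metric
  proof (intro iffI conjI ballI allI impI)
    assume *: "\<forall>x\<in>topspace Z. \<forall>e>0. \<exists>U. openin Z U \<and> x \<in> U \<and> (\<forall>y\<in>U. f y \<in> kmetric.mball (f x) e)"
    show f: "f \<in> topspace Z \<rightarrow> carrier K"
    proof
      fix x assume "x \<in> topspace Z"
      then obtain A where "x \<in> A" "\<forall>a\<in>A. f a \<in> kmetric.mball (f x) 1"
        using *[rule_format, of x 1] by auto
      then show "f x \<in> carrier K" unfolding kmetric.mball_def by auto
    qed
    fix z and e :: real assume "z \<in> topspace Z" "e > 0"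
    then obtain A where A: "openin Z A" "z \<in> A" "\<forall>a\<in>A. f a \<in> kmetric.mball (f z) e"
      using *[rule_format, of z e] by auto
    moreover have "A \<subseteq> topspace Z" using A(1) openin_subset by blast
    ultimately have "absval K (f a \<ominus> f z) < e" if "a \<in> A" for a
      using mb[of a z e] f \<open>z \<in> topspace Z\<close> that by (auto simp: Pi_iff)
    with A show "\<exists>A. openin Z A \<and> z \<in> A \<and> (\<forall>a\<in>A. absval K (f a \<ominus> f z) < e)" by auto
  next
    assume *: "f \<in> topspace Z \<rightarrow> carrier K \<and>
     (\<forall>z\<in>topspace Z. \<forall>e>0. \<exists>A. openin Z A \<and> z \<in> A \<and> (\<forall>a\<in>A. absval K (f a \<ominus> f z) < e))"
    fix z and e :: real assume "z \<in> topspace Z" "e > 0"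
    then obtain A where A: "openin Z A" "z \<in> A" "\<forall>a\<in>A. absval K (f a \<ominus> f z) < e"
      using *[THEN conjunct2, rule_format, of z e] by auto
    moreover have "A \<subseteq> topspace Z" using A(1) openin_subset by blast
    ultimately have "f a \<in> kmetric.mball (f z) e" if "a \<in> A" for a
      using mb[of a z e] *[THEN conjunct1] \<open>z \<in> topspace Z\<close> that by (auto simp: Pi_iff)
    with A show "\<exists>U. openin Z U \<and> z \<in> U \<and> (\<forall>y\<in>U. f y \<in> kmetric.mball (f z) e)" by auto
  qed
qed

text \<open>If all nonzero scalars had absolute value at least \<open>e\<close>, every ball of
  radius \<open>e\<close> would be a single point and the topology discrete. Nondiscreteness enters
  only here; the limits \<open>t \<rightarrow> \<zero>\<close> and the shrinking of scalars below
  both rest on it.\<close>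

lemma small_scalar:
  assumes "0 < e" obtains s where "s \<in> carrier K" "s \<noteq> \<zero>" "absval K s < e"
proof -
  have "\<exists>s\<in>carrier K. s \<noteq> \<zero> \<and> absval K s < e"
  proof (rule ccontr)
    assume n: "\<not> ?thesis"
    have "openin (ktop K) S" if S: "S \<subseteq> carrier K" for S
      unfolding openin_ktop
    proof (intro conjI ballI S)
      fix x assume x: "x \<in> S"
      show "\<exists>r>0. \<forall>y\<in>carrier K. absval K (y \<ominus> x) < r \<longrightarrow> y \<in> S"
      proof (intro exI[of _ e] conjI ballI impI assms)
        fix y assume "y \<in> carrier K" "absval K (y \<ominus> x) < e"
        then have "y \<ominus> x = \<zero>" using n x S by auto
        then show "y \<in> S" using x S \<open>y \<in> carrier K\<close> minus_eq_0_iff by auto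
      qed
    qed
    then have "ktop K = discrete_topology (carrier K)"
      unfolding topology_eq openin_discrete_topology using openin_subset[of "ktop K"] by auto
    then show False using nondiscrete by simp
  qed
  then show ?thesis using that by blast
qed

lemma kcont_add:
  assumes "continuous_map Z (ktop K) f" "continuous_map Z (ktop K) g"
  shows "continuous_map Z (ktop K) (\<lambda>z. f z \<oplus> g z)"
  unfolding continuous_into_ktop
proof (intro conjI ballI allI impI)
  have fg: "f \<in> topspace Z \<rightarrow> carrier K" "g \<in> topspace Z \<rightarrow> carrier K"
    using assms by (auto simp: continuous_map_def)
  then show "(\<lambda>z. f z \<oplus> g z) \<in> topspace Z \<rightarrow> carrier K" by auto
  fix z and e :: real assume z: "z \<in> topspace Z" and e: "e > 0"
  then have "e/2 > 0" by simp
  then obtain A B where A: "openin Z A" "z \<in> A" "\<forall>a\<in>A. absval K (f a \<ominus> f z) < e/2"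
    and B: "openin Z B" "z \<in> B" "\<forall>a\<in>B. absval K (g a \<ominus> g z) < e/2"
    using assms z unfolding continuous_into_ktop by meson
  show "\<exists>A. openin Z A \<and> z \<in> A \<and> (\<forall>a\<in>A. absval K ((f a \<oplus> g a) \<ominus> (f z \<oplus> g z)) < e)"
  proof (intro exI[of _ "A \<inter> B"] conjI ballI)
    fix a assume a: "a \<in> A \<inter> B"
    then have "a \<in> topspace Z" using A openin_subset by blast
    then have c: "f a \<in> carrier K" "f z \<in> carrier K" "g a \<in> carrier K" "g z \<in> carrier K"
      using fg z by auto
    have "(f a \<oplus> g a) \<ominus> (f z \<oplus> g z) = (f a \<ominus> f z) \<oplus> (g a \<ominus> g z)" using c by algebra
    then have "absval K ((f a \<oplus> g a) \<ominus> (f z \<oplus> g z)) \<le> absval K (f a \<ominus> f z) + absval K (g a \<ominus> g z)"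
      using c by (simp add: absval_triangle)
    also have "\<dots> < e" using a A(3) B(3) by force
    finally show "absval K ((f a \<oplus> g a) \<ominus> (f z \<oplus> g z)) < e" .
  qed (use A B in auto)
qed

lemma kcont_mult:
  assumes "continuous_map Z (ktop K) f" "continuous_map Z (ktop K) g"
  shows "continuous_map Z (ktop K) (\<lambda>z. f z \<otimes> g z)"
  unfolding continuous_into_ktop
proof (intro conjI ballI allI impI)
  have fg: "f \<in> topspace Z \<rightarrow> carrier K" "g \<in> topspace Z \<rightarrow> carrier K"
    using assms by (auto simp: continuous_map_def)
  then show "(\<lambda>z. f z \<otimes> g z) \<in> topspace Z \<rightarrow> carrier K" by auto
  fix z and e :: real assume z: "z \<in> topspace Z" and e: "e > 0"
  \<comment> \<open>For increments \<open>u\<close> and \<open>v\<close> below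
    \<open>d \<le> 1\<close>, the terms \<open>u v\<close>, \<open>u (g z)\<close> and
    \<open>(f z) v\<close> add up to at most \<open>M d\<close>; the summand 1 of \<open>M\<close>
    covers the first of them.\<close>
  define M where "M = absval K (f z) + absval K (g z) + 1"
  have c0: "f z \<in> carrier K" "g z \<in> carrier K" using fg z by auto
  have M: "M \<ge> 1" using absval_nonneg c0 by (simp add: M_def)
  define d where "d = min 1 (e / (2*M))"
  have d: "d > 0" "d \<le> 1" "d \<le> e / (2*M)" using M e by (auto simp: d_def)
  then have "M * d \<le> M * (e / (2*M))" using M by (intro mult_left_mono) auto
  then have d3: "M * d \<le> e/2" using M by simp
  obtain A B where A: "openin Z A" "z \<in> A" "\<forall>a\<in>A. absval K (f a \<ominus> f z) < d"
    and B: "openin Z B" "z \<in> B" "\<forall>a\<in>B. absval K (g a \<ominus> g z) < d"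
    using assms z d(1) unfolding continuous_into_ktop by meson
  show "\<exists>A. openin Z A \<and> z \<in> A \<and> (\<forall>a\<in>A. absval K ((f a \<otimes> g a) \<ominus> (f z \<otimes> g z)) < e)"
  proof (intro exI[of _ "A \<inter> B"] conjI ballI)
    fix a assume a: "a \<in> A \<inter> B"
    then have "a \<in> topspace Z" using A openin_subset by blast
    then have c: "f a \<in> carrier K" "g a \<in> carrier K" using fg z by auto
    define u v where "u = f a \<ominus> f z" and "v = g a \<ominus> g z"
    have uv: "u \<in> carrier K" "v \<in> carrier K" "absval K u < d" "absval K v < d"
      using c c0 a A(3) B(3) by (auto simp: u_def v_def)
    have "(f a \<otimes> g a) \<ominus> (f z \<otimes> g z) = u \<otimes> v \<oplus> (u \<otimes> g z \<oplus> f z \<otimes> v)"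
      unfolding u_def v_def using c c0 by algebra
    then have "absval K ((f a \<otimes> g a) \<ominus> (f z \<otimes> g z)) \<le> absval K (u \<otimes> v) + absval K (u \<otimes> g z \<oplus> f z \<otimes> v)"
      using uv c0 by (simp add: absval_triangle)
    also have "\<dots> \<le> absval K (u \<otimes> v) + (absval K (u \<otimes> g z) + absval K (f z \<otimes> v))"
      using uv c0 by (simp add: absval_triangle)
    also have "\<dots> = absval K u * absval K v + (absval K u * absval K (g z) + absval K (f z) * absval K v)"
      using uv c0 by (simp add: absval_mult)
    also have "\<dots> \<le> d * 1 + (d * absval K (g z) + absval K (f z) * d)"
      using uv c0 d absval_nonneg by (intro add_mono mult_mono) auto
    also have "\<dots> = M * d" by (simp add: M_def algebra_simps)
    also have "\<dots> < e" using d3 e by simp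
    finally show "absval K ((f a \<otimes> g a) \<ominus> (f z \<otimes> g z)) < e" .
  qed (use A B in auto)
qed

lemma kcont_inv:
  assumes "continuous_map Z (ktop K) f" "\<And>z. z \<in> topspace Z \<Longrightarrow> f z \<noteq> \<zero>"
  shows "continuous_map Z (ktop K) (\<lambda>z. inv (f z))"
  unfolding continuous_into_ktop
proof (intro conjI ballI allI impI)
  have fg: "f \<in> topspace Z \<rightarrow> carrier K"
    using assms by (auto simp: continuous_map_def)
  then show "(\<lambda>z. inv (f z)) \<in> topspace Z \<rightarrow> carrier K" using assms(2) by (simp add: Pi_iff)
  fix z and e :: real assume z: "z \<in> topspace Z" and e: "e > 0"
  define w where "w = absval K (f z)"
  have c0: "f z \<in> carrier K" "f z \<noteq> \<zero>" using fg z assms(2) by auto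
  then have w: "w > 0" using absval_pos by (simp add: w_def)
  \<comment> \<open>The first bound keeps \<open>absval K (f a)\<close> above \<open>w/2\<close>;
    given this, the second one makes \<open>u\<close>, divided by \<open>f a\<close> and
    \<open>f z\<close>, smaller than \<open>e\<close>.\<close>
  define d where "d = min (w/2) (e * w * w / 2)"
  have d: "d > 0" "d \<le> w/2" "d \<le> e * w * w / 2" using w e by (auto simp: d_def)
  obtain A where A: "openin Z A" "z \<in> A" "\<forall>a\<in>A. absval K (f a \<ominus> f z) < d"
    using assms(1) z d(1) unfolding continuous_into_ktop by meson
  show "\<exists>A. openin Z A \<and> z \<in> A \<and> (\<forall>a\<in>A. absval K (inv (f a) \<ominus> inv (f z)) < e)"
  proof (intro exI[of _ A] conjI ballI)
    fix a assume a: "a \<in> A"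
    then have "a \<in> topspace Z" using A openin_subset by blast
    then have c: "f a \<in> carrier K" "f a \<noteq> \<zero>" using fg assms(2) by auto
    define u where "u = f z \<ominus> f a"
    have "u = \<ominus> (f a \<ominus> f z)" unfolding u_def using c c0 by algebra
    then have u: "u \<in> carrier K" "absval K u < d" using c c0 a A(3) by auto
    have "f z = u \<oplus> f a" unfolding u_def using c c0 by algebra
    then have "w \<le> absval K u + absval K (f a)" using u c absval_triangle by (metis w_def)
    then have fa: "absval K (f a) > w/2" using u d by simp
    have "(p \<ominus> q) \<otimes> (r \<otimes> s) = (p \<otimes> s) \<otimes> r \<ominus> (q \<otimes> r) \<otimes> s"
      if "p \<in> carrier K" "q \<in> carrier K" "r \<in> carrier K" "s \<in> carrier K" for p q r s using that by algebra
    from this[OF c0(1) c(1) inv_closed0[OF c] inv_closed0[OF c0]]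
    have "u \<otimes> (inv (f a) \<otimes> inv (f z)) = (f z \<otimes> inv (f z)) \<otimes> inv (f a) \<ominus> (f a \<otimes> inv (f a)) \<otimes> inv (f z)"
      unfolding u_def .
    also have "\<dots> = inv (f a) \<ominus> inv (f z)" using c c0 by simp
    finally have "absval K (inv (f a) \<ominus> inv (f z)) = absval K u * (1 / absval K (f a) * (1 / w))"
      using u c c0 absval_mult[of u "inv (f a) \<otimes> inv (f z)"] absval_mult[of "inv (f a)" "inv (f z)"]
      by (simp add: absval_inv w_def)
    also have "\<dots> = absval K u / (absval K (f a) * w)" by simp
    also have "\<dots> < e"
    proof -
      have "absval K u < e * (w / 2 * w)" using u d by simp
      also have "\<dots> \<le> e * (absval K (f a) * w)" using fa e w by (intro mult_left_mono mult_right_mono) auto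
      finally show ?thesis using fa w by (simp add: field_simps)
    qed
    finally show "absval K (inv (f a) \<ominus> inv (f z)) < e" .
  qed (use A in auto)
qed

lemma Hausdorff_ktop: "Hausdorff_space (ktop K)"
  unfolding ktop_def by (rule kmetric.Hausdorff_space_mtopology)

text \<open>Zero is not isolated in the field, so some nonzero scalar would land in both of the
  disjoint neighbourhoods that separate the two values. Facts about difference quotients at
  \<open>t = \<zero>\<close> are derived from \<open>t \<noteq> \<zero>\<close> in this way.\<close>

lemma vanishing_limit:
  assumes Z: "Hausdorff_space Z" and A: "openin (ktop K) A" "\<zero> \<in> A"
    and f: "continuous_map (subtopology (ktop K) A) Z f" and g: "continuous_map (subtopology (ktop K) A) Z g"
    and eq: "\<And>t. t \<in> A \<Longrightarrow> t \<noteq> \<zero> \<Longrightarrow> f t = g t"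
  shows "f \<zero> = g \<zero>"
proof (rule ccontr)
  assume ne: "f \<zero> \<noteq> g \<zero>"
  have A': "A \<subseteq> carrier K" using A(1) openin_subset by fastforce
  then have ts: "topspace (subtopology (ktop K) A) = A" by auto
  have "f \<zero> \<in> topspace Z" "g \<zero> \<in> topspace Z" using f g A(2) ts continuous_map_image_subset_topspace by blast+
  then obtain S T where S: "openin Z S" "openin Z T" "f \<zero> \<in> S" "g \<zero> \<in> T" "disjnt S T"
    using Z ne unfolding Hausdorff_space_def by blast
  have "openin (subtopology (ktop K) A) {t \<in> A. f t \<in> S}" "openin (subtopology (ktop K) A) {t \<in> A. g t \<in> T}"
    using openin_continuous_map_preimage[OF f S(1)] openin_continuous_map_preimage[OF g S(2)]
    unfolding ts by auto
  then have "openin (ktop K) ({t \<in> A. f t \<in> S} \<inter> {t \<in> A. g t \<in> T})"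
    using A(1) openin_open_subtopology by blast
  then obtain r where r: "r > 0" "\<forall>y\<in>carrier K. absval K (y \<ominus> \<zero>) < r \<longrightarrow> y \<in> {t \<in> A. f t \<in> S} \<inter> {t \<in> A. g t \<in> T}"
    using S A(2) unfolding openin_ktop by blast
  obtain s where "s \<in> carrier K" "s \<noteq> \<zero>" "absval K s < r" using small_scalar[OF r(1)] .
  moreover from this r(2) have "s \<in> A" "f s \<in> S" "g s \<in> T" by (auto simp: minus_eq)
  ultimately show False using eq[of s] S(5) by (auto simp: disjnt_iff)
qed

end

section \<open>Continuity of the vector operations, and constructions of spaces\<close>

lemma cont_fst: "continuous_map Z (prod_topology X Y) f \<Longrightarrow> continuous_map Z X (\<lambda>z. fst (f z))"
  and cont_snd: "continuous_map Z (prod_topology X Y) f \<Longrightarrow> continuous_map Z Y (\<lambda>z. snd (f z))"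
  using continuous_map_pairwise[of Z X Y f] by (auto simp: o_def)

context valued_field begin

abbreviation TVS :: "('k, 'x) tvs \<Rightarrow> bool" where
  "TVS E \<equiv> topological_vector_space K E"

lemma tvs_cont_add:
  assumes "TVS E" "continuous_map Z (vtop E) f" "continuous_map Z (vtop E) g"
  shows "continuous_map Z (vtop E) (\<lambda>z. f z \<oplus>\<^bsub>E\<^esub> g z)"
  using continuous_map_compose[OF continuous_map_pairedI[OF assms(2,3)]
      topological_vector_space.continuous_add[OF assms(1)]]
  by (simp add: o_def)

lemma tvs_cont_smult:
  assumes "TVS E" "continuous_map Z (ktop K) c" "continuous_map Z (vtop E) f"
  shows "continuous_map Z (vtop E) (\<lambda>z. c z \<odot>\<^bsub>E\<^esub> f z)"
  using continuous_map_compose[OF continuous_map_pairedI[OF assms(2,3)]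
      topological_vector_space.continuous_smult[OF assms(1)]]
  by (simp add: o_def)

text \<open>Reduces continuity of subtraction to that of addition and scalar multiplication, the two
  operations of which the definition of a topological vector space speaks.\<close>

lemma tvs_minus:
  assumes "TVS E" "x \<in> carrier E" shows "\<ominus>\<^bsub>E\<^esub> x = (\<ominus> \<one>) \<odot>\<^bsub>E\<^esub> x"
proof -
  interpret E: topological_vector_space K E by fact
  show ?thesis using E.smult_l_minus[of \<one> x] assms(2) by simp
qed

lemma tvs_cont_minus:
  assumes "TVS E" "continuous_map Z (vtop E) f" "continuous_map Z (vtop E) g"
  shows "continuous_map Z (vtop E) (\<lambda>z. f z \<ominus>\<^bsub>E\<^esub> g z)"
proof -
  interpret E: topological_vector_space K E by fact
  have "continuous_map Z (vtop E) (\<lambda>z. f z \<oplus>\<^bsub>E\<^esub> ((\<ominus> \<one>) \<odot>\<^bsub>E\<^esub> g z))"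
    by (intro tvs_cont_add tvs_cont_smult assms) auto
  then show ?thesis
  proof (rule continuous_map_eq)
    fix z assume "z \<in> topspace Z"
    then have "g z \<in> carrier E" using assms(3) E.topspace_vtop by (auto simp: continuous_map_def Pi_iff)
    then show "f z \<oplus>\<^bsub>E\<^esub> (\<ominus> \<one>) \<odot>\<^bsub>E\<^esub> g z = f z \<ominus>\<^bsub>E\<^esub> g z"
      by (simp add: tvs_minus[OF assms(1)] a_minus_def)
  qed
qed

lemma tvs_intro:
  assumes "module K E" "topspace (vtop E) = carrier E" "Hausdorff_space (vtop E)"
    "continuous_map (prod_topology (vtop E) (vtop E)) (vtop E) (\<lambda>(x, y). x \<oplus>\<^bsub>E\<^esub> y)"
    "continuous_map (prod_topology (ktop K) (vtop E)) (vtop E) (\<lambda>(c, x). c \<odot>\<^bsub>E\<^esub> x)"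
  shows "TVS E"
  using assms valued_field_axioms
  by (simp add: topological_vector_space_def topological_vector_space_axioms_def)

lemma scalar_tvs_simps [simp]:
  "carrier (scalar_tvs K) = carrier K" "\<zero>\<^bsub>scalar_tvs K\<^esub> = \<zero>"
  "(\<oplus>\<^bsub>scalar_tvs K\<^esub>) = (\<oplus>)" "(\<odot>\<^bsub>scalar_tvs K\<^esub>) = (\<otimes>)" "vtop (scalar_tvs K) = ktop K"
  by (auto simp: scalar_tvs_def)

lemma tvs_scalar: "TVS (scalar_tvs K)"
proof (rule tvs_intro)
  have "abelian_group (scalar_tvs K)"
    by (rule abelian_groupI) (auto simp: a_ac intro: bexI[of _ "\<ominus> _"] l_neg)
  then show "module K (scalar_tvs K)"
    by (intro moduleI) (auto simp: l_distr r_distr m_assoc is_cring)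
  show "continuous_map (prod_topology (vtop (scalar_tvs K)) (vtop (scalar_tvs K))) (vtop (scalar_tvs K))
     (\<lambda>(x, y). x \<oplus>\<^bsub>scalar_tvs K\<^esub> y)"
    using kcont_add[OF continuous_map_fst continuous_map_snd] by (simp add: case_prod_unfold)
  show "continuous_map (prod_topology (ktop K) (vtop (scalar_tvs K))) (vtop (scalar_tvs K))
     (\<lambda>(x, y). x \<odot>\<^bsub>scalar_tvs K\<^esub> y)"
    using kcont_mult[OF continuous_map_fst continuous_map_snd] by (simp add: case_prod_unfold)
qed (auto simp: Hausdorff_ktop)

lemma prod_tvs_simps [simp]:
  "carrier (prod_tvs E F) = carrier E \<times> carrier F" "\<zero>\<^bsub>prod_tvs E F\<^esub> = (\<zero>\<^bsub>E\<^esub>, \<zero>\<^bsub>F\<^esub>)"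
  "p \<oplus>\<^bsub>prod_tvs E F\<^esub> q = (fst p \<oplus>\<^bsub>E\<^esub> fst q, snd p \<oplus>\<^bsub>F\<^esub> snd q)"
  "c \<odot>\<^bsub>prod_tvs E F\<^esub> p = (c \<odot>\<^bsub>E\<^esub> fst p, c \<odot>\<^bsub>F\<^esub> snd p)"
  "vtop (prod_tvs E F) = prod_topology (vtop E) (vtop F)"
  by (auto simp: prod_tvs_def case_prod_unfold)

lemma tvs_prod:
  assumes "TVS E" "TVS F" shows "TVS (prod_tvs E F)"
proof (rule tvs_intro)
  interpret E: topological_vector_space K E by fact
  interpret F: topological_vector_space K F by fact
  have "abelian_group (prod_tvs E F)"
    by (rule abelian_groupI) (auto simp: E.a_ac F.a_ac
        intro!: bexI[of _ "\<ominus>\<^bsub>E\<^esub> _"] bexI[of _ "\<ominus>\<^bsub>F\<^esub> _"] E.l_neg F.l_neg)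
  then show "module K (prod_tvs E F)"
    by (intro moduleI) (auto simp: E.smult_l_distr F.smult_l_distr E.smult_r_distr F.smult_r_distr
        E.smult_assoc1 F.smult_assoc1 is_cring)
  show "topspace (vtop (prod_tvs E F)) = carrier (prod_tvs E F)"
    by (simp add: E.topspace_vtop F.topspace_vtop)
  show "Hausdorff_space (vtop (prod_tvs E F))"
    by (simp add: Hausdorff_space_prod_topology E.Hausdorff_vtop F.Hausdorff_vtop)
  show "continuous_map (prod_topology (vtop (prod_tvs E F)) (vtop (prod_tvs E F))) (vtop (prod_tvs E F))
     (\<lambda>(x, y). x \<oplus>\<^bsub>prod_tvs E F\<^esub> y)"
    unfolding prod_tvs_simps case_prod_unfold
    by (intro continuous_map_pairedI tvs_cont_add assms) (rule continuous_map_fst continuous_map_snd | rule cont_fst cont_snd)+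
  show "continuous_map (prod_topology (ktop K) (vtop (prod_tvs E F))) (vtop (prod_tvs E F))
     (\<lambda>(x, y). x \<odot>\<^bsub>prod_tvs E F\<^esub> y)"
    unfolding prod_tvs_simps case_prod_unfold
    by (intro continuous_map_pairedI tvs_cont_smult assms) (rule continuous_map_fst continuous_map_snd | rule cont_fst cont_snd)+
qed

text \<open>A linear bijection that is also a homeomorphism carries all axioms back. It is applied
  to trees and to tangent spaces, where it spares a separate check of the axioms.\<close>

lemma tvs_transport:
  assumes E: "TVS E" and bij: "bij_betw b (carrier L) (carrier E)"
    and zero: "\<zero>\<^bsub>L\<^esub> \<in> carrier L" "b \<zero>\<^bsub>L\<^esub> = \<zero>\<^bsub>E\<^esub>"
    and add: "\<And>x y. x \<in> carrier L \<Longrightarrow> y \<in> carrier L \<Longrightarrow> x \<oplus>\<^bsub>L\<^esub> y \<in> carrier L \<and> b (x \<oplus>\<^bsub>L\<^esub> y) = b x \<oplus>\<^bsub>E\<^esub> b y"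
    and smult: "\<And>c x. c \<in> carrier K \<Longrightarrow> x \<in> carrier L \<Longrightarrow> c \<odot>\<^bsub>L\<^esub> x \<in> carrier L \<and> b (c \<odot>\<^bsub>L\<^esub> x) = c \<odot>\<^bsub>E\<^esub> b x"
    and ts: "topspace (vtop L) = carrier L" and homeo: "homeomorphic_map (vtop L) (vtop E) b"
  shows "TVS L"
proof -
  interpret E: topological_vector_space K E by fact
  have inj: "inj_on b (carrier L)" using bij by (rule bij_betw_imp_inj_on)
  have cl: "b x \<in> carrier E" if "x \<in> carrier L" for x using bij that by (meson bij_betwE)
  have eqI: "x = y" if "b x = b y" "x \<in> carrier L" "y \<in> carrier L" for x y
    using inj that by (meson inj_onD)
  obtain g where g: "homeomorphic_maps (vtop L) (vtop E) b g" using homeo homeomorphic_map_maps by blast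
  then have gb: "g (b x) = x" if "x \<in> carrier L" for x
    using that ts by (auto simp: homeomorphic_maps_def)
  have cb: "continuous_map (vtop L) (vtop E) b" and cg: "continuous_map (vtop E) (vtop L) g"
    using g by (auto simp: homeomorphic_maps_def)
  have "abelian_group L"
  proof (rule abelian_groupI)
    fix x assume x: "x \<in> carrier L"
    obtain y where y: "y \<in> carrier L" "b y = \<ominus>\<^bsub>E\<^esub> b x"
      using bij cl[OF x] by (metis E.a_inv_closed bij_betw_iff_bijections)
    show "\<exists>y\<in>carrier L. y \<oplus>\<^bsub>L\<^esub> x = \<zero>\<^bsub>L\<^esub>"
      using y x add zero cl[OF x] by (intro bexI[of _ y] eqI) (auto simp: E.l_neg)
  qed (auto intro!: eqI simp: add zero cl E.a_assoc E.a_comm E.add.m_lcomm)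
  then have "module K L"
    by (intro moduleI eqI)
      (auto simp: is_cring add smult cl E.smult_l_distr E.smult_r_distr E.smult_assoc1 intro!: eqI)
  moreover have "Hausdorff_space (vtop L)"
    using E.Hausdorff_vtop homeo homeomorphic_Hausdorff_space homeomorphic_map_imp_homeomorphic_space by blast
  moreover have "continuous_map (prod_topology (vtop L) (vtop L)) (vtop L) (\<lambda>(x, y). x \<oplus>\<^bsub>L\<^esub> y)"
  proof (rule continuous_map_eq)
    have "continuous_map (prod_topology (vtop L) (vtop L)) (vtop E) (\<lambda>p. b (fst p) \<oplus>\<^bsub>E\<^esub> b (snd p))"
      by (intro tvs_cont_add E continuous_map_compose[OF continuous_map_fst cb, unfolded o_def]
          continuous_map_compose[OF continuous_map_snd cb, unfolded o_def])
    then show "continuous_map (prod_topology (vtop L) (vtop L)) (vtop L) (g \<circ> (\<lambda>p. b (fst p) \<oplus>\<^bsub>E\<^esub> b (snd p)))"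
      using cg continuous_map_compose by blast
  qed (use add ts gb in \<open>force simp: \<close>)
  moreover have "continuous_map (prod_topology (ktop K) (vtop L)) (vtop L) (\<lambda>(x, y). x \<odot>\<^bsub>L\<^esub> y)"
  proof (rule continuous_map_eq)
    have "continuous_map (prod_topology (ktop K) (vtop L)) (vtop E) (\<lambda>p. fst p \<odot>\<^bsub>E\<^esub> b (snd p))"
      by (intro tvs_cont_smult E continuous_map_fst
          continuous_map_compose[OF continuous_map_snd cb, unfolded o_def])
    then show "continuous_map (prod_topology (ktop K) (vtop L)) (vtop L) (g \<circ> (\<lambda>p. fst p \<odot>\<^bsub>E\<^esub> b (snd p)))"
      using cg continuous_map_compose by blast
  qed (use smult ts gb in \<open>force simp: \<close>)
  ultimately show ?thesis using ts by (intro tvs_intro) auto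
qed

lemma image_tvs_simps:
  assumes "inj h"
  shows "carrier (image_tvs h E) = h ` carrier E" "\<zero>\<^bsub>image_tvs h E\<^esub> = h \<zero>\<^bsub>E\<^esub>"
    "h x \<oplus>\<^bsub>image_tvs h E\<^esub> h y = h (x \<oplus>\<^bsub>E\<^esub> y)"
    "c \<odot>\<^bsub>image_tvs h E\<^esub> h x = h (c \<odot>\<^bsub>E\<^esub> x)"
  using assms by (auto simp: image_tvs_def inv_f_f)

lemma homeomorphic_image_tvs:
  assumes "TVS E" "inj h"
  shows "homeomorphic_maps (vtop E) (vtop (image_tvs h E)) h (inv_into UNIV h)"
proof -
  interpret E: topological_vector_space K E by fact
  have v: "vtop (image_tvs h E) = pullback_topology (h ` carrier E) (inv_into UNIV h) (vtop E)"
    by (simp add: image_tvs_def)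
  have "continuous_map (vtop (image_tvs h E)) (vtop E) (inv_into UNIV h)"
    unfolding v using continuous_map_pullback[OF continuous_map_id, of "h ` carrier E" "inv_into UNIV h" "vtop E"] by simp
  moreover have "continuous_map (vtop E) (vtop (image_tvs h E)) h"
    unfolding v
    by (rule continuous_map_pullback') (use assms(2) in \<open>auto simp: o_def inv_f_f E.topspace_vtop\<close>)
  ultimately show ?thesis
    using assms(2) by (auto simp: homeomorphic_maps_def v topspace_pullback_topology inv_f_f)
qed

lemma tvs_image:
  assumes "TVS E" "inj h" shows "TVS (image_tvs h E)"
proof (rule tvs_transport[OF assms(1), of "inv_into UNIV h"])
  interpret E: topological_vector_space K E by fact
  show "bij_betw (inv_into UNIV h) (carrier (image_tvs h E)) (carrier E)"
    using assms(2) by (auto simp: image_tvs_simps bij_betw_def inj_on_def inv_f_f image_image)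
  show "topspace (vtop (image_tvs h E)) = carrier (image_tvs h E)"
    using assms(2) by (auto simp: image_tvs_def topspace_pullback_topology inv_f_f E.topspace_vtop)
  show "homeomorphic_map (vtop (image_tvs h E)) (vtop E) (inv_into UNIV h)"
    using homeomorphic_image_tvs[OF assms] homeomorphic_maps_map by blast
qed (use assms in \<open>auto simp: image_tvs_simps inv_f_f topological_vector_space_def module_def abelian_group_def abelian_monoid.zero_closed
   abelian_monoid.a_closed module_axioms_def\<close>)

subsection \<open>Continuous linear maps\<close>

definition clin :: "('k, 'x) tvs \<Rightarrow> ('k, 'y) tvs \<Rightarrow> ('x \<Rightarrow> 'y) \<Rightarrow> bool" where
  "clin X Y l \<longleftrightarrow> l \<in> carrier X \<rightarrow> carrier Y \<and>
     (\<forall>x\<in>carrier X. \<forall>y\<in>carrier X. l (x \<oplus>\<^bsub>X\<^esub> y) = l x \<oplus>\<^bsub>Y\<^esub> l y) \<and>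
     (\<forall>c\<in>carrier K. \<forall>x\<in>carrier X. l (c \<odot>\<^bsub>X\<^esub> x) = c \<odot>\<^bsub>Y\<^esub> l x) \<and>
     continuous_map (vtop X) (vtop Y) l"

lemma clinD:
  assumes "clin X Y l"
  shows "x \<in> carrier X \<Longrightarrow> l x \<in> carrier Y"
    "x \<in> carrier X \<Longrightarrow> y \<in> carrier X \<Longrightarrow> l (x \<oplus>\<^bsub>X\<^esub> y) = l x \<oplus>\<^bsub>Y\<^esub> l y"
    "c \<in> carrier K \<Longrightarrow> x \<in> carrier X \<Longrightarrow> l (c \<odot>\<^bsub>X\<^esub> x) = c \<odot>\<^bsub>Y\<^esub> l x"
    "continuous_map (vtop X) (vtop Y) l"
  using assms by (auto simp: clin_def Pi_iff)

text \<open>\<open>x + t y\<close> is the one combination of arguments that occurs in difference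
  quotients.\<close>

lemma clin_axpy:
  assumes "clin X Y l" "TVS X" "x \<in> carrier X" "y \<in> carrier X" "t \<in> carrier K"
  shows "l (x \<oplus>\<^bsub>X\<^esub> t \<odot>\<^bsub>X\<^esub> y) = l x \<oplus>\<^bsub>Y\<^esub> t \<odot>\<^bsub>Y\<^esub> l y"
proof -
  interpret X: topological_vector_space K X by fact
  show ?thesis using clinD[OF assms(1)] assms by simp
qed

lemma clin_id: "clin X X (\<lambda>x. x)"
  by (auto simp: clin_def)

lemma clin_compose:
  assumes "clin X Y l" "clin Y Z m" shows "clin X Z (\<lambda>x. m (l x))"
  using assms continuous_map_compose[of "vtop X" "vtop Y" l "vtop Z" m]
  by (auto simp: clin_def Pi_iff o_def)

lemma clin_zero:
  assumes "clin X Y l" "TVS X" "TVS Y" shows "l \<zero>\<^bsub>X\<^esub> = \<zero>\<^bsub>Y\<^esub>"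
proof -
  interpret X: topological_vector_space K X by fact
  interpret Y: topological_vector_space K Y by fact
  have "l (\<zero> \<odot>\<^bsub>X\<^esub> \<zero>\<^bsub>X\<^esub>) = \<zero> \<odot>\<^bsub>Y\<^esub> l \<zero>\<^bsub>X\<^esub>"
    using clinD(3)[OF assms(1), of \<zero> "\<zero>\<^bsub>X\<^esub>"] by simp
  then show ?thesis using clinD(1)[OF assms(1)] by simp
qed

lemma clin_fst: "clin (prod_tvs X Y) X fst"
  by (auto simp: clin_def continuous_map_fst)

lemma clin_snd: "clin (prod_tvs X Y) Y snd"
  by (auto simp: clin_def continuous_map_snd)

lemma clin_pair: "clin X Y l \<Longrightarrow> clin X Z m \<Longrightarrow> clin X (prod_tvs Y Z) (\<lambda>x. (l x, m x))"
  by (auto simp: clin_def Pi_iff intro: continuous_map_pairedI)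

lemma clin_image:
  assumes "TVS E" "inj h"
  shows "clin E (image_tvs h E) h" "clin (image_tvs h E) E (inv_into UNIV h)"
  using homeomorphic_image_tvs[OF assms] assms(2)
  by (auto simp: clin_def homeomorphic_maps_def image_tvs_simps inv_f_f)

lemma clin_add:
  assumes "TVS E" shows "clin (prod_tvs E E) E (\<lambda>p. fst p \<oplus>\<^bsub>E\<^esub> snd p)"
proof -
  interpret E: topological_vector_space K E by fact
  show ?thesis using E.continuous_add
    by (auto simp: clin_def case_prod_unfold E.smult_r_distr E.add.m_ac)
qed

lemma clin_smult:
  assumes "TVS E" "a \<in> carrier K" shows "clin E E (\<lambda>x. a \<odot>\<^bsub>E\<^esub> x)"
proof -
  interpret E: topological_vector_space K E by fact
  show ?thesis
    using assms tvs_cont_smult[OF assms(1), of "vtop E" "\<lambda>_. a" "\<lambda>x. x"]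
    by (auto simp: clin_def E.smult_r_distr m_comm simp flip: E.smult_assoc1)
qed

lemma clin_minus:
  assumes "TVS E" shows "clin (prod_tvs E E) E (\<lambda>p. fst p \<ominus>\<^bsub>E\<^esub> snd p)"
proof -
  interpret E: topological_vector_space K E by fact
  have "clin (prod_tvs E E) E (\<lambda>p. fst p \<oplus>\<^bsub>E\<^esub> ((\<ominus> \<one>) \<odot>\<^bsub>E\<^esub> snd p))"
    using clin_compose[OF clin_pair[OF clin_fst clin_compose[OF clin_snd clin_smult[OF assms, of "\<ominus> \<one>"]]]
        clin_add[OF assms]] by simp
  moreover have "\<forall>p\<in>carrier (prod_tvs E E). fst p \<oplus>\<^bsub>E\<^esub> ((\<ominus> \<one>) \<odot>\<^bsub>E\<^esub> snd p) = fst p \<ominus>\<^bsub>E\<^esub> snd p"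
    by (auto simp: a_minus_def tvs_minus[OF assms])
  ultimately show ?thesis
    by (auto simp: clin_def Pi_iff E.topspace_vtop elim!: continuous_map_eq)
qed

end

section \<open>Difference quotients on trees\<close>

text \<open>Spaces with elements of a type \<open>('e, 'k) itree\<close> are closed under \<open>X \<mapsto> X \<times> X \<times> K\<close>, so that
  all the iterated difference quotients of a map can be treated on one type.\<close>

primrec bl :: "('e, 'k) itree \<Rightarrow> ('e, 'k) itree" where
  "bl (Base x) = undefined" | "bl (Br p q t) = p"

primrec br :: "('e, 'k) itree \<Rightarrow> ('e, 'k) itree" where
  "br (Base x) = undefined" | "br (Br p q t) = q"

primrec bs :: "('e, 'k) itree \<Rightarrow> 'k" where
  "bs (Base x) = undefined" | "bs (Br p q t) = t"

text \<open>\<open>nx K X\<close> is the space \<open>X^[1] = X \<times> X \<times> K\<close> and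
  \<open>nd K X U\<close> is the domain \<open>U^[1]\<close> in it; \<open>iter_tvs\<close> and
  \<open>iter_dom\<close> iterate these two operations (\<open>iter_Suc\<close>).\<close>

definition nx :: "'k vfield \<Rightarrow> ('k, ('e, 'k) itree) tvs \<Rightarrow> ('k, ('e, 'k) itree) tvs" where
  "nx K X = image_tvs (\<lambda>(x, y, t). Br x y t) (prod_tvs X (prod_tvs X (scalar_tvs K)))"

definition nd :: "'k vfield \<Rightarrow> ('k, ('e, 'k) itree) tvs \<Rightarrow> ('e, 'k) itree set \<Rightarrow> ('e, 'k) itree set" where
  "nd K X U = (\<lambda>(x, y, t). Br x y t) ` dq_dom K X U"

lemma inj_Br: "inj (\<lambda>(x, y, t). Br x y t)"
  by (auto simp: inj_def)

lemma inv_Br [simp]: "inv_into UNIV (\<lambda>(x, y, t). Br x y t) (Br x y t) = (x, y, t)"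
  using inv_f_f[OF inj_Br, of "(x, y, t)"] by simp

lemma inj_Base: "inj Base"
  by (auto simp: inj_def)

lemma inv_Base [simp]: "inv_into UNIV Base (Base x) = x"
  by (simp add: inv_f_f inj_Base)

context valued_field begin

lemma nx_simps [simp]:
  "Br x y t \<in> carrier (nx K X) \<longleftrightarrow> x \<in> carrier X \<and> y \<in> carrier X \<and> t \<in> carrier K"
  "Base z \<notin> carrier (nx K X)"
  "\<zero>\<^bsub>nx K X\<^esub> = Br \<zero>\<^bsub>X\<^esub> \<zero>\<^bsub>X\<^esub> \<zero>"
  "Br x y t \<oplus>\<^bsub>nx K X\<^esub> Br x' y' t' = Br (x \<oplus>\<^bsub>X\<^esub> x') (y \<oplus>\<^bsub>X\<^esub> y') (t \<oplus> t')"
  "c \<odot>\<^bsub>nx K X\<^esub> Br x y t = Br (c \<odot>\<^bsub>X\<^esub> x) (c \<odot>\<^bsub>X\<^esub> y) (c \<otimes> t)"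
  using image_tvs_simps(3)[OF inj_Br, where E = "prod_tvs X (prod_tvs X (scalar_tvs K))" and x = "(x, y, t)" and y = "(x', y', t')"]
    image_tvs_simps(4)[OF inj_Br, where c = c and E = "prod_tvs X (prod_tvs X (scalar_tvs K))" and x = "(x, y, t)"]
  by (force simp: nx_def image_tvs_simps[OF inj_Br])+

lemma nx_cases:
  assumes "p \<in> carrier (nx K X)"
  obtains x y t where "p = Br x y t" "x \<in> carrier X" "y \<in> carrier X" "t \<in> carrier K"
  using assms by (cases p) auto

lemma nd_simps [simp]:
  "Br x y t \<in> nd K X U \<longleftrightarrow> x \<in> U \<and> y \<in> carrier X \<and> t \<in> carrier K \<and> x \<oplus>\<^bsub>X\<^esub> t \<odot>\<^bsub>X\<^esub> y \<in> U"
  "Base z \<notin> nd K X U"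
  by (force simp: nd_def dq_dom_def)+

lemma nd_cases:
  assumes "p \<in> nd K X U"
  obtains x y t where "p = Br x y t" "x \<in> U" "y \<in> carrier X" "t \<in> carrier K"
    "x \<oplus>\<^bsub>X\<^esub> t \<odot>\<^bsub>X\<^esub> y \<in> U"
  using assms by (cases p) auto

lemma tvs_nx: "TVS X \<Longrightarrow> TVS (nx K X)"
  unfolding nx_def by (intro tvs_image tvs_prod tvs_scalar inj_Br)

lemma homeomorphic_nx:
  assumes "TVS X"
  shows "homeomorphic_maps (vtop (prod_tvs X (prod_tvs X (scalar_tvs K)))) (vtop (nx K X))
    (\<lambda>(x, y, t). Br x y t) (inv_into UNIV (\<lambda>(x, y, t). Br x y t))"
  unfolding nx_def by (intro homeomorphic_image_tvs tvs_prod tvs_scalar inj_Br assms)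

lemma clin_nx_intro:
  assumes "TVS X" "clin Z X a" "clin Z X b" "clin Z (scalar_tvs K) c"
  shows "clin Z (nx K X) (\<lambda>z. Br (a z) (b z) (c z))"
proof -
  have "clin Z (prod_tvs X (prod_tvs X (scalar_tvs K))) (\<lambda>z. (a z, b z, c z))"
    using clin_pair[OF assms(2) clin_pair[OF assms(3,4)]] .
  from clin_compose[OF this clin_image(1)[OF _ inj_Br]] show ?thesis
    unfolding nx_def using assms(1) by (simp add: tvs_prod tvs_scalar)
qed

lemma clin_cong:
  assumes "clin X Y l" "TVS X" "\<And>x. x \<in> carrier X \<Longrightarrow> l' x = l x" shows "clin X Y l'"
proof -
  interpret X: topological_vector_space K X by fact
  have "continuous_map (vtop X) (vtop Y) l'"
    using clinD(4)[OF assms(1)] assms(3) by (auto simp: X.topspace_vtop elim: continuous_map_eq)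
  then show ?thesis using assms by (auto simp: clin_def Pi_iff)
qed

lemma clin_nx:
  assumes "TVS X" shows "clin (nx K X) X bl" "clin (nx K X) X br" "clin (nx K X) (scalar_tvs K) bs"
proof -
  let ?j = "inv_into UNIV (\<lambda>(x, y, t). Br x y t)"
  let ?P = "prod_tvs X (prod_tvs X (scalar_tvs K))"
  have j: "clin (nx K X) ?P ?j"
    unfolding nx_def by (intro clin_image inj_Br tvs_prod assms tvs_scalar)
  show "clin (nx K X) X bl"
    by (rule clin_cong[OF clin_compose[OF j clin_fst] tvs_nx[OF assms]]) (auto elim!: nx_cases)
  show "clin (nx K X) X br"
    by (rule clin_cong[OF clin_compose[OF j clin_compose[OF clin_snd clin_fst]] tvs_nx[OF assms]]) (auto elim!: nx_cases)
  show "clin (nx K X) (scalar_tvs K) bs"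
    by (rule clin_cong[OF clin_compose[OF j clin_compose[OF clin_snd clin_snd]] tvs_nx[OF assms]]) (auto elim!: nx_cases)
qed

lemma openin_carrier: "TVS X \<Longrightarrow> openin (vtop X) U \<Longrightarrow> U \<subseteq> carrier X"
  using openin_subset topological_vector_space.topspace_vtop by metis

lemma nd_alt:
  assumes "TVS X" "U \<subseteq> carrier X"
  shows "nd K X U = {p \<in> carrier (nx K X). bl p \<in> U \<and> bl p \<oplus>\<^bsub>X\<^esub> bs p \<odot>\<^bsub>X\<^esub> br p \<in> U}"
  using assms(2) by (auto elim!: nd_cases nx_cases)

lemma cont_step:
  assumes "TVS X"
  shows "continuous_map (vtop (nx K X)) (vtop X) (\<lambda>p. bl p \<oplus>\<^bsub>X\<^esub> bs p \<odot>\<^bsub>X\<^esub> br p)"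
  using clin_nx[OF assms, THEN clinD(4)] by (intro tvs_cont_add tvs_cont_smult assms) auto

lemma openin_nd:
  assumes "TVS X" "openin (vtop X) U" shows "openin (vtop (nx K X)) (nd K X U)"
proof -
  have U: "U \<subseteq> carrier X" using openin_carrier assms by blast
  have "openin (vtop (nx K X)) ({p \<in> topspace (vtop (nx K X)). bl p \<in> U} \<inter>
     {p \<in> topspace (vtop (nx K X)). bl p \<oplus>\<^bsub>X\<^esub> bs p \<odot>\<^bsub>X\<^esub> br p \<in> U})"
    using clinD(4)[OF clin_nx(1)[OF assms(1)]] cont_step[OF assms(1)] assms(2)
    by (intro openin_Int openin_continuous_map_preimage) 
  moreover have "topspace (vtop (nx K X)) = carrier (nx K X)"
    by (rule topological_vector_space.topspace_vtop[OF tvs_nx[OF assms(1)]])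
  ultimately show ?thesis unfolding nd_alt[OF assms(1) U] by (simp add: Collect_conj_eq[symmetric] Int_def conj_ac)
qed

text \<open>Stated without division, so that at \<open>t = \<zero>\<close> the equation is trivially
  right, and it survives linear operations as it stands. Continuity of \<open>g\<close> is required
  separately where it matters.\<close>

definition dstep :: "('k, ('x, 'k) itree) tvs \<Rightarrow> ('k, 'f) tvs \<Rightarrow> ('x, 'k) itree set
    \<Rightarrow> (('x, 'k) itree \<Rightarrow> 'f) \<Rightarrow> (('x, 'k) itree \<Rightarrow> 'f) \<Rightarrow> bool" where
  "dstep X F U f g \<longleftrightarrow> (\<forall>x y t. Br x y t \<in> nd K X U \<longrightarrow>
     g (Br x y t) \<in> carrier F \<and> f (x \<oplus>\<^bsub>X\<^esub> t \<odot>\<^bsub>X\<^esub> y) = f x \<oplus>\<^bsub>F\<^esub> t \<odot>\<^bsub>F\<^esub> g (Br x y t))"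

lemma dstepD:
  assumes "dstep X F U f g" "Br x y t \<in> nd K X U"
  shows "g (Br x y t) \<in> carrier F" "f (x \<oplus>\<^bsub>X\<^esub> t \<odot>\<^bsub>X\<^esub> y) = f x \<oplus>\<^bsub>F\<^esub> t \<odot>\<^bsub>F\<^esub> g (Br x y t)"
  using assms unfolding dstep_def by blast+

text \<open>For fixed \<open>x\<close> and \<open>y\<close> with \<open>x \<in> U\<close>, the
  triples \<open>(x, y, s)\<close> stay in the domain for small \<open>s\<close>, so a point with
  \<open>t = \<zero>\<close> is a limit of points with nonzero scalar.\<close>

lemma scalar_dense:
  assumes X: "TVS X" and U: "openin (vtop X) U" and F: "Hausdorff_space Z"
    and g: "continuous_map (subtopology (vtop (nx K X)) (nd K X U)) Z g"
    and h: "continuous_map (subtopology (vtop (nx K X)) (nd K X U)) Z h"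
    and eq: "\<And>x y t. Br x y t \<in> nd K X U \<Longrightarrow> t \<noteq> \<zero> \<Longrightarrow> g (Br x y t) = h (Br x y t)"
    and p: "p \<in> nd K X U"
  shows "g p = h p"
proof -
  interpret X: topological_vector_space K X by fact
  obtain x y t where pe: "p = Br x y t" and xyt: "x \<in> U" "y \<in> carrier X" "t \<in> carrier K"
    "x \<oplus>\<^bsub>X\<^esub> t \<odot>\<^bsub>X\<^esub> y \<in> U" using p by (rule nd_cases)
  have x: "x \<in> carrier X" using xyt openin_carrier[OF X U] by blast
  show ?thesis
  proof (cases "t = \<zero>")
    case True
    define A where "A = {s \<in> carrier K. x \<oplus>\<^bsub>X\<^esub> s \<odot>\<^bsub>X\<^esub> y \<in> U}"
    have "continuous_map (ktop K) (vtop X) (\<lambda>s. x \<oplus>\<^bsub>X\<^esub> s \<odot>\<^bsub>X\<^esub> y)"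
      using x xyt by (intro tvs_cont_add tvs_cont_smult X) (auto simp: X.topspace_vtop)
    from openin_continuous_map_preimage[OF this U] have A: "openin (ktop K) A" by (simp add: A_def)
    have A0: "\<zero> \<in> A" using xyt True by (simp add: A_def)
    have "continuous_map (ktop K) (vtop (prod_tvs X (prod_tvs X (scalar_tvs K)))) (\<lambda>s. (x, y, s))"
      using x xyt by (auto intro!: continuous_map_pairedI simp: X.topspace_vtop)
    then have "continuous_map (ktop K) (vtop (nx K X)) ((\<lambda>(x, y, t). Br x y t) \<circ> (\<lambda>s. (x, y, s)))"
      using homeomorphic_nx[OF X] continuous_map_compose unfolding homeomorphic_maps_def by blast
    then have "continuous_map (subtopology (ktop K) A) (subtopology (vtop (nx K X)) (nd K X U)) (\<lambda>s. Br x y s)"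
      using xyt by (auto simp: continuous_map_in_subtopology o_def A_def continuous_map_from_subtopology)
    from continuous_map_compose[OF this g] continuous_map_compose[OF this h]
    have "g (Br x y \<zero>) = h (Br x y \<zero>)"
      by (intro vanishing_limit[OF F A A0, of "\<lambda>s. g (Br x y s)" "\<lambda>s. h (Br x y s)"])
        (use eq xyt in \<open>auto simp: o_def A_def\<close>)
    with True pe show ?thesis by simp
  qed (use eq p pe in auto)
qed

lemma cont_openin_carrier:
  assumes "TVS X" "TVS F" "openin (vtop X) U" "continuous_map (subtopology (vtop X) U) (vtop F) f" "x \<in> U"
  shows "f x \<in> carrier F"
proof -
  have "x \<in> topspace (subtopology (vtop X) U)"
    using assms openin_subset by fastforce
  then have "f x \<in> topspace (vtop F)" using assms(4) by (auto simp: continuous_map_def Pi_iff)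
  then show ?thesis using topological_vector_space.topspace_vtop[OF assms(2)] by simp
qed

lemma tvs_cancel_step:
  assumes "TVS F" "a \<in> carrier F" "u \<in> carrier F" "v \<in> carrier F" "t \<in> carrier K" "t \<noteq> \<zero>"
    "a \<oplus>\<^bsub>F\<^esub> t \<odot>\<^bsub>F\<^esub> u = a \<oplus>\<^bsub>F\<^esub> t \<odot>\<^bsub>F\<^esub> v"
  shows "u = v"
proof -
  interpret F: topological_vector_space K F by fact
  have "t \<odot>\<^bsub>F\<^esub> u = t \<odot>\<^bsub>F\<^esub> v" using assms by simp
  then have "inv t \<odot>\<^bsub>F\<^esub> (t \<odot>\<^bsub>F\<^esub> u) = inv t \<odot>\<^bsub>F\<^esub> (t \<odot>\<^bsub>F\<^esub> v)" by simp
  then show ?thesis using assms by (simp flip: F.smult_assoc1)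
qed

text \<open>Where \<open>t\<close> is invertible it can be cancelled from the defining equation, and
  density of these points settles \<open>t = \<zero>\<close>. Two expressions for a difference
  quotient are identified below by checking continuity and the equation for both.\<close>

lemma dstep_unique:
  assumes "TVS X" "TVS F" "openin (vtop X) U" "\<And>x. x \<in> U \<Longrightarrow> f x \<in> carrier F"
    and "continuous_map (subtopology (vtop (nx K X)) (nd K X U)) (vtop F) g" "dstep X F U f g"
    and "continuous_map (subtopology (vtop (nx K X)) (nd K X U)) (vtop F) h" "dstep X F U f h"
    and "p \<in> nd K X U"
  shows "g p = h p"
proof (rule scalar_dense[OF assms(1,3) _ assms(5,7) _ assms(9)])
  show "Hausdorff_space (vtop F)" by (rule topological_vector_space.Hausdorff_vtop[OF assms(2)])
  fix x y t assume a: "Br x y t \<in> nd K X U" "t \<noteq> \<zero>"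
  then have a': "x \<in> U" "t \<in> carrier K" by simp_all
  show "g (Br x y t) = h (Br x y t)"
  proof (rule tvs_cancel_step[OF assms(2), of "f x" _ _ t])
    show "f x \<in> carrier F" using assms(4) a' by simp
    show "f x \<oplus>\<^bsub>F\<^esub> t \<odot>\<^bsub>F\<^esub> g (Br x y t) = f x \<oplus>\<^bsub>F\<^esub> t \<odot>\<^bsub>F\<^esub> h (Br x y t)"
      using dstepD(2)[OF assms(6) a(1)] dstepD(2)[OF assms(8) a(1)] by simp
  qed (fact dstepD(1)[OF assms(6) a(1)] dstepD(1)[OF assms(8) a(1)] a' a(2))+
qed

section \<open>Smooth maps on spaces of trees\<close>

text \<open>Smoothness as a greatest fixed point: a map is smooth iff it is continuous and has a smooth
  difference quotient. Closure properties then follow by coinduction, without a degree of smoothness.\<close>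

definition Sm_step where
  "Sm_step F R X U f \<longleftrightarrow> continuous_map (subtopology (vtop X) U) (vtop F) f \<and>
     (\<exists>g. dstep X F U f g \<and> R (nx K X) (nd K X U) g)"

definition Sm :: "('k, ('x, 'k) itree) tvs \<Rightarrow> ('k, 'f) tvs \<Rightarrow> ('x, 'k) itree set
    \<Rightarrow> (('x, 'k) itree \<Rightarrow> 'f) \<Rightarrow> bool" where
  "Sm X F U f \<longleftrightarrow> TVS X \<and> TVS F \<and> openin (vtop X) U \<and>
     (\<exists>R. R X U f \<and> (\<forall>X U f. TVS X \<and> openin (vtop X) U \<and> R X U f \<longrightarrow> Sm_step F R X U f))"

lemma Sm_coinduct:
  assumes "R X U f" "TVS X" "TVS F" "openin (vtop X) U"
    and "\<And>X U f. TVS X \<Longrightarrow> openin (vtop X) U \<Longrightarrow> R X U f \<Longrightarrow>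
       continuous_map (subtopology (vtop X) U) (vtop F) f \<and>
       (\<exists>g. dstep X F U f g \<and> R (nx K X) (nd K X U) g)"
  shows "Sm X F U f"
  unfolding Sm_def Sm_step_def using assms(2-4) by (intro conjI exI[of _ R] allI impI assms(1) assms(5)) auto

lemma SmD:
  assumes "Sm X F U f"
  shows "TVS X" "TVS F" "openin (vtop X) U" "continuous_map (subtopology (vtop X) U) (vtop F) f"
proof -
  obtain R where R: "R X U f" "\<forall>X U f. TVS X \<and> openin (vtop X) U \<and> R X U f \<longrightarrow> Sm_step F R X U f"
    and *: "TVS X" "TVS F" "openin (vtop X) U"
    using assms unfolding Sm_def by (elim conjE exE)
  show "TVS X" "TVS F" "openin (vtop X) U" by fact+
  show "continuous_map (subtopology (vtop X) U) (vtop F) f"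
    using R(2)[rule_format, of X U f] R(1) * by (simp add: Sm_step_def)
qed

lemma Sm_in_carrier: "Sm X F U f \<Longrightarrow> x \<in> U \<Longrightarrow> f x \<in> carrier F"
  by (rule cont_openin_carrier[OF SmD])

text \<open>An invariant that contains \<open>f\<close> contains a difference quotient of
  \<open>f\<close>, so it witnesses the smoothness of that quotient as well: this unfolds the fixed
  point once.\<close>

lemma SmE:
  assumes "Sm X F U f"
  obtains g where "dstep X F U f g" "Sm (nx K X) F (nd K X U) g"
proof -
  obtain R where R: "R X U f" "\<forall>X U f. TVS X \<and> openin (vtop X) U \<and> R X U f \<longrightarrow> Sm_step F R X U f"
    using assms unfolding Sm_def by (elim conjE exE)
  then obtain g where "dstep X F U f g" "R (nx K X) (nd K X U) g"
    using R(2)[rule_format, OF conjI[OF SmD(1)[OF assms] conjI[OF SmD(3)[OF assms] R(1)]]]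
    unfolding Sm_step_def by auto
  moreover have "Sm (nx K X) F (nd K X U) g"
    unfolding Sm_def using SmD(1-3)[OF assms] calculation(2) R(2)
    by (intro conjI exI[of _ R] tvs_nx openin_nd)
  ultimately show thesis using that by blast
qed


section \<open>Closure properties of smooth maps on trees\<close>

lemma dstepI:
  assumes "\<And>x y t. x \<in> U \<Longrightarrow> y \<in> carrier X \<Longrightarrow> t \<in> carrier K \<Longrightarrow> x \<oplus>\<^bsub>X\<^esub> t \<odot>\<^bsub>X\<^esub> y \<in> U \<Longrightarrow>
     g (Br x y t) \<in> carrier F \<and> f (x \<oplus>\<^bsub>X\<^esub> t \<odot>\<^bsub>X\<^esub> y) = f x \<oplus>\<^bsub>F\<^esub> t \<odot>\<^bsub>F\<^esub> g (Br x y t)"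
  shows "dstep X F U f g"
  using assms by (auto simp: dstep_def)

text \<open>Linearity gives \<open>(f \<circ> l)^[1](x, y, t) = f^[1](l x, l y, t)\<close>, again a
  composition with a linear map, now between trees one level deeper. This case precedes the chain
  rule because the proof of the chain rule uses its instance \<open>Sm_bl\<close>.\<close>

lemma Sm_precomp:
  fixes X :: "('k, ('a, 'k) itree) tvs" and Y :: "('k, ('b, 'k) itree) tvs"
  assumes "Sm Y F V f" "TVS X" "openin (vtop X) U" "clin X Y l" "\<And>x. x \<in> U \<Longrightarrow> l x \<in> V"
    and "\<And>x. x \<in> U \<Longrightarrow> h x = f (l x)"
  shows "Sm X F U h"
proof (rule Sm_coinduct[where R = "\<lambda>X U h. \<exists>(Y :: ('k, ('b, 'k) itree) tvs) V f l. Sm Y F V f \<and> clin X Y l \<and> (\<forall>x\<in>U. l x \<in> V \<and> h x = f (l x))"])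
  show "\<exists>(Y :: ('k, ('b, 'k) itree) tvs) V f l. Sm Y F V f \<and> clin X Y l \<and> (\<forall>x\<in>U. l x \<in> V \<and> h x = f (l x))"
    using assms by blast
  fix X :: "('k, ('a, 'k) itree) tvs" and U h
  assume X: "TVS X" and U: "openin (vtop X) U"
    and "\<exists>(Y :: ('k, ('b, 'k) itree) tvs) V f l. Sm Y F V f \<and> clin X Y l \<and> (\<forall>x\<in>U. l x \<in> V \<and> h x = f (l x))"
  then obtain Y :: "('k, ('b, 'k) itree) tvs" and V f l where f: "Sm Y F V f" and l: "clin X Y l"
    and U': "\<And>x. x \<in> U \<Longrightarrow> l x \<in> V" and h: "\<And>x. x \<in> U \<Longrightarrow> h x = f (l x)" by (elim exE conjE) blast
  note Uc = openin_carrier[OF X U]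
  have "continuous_map (subtopology (vtop X) U) (subtopology (vtop Y) V) l"
    using clinD(4)[OF l] U' by (auto simp: continuous_map_in_subtopology continuous_map_from_subtopology)
  from continuous_map_compose[OF this SmD(4)[OF f]]
  have "continuous_map (subtopology (vtop X) U) (vtop F) h"
    by (rule continuous_map_eq) (simp add: h)
  moreover obtain g where g: "dstep Y F V f g" "Sm (nx K Y) F (nd K Y V) g" using SmE[OF f] .
  let ?l = "\<lambda>p. Br (l (bl p)) (l (br p)) (bs p)"
  have l': "clin (nx K X) (nx K Y) ?l"
    by (intro clin_nx_intro SmD(1)[OF f] clin_nx X clin_compose[OF _ l])
  have eq: "l (x \<oplus>\<^bsub>X\<^esub> t \<odot>\<^bsub>X\<^esub> y) = l x \<oplus>\<^bsub>Y\<^esub> t \<odot>\<^bsub>Y\<^esub> l y" if "x \<in> U" "y \<in> carrier X" "t \<in> carrier K" for x y t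
    using that Uc by (intro clin_axpy[OF l X]) auto
  have nd: "?l p \<in> nd K Y V" if "p \<in> nd K X U" for p
    using that by (rule nd_cases) (use U' eq clinD(1)[OF l] in force)
  have "dstep X F U h (\<lambda>p. g (?l p))"
  proof (rule dstepI)
    fix x y t assume a: "x \<in> U" "y \<in> carrier X" "t \<in> carrier K" "x \<oplus>\<^bsub>X\<^esub> t \<odot>\<^bsub>X\<^esub> y \<in> U"
    have "Br (l x) (l y) t \<in> nd K Y V" using nd[of "Br x y t"] a by simp
    from dstepD[OF g(1) this] show "g (?l (Br x y t)) \<in> carrier F \<and>
       h (x \<oplus>\<^bsub>X\<^esub> t \<odot>\<^bsub>X\<^esub> y) = h x \<oplus>\<^bsub>F\<^esub> t \<odot>\<^bsub>F\<^esub> g (?l (Br x y t))"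
      using a by (simp add: h eq)
  qed
  ultimately show "continuous_map (subtopology (vtop X) U) (vtop F) h \<and>
     (\<exists>g. dstep X F U h g \<and> (\<exists>(Y :: ('k, ('b, 'k) itree) tvs) V f l. Sm Y F V f \<and> clin (nx K X) Y l \<and>
       (\<forall>x\<in>nd K X U. l x \<in> V \<and> g x = f (l x))))"
    using g(2) l' nd by blast
qed (use assms SmD(2)[OF assms(1)] in simp_all)

text \<open>Changing a map off \<open>U\<close>, like restricting it in \<open>Sm_subset\<close>, is
  a precomposition with the identity.\<close>

lemma Sm_cong:
  assumes "Sm X F U f" "\<And>x. x \<in> U \<Longrightarrow> h x = f x" shows "Sm X F U h"
  by (rule Sm_precomp[OF assms(1) SmD(1,3)[OF assms(1)] clin_id]) (use assms in auto)

lemma Sm_subset: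
  assumes "Sm X F U f" "openin (vtop X) V" "V \<subseteq> U" shows "Sm X F V f"
  by (rule Sm_precomp[OF assms(1) SmD(1)[OF assms(1)] assms(2) clin_id]) (use assms in auto)

lemma Sm_bl: "Sm X F U f \<Longrightarrow> Sm (nx K X) F (nd K X U) (\<lambda>p. f (bl p))"
  by (rule Sm_precomp[OF _ tvs_nx openin_nd clin_nx(1)]) (auto dest: SmD(1,3) elim!: nd_cases)

text \<open>A linear map commutes with the formation of difference quotients, so the invariant keeps
  \<open>m\<close> fixed and replaces \<open>f\<close> only.\<close>

lemma Sm_postcomp:
  assumes "Sm X F U f" "TVS G" "clin F G m"
  shows "Sm X G U (\<lambda>x. m (f x))"
proof (rule Sm_coinduct[where R = "\<lambda>X U h. \<exists>f. Sm X F U f \<and> (\<forall>x\<in>U. h x = m (f x))"])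
  show "\<exists>fa. Sm X F U fa \<and> (\<forall>x\<in>U. m (f x) = m (fa x))" using assms by blast
  fix X :: "('k, ('a, 'k) itree) tvs" and U h
  assume X: "TVS X" and U: "openin (vtop X) U" and "\<exists>f. Sm X F U f \<and> (\<forall>x\<in>U. h x = m (f x))"
  then obtain f where f: "Sm X F U f" and h: "\<And>x. x \<in> U \<Longrightarrow> h x = m (f x)" by (elim exE conjE) blast
  from continuous_map_compose[OF SmD(4)[OF f] clinD(4)[OF assms(3)]]
  have "continuous_map (subtopology (vtop X) U) (vtop G) h"
    by (rule continuous_map_eq) (simp add: h)
  moreover obtain g where g: "dstep X F U f g" "Sm (nx K X) F (nd K X U) g" using SmE[OF f] .
  have "dstep X G U h (\<lambda>p. m (g p))"
  proof (rule dstepI)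
    fix x y t assume a: "x \<in> U" "y \<in> carrier X" "t \<in> carrier K" "x \<oplus>\<^bsub>X\<^esub> t \<odot>\<^bsub>X\<^esub> y \<in> U"
    then have "Br x y t \<in> nd K X U" by simp
    from dstepD[OF g(1) this] show "m (g (Br x y t)) \<in> carrier G \<and>
       h (x \<oplus>\<^bsub>X\<^esub> t \<odot>\<^bsub>X\<^esub> y) = h x \<oplus>\<^bsub>G\<^esub> t \<odot>\<^bsub>G\<^esub> m (g (Br x y t))"
      using a clin_axpy[OF assms(3) SmD(2)[OF f] Sm_in_carrier[OF f a(1)]] clinD(1)[OF assms(3)] by (simp add: h)
  qed
  ultimately show "continuous_map (subtopology (vtop X) U) (vtop G) h \<and>
     (\<exists>g. dstep X G U h g \<and> (\<exists>f. Sm (nx K X) F (nd K X U) f \<and> (\<forall>x\<in>nd K X U. g x = m (f x))))"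
    using g(2) by blast
qed (use assms SmD(1,3)[OF assms(1)] in simp_all)

lemma Sm_pair:
  assumes "Sm X F U f" "Sm X G U g"
  shows "Sm X (prod_tvs F G) U (\<lambda>x. (f x, g x))"
proof (rule Sm_coinduct[where R = "\<lambda>X U h. \<exists>f g. Sm X F U f \<and> Sm X G U g \<and> (\<forall>x\<in>U. h x = (f x, g x))"])
  show "\<exists>fa ga. Sm X F U fa \<and> Sm X G U ga \<and> (\<forall>x\<in>U. (f x, g x) = (fa x, ga x))" using assms by blast
  fix X :: "('k, ('a, 'k) itree) tvs" and U h
  assume X: "TVS X" and U: "openin (vtop X) U"
    and "\<exists>f g. Sm X F U f \<and> Sm X G U g \<and> (\<forall>x\<in>U. h x = (f x, g x))"
  then obtain f g where f: "Sm X F U f" and g: "Sm X G U g" and h: "\<And>x. x \<in> U \<Longrightarrow> h x = (f x, g x)"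
    by (elim exE conjE) blast
  from continuous_map_pairedI[OF SmD(4)[OF f] SmD(4)[OF g]]
  have "continuous_map (subtopology (vtop X) U) (vtop (prod_tvs F G)) h"
    unfolding prod_tvs_simps by (rule continuous_map_eq) (simp add: h)
  moreover obtain f1 where f1: "dstep X F U f f1" "Sm (nx K X) F (nd K X U) f1" using SmE[OF f] .
  moreover obtain g1 where g1: "dstep X G U g g1" "Sm (nx K X) G (nd K X U) g1" using SmE[OF g] .
  have "dstep X (prod_tvs F G) U h (\<lambda>p. (f1 p, g1 p))"
  proof (rule dstepI)
    fix x y t assume a: "x \<in> U" "y \<in> carrier X" "t \<in> carrier K" "x \<oplus>\<^bsub>X\<^esub> t \<odot>\<^bsub>X\<^esub> y \<in> U"
    then have "Br x y t \<in> nd K X U" by simp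
    from dstepD[OF f1(1) this] dstepD[OF g1(1) this]
    show "(f1 (Br x y t), g1 (Br x y t)) \<in> carrier (prod_tvs F G) \<and>
       h (x \<oplus>\<^bsub>X\<^esub> t \<odot>\<^bsub>X\<^esub> y) = h x \<oplus>\<^bsub>prod_tvs F G\<^esub> t \<odot>\<^bsub>prod_tvs F G\<^esub> (f1 (Br x y t), g1 (Br x y t))"
      using a by (simp add: h)
  qed
  ultimately show "continuous_map (subtopology (vtop X) U) (vtop (prod_tvs F G)) h \<and>
     (\<exists>g. dstep X (prod_tvs F G) U h g \<and> (\<exists>f ga. Sm (nx K X) F (nd K X U) f \<and>
        Sm (nx K X) G (nd K X U) ga \<and> (\<forall>x\<in>nd K X U. g x = (f x, ga x))))"
    using g1(2) by blast
qed (use SmD[OF assms(1)] SmD[OF assms(2)] tvs_prod in simp_all)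

text \<open>\<open>l^[1](x, y, t) = l y\<close>, which is again linear on the trees one level
  deeper.\<close>

lemma Sm_clin:
  assumes "clin X F l" "TVS X" "TVS F" "openin (vtop X) U"
  shows "Sm X F U l"
proof (rule Sm_coinduct[where R = "\<lambda>X U h. \<exists>l. clin X F l \<and> (\<forall>x\<in>U. h x = l x)"])
  show "\<exists>la. clin X F la \<and> (\<forall>x\<in>U. l x = la x)" using assms by blast
  fix X :: "('k, ('a, 'k) itree) tvs" and U h
  assume X: "TVS X" and U: "openin (vtop X) U" and "\<exists>l. clin X F l \<and> (\<forall>x\<in>U. h x = l x)"
  then obtain l where l: "clin X F l" and h: "\<And>x. x \<in> U \<Longrightarrow> h x = l x" by (elim exE conjE) blast
  note Uc = openin_carrier[OF X U]
  have "continuous_map (subtopology (vtop X) U) (vtop F) l"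
    using clinD(4)[OF l] by (rule continuous_map_from_subtopology)
  then have "continuous_map (subtopology (vtop X) U) (vtop F) h"
    by (rule continuous_map_eq) (simp add: h)
  moreover have "dstep X F U h (\<lambda>p. l (br p))"
    by (rule dstepI) (use Uc clin_axpy[OF l X] clinD(1)[OF l] in \<open>auto simp: h\<close>)
  ultimately show "continuous_map (subtopology (vtop X) U) (vtop F) h \<and>
     (\<exists>g. dstep X F U h g \<and> (\<exists>l. clin (nx K X) F l \<and> (\<forall>x\<in>nd K X U. g x = l x)))"
    using clin_compose[OF clin_nx(2)[OF X] l] by blast
qed (use assms in simp_all)

lemma Sm_const:
  fixes X :: "('k, ('a, 'k) itree) tvs"
  assumes "a \<in> carrier F" "TVS X" "TVS F" "openin (vtop X) U"
  shows "Sm X F U (\<lambda>_. a)"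
proof (rule Sm_coinduct[where R = "\<lambda>X U h. \<exists>a\<in>carrier F. \<forall>x\<in>U. h x = a"])
  show "\<exists>aa\<in>carrier F. \<forall>x\<in>U. a = aa" using assms by blast
next
  interpret F: topological_vector_space K F by fact
  fix X :: "('k, ('a, 'k) itree) tvs" and U h
  assume X: "TVS X" and U: "openin (vtop X) U" and "\<exists>a\<in>carrier F. \<forall>x\<in>U. h x = a"
  then obtain a where a: "a \<in> carrier F" and h: "\<And>x. x \<in> U \<Longrightarrow> h x = a" by blast
  have "continuous_map (subtopology (vtop X) U) (vtop F) (\<lambda>_. a)"
    using a F.topspace_vtop by simp
  then have "continuous_map (subtopology (vtop X) U) (vtop F) h"
    by (rule continuous_map_eq) (simp add: h)
  moreover have "dstep X F U h (\<lambda>p. \<zero>\<^bsub>F\<^esub>)"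
    by (rule dstepI) (use a in \<open>auto simp: h\<close>)
  ultimately show "continuous_map (subtopology (vtop X) U) (vtop F) h \<and>
     (\<exists>g. dstep X F U h g \<and> (\<exists>a\<in>carrier F. \<forall>x\<in>nd K X U. g x = a))"
    using F.zero_closed by blast
qed (use assms in simp_all)

lemma Sm_Br:
  assumes "Sm X Y U a" "Sm X Y U b" "Sm X (scalar_tvs K) U c"
  shows "Sm X (nx K Y) U (\<lambda>p. Br (a p) (b p) (c p))"
proof -
  note Y = SmD(2)[OF assms(1)]
  have "clin (prod_tvs Y (prod_tvs Y (scalar_tvs K))) (nx K Y) (\<lambda>(x, y, t). Br x y t)"
    unfolding nx_def by (intro clin_image tvs_prod Y tvs_scalar inj_Br)
  from Sm_postcomp[OF Sm_pair[OF assms(1) Sm_pair[OF assms(2,3)]] tvs_nx[OF Y] this]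
  show ?thesis by simp
qed

lemma Sm_bs: "TVS X \<Longrightarrow> openin (vtop X) U \<Longrightarrow> Sm (nx K X) (scalar_tvs K) (nd K X U) bs"
  by (intro Sm_clin clin_nx tvs_nx tvs_scalar openin_nd)

text \<open>The chain rule \<open>(g \<circ> f)\<^sup>[\<^sup>1\<^sup>](x, y, t) = g\<^sup>[\<^sup>1\<^sup>](f x, f\<^sup>[\<^sup>1\<^sup>](x, y, t), t)\<close> exhibits the difference
  quotient of a composition as a composition of the same kind.\<close>

lemma Sm_compose:
  fixes X :: "('k, ('a, 'k) itree) tvs" and Y :: "('k, ('b, 'k) itree) tvs"
  assumes "Sm Y G V g" "Sm X Y U f" "\<And>x. x \<in> U \<Longrightarrow> f x \<in> V"
  shows "Sm X G U (\<lambda>x. g (f x))"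
proof (rule Sm_coinduct[where R = "\<lambda>X U h. \<exists>(Y :: ('k, ('b, 'k) itree) tvs) V f g. Sm X Y U f \<and> Sm Y G V g \<and> (\<forall>x\<in>U. f x \<in> V \<and> h x = g (f x))"])
  show "\<exists>(Y :: ('k, ('b, 'k) itree) tvs) V fa ga. Sm X Y U fa \<and> Sm Y G V ga \<and> (\<forall>x\<in>U. fa x \<in> V \<and> g (f x) = ga (fa x))" using assms by blast
  fix X :: "('k, ('a, 'k) itree) tvs" and U h
  assume X: "TVS X" and U: "openin (vtop X) U"
    and "\<exists>(Y :: ('k, ('b, 'k) itree) tvs) V f g. Sm X Y U f \<and> Sm Y G V g \<and> (\<forall>x\<in>U. f x \<in> V \<and> h x = g (f x))"
  then obtain Y :: "('k, ('b, 'k) itree) tvs" and V f g where f: "Sm X Y U f" and g: "Sm Y G V g"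
    and fV: "\<And>x. x \<in> U \<Longrightarrow> f x \<in> V" and h: "\<And>x. x \<in> U \<Longrightarrow> h x = g (f x)" by (elim exE conjE) blast
  have "continuous_map (subtopology (vtop X) U) (subtopology (vtop Y) V) f"
    using SmD(4)[OF f] fV by (auto simp: continuous_map_in_subtopology)
  from continuous_map_compose[OF this SmD(4)[OF g]]
  have "continuous_map (subtopology (vtop X) U) (vtop G) h"
    by (rule continuous_map_eq) (simp add: h)
  moreover obtain f1 where f1: "dstep X Y U f f1" "Sm (nx K X) Y (nd K X U) f1" using SmE[OF f] .
  moreover obtain g1 where g1: "dstep Y G V g g1" "Sm (nx K Y) G (nd K Y V) g1" using SmE[OF g] .
  let ?f = "\<lambda>p. Br (f (bl p)) (f1 p) (bs p)"
  have Sf: "Sm (nx K X) (nx K Y) (nd K X U) ?f"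
    by (intro Sm_Br Sm_bl f f1 Sm_bs X U)
  have nd: "?f p \<in> nd K Y V" if "p \<in> nd K X U" for p
    using that
  proof (rule nd_cases)
    fix x y t assume a: "p = Br x y t" "x \<in> U" "y \<in> carrier X" "t \<in> carrier K" "x \<oplus>\<^bsub>X\<^esub> t \<odot>\<^bsub>X\<^esub> y \<in> U"
    then have "Br x y t \<in> nd K X U" by simp
    from dstepD[OF f1(1) this] fV[OF a(2)] fV[OF a(5)] show ?thesis using a by simp
  qed
  have "dstep X G U h (\<lambda>p. g1 (?f p))"
  proof (rule dstepI)
    fix x y t assume a: "x \<in> U" "y \<in> carrier X" "t \<in> carrier K" "x \<oplus>\<^bsub>X\<^esub> t \<odot>\<^bsub>X\<^esub> y \<in> U"
    then have n: "Br x y t \<in> nd K X U" by simp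
    have "Br (f x) (f1 (Br x y t)) t \<in> nd K Y V" using nd[OF n] by simp
    from dstepD[OF f1(1) n] dstepD[OF g1(1) this]
    show "g1 (?f (Br x y t)) \<in> carrier G \<and> h (x \<oplus>\<^bsub>X\<^esub> t \<odot>\<^bsub>X\<^esub> y) = h x \<oplus>\<^bsub>G\<^esub> t \<odot>\<^bsub>G\<^esub> g1 (?f (Br x y t))"
      using a by (simp add: h)
  qed
  ultimately show "continuous_map (subtopology (vtop X) U) (vtop G) h \<and>
     (\<exists>g. dstep X G U h g \<and> (\<exists>(Y :: ('k, ('b, 'k) itree) tvs) V f ga. Sm (nx K X) Y (nd K X U) f \<and> Sm Y G V ga \<and>
       (\<forall>x\<in>nd K X U. f x \<in> V \<and> g x = ga (f x))))"
    using g1(2) Sf nd by blast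
qed (use SmD[OF assms(1)] SmD[OF assms(2)] in simp_all)

section \<open>Sums, scalar multiples and quotients\<close>

lemma Sm_add:
  assumes "Sm X F U f" "Sm X F U g" shows "Sm X F U (\<lambda>x. f x \<oplus>\<^bsub>F\<^esub> g x)"
  using Sm_postcomp[OF Sm_pair[OF assms] SmD(2)[OF assms(1)] clin_add[OF SmD(2)[OF assms(1)]]] by simp

lemma Sm_minus:
  assumes "Sm X F U f" "Sm X F U g" shows "Sm X F U (\<lambda>x. f x \<ominus>\<^bsub>F\<^esub> g x)"
  using Sm_postcomp[OF Sm_pair[OF assms] SmD(2)[OF assms(1)] clin_minus[OF SmD(2)[OF assms(1)]]] by simp

end

text \<open>Products alone are no invariant for the coinduction, since the product rule turns their
  difference quotients into sums of products. Closing the smooth maps under both operations gives an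
  invariant.\<close>

inductive smult_closure :: "'k vfield \<Rightarrow> ('k, 'f) tvs \<Rightarrow> ('k, ('e, 'k) itree) tvs \<Rightarrow> ('e, 'k) itree set
    \<Rightarrow> (('e, 'k) itree \<Rightarrow> 'f) \<Rightarrow> bool" for K F X U where
  base: "valued_field.Sm K X F U f \<Longrightarrow> smult_closure K F X U f"
| add: "smult_closure K F X U f \<Longrightarrow> smult_closure K F X U g
    \<Longrightarrow> smult_closure K F X U (\<lambda>x. f x \<oplus>\<^bsub>F\<^esub> g x)"
| smult: "valued_field.Sm K X (scalar_tvs K) U c \<Longrightarrow> smult_closure K F X U f
    \<Longrightarrow> smult_closure K F X U (\<lambda>x. c x \<odot>\<^bsub>F\<^esub> f x)"

context valued_field begin

text \<open>The clause on \<open>h (bl p)\<close> is there for the product rule, in whose result the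
  factor \<open>f\<close> reappears as a function of the base point; the induction has to supply its
  membership in the closure.\<close>

lemma smult_closure_step:
  assumes "smult_closure K F X U h" "TVS F" "TVS X" "openin (vtop X) U"
  shows "continuous_map (subtopology (vtop X) U) (vtop F) h \<and>
     smult_closure K F (nx K X) (nd K X U) (\<lambda>p. h (bl p)) \<and>
     (\<exists>g. dstep X F U h g \<and> smult_closure K F (nx K X) (nd K X U) g)"
  using assms(1)
proof induction
  case (base f)
  obtain g where "dstep X F U f g" "Sm (nx K X) F (nd K X U) g" using SmE[OF base] .
  then show ?case using SmD(4)[OF base] smult_closure.base[OF Sm_bl[OF base]] smult_closure.base by blast
next
  interpret F: topological_vector_space K F by fact
  case (add f g)
  then obtain f1 g1 where 1: "dstep X F U f f1" "smult_closure K F (nx K X) (nd K X U) f1"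
    "dstep X F U g g1" "smult_closure K F (nx K X) (nd K X U) g1" by blast
  have "dstep X F U (\<lambda>x. f x \<oplus>\<^bsub>F\<^esub> g x) (\<lambda>x. f1 x \<oplus>\<^bsub>F\<^esub> g1 x)"
  proof (rule dstepI)
    fix x y t assume a: "x \<in> U" "y \<in> carrier X" "t \<in> carrier K" "x \<oplus>\<^bsub>X\<^esub> t \<odot>\<^bsub>X\<^esub> y \<in> U"
    then have n: "Br x y t \<in> nd K X U" by simp
    have c: "f x \<in> carrier F" "g x \<in> carrier F"
      using add.IH cont_openin_carrier[OF assms(3,2,4) _ a(1)] by blast+
    show "f1 (Br x y t) \<oplus>\<^bsub>F\<^esub> g1 (Br x y t) \<in> carrier F \<and> f (x \<oplus>\<^bsub>X\<^esub> t \<odot>\<^bsub>X\<^esub> y) \<oplus>\<^bsub>F\<^esub> g (x \<oplus>\<^bsub>X\<^esub> t \<odot>\<^bsub>X\<^esub> y)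
       = f x \<oplus>\<^bsub>F\<^esub> g x \<oplus>\<^bsub>F\<^esub> t \<odot>\<^bsub>F\<^esub> (f1 (Br x y t) \<oplus>\<^bsub>F\<^esub> g1 (Br x y t))"
      using dstepD[OF 1(1) n] dstepD[OF 1(3) n] c a by (simp add: F.smult_r_distr F.a_ac)
  qed
  moreover have "continuous_map (subtopology (vtop X) U) (vtop F) (\<lambda>x. f x \<oplus>\<^bsub>F\<^esub> g x)"
    using add.IH by (intro tvs_cont_add assms) blast+
  moreover have "smult_closure K F (nx K X) (nd K X U) (\<lambda>p. f (bl p) \<oplus>\<^bsub>F\<^esub> g (bl p))"
    using add.IH by (intro smult_closure.add) blast+
  ultimately show ?case using smult_closure.add[OF 1(2,4)] by blast
next
  interpret F: topological_vector_space K F by fact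
  case (smult c f)
  then obtain f1 where f1: "dstep X F U f f1" "smult_closure K F (nx K X) (nd K X U) f1" by blast
  obtain c1 where c1: "dstep X (scalar_tvs K) U c c1" "Sm (nx K X) (scalar_tvs K) (nd K X U) c1"
    using SmE[OF smult.hyps(1)] .
  \<comment> \<open>Product rule: \<open>c f^[1] + c^[1] f + t c^[1] f^[1]\<close>. The last term is
    there because both factors change at once over a step \<open>t\<close> that need not be
    zero.\<close>
  define h1 where "h1 = (\<lambda>p. c (bl p) \<odot>\<^bsub>F\<^esub> f1 p \<oplus>\<^bsub>F\<^esub> (c1 p \<odot>\<^bsub>F\<^esub> f (bl p) \<oplus>\<^bsub>F\<^esub> c1 p \<odot>\<^bsub>F\<^esub> (bs p \<odot>\<^bsub>F\<^esub> f1 p)))"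
  have "smult_closure K F (nx K X) (nd K X U) h1" unfolding h1_def
    by (intro smult_closure.add smult_closure.smult Sm_bl smult.hyps(1) f1 c1 Sm_bs assms)
      (use smult.IH in blast)
  moreover have "dstep X F U (\<lambda>x. c x \<odot>\<^bsub>F\<^esub> f x) h1"
  proof (rule dstepI)
    fix x y t assume a: "x \<in> U" "y \<in> carrier X" "t \<in> carrier K" "x \<oplus>\<^bsub>X\<^esub> t \<odot>\<^bsub>X\<^esub> y \<in> U"
    then have n: "Br x y t \<in> nd K X U" by simp
    have c: "f x \<in> carrier F" using smult.IH cont_openin_carrier[OF assms(3,2,4) _ a(1)] by blast
    have cc: "c x \<in> carrier K" using Sm_in_carrier[OF smult.hyps(1) a(1)] by simp
    note d = dstepD[OF f1(1) n] dstepD[OF c1(1) n, simplified]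
    have "(c x \<oplus> t \<otimes> c1 (Br x y t)) \<odot>\<^bsub>F\<^esub> (f x \<oplus>\<^bsub>F\<^esub> t \<odot>\<^bsub>F\<^esub> f1 (Br x y t)) =
       c x \<odot>\<^bsub>F\<^esub> f x \<oplus>\<^bsub>F\<^esub> t \<odot>\<^bsub>F\<^esub> (c x \<odot>\<^bsub>F\<^esub> f1 (Br x y t) \<oplus>\<^bsub>F\<^esub> (c1 (Br x y t) \<odot>\<^bsub>F\<^esub> f x \<oplus>\<^bsub>F\<^esub> c1 (Br x y t) \<odot>\<^bsub>F\<^esub> (t \<odot>\<^bsub>F\<^esub> f1 (Br x y t))))"
      using d(1,3) c cc a
      by (simp add: F.smult_r_distr F.smult_l_distr F.a_ac m_ac r_distr flip: F.smult_assoc1)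
    then show "h1 (Br x y t) \<in> carrier F \<and> c (x \<oplus>\<^bsub>X\<^esub> t \<odot>\<^bsub>X\<^esub> y) \<odot>\<^bsub>F\<^esub> f (x \<oplus>\<^bsub>X\<^esub> t \<odot>\<^bsub>X\<^esub> y)
       = c x \<odot>\<^bsub>F\<^esub> f x \<oplus>\<^bsub>F\<^esub> t \<odot>\<^bsub>F\<^esub> h1 (Br x y t)"
      using d c cc a by (simp add: h1_def)
  qed
  moreover have "smult_closure K F (nx K X) (nd K X U) (\<lambda>p. c (bl p) \<odot>\<^bsub>F\<^esub> f (bl p))"
    using smult.IH Sm_bl[OF smult.hyps(1)] smult_closure.smult[of K "nx K X" "nd K X U"] by blast
  moreover have "continuous_map (subtopology (vtop X) U) (vtop F) (\<lambda>x. c x \<odot>\<^bsub>F\<^esub> f x)"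
    by (rule tvs_cont_smult[OF assms(2)]) (use SmD(4)[OF smult.hyps(1)] smult.IH in simp_all)
  ultimately show ?case by blast
qed

lemma Sm_smult:
  assumes "Sm X (scalar_tvs K) U c" "Sm X F U f" shows "Sm X F U (\<lambda>x. c x \<odot>\<^bsub>F\<^esub> f x)"
proof (rule Sm_coinduct[where R = "smult_closure K F"])
  show "smult_closure K F X U (\<lambda>x. c x \<odot>\<^bsub>F\<^esub> f x)"
    by (intro smult_closure.smult smult_closure.base assms)
qed (use SmD[OF assms(2)] smult_closure_step in blast)+


text \<open>The quotient rule reads
  \<open>(a/r)^[1] = (a^[1] r - a r^[1]) / (r (r + t r^[1]))\<close>, where the second factor of the
  denominator is \<open>r (x + t y)\<close> and so does not vanish. Carrying a numerator along keeps
  the result within the class, which would fail for inverses alone.\<close>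

lemma Sm_inv_mult:
  fixes X :: "('k, ('a, 'k) itree) tvs"
  assumes "Sm X (scalar_tvs K) U a" "Sm X (scalar_tvs K) U r" "\<And>x. x \<in> U \<Longrightarrow> r x \<noteq> \<zero>"
  shows "Sm X (scalar_tvs K) U (\<lambda>x. a x \<otimes> inv (r x))"
proof (rule Sm_coinduct[where R = "\<lambda>X U h. \<exists>a r. Sm X (scalar_tvs K) U a \<and> Sm X (scalar_tvs K) U r \<and>
    (\<forall>x\<in>U. r x \<noteq> \<zero> \<and> h x = a x \<otimes> inv (r x))"])
  show "\<exists>aa ra. Sm X (scalar_tvs K) U aa \<and> Sm X (scalar_tvs K) U ra \<and>
    (\<forall>x\<in>U. ra x \<noteq> \<zero> \<and> a x \<otimes> inv (r x) = aa x \<otimes> inv (ra x))" using assms by blast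
  fix X :: "('k, ('a, 'k) itree) tvs" and U h
  assume X: "TVS X" and U: "openin (vtop X) U"
    and "\<exists>a r. Sm X (scalar_tvs K) U a \<and> Sm X (scalar_tvs K) U r \<and> (\<forall>x\<in>U. r x \<noteq> \<zero> \<and> h x = a x \<otimes> inv (r x))"
  then obtain a r where a: "Sm X (scalar_tvs K) U a" and r: "Sm X (scalar_tvs K) U r"
    and nz: "\<And>x. x \<in> U \<Longrightarrow> r x \<noteq> \<zero>" and h: "\<And>x. x \<in> U \<Longrightarrow> h x = a x \<otimes> inv (r x)"
    by (elim exE conjE) blast
  have "continuous_map (subtopology (vtop X) U) (ktop K) (\<lambda>x. a x \<otimes> inv (r x))"
    using SmD(4)[OF a] SmD(4)[OF r] nz by (intro kcont_mult kcont_inv) auto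
  then have "continuous_map (subtopology (vtop X) U) (vtop (scalar_tvs K)) h"
    unfolding scalar_tvs_simps by (rule continuous_map_eq) (simp add: h)
  moreover
  obtain a1 where a1: "dstep X (scalar_tvs K) U a a1" "Sm (nx K X) (scalar_tvs K) (nd K X U) a1"
    using SmE[OF a] .
  obtain r1 where r1: "dstep X (scalar_tvs K) U r r1" "Sm (nx K X) (scalar_tvs K) (nd K X U) r1"
    using SmE[OF r] .
  define a' where "a' = (\<lambda>p. a1 p \<otimes> r (bl p) \<ominus>\<^bsub>scalar_tvs K\<^esub> a (bl p) \<otimes> r1 p)"
  define r' where "r' = (\<lambda>p. r (bl p) \<otimes> (r (bl p) \<oplus> bs p \<otimes> r1 p))"
  have Sa: "Sm (nx K X) (scalar_tvs K) (nd K X U) a'" unfolding a'_def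
    using Sm_minus[OF Sm_smult[OF a1(2) Sm_bl[OF r]] Sm_smult[OF Sm_bl[OF a] r1(2)]] by simp
  have Sr: "Sm (nx K X) (scalar_tvs K) (nd K X U) r'" unfolding r'_def
    using Sm_smult[OF Sm_bl[OF r] Sm_add[OF Sm_bl[OF r] Sm_smult[OF Sm_bs[OF X U] r1(2)]]] by simp
  have *: "r' p \<noteq> \<zero> \<and> (p = Br x y t \<longrightarrow> a' p \<otimes> inv (r' p) \<in> carrier K \<and>
      h (x \<oplus>\<^bsub>X\<^esub> t \<odot>\<^bsub>X\<^esub> y) = h x \<oplus> t \<otimes> (a' p \<otimes> inv (r' p)))" if p: "p \<in> nd K X U" for p x y t
    using p
  proof (rule nd_cases)
    fix x' y' t' assume c: "p = Br x' y' t'" "x' \<in> U" "y' \<in> carrier X" "t' \<in> carrier K" "x' \<oplus>\<^bsub>X\<^esub> t' \<odot>\<^bsub>X\<^esub> y' \<in> U"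
    note d = dstepD[OF a1(1) p[unfolded c(1)], simplified] dstepD[OF r1(1) p[unfolded c(1)], simplified]
    define A A1 R R1 where "A = a x'" and "A1 = a1 p" and "R = r x'" and "R1 = r1 p"
    have cl: "A \<in> carrier K" "A1 \<in> carrier K" "R \<in> carrier K" "R1 \<in> carrier K" "R \<noteq> \<zero>"
      using d c Sm_in_carrier[OF a] Sm_in_carrier[OF r] nz by (auto simp: A_def A1_def R_def R1_def)
    define Q where "Q = R \<oplus> t' \<otimes> R1"
    have Q: "Q \<in> carrier K" "Q \<noteq> \<zero>" using cl c d nz[OF c(5)] by (auto simp: Q_def R_def R1_def)
    define u v where "u = inv R" and "v = inv Q"
    have uv: "u \<in> carrier K" "v \<in> carrier K" "R \<otimes> u = \<one>" "Q \<otimes> v = \<one>"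
      using Q cl by (auto simp: u_def v_def)
    have iRQ: "inv (R \<otimes> Q) = u \<otimes> v"
    proof (rule inv_unique0)
      have "(R \<otimes> Q) \<otimes> (u \<otimes> v) = (R \<otimes> u) \<otimes> (Q \<otimes> v)" using uv(1,2) Q(1) cl by algebra
      then show "(R \<otimes> Q) \<otimes> (u \<otimes> v) = \<one>" using uv by simp
    qed (use uv Q cl in auto)
    have "a' p = A1 \<otimes> R \<ominus> A \<otimes> R1"
      using c cl by (simp add: a'_def A_def A1_def R_def R1_def a_minus_def tvs_minus[OF tvs_scalar] l_minus)
    moreover have rp: "r' p = R \<otimes> Q" using c by (simp add: r'_def R_def Q_def R1_def)
    moreover have "A \<otimes> u \<oplus> t' \<otimes> ((A1 \<otimes> R \<ominus> A \<otimes> R1) \<otimes> (u \<otimes> v)) = (A \<oplus> t' \<otimes> A1) \<otimes> v"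
    proof -
      \<comment> \<open>Inserting \<open>R \<otimes> u = \<one>\<close> produces the common
        denominator; the next equality is then ring algebra.\<close>
      have "(A \<oplus> t' \<otimes> A1) \<otimes> v = (A \<oplus> t' \<otimes> A1) \<otimes> (R \<otimes> u) \<otimes> v" using uv cl c by simp
      also have "\<dots> = A \<otimes> u \<otimes> (Q \<otimes> v) \<oplus> t' \<otimes> ((A1 \<otimes> R \<ominus> A \<otimes> R1) \<otimes> (u \<otimes> v))"
        unfolding Q_def using uv(1,2) cl(1-4) c(4) by algebra
      finally show ?thesis using uv cl by simp
    qed
    ultimately have "A \<otimes> u \<oplus> t' \<otimes> (a' p \<otimes> inv (r' p)) = (A \<oplus> t' \<otimes> A1) \<otimes> v"
      by (simp only: iRQ)
    moreover have "h x' = A \<otimes> u" using c by (simp add: h A_def u_def R_def)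
    moreover have "h (x' \<oplus>\<^bsub>X\<^esub> t' \<odot>\<^bsub>X\<^esub> y') = (A \<oplus> t' \<otimes> A1) \<otimes> v"
      using d c by (simp add: h A_def R_def A1_def R1_def Q_def v_def)
    ultimately have "h (x' \<oplus>\<^bsub>X\<^esub> t' \<odot>\<^bsub>X\<^esub> y') = h x' \<oplus> t' \<otimes> (a' p \<otimes> inv (r' p))"
      by simp
    moreover have "r' p \<noteq> \<zero>" unfolding rp using mult_nonzero cl Q by blast
    ultimately show ?thesis using c Sm_in_carrier[OF Sa p] Sm_in_carrier[OF Sr p] by auto
  qed
  have "dstep X (scalar_tvs K) U h (\<lambda>p. a' p \<otimes> inv (r' p))"
  proof (rule dstepI)
    fix x y t assume "x \<in> U" "y \<in> carrier X" "t \<in> carrier K" "x \<oplus>\<^bsub>X\<^esub> t \<odot>\<^bsub>X\<^esub> y \<in> U"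
    then show "a' (Br x y t) \<otimes> inv (r' (Br x y t)) \<in> carrier (scalar_tvs K) \<and>
       h (x \<oplus>\<^bsub>X\<^esub> t \<odot>\<^bsub>X\<^esub> y) = h x \<oplus>\<^bsub>scalar_tvs K\<^esub> t \<odot>\<^bsub>scalar_tvs K\<^esub> (a' (Br x y t) \<otimes> inv (r' (Br x y t)))"
      using *[of "Br x y t" x y t] by simp
  qed
  ultimately show "continuous_map (subtopology (vtop X) U) (vtop (scalar_tvs K)) h \<and>
     (\<exists>g. dstep X (scalar_tvs K) U h g \<and> (\<exists>a r. Sm (nx K X) (scalar_tvs K) (nd K X U) a \<and>
        Sm (nx K X) (scalar_tvs K) (nd K X U) r \<and> (\<forall>x\<in>nd K X U. r x \<noteq> \<zero> \<and> g x = a x \<otimes> inv (r x))))"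
    using Sa Sr * by blast
qed (use SmD[OF assms(1)] in simp_all)

lemma Sm_inv:
  assumes "Sm X (scalar_tvs K) U r" "\<And>x. x \<in> U \<Longrightarrow> r x \<noteq> \<zero>"
  shows "Sm X (scalar_tvs K) U (\<lambda>x. inv (r x))"
proof (rule Sm_cong)
  show "Sm X (scalar_tvs K) U (\<lambda>x. \<one> \<otimes> inv (r x))"
    using SmD[OF assms(1)] by (intro Sm_inv_mult Sm_const assms) auto
qed (use Sm_in_carrier[OF assms(1)] assms(2) in auto)

lemma continuous_map_local:
  assumes "openin T U" "\<And>p. p \<in> U \<Longrightarrow> \<exists>N. openin T N \<and> p \<in> N \<and> N \<subseteq> U \<and> continuous_map (subtopology T N) Z h"
  shows "continuous_map (subtopology T U) Z h"
proof -
  have ts: "topspace (subtopology T U) = U" using assms(1) openin_subset by fastforce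
  show ?thesis
    unfolding continuous_map_def ts
  proof (intro conjI allI impI)
    show "h \<in> U \<rightarrow> topspace Z"
    proof
      fix p assume "p \<in> U"
      then obtain N where N: "openin T N" "p \<in> N" "continuous_map (subtopology T N) Z h" using assms(2) by blast
      then have "p \<in> topspace (subtopology T N)" using openin_subset by fastforce
      then show "h p \<in> topspace Z" using N(3) by (auto simp: continuous_map_def Pi_iff)
    qed
    fix W assume W: "openin Z W"
    show "openin (subtopology T U) {x \<in> U. h x \<in> W}"
    proof (subst openin_subopen, intro ballI)
      fix p assume p: "p \<in> {x \<in> U. h x \<in> W}"
      then obtain N where N: "openin T N" "p \<in> N" "N \<subseteq> U" "continuous_map (subtopology T N) Z h" using assms(2) by blast
      have "topspace (subtopology T N) = N" using N(1) openin_subset by fastforce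
      from openin_continuous_map_preimage[OF N(4) W, unfolded this]
      have "openin (subtopology T N) {x \<in> N. h x \<in> W}" .
      then have "openin T {x \<in> N. h x \<in> W}" using N(1) openin_open_subtopology by blast
      then have "openin (subtopology T U) {x \<in> N. h x \<in> W}" using N(3) assms(1) by (auto simp: openin_open_subtopology)
      then show "\<exists>T'. openin (subtopology T U) T' \<and> p \<in> T' \<and> T' \<subseteq> {x \<in> U. h x \<in> W}" using p N by blast
    qed
  qed
qed

text \<open>Locality is not immediate: for \<open>t \<noteq> 0\<close> the points \<open>x\<close> and \<open>x + t y\<close> may lie in different sets
  of the cover. There, the difference quotient is smooth as a quotient by \<open>t\<close>.\<close>

lemma Sm_local:
  fixes X :: "('k, ('a, 'k) itree) tvs"
  assumes "TVS X" "TVS F" "openin (vtop X) U"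
    and "\<And>p. p \<in> U \<Longrightarrow> \<exists>N. p \<in> N \<and> N \<subseteq> U \<and> Sm X F N h"
  shows "Sm X F U h"
proof (rule Sm_coinduct[where R = "\<lambda>X U h. \<forall>p\<in>U. \<exists>N. p \<in> N \<and> N \<subseteq> U \<and> Sm X F N h"])
  show "\<forall>p\<in>U. \<exists>N. p \<in> N \<and> N \<subseteq> U \<and> Sm X F N h" using assms by blast
next
  interpret F: topological_vector_space K F by fact
  fix X :: "('k, ('a, 'k) itree) tvs" and U h
  assume X: "TVS X" and U: "openin (vtop X) U" and ex: "\<forall>p\<in>U. \<exists>N. p \<in> N \<and> N \<subseteq> U \<and> Sm X F N h"
  obtain N where "\<forall>p\<in>U. p \<in> N p \<and> N p \<subseteq> U \<and> Sm X F (N p) h" using bchoice[OF ex] by (elim exE)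
  then have N: "\<And>p. p \<in> U \<Longrightarrow> p \<in> N p" "\<And>p. p \<in> U \<Longrightarrow> N p \<subseteq> U" "\<And>p. p \<in> U \<Longrightarrow> Sm X F (N p) h"
    by simp_all
  interpret X: topological_vector_space K X by fact
  note Uc = openin_carrier[OF X U]
  have "continuous_map (subtopology (vtop X) U) (vtop F) h"
  proof (rule continuous_map_local[OF U])
    fix p assume p: "p \<in> U"
    show "\<exists>M. openin (vtop X) M \<and> p \<in> M \<and> M \<subseteq> U \<and> continuous_map (subtopology (vtop X) M) (vtop F) h"
      by (intro exI[of _ "N p"] conjI N SmD(3,4)[OF N(3)] p)
  qed
  moreover
  have "\<forall>p\<in>U. \<exists>G. dstep X F (N p) h G \<and> Sm (nx K X) F (nd K X (N p)) G"
  proof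
    fix p assume "p \<in> U"
    from SmE[OF N(3)[OF this]] show "\<exists>G. dstep X F (N p) h G \<and> Sm (nx K X) F (nd K X (N p)) G" by blast
  qed
  from bchoice[OF this] obtain G where "\<forall>p\<in>U. dstep X F (N p) h (G p) \<and> Sm (nx K X) F (nd K X (N p)) (G p)"
    by (elim exE)
  then have G: "\<And>p. p \<in> U \<Longrightarrow> dstep X F (N p) h (G p)" "\<And>p. p \<in> U \<Longrightarrow> Sm (nx K X) F (nd K X (N p)) (G p)"
    by simp_all
  have hc: "h p \<in> carrier F" if "p \<in> U" for p using Sm_in_carrier[OF N(3)] N(1) that by blast
  define g where "g = (\<lambda>q. if bs q = \<zero> then G (bl q) q
     else inv (bs q) \<odot>\<^bsub>F\<^esub> (h (bl q \<oplus>\<^bsub>X\<^esub> bs q \<odot>\<^bsub>X\<^esub> br q) \<ominus>\<^bsub>F\<^esub> h (bl q)))"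
  \<comment> \<open>The choice of neighbourhood does not matter: at \<open>t = \<zero>\<close> the
    quotients chosen at \<open>p\<close> and at \<open>x\<close> agree, by uniqueness on the overlap
    of the two neighbourhoods.\<close>
  have gG: "g q = G p q" if p: "p \<in> U" and q: "q \<in> nd K X (N p)" for p q
    using q
  proof (rule nd_cases)
    fix x y t assume c: "q = Br x y t" "x \<in> N p" "y \<in> carrier X" "t \<in> carrier K" "x \<oplus>\<^bsub>X\<^esub> t \<odot>\<^bsub>X\<^esub> y \<in> N p"
    have xU: "x \<in> U" using c p N by blast
    show ?thesis
    proof (cases "t = \<zero>")
      case False
      note d = dstepD[OF G(1)[OF p] q[unfolded c(1)]]
      have "inv t \<odot>\<^bsub>F\<^esub> (h (x \<oplus>\<^bsub>X\<^esub> t \<odot>\<^bsub>X\<^esub> y) \<ominus>\<^bsub>F\<^esub> h x) = inv t \<odot>\<^bsub>F\<^esub> (t \<odot>\<^bsub>F\<^esub> G p (Br x y t))"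
        using d hc[OF xU] c(4) by (simp add: a_minus_def F.a_ac F.r_neg1 F.r_neg2 F.r_neg)
      also have "\<dots> = G p (Br x y t)" using False c d by (simp flip: F.smult_assoc1)
      finally show ?thesis using c False by (simp add: g_def)
    next
      case True
      let ?V = "N p \<inter> N x"
      have V: "openin (vtop X) ?V" using SmD(3)[OF N(3)] p xU by blast
      have sub: "nd K X ?V \<subseteq> nd K X (N p)" "nd K X ?V \<subseteq> nd K X (N x)" by (auto elim!: nd_cases)
      have "G p q = G x q"
      proof (rule dstep_unique[OF X assms(2) V])
        show "h z \<in> carrier F" if "z \<in> ?V" for z using hc that N p by blast
        show "q \<in> nd K X ?V" using c True xU N(1) Uc by auto
        show "dstep X F ?V h (G p)" "dstep X F ?V h (G x)"
          using G(1)[OF p] G(1)[OF xU] sub unfolding dstep_def by blast+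
        show "continuous_map (subtopology (vtop (nx K X)) (nd K X ?V)) (vtop F) (G p)"
             "continuous_map (subtopology (vtop (nx K X)) (nd K X ?V)) (vtop F) (G x)"
          using SmD(4)[OF G(2)[OF p]] SmD(4)[OF G(2)[OF xU]] sub continuous_map_from_subtopology_mono by blast+
      qed
      then show ?thesis using c True by (simp add: g_def)
    qed
  qed
  have "dstep X F U h g"
  proof (rule dstepI)
    fix x y t assume c: "x \<in> U" "y \<in> carrier X" "t \<in> carrier K" "x \<oplus>\<^bsub>X\<^esub> t \<odot>\<^bsub>X\<^esub> y \<in> U"
    show "g (Br x y t) \<in> carrier F \<and> h (x \<oplus>\<^bsub>X\<^esub> t \<odot>\<^bsub>X\<^esub> y) = h x \<oplus>\<^bsub>F\<^esub> t \<odot>\<^bsub>F\<^esub> g (Br x y t)"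
    proof (cases "t = \<zero>")
      case True
      then have "Br x y t \<in> nd K X (N x)" using c N(1) Uc by auto
      from dstepD[OF G(1)[OF c(1)] this] show ?thesis using True by (simp add: g_def)
    next
      case False
      then show ?thesis using c hc[OF c(1)] hc[OF c(4)]
        by (simp add: g_def a_minus_def F.a_ac F.r_neg1 F.r_neg2 F.r_neg flip: F.smult_assoc1)
    qed
  qed
  moreover have "\<exists>M. q \<in> M \<and> M \<subseteq> nd K X U \<and> Sm (nx K X) F M g" if q: "q \<in> nd K X U" for q
    using q
  proof (rule nd_cases)
    fix x y t assume c: "q = Br x y t" "x \<in> U" "y \<in> carrier X" "t \<in> carrier K" "x \<oplus>\<^bsub>X\<^esub> t \<odot>\<^bsub>X\<^esub> y \<in> U"
    show ?thesis
    proof (cases "t = \<zero>")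
      case True
      then have "q \<in> nd K X (N x)" using c N(1) Uc by auto
      moreover have "nd K X (N x) \<subseteq> nd K X U" using N(2)[OF c(2)] by (auto elim!: nd_cases)
      moreover have "Sm (nx K X) F (nd K X (N x)) g" using Sm_cong[OF G(2)[OF c(2)]] gG[OF c(2)] by blast
      ultimately show ?thesis by blast
    next
      case False
      let ?s = "\<lambda>p. bl p \<oplus>\<^bsub>X\<^esub> bs p \<odot>\<^bsub>X\<^esub> br p"
      let ?C = "carrier (nx K X)"
      define M where "M = {p \<in> ?C. bl p \<in> N x \<and> ?s p \<in> N (x \<oplus>\<^bsub>X\<^esub> t \<odot>\<^bsub>X\<^esub> y) \<and> bs p \<in> carrier K - {\<zero>}}"
      have tsC: "topspace (vtop (nx K X)) = ?C"
        by (rule topological_vector_space.topspace_vtop[OF tvs_nx[OF X]])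
      have "openin (ktop K) (carrier K - {\<zero>})"
        using Hausdorff_ktop by (metis Hausdorff_imp_t1_space closedin_def closedin_t1_singleton topspace_ktop zero_closed)
      then have "openin (vtop (nx K X)) ({p \<in> ?C. bl p \<in> N x} \<inter> {p \<in> ?C. ?s p \<in> N (x \<oplus>\<^bsub>X\<^esub> t \<odot>\<^bsub>X\<^esub> y)}
         \<inter> {p \<in> ?C. bs p \<in> carrier K - {\<zero>}})"
        unfolding tsC[symmetric]
        using clinD(4)[OF clin_nx(1)[OF X]] cont_step[OF X] clinD(4)[OF clin_nx(3)[OF X]] SmD(3)[OF N(3)] c
        by (intro openin_Int openin_continuous_map_preimage) auto
      then have M: "openin (vtop (nx K X)) M" by (simp add: M_def Collect_conj_eq[symmetric] Int_def conj_ac)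
      have Sbs: "Sm (nx K X) (scalar_tvs K) M bs" by (intro Sm_clin clin_nx X tvs_nx tvs_scalar M)
      have Sbl: "Sm (nx K X) X M bl" by (intro Sm_clin clin_nx X tvs_nx M)
      have "Sm (nx K X) X M br" by (intro Sm_clin clin_nx X tvs_nx M)
      then have Ss: "Sm (nx K X) X M ?s" by (intro Sm_add Sbl Sm_smult Sbs)
      have "Sm (nx K X) F M (\<lambda>p. inv (bs p) \<odot>\<^bsub>F\<^esub> (h (?s p) \<ominus>\<^bsub>F\<^esub> h (bl p)))"
        by (intro Sm_smult Sm_inv Sm_minus Sbs Sm_compose[OF N(3)[OF c(5)] Ss] Sm_compose[OF N(3)[OF c(2)] Sbl])
          (auto simp: M_def)
      then have "Sm (nx K X) F M g" by (rule Sm_cong) (auto simp: M_def g_def)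
      moreover have "q \<in> M" using c False N(1) Uc by (auto simp: M_def)
      moreover have "M \<subseteq> nd K X U" using N(2)[OF c(2)] N(2)[OF c(5)] by (auto simp: M_def elim!: nx_cases)
      ultimately show ?thesis by blast
    qed
  qed
  ultimately show "continuous_map (subtopology (vtop X) U) (vtop F) h \<and>
     (\<exists>g. dstep X F U h g \<and> (\<forall>p\<in>nd K X U. \<exists>N. p \<in> N \<and> N \<subseteq> nd K X U \<and> Sm (nx K X) F N g))"
    by blast
qed (use assms in simp_all)

end

section \<open>Smooth maps on arbitrary spaces\<close>

lemma continuous_map_homeo_sub:
  assumes "homeomorphic_maps T T' h k" "S \<subseteq> topspace T"
  shows "continuous_map (subtopology T S) Z (\<lambda>x. g (h x)) \<longleftrightarrow> continuous_map (subtopology T' (h ` S)) Z g"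
proof
  have h: "continuous_map (subtopology T S) (subtopology T' (h ` S)) h"
    using assms by (auto simp: homeomorphic_maps_def continuous_map_in_subtopology continuous_map_from_subtopology)
  have k: "continuous_map (subtopology T' (h ` S)) (subtopology T S) k"
    using assms by (auto simp: homeomorphic_maps_def continuous_map_in_subtopology continuous_map_from_subtopology)
  { assume "continuous_map (subtopology T' (h ` S)) Z g"
    from continuous_map_compose[OF h this] show "continuous_map (subtopology T S) Z (\<lambda>x. g (h x))"
      by (simp add: o_def) }
  assume "continuous_map (subtopology T S) Z (\<lambda>x. g (h x))"
  from continuous_map_compose[OF k this] show "continuous_map (subtopology T' (h ` S)) Z g"
    by (rule continuous_map_eq) (use assms in \<open>auto simp: homeomorphic_maps_def\<close>)
qed

definition tree_fun :: "('e \<Rightarrow> 'f) \<Rightarrow> ('e, 'k) itree \<Rightarrow> 'f" where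
  "tree_fun f p = (case p of Base x \<Rightarrow> f x | Br _ _ _ \<Rightarrow> undefined)"

lemma tree_fun_Base [simp]: "tree_fun f (Base x) = f x"
  by (simp add: tree_fun_def)

context valued_field begin

lemma cont_nd_iff:
  assumes "TVS X" "U \<subseteq> carrier X"
  shows "continuous_map (subtopology (vtop (prod_tvs X (prod_tvs X (scalar_tvs K)))) (dq_dom K X U)) Z
      (\<lambda>(x, y, t). g (Br x y t)) \<longleftrightarrow> continuous_map (subtopology (vtop (nx K X)) (nd K X U)) Z g"
proof -
  interpret X: topological_vector_space K X by fact
  have "dq_dom K X U \<subseteq> topspace (vtop (prod_tvs X (prod_tvs X (scalar_tvs K))))"
    using assms(2) by (auto simp: dq_dom_def X.topspace_vtop)
  from continuous_map_homeo_sub[OF homeomorphic_nx[OF assms(1)] this, where g = g and Z = Z]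
  show ?thesis by (simp add: nd_def case_prod_unfold)
qed

lemma step_iff:
  assumes "TVS F" "a \<in> carrier F" "b \<in> carrier F" "g \<in> carrier F" "t \<in> carrier K" "t \<noteq> \<zero>"
  shows "g = inv t \<odot>\<^bsub>F\<^esub> (b \<ominus>\<^bsub>F\<^esub> a) \<longleftrightarrow> b = a \<oplus>\<^bsub>F\<^esub> t \<odot>\<^bsub>F\<^esub> g"
proof -
  interpret F: topological_vector_space K F by fact
  show ?thesis
  proof
    assume "g = inv t \<odot>\<^bsub>F\<^esub> (b \<ominus>\<^bsub>F\<^esub> a)"
    then show "b = a \<oplus>\<^bsub>F\<^esub> t \<odot>\<^bsub>F\<^esub> g" using assms
      by (simp add: a_minus_def F.a_lcomm[of a b] F.r_neg flip: F.smult_assoc1)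
  next
    assume "b = a \<oplus>\<^bsub>F\<^esub> t \<odot>\<^bsub>F\<^esub> g"
    then have "b \<ominus>\<^bsub>F\<^esub> a = t \<odot>\<^bsub>F\<^esub> g" using assms
      by (simp add: a_minus_def F.a_ac F.r_neg1 F.r_neg2 F.r_neg)
    then show "g = inv t \<odot>\<^bsub>F\<^esub> (b \<ominus>\<^bsub>F\<^esub> a)" using assms by (simp flip: F.smult_assoc1)
  qed
qed

text \<open>For \<open>t \<noteq> \<zero>\<close> the equations with and without division are
  equivalent, and at \<open>t = \<zero>\<close> the one without division holds by itself; so for
  continuous \<open>g\<close> the two notions coincide.\<close>

lemma is_dq_iff_dstep:
  assumes X: "TVS X" and F: "TVS F" and U: "openin (vtop X) U" and f: "\<And>x. x \<in> U \<Longrightarrow> f x \<in> carrier F"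
  shows "is_dq K X F U f (\<lambda>(x, y, t). g (Br x y t)) \<longleftrightarrow>
     continuous_map (subtopology (vtop (nx K X)) (nd K X U)) (vtop F) g \<and> dstep X F U f g"
proof -
  interpret X: topological_vector_space K X by fact
  interpret F: topological_vector_space K F by fact
  note Uc = openin_carrier[OF X U]
  have "(\<forall>(x, y, t)\<in>dq_dom K X U. t \<noteq> \<zero> \<longrightarrow> g (Br x y t) = inv t \<odot>\<^bsub>F\<^esub> (f (x \<oplus>\<^bsub>X\<^esub> t \<odot>\<^bsub>X\<^esub> y) \<ominus>\<^bsub>F\<^esub> f x))
      \<longleftrightarrow> dstep X F U f g"
    if c: "continuous_map (subtopology (vtop (nx K X)) (nd K X U)) (vtop F) g"
  proof -
    have gc: "g p \<in> carrier F" if "p \<in> nd K X U" for p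
      using cont_openin_carrier[OF tvs_nx[OF X] F openin_nd[OF X U] c that] .
    have 1: "f (x \<oplus>\<^bsub>X\<^esub> t \<odot>\<^bsub>X\<^esub> y) = f x \<oplus>\<^bsub>F\<^esub> t \<odot>\<^bsub>F\<^esub> g (Br x y t)"
      if "Br x y t \<in> nd K X U" "t = \<zero>" for x y t
      using that Uc f gc[OF that(1)] by auto
    have 2: "g (Br x y t) = inv t \<odot>\<^bsub>F\<^esub> (f (x \<oplus>\<^bsub>X\<^esub> t \<odot>\<^bsub>X\<^esub> y) \<ominus>\<^bsub>F\<^esub> f x) \<longleftrightarrow>
        f (x \<oplus>\<^bsub>X\<^esub> t \<odot>\<^bsub>X\<^esub> y) = f x \<oplus>\<^bsub>F\<^esub> t \<odot>\<^bsub>F\<^esub> g (Br x y t)"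
      if "Br x y t \<in> nd K X U" "t \<noteq> \<zero>" for x y t
      using that gc[OF that(1)] by (intro step_iff F f) auto
    have "(x, y, t) \<in> dq_dom K X U \<longleftrightarrow> Br x y t \<in> nd K X U" for x y t by (simp add: dq_dom_def)
    then show ?thesis unfolding dstep_def using 1 2 gc by fast
  qed
  then show ?thesis unfolding is_dq_def cont_nd_iff[OF X Uc] by auto
qed

lemma is_dq_dstep:
  fixes f :: "('a, 'k) itree \<Rightarrow> 'b"
  assumes X: "TVS X" and F: "TVS F" and U: "openin (vtop X) U" and f: "\<And>x. x \<in> U \<Longrightarrow> f x \<in> carrier F"
    and "is_dq K X F U f g"
  shows "continuous_map (subtopology (vtop (nx K X)) (nd K X U)) (vtop F) (\<lambda>p. g (bl p, br p, bs p))"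
    "dstep X F U f (\<lambda>p. g (bl p, br p, bs p))"
proof -
  have "(\<lambda>(x, y, t). g (bl (Br x y t), br (Br x y t), bs (Br x y t))) = g" by auto
  then have "is_dq K X F U f (\<lambda>(x, y, t). g (bl (Br x y t), br (Br x y t), bs (Br x y t)))"
    using assms(5) by (simp only:)
  then show "continuous_map (subtopology (vtop (nx K X)) (nd K X U)) (vtop F) (\<lambda>p. g (bl p, br p, bs p))"
    "dstep X F U f (\<lambda>p. g (bl p, br p, bs p))"
    using is_dq_iff_dstep[OF X F U, of f "\<lambda>p. g (bl p, br p, bs p)"] f by blast+
qed

abbreviation BT :: "('k, 'e) tvs \<Rightarrow> ('k, ('e, 'k) itree) tvs" where
  "BT E \<equiv> image_tvs Base E"

abbreviation BU :: "'e set \<Rightarrow> ('e, 'k) itree set" where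
  "BU U \<equiv> Base ` U"

lemma iter_Suc: "iter_tvs K E (Suc j) = nx K (iter_tvs K E j)"
  "iter_dom K E U (Suc j) = nd K (iter_tvs K E j) (iter_dom K E U j)"
  by (simp_all add: nx_def nd_def)

lemma openin_Base_iff:
  assumes "TVS E" shows "openin (vtop (BT E)) (BU U) \<longleftrightarrow> openin (vtop E) U"
proof -
  note h = homeomorphic_image_tvs[OF assms inj_Base]
  interpret E: topological_vector_space K E by fact
  interpret B: topological_vector_space K "BT E" using assms by (intro tvs_image inj_Base)
  have hm: "homeomorphic_map (vtop E) (vtop (BT E)) Base" using h homeomorphic_maps_map by blast
  have "openin (vtop (BT E)) (BU U) \<longleftrightarrow> openin (vtop E) U" if "U \<subseteq> topspace (vtop E)"
    using homeomorphic_map_openness[OF hm that] .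
  moreover have "U \<subseteq> carrier E" if "BU U \<subseteq> carrier (BT E)"
    using that by (auto simp: image_tvs_simps inj_Base)
  ultimately show ?thesis using openin_subset E.topspace_vtop B.topspace_vtop by metis
qed

lemma iter_dq_0: "iter_dq K E F U f 0 = tree_fun f"
  by (simp add: fun_eq_iff tree_fun_def)

lemma C1_step:
  assumes X: "TVS X" and F: "TVS F" and U: "openin (vtop X) U" and "C1_on K X F U f"
  shows "continuous_map (subtopology (vtop (nx K X)) (nd K X U)) (vtop F) (\<lambda>p. dq K X F U f (bl p, br p, bs p))"
    "dstep X F U f (\<lambda>p. dq K X F U f (bl p, br p, bs p))"
proof -
  have c: "continuous_map (subtopology (vtop X) U) (vtop F) f" and "\<exists>g. is_dq K X F U f g"
    using assms(4) by (auto simp: C1_on_def)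
  then have "is_dq K X F U f (dq K X F U f)" unfolding dq_def by (metis someI)
  from is_dq_dstep[OF X F U cont_openin_carrier[OF X F U c] this]
  show "continuous_map (subtopology (vtop (nx K X)) (nd K X U)) (vtop F) (\<lambda>p. dq K X F U f (bl p, br p, bs p))"
    "dstep X F U f (\<lambda>p. dq K X F U f (bl p, br p, bs p))" by auto
qed

text \<open>The iterates \<open>f^[j]\<close> on their domains form an invariant: degree
  \<open>j + 1\<close> of differentiability provides, at stage \<open>j\<close>, the continuity of
  \<open>f^[j]\<close> and a quotient of it, for which \<open>dq\<close> has chosen one.\<close>

lemma Ck_imp_Sm:
  fixes E :: "('k, 'e) tvs"
  assumes E: "TVS E" and F: "TVS F" and U: "openin (vtop E) U" and Ck: "\<And>k. Ck_on K E F U f k"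
  shows "Sm (BT E) F (BU U) (tree_fun f)"
proof (rule Sm_coinduct[where R = "\<lambda>X V h. \<exists>j. X = iter_tvs K E j \<and> V = iter_dom K E U j \<and> (\<forall>x\<in>V. h x = iter_dq K E F U f j x)"])
  show "\<exists>j. BT E = iter_tvs K E j \<and> BU U = iter_dom K E U j \<and>
     (\<forall>x\<in>BU U. tree_fun f x = iter_dq K E F U f j x)"
    by (rule exI[of _ 0]) (simp add: tree_fun_def)
next
  fix X :: "('k, ('e, 'k) itree) tvs" and V h
  assume X: "TVS X" and V: "openin (vtop X) V" and
    "\<exists>j. X = iter_tvs K E j \<and> V = iter_dom K E U j \<and> (\<forall>x\<in>V. h x = iter_dq K E F U f j x)"
  then obtain j where j: "X = iter_tvs K E j" "V = iter_dom K E U j" "\<And>x. x \<in> V \<Longrightarrow> h x = iter_dq K E F U f j x"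
    by blast
  let ?f = "iter_dq K E F U f"
  have C: "C1_on K X F V (?f j)" using Ck[of "Suc j"] j by simp
  then have "continuous_map (subtopology (vtop X) V) (vtop F) (?f j)" by (simp add: C1_on_def)
  then have "continuous_map (subtopology (vtop X) V) (vtop F) h"
    by (rule continuous_map_eq) (simp add: j(3))
  moreover have "dstep X F V h (?f (Suc j))"
  proof (rule dstepI)
    fix x y t assume a: "x \<in> V" "y \<in> carrier X" "t \<in> carrier K" "x \<oplus>\<^bsub>X\<^esub> t \<odot>\<^bsub>X\<^esub> y \<in> V"
    then have "Br x y t \<in> nd K X V" by simp
    from dstepD[OF C1_step(2)[OF X F V C] this]
    show "?f (Suc j) (Br x y t) \<in> carrier F \<and> h (x \<oplus>\<^bsub>X\<^esub> t \<odot>\<^bsub>X\<^esub> y) = h x \<oplus>\<^bsub>F\<^esub> t \<odot>\<^bsub>F\<^esub> ?f (Suc j) (Br x y t)"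
      using a j by simp
  qed
  ultimately show "continuous_map (subtopology (vtop X) V) (vtop F) h \<and>
     (\<exists>g. dstep X F V h g \<and> (\<exists>j. nx K X = iter_tvs K E j \<and> nd K X V = iter_dom K E U j \<and>
        (\<forall>x\<in>nd K X V. g x = iter_dq K E F U f j x)))"
    unfolding j(1,2) iter_Suc[symmetric] by blast
qed (simp_all add: assms tvs_image inj_Base openin_Base_iff)

text \<open>The iterates are defined by choice, so the induction has to claim in addition that each
  \<open>f^[k]\<close> is smooth: uniqueness identifies the chosen quotient with the smooth one from
  \<open>SmE\<close>.\<close>

lemma Sm_imp_Ck:
  assumes E: "TVS E" and F: "TVS F" and f: "Sm (BT E) F (BU U) (tree_fun f)"
  shows "Ck_on K E F U f k"
proof -
  let ?X = "iter_tvs K E" and ?U = "iter_dom K E U" and ?f = "iter_dq K E F U f"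
  have U: "openin (vtop E) U" using SmD(3)[OF f] by (simp add: openin_Base_iff E)
  interpret E: topological_vector_space K E by fact
  have "homeomorphic_maps (vtop E) (vtop (BT E)) Base (inv_into UNIV Base)"
    by (rule homeomorphic_image_tvs[OF E inj_Base])
  from continuous_map_homeo_sub[OF this openin_subset[OF U], of "vtop F" "tree_fun f"] SmD(4)[OF f]
  have c: "continuous_map (subtopology (vtop E) U) (vtop F) f" by simp
  have "Ck_on K E F U f k \<and> Sm (?X k) F (?U k) (?f k)"
  proof (induction k)
    case 0
    then show ?case using c f by (simp add: iter_dq_0 del: iter_dq.simps)
  next
    case (Suc k)
    then have S: "Sm (?X k) F (?U k) (?f k)" by blast
    obtain g where g: "dstep (?X k) F (?U k) (?f k) g" "Sm (nx K (?X k)) F (nd K (?X k) (?U k)) g" using SmE[OF S] .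
    note cf = Sm_in_carrier[OF S]
    have "is_dq K (?X k) F (?U k) (?f k) (\<lambda>(x, y, t). g (Br x y t))"
      using is_dq_iff_dstep[OF SmD(1-3)[OF S], of "?f k" g] cf SmD(4)[OF g(2)] g(1) by blast
    then have C: "C1_on K (?X k) F (?U k) (?f k)" using SmD(4)[OF S] unfolding C1_on_def by blast
    have "Sm (nx K (?X k)) F (nd K (?X k) (?U k)) (?f (Suc k))"
    proof (rule Sm_cong[OF g(2)])
      fix p assume p: "p \<in> nd K (?X k) (?U k)"
      from dstep_unique[OF SmD(1-3)[OF S] cf C1_step[OF SmD(1-3)[OF S] C] SmD(4)[OF g(2)] g(1) p]
      show "?f (Suc k) p = g p" using p by (cases p) auto
    qed
    with C Suc show ?case unfolding iter_Suc by (simp del: iter_dq.simps iter_tvs.simps iter_dom.simps)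
  qed
  then show ?thesis by blast
qed

text \<open>Includes the axioms of both spaces, so that one fact about \<open>f\<close> supplies the
  hypotheses of most closure properties.\<close>

definition smo :: "('k, 'e) tvs \<Rightarrow> ('k, 'f) tvs \<Rightarrow> 'e set \<Rightarrow> ('e \<Rightarrow> 'f) \<Rightarrow> bool" where
  "smo E F U f \<longleftrightarrow> TVS E \<and> TVS F \<and> smooth_on K E F U f"

lemma smo_iff_Sm: "smo E F U f \<longleftrightarrow> TVS E \<and> TVS F \<and> Sm (BT E) F (BU U) (tree_fun f)"
proof
  assume "smo E F U f"
  then show "TVS E \<and> TVS F \<and> Sm (BT E) F (BU U) (tree_fun f)"
    using Ck_imp_Sm[of E F U f] by (auto simp: smo_def smooth_on_def)
next
  assume a: "TVS E \<and> TVS F \<and> Sm (BT E) F (BU U) (tree_fun f)"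
  then have "openin (vtop E) U" using SmD(3)[of "BT E" F "BU U" "tree_fun f"] by (simp add: openin_Base_iff)
  then show "smo E F U f" using a Sm_imp_Ck[of E F U f] by (auto simp: smo_def smooth_on_def)
qed

lemma smoD:
  assumes "smo E F U f"
  shows "TVS E" "TVS F" "openin (vtop E) U" "continuous_map (subtopology (vtop E) U) (vtop F) f"
    "smooth_on K E F U f" "x \<in> U \<Longrightarrow> f x \<in> carrier F" "x \<in> U \<Longrightarrow> x \<in> carrier E"
proof -
  show 1: "TVS E" "TVS F" "openin (vtop E) U" "smooth_on K E F U f" using assms by (auto simp: smo_def smooth_on_def)
  have "Ck_on K E F U f 0" using 1 unfolding smooth_on_def by blast
  then show 2: "continuous_map (subtopology (vtop E) U) (vtop F) f" by simp
  show "x \<in> U \<Longrightarrow> f x \<in> carrier F" using cont_openin_carrier[OF 1(1-3) 2] .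
  show "x \<in> U \<Longrightarrow> x \<in> carrier E" using openin_carrier[OF 1(1,3)] by blast
qed

section \<open>Closure properties, carried over from trees\<close>

lemma smo_compose:
  assumes "smo F G V g" "smo E F U f" "\<And>x. x \<in> U \<Longrightarrow> f x \<in> V"
  shows "smo E G U (\<lambda>x. g (f x))"
proof -
  note F = smoD(1)[OF assms(1)]
  have f: "Sm (BT E) F (BU U) (tree_fun f)" and g: "Sm (BT F) G (BU V) (tree_fun g)"
    using assms(1,2) by (auto simp: smo_iff_Sm)
  have "Sm (BT E) (BT F) (BU U) (\<lambda>p. Base (tree_fun f p))"
    by (rule Sm_postcomp[OF f tvs_image[OF F inj_Base] clin_image(1)[OF F inj_Base]])
  from Sm_compose[OF g this]
  have "Sm (BT E) G (BU U) (\<lambda>p. tree_fun g (Base (tree_fun f p)))" using assms(3) by force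
  then have "Sm (BT E) G (BU U) (tree_fun (\<lambda>x. g (f x)))"
    by (rule Sm_cong) auto
  then show ?thesis using assms by (simp add: smo_iff_Sm)
qed

lemma smo_cong:
  assumes "smo E F U f" "\<And>x. x \<in> U \<Longrightarrow> h x = f x" shows "smo E F U h"
  using assms(1) Sm_cong[of "BT E" F "BU U" "tree_fun f" "tree_fun h"] assms(2)
  by (force simp: smo_iff_Sm)

lemma smo_subset:
  assumes "smo E F U f" "openin (vtop E) V" "V \<subseteq> U" shows "smo E F V f"
  using assms Sm_subset[of "BT E" F "BU U" "tree_fun f" "BU V"]
  by (auto simp: smo_iff_Sm openin_Base_iff)

lemma smo_local:
  assumes "TVS E" "TVS F" "\<And>p. p \<in> U \<Longrightarrow> \<exists>N. p \<in> N \<and> N \<subseteq> U \<and> smo E F N h"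
  shows "smo E F U h"
proof -
  have "openin (vtop E) U"
  proof (subst openin_subopen, intro ballI)
    fix p assume "p \<in> U"
    then obtain N where "p \<in> N" "N \<subseteq> U" "smo E F N h" using assms(3) by blast
    with smoD(3)[OF this(3)] show "\<exists>T. openin (vtop E) T \<and> p \<in> T \<and> T \<subseteq> U" by blast
  qed
  moreover have "\<exists>M. q \<in> M \<and> M \<subseteq> BU U \<and> Sm (BT E) F M (tree_fun h)" if q: "q \<in> BU U" for q
  proof -
    obtain p where p: "p \<in> U" "q = Base p" using q by blast
    obtain N where "p \<in> N \<and> N \<subseteq> U \<and> smo E F N h" using assms(3)[OF p(1)] by blast
    then show ?thesis using p by (intro exI[of _ "BU N"]) (auto simp: smo_iff_Sm)
  qed
  ultimately show ?thesis unfolding smo_iff_Sm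
    by (intro conjI assms Sm_local tvs_image inj_Base) (simp_all add: openin_Base_iff assms(1))
qed

lemma smo_clin:
  assumes "clin E F l" "TVS E" "TVS F" "openin (vtop E) U" shows "smo E F U l"
proof -
  have "Sm (BT E) F (BU U) (\<lambda>p. l (inv_into UNIV Base p))"
    by (intro Sm_clin clin_compose[OF clin_image(2) assms(1)] tvs_image inj_Base assms)
      (simp add: openin_Base_iff assms)
  then have "Sm (BT E) F (BU U) (tree_fun l)" by (rule Sm_cong) auto
  then show ?thesis using assms by (simp add: smo_iff_Sm)
qed

lemma smo_id: "TVS E \<Longrightarrow> openin (vtop E) U \<Longrightarrow> smo E E U (\<lambda>x. x)"
  by (intro smo_clin clin_id)

lemma smo_const:
  assumes "a \<in> carrier F" "TVS E" "TVS F" "openin (vtop E) U" shows "smo E F U (\<lambda>_. a)"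
proof -
  have "Sm (BT E) F (BU U) (\<lambda>_. a)"
    by (intro Sm_const tvs_image inj_Base assms) (simp add: openin_Base_iff assms)
  then have "Sm (BT E) F (BU U) (tree_fun (\<lambda>_. a))" by (rule Sm_cong) auto
  then show ?thesis using assms by (simp add: smo_iff_Sm)
qed

lemma smo_pair:
  assumes "smo E F U f" "smo E G U g" shows "smo E (prod_tvs F G) U (\<lambda>x. (f x, g x))"
proof -
  have "Sm (BT E) (prod_tvs F G) (BU U) (\<lambda>p. (tree_fun f p, tree_fun g p))"
    using assms by (intro Sm_pair) (auto simp: smo_iff_Sm)
  then have "Sm (BT E) (prod_tvs F G) (BU U) (tree_fun (\<lambda>x. (f x, g x)))"
    by (rule Sm_cong) auto
  then show ?thesis using assms by (simp add: smo_iff_Sm tvs_prod)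
qed

lemma smo_add:
  assumes "smo E F U f" "smo E F U g" shows "smo E F U (\<lambda>x. f x \<oplus>\<^bsub>F\<^esub> g x)"
proof -
  have F: "TVS F" using smoD assms by blast
  have "openin (vtop (prod_tvs F F)) (carrier (prod_tvs F F))"
    using topological_vector_space.topspace_vtop[OF tvs_prod[OF F F]] openin_topspace by metis
  from smo_compose[OF smo_clin[OF clin_add[OF F] tvs_prod[OF F F] F this] smo_pair[OF assms]]
  show ?thesis using smoD(6)[OF assms(1)] smoD(6)[OF assms(2)] by simp
qed

lemma smo_minus:
  assumes "smo E F U f" "smo E F U g" shows "smo E F U (\<lambda>x. f x \<ominus>\<^bsub>F\<^esub> g x)"
proof -
  have F: "TVS F" using smoD assms by blast
  have "openin (vtop (prod_tvs F F)) (carrier (prod_tvs F F))"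
    using topological_vector_space.topspace_vtop[OF tvs_prod[OF F F]] openin_topspace by metis
  from smo_compose[OF smo_clin[OF clin_minus[OF F] tvs_prod[OF F F] F this] smo_pair[OF assms]]
  show ?thesis using smoD(6)[OF assms(1)] smoD(6)[OF assms(2)] by simp
qed

lemma smo_openin_preimage:
  assumes "smo E F U f" "openin (vtop F) V" shows "openin (vtop E) {x \<in> U. f x \<in> V}"
proof -
  have "topspace (subtopology (vtop E) U) = U" using smoD(3)[OF assms(1)] openin_subset by fastforce
  from openin_continuous_map_preimage[OF smoD(4)[OF assms(1)] assms(2), unfolded this]
  show ?thesis using smoD(3)[OF assms(1)] openin_open_subtopology by blast
qed

end

section \<open>Box topologies\<close>

text \<open>Formulated for subsets \<open>D\<close> of products of arbitrary spaces, in order to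
  serve both for direct sums of vector spaces and for the weak direct product of groups.\<close>

definition wbox :: "'i set \<Rightarrow> ('i \<Rightarrow> 'a topology) \<Rightarrow> ('i \<Rightarrow> 'a) set \<Rightarrow> ('i \<Rightarrow> 'a) topology" where
  "wbox I T D = topology (\<lambda>X. X \<subseteq> D \<and>
     (\<forall>x\<in>X. \<exists>N. (\<forall>i\<in>I. openin (T i) (N i) \<and> x i \<in> N i) \<and> D \<inter> (\<Pi>\<^sub>E i\<in>I. N i) \<subseteq> X))"

lemma openin_wbox:
  "openin (wbox I T D) X \<longleftrightarrow> X \<subseteq> D \<and>
     (\<forall>x\<in>X. \<exists>N. (\<forall>i\<in>I. openin (T i) (N i) \<and> x i \<in> N i) \<and> D \<inter> (\<Pi>\<^sub>E i\<in>I. N i) \<subseteq> X)"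
proof -
  have "istopology (\<lambda>X. X \<subseteq> D \<and>
     (\<forall>x\<in>X. \<exists>N. (\<forall>i\<in>I. openin (T i) (N i) \<and> x i \<in> N i) \<and> D \<inter> (\<Pi>\<^sub>E i\<in>I. N i) \<subseteq> X))" (is "istopology ?P")
    unfolding istopology_def
  proof (intro conjI allI impI)
    fix S S' assume S: "?P S" and S': "?P S'"
    show "S \<inter> S' \<subseteq> D" using S by blast
    show "\<forall>x\<in>S \<inter> S'. \<exists>N. (\<forall>i\<in>I. openin (T i) (N i) \<and> x i \<in> N i) \<and> D \<inter> (\<Pi>\<^sub>E i\<in>I. N i) \<subseteq> S \<inter> S'"
    proof
      fix x assume x: "x \<in> S \<inter> S'"
      obtain N where N: "\<forall>i\<in>I. openin (T i) (N i) \<and> x i \<in> N i" "D \<inter> (\<Pi>\<^sub>E i\<in>I. N i) \<subseteq> S" using S x by blast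
      obtain N' where N': "\<forall>i\<in>I. openin (T i) (N' i) \<and> x i \<in> N' i" "D \<inter> (\<Pi>\<^sub>E i\<in>I. N' i) \<subseteq> S'" using S' x by blast
      show "\<exists>N. (\<forall>i\<in>I. openin (T i) (N i) \<and> x i \<in> N i) \<and> D \<inter> (\<Pi>\<^sub>E i\<in>I. N i) \<subseteq> S \<inter> S'"
      proof (intro exI[of _ "\<lambda>i. N i \<inter> N' i"] conjI)
        have "(\<Pi>\<^sub>E i\<in>I. N i \<inter> N' i) \<subseteq> (\<Pi>\<^sub>E i\<in>I. N i) \<inter> (\<Pi>\<^sub>E i\<in>I. N' i)" by auto
        then show "D \<inter> (\<Pi>\<^sub>E i\<in>I. N i \<inter> N' i) \<subseteq> S \<inter> S'" using N(2) N'(2) by blast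
      qed (use N(1) N'(1) in auto)
    qed
  next
    fix \<K> assume S: "\<forall>S\<in>\<K>. ?P S"
    then show "\<Union>\<K> \<subseteq> D" by blast
    show "\<forall>x\<in>\<Union>\<K>. \<exists>N. (\<forall>i\<in>I. openin (T i) (N i) \<and> x i \<in> N i) \<and> D \<inter> (\<Pi>\<^sub>E i\<in>I. N i) \<subseteq> \<Union>\<K>"
      using S by (meson UnionE Union_upper subset_trans)
  qed
  then show ?thesis unfolding wbox_def by simp
qed

lemma openin_wboxI:
  assumes "\<And>i. i \<in> I \<Longrightarrow> openin (T i) (N i)" shows "openin (wbox I T D) (D \<inter> (\<Pi>\<^sub>E i\<in>I. N i))"
  unfolding openin_wbox
proof (intro conjI ballI)
  fix x assume "x \<in> D \<inter> (\<Pi>\<^sub>E i\<in>I. N i)"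
  then show "\<exists>M. (\<forall>i\<in>I. openin (T i) (M i) \<and> x i \<in> M i) \<and> D \<inter> (\<Pi>\<^sub>E i\<in>I. M i) \<subseteq> D \<inter> (\<Pi>\<^sub>E i\<in>I. N i)"
    using assms by (intro exI[of _ N]) (auto simp: PiE_iff)
qed auto

lemma topspace_wbox:
  assumes "D \<subseteq> (\<Pi>\<^sub>E i\<in>I. topspace (T i))" shows "topspace (wbox I T D) = D"
proof -
  have "D \<inter> (\<Pi>\<^sub>E i\<in>I. topspace (T i)) = D" using assms by blast
  then have "openin (wbox I T D) D" using openin_wboxI[of I T "\<lambda>i. topspace (T i)" D] by simp
  then show ?thesis by (meson openin_subset openin_topspace openin_wbox subset_antisym)
qed

text \<open>The neighbourhood \<open>A\<close> has to work for all \<open>i\<close> at once. This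
  uniformity is the difference from the product topology, and providing it is the task in every
  application.\<close>

lemma continuous_into_wbox:
  assumes "D \<subseteq> (\<Pi>\<^sub>E i\<in>I. topspace (T i))" "\<And>z. z \<in> topspace Z \<Longrightarrow> f z \<in> D"
    and "\<And>z N. z \<in> topspace Z \<Longrightarrow> (\<And>i. i \<in> I \<Longrightarrow> openin (T i) (N i) \<and> f z i \<in> N i) \<Longrightarrow>
      \<exists>A. openin Z A \<and> z \<in> A \<and> (\<forall>a\<in>A. \<forall>i\<in>I. f a i \<in> N i)"
  shows "continuous_map Z (wbox I T D) f"
  unfolding continuous_map_def topspace_wbox[OF assms(1)]
proof (intro conjI allI impI)
  show "f \<in> topspace Z \<rightarrow> D" using assms(2) by blast
  fix X assume X: "openin (wbox I T D) X"
  show "openin Z {z \<in> topspace Z. f z \<in> X}"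
  proof (subst openin_subopen, intro ballI)
    fix z assume z: "z \<in> {z \<in> topspace Z. f z \<in> X}"
    then obtain N where N: "\<forall>i\<in>I. openin (T i) (N i) \<and> f z i \<in> N i" "D \<inter> (\<Pi>\<^sub>E i\<in>I. N i) \<subseteq> X"
      using X unfolding openin_wbox by blast
    then obtain A where A: "openin Z A" "z \<in> A" "\<forall>a\<in>A. \<forall>i\<in>I. f a i \<in> N i"
      using assms(3)[of z N] z by blast
    have "f a \<in> D \<inter> (\<Pi>\<^sub>E i\<in>I. N i)" if "a \<in> A" for a
    proof -
      have "f a \<in> D" using assms(2) openin_subset[OF A(1)] that by blast
      then show ?thesis using A(3) that assms(1) by (auto simp: PiE_iff)
    qed
    then show "\<exists>T. openin Z T \<and> z \<in> T \<and> T \<subseteq> {z \<in> topspace Z. f z \<in> X}"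
      using A N(2) openin_subset[OF A(1)] by (intro exI[of _ A]) blast
  qed
qed

text \<open>If component \<open>i\<close> of the value depends on component \<open>i\<close> of the
  argument only, a box in the target is met by shrinking each coordinate on its own.\<close>

lemma continuous_wbox_map:
  assumes D: "D \<subseteq> (\<Pi>\<^sub>E i\<in>I. topspace (T i))" and D': "D' \<subseteq> (\<Pi>\<^sub>E i\<in>I. topspace (T' i))"
    and U: "\<And>i. i \<in> I \<Longrightarrow> openin (T i) (U i)"
    and f: "\<And>i. i \<in> I \<Longrightarrow> continuous_map (subtopology (T i) (U i)) (T' i) (f i)"
    and fD: "\<And>x. x \<in> D \<Longrightarrow> x \<in> (\<Pi>\<^sub>E i\<in>I. U i) \<Longrightarrow> (\<lambda>i\<in>I. f i (x i)) \<in> D'"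
  shows "continuous_map (subtopology (wbox I T D) (D \<inter> (\<Pi>\<^sub>E i\<in>I. U i))) (wbox I T' D') (\<lambda>x. \<lambda>i\<in>I. f i (x i))"
proof (rule continuous_into_wbox[OF D'])
  have ts: "topspace (subtopology (wbox I T D) (D \<inter> (\<Pi>\<^sub>E i\<in>I. U i))) = D \<inter> (\<Pi>\<^sub>E i\<in>I. U i)"
    using topspace_wbox[OF D] by auto
  show "(\<lambda>i\<in>I. f i (z i)) \<in> D'" if "z \<in> topspace (subtopology (wbox I T D) (D \<inter> (\<Pi>\<^sub>E i\<in>I. U i)))" for z
    using fD that unfolding ts by blast
  fix z N assume z: "z \<in> topspace (subtopology (wbox I T D) (D \<inter> (\<Pi>\<^sub>E i\<in>I. U i)))"
    and N: "\<And>i. i \<in> I \<Longrightarrow> openin (T' i) (N i) \<and> (\<lambda>i\<in>I. f i (z i)) i \<in> N i"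
  let ?M = "\<lambda>i. {x \<in> U i. f i x \<in> N i}"
  have M: "openin (T i) (?M i)" if "i \<in> I" for i
  proof -
    have "topspace (subtopology (T i) (U i)) = U i" using openin_subset[OF U[OF that]] by auto
    from openin_continuous_map_preimage[OF f[OF that] conjunct1[OF N[OF that]], unfolded this]
    show ?thesis using openin_open_subtopology[OF U[OF that]] by blast
  qed
  let ?A = "D \<inter> (\<Pi>\<^sub>E i\<in>I. ?M i)"
  show "\<exists>A. openin (subtopology (wbox I T D) (D \<inter> (\<Pi>\<^sub>E i\<in>I. U i))) A \<and> z \<in> A \<and> (\<forall>a\<in>A. \<forall>i\<in>I. (\<lambda>i\<in>I. f i (a i)) i \<in> N i)"
  proof (intro exI[of _ ?A] conjI ballI)
    have "openin (wbox I T D) ?A" using M by (rule openin_wboxI)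
    moreover have "?A \<subseteq> D \<inter> (\<Pi>\<^sub>E i\<in>I. U i)" by (auto simp: PiE_iff)
    ultimately show "openin (subtopology (wbox I T D) (D \<inter> (\<Pi>\<^sub>E i\<in>I. U i))) ?A"
      unfolding openin_subtopology by blast
    show "z \<in> ?A" using z N unfolding ts by (auto simp: PiE_iff)
    show "\<And>a i. a \<in> ?A \<Longrightarrow> i \<in> I \<Longrightarrow> (\<lambda>i\<in>I. f i (a i)) i \<in> N i" by (auto simp: PiE_iff)
  qed
qed

text \<open>Two distinct families differ at some coordinate, and boxes restricted at that coordinate
  alone separate them.\<close>

lemma Hausdorff_wbox:
  assumes D: "D \<subseteq> (\<Pi>\<^sub>E i\<in>I. topspace (T i))" and H: "\<And>i. i \<in> I \<Longrightarrow> Hausdorff_space (T i)"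
  shows "Hausdorff_space (wbox I T D)"
  unfolding Hausdorff_space_def topspace_wbox[OF D]
proof (intro allI impI)
  fix x y assume "x \<in> D \<and> y \<in> D \<and> x \<noteq> y"
  then have xy: "x \<in> D" "y \<in> D" "x \<noteq> y" by auto
  then have "\<exists>i\<in>I. x i \<noteq> y i" using D PiE_ext[of x I "\<lambda>i. topspace (T i)" y] by blast
  then obtain i where i: "i \<in> I" "x i \<noteq> y i" by blast
  have "x i \<in> topspace (T i)" "y i \<in> topspace (T i)" using xy D i(1) by (auto simp: PiE_iff)
  then obtain V W where VW: "openin (T i) V" "openin (T i) W" "x i \<in> V" "y i \<in> W" "disjnt V W"
    using H[OF i(1)] i(2) unfolding Hausdorff_space_def by blast
  define P where "P = (\<lambda>V. D \<inter> (\<Pi>\<^sub>E j\<in>I. if j = i then V else topspace (T j)))"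
  have "openin (wbox I T D) (P V)" "openin (wbox I T D) (P W)" using VW unfolding P_def by (auto intro!: openin_wboxI)
  moreover have "x \<in> P V" "y \<in> P W" using xy D VW by (auto simp: P_def PiE_iff subset_iff)
  moreover have "z i \<in> V'" if "z \<in> P V'" for z V' using that i(1) by (auto simp: P_def PiE_iff split: if_splits)
  then have "disjnt (P V) (P W)" using VW(5) unfolding disjnt_iff by blast
  ultimately show "\<exists>U V. openin (wbox I T D) U \<and> openin (wbox I T D) V \<and> x \<in> U \<and> y \<in> V \<and> disjnt U V" by blast
qed

section \<open>The box topology on direct sums of vector spaces\<close>

context valued_field begin

lemma tvs_translate_open:
  assumes "TVS E" "openin (vtop E) N" "a \<in> carrier E"
  shows "openin (vtop E) {x \<in> carrier E. a \<oplus>\<^bsub>E\<^esub> x \<in> N}" "openin (vtop E) {x \<in> carrier E. x \<ominus>\<^bsub>E\<^esub> a \<in> N}"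
proof -
  interpret E: topological_vector_space K E by fact
  have "continuous_map (vtop E) (vtop E) (\<lambda>x. a \<oplus>\<^bsub>E\<^esub> x)" "continuous_map (vtop E) (vtop E) (\<lambda>x. x \<ominus>\<^bsub>E\<^esub> a)"
    using assms(3) by (auto intro!: tvs_cont_add tvs_cont_minus assms(1) simp: E.topspace_vtop)
  from openin_continuous_map_preimage[OF this(1) assms(2)] openin_continuous_map_preimage[OF this(2) assms(2)]
  show "openin (vtop E) {x \<in> carrier E. a \<oplus>\<^bsub>E\<^esub> x \<in> N}" "openin (vtop E) {x \<in> carrier E. x \<ominus>\<^bsub>E\<^esub> a \<in> N}"
    by (simp_all add: E.topspace_vtop)
qed

lemma sum_carrier_PiE: "(\<And>i. i \<in> I \<Longrightarrow> TVS (E i)) \<Longrightarrow> sum_carrier I E \<subseteq> (\<Pi>\<^sub>E i\<in>I. topspace (vtop (E i)))"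
  using topological_vector_space.topspace_vtop by (fastforce simp: sum_carrier_def PiE_iff extensional_def)

lemma sum_add_closed:
  assumes E: "\<And>i. i \<in> I \<Longrightarrow> TVS (E i)" and "x \<in> sum_carrier I E" "y \<in> sum_carrier I E"
  shows "sum_add I E x y \<in> sum_carrier I E"
proof -
  have z: "\<zero>\<^bsub>E i\<^esub> \<oplus>\<^bsub>E i\<^esub> \<zero>\<^bsub>E i\<^esub> = \<zero>\<^bsub>E i\<^esub>" "x i \<oplus>\<^bsub>E i\<^esub> y i \<in> carrier (E i)" if "i \<in> I" for i
  proof -
    interpret E: topological_vector_space K "E i" using E that by blast
    show "\<zero>\<^bsub>E i\<^esub> \<oplus>\<^bsub>E i\<^esub> \<zero>\<^bsub>E i\<^esub> = \<zero>\<^bsub>E i\<^esub>" by simp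
    show "x i \<oplus>\<^bsub>E i\<^esub> y i \<in> carrier (E i)" using assms(2,3) that by (auto simp: sum_carrier_def PiE_iff)
  qed
  have "{i \<in> I. sum_add I E x y i \<noteq> \<zero>\<^bsub>E i\<^esub>} \<subseteq> {i \<in> I. x i \<noteq> \<zero>\<^bsub>E i\<^esub>} \<union> {i \<in> I. y i \<noteq> \<zero>\<^bsub>E i\<^esub>}"
    using z(1) by (auto simp: sum_add_def)
  then have "finite {i \<in> I. sum_add I E x y i \<noteq> \<zero>\<^bsub>E i\<^esub>}"
    using assms(2,3) by (auto simp: sum_carrier_def intro: finite_subset)
  then show ?thesis using z(2) by (auto simp: sum_carrier_def sum_add_def)
qed

text \<open>Translation by \<open>x\<close> acts by homeomorphisms in each coordinate, so it turns
  boxes around zero into boxes around \<open>x\<close> and back, and it preserves finite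
  support.\<close>

lemma box_topology_eq:
  assumes E: "\<And>i. i \<in> I \<Longrightarrow> TVS (E i)"
  shows "box_topology I E = wbox I (\<lambda>i. vtop (E i)) (sum_carrier I E)"
proof -
  let ?D = "sum_carrier I E"
  have "(\<exists>W. (\<forall>i\<in>I. openin (vtop (E i)) (W i) \<and> \<zero>\<^bsub>E i\<^esub> \<in> W i) \<and>
        (\<forall>y \<in> ?D \<inter> (\<Pi>\<^sub>E i\<in>I. W i). sum_add I E x y \<in> X)) \<longleftrightarrow>
     (\<exists>N. (\<forall>i\<in>I. openin (vtop (E i)) (N i) \<and> x i \<in> N i) \<and> ?D \<inter> (\<Pi>\<^sub>E i\<in>I. N i) \<subseteq> X)"
    if X: "X \<subseteq> ?D" and x: "x \<in> X" for X x
  proof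
    have xc: "x i \<in> carrier (E i)" if "i \<in> I" for i using X x that by (auto simp: sum_carrier_def PiE_iff)
    {
      assume "\<exists>W. (\<forall>i\<in>I. openin (vtop (E i)) (W i) \<and> \<zero>\<^bsub>E i\<^esub> \<in> W i) \<and>
        (\<forall>y \<in> ?D \<inter> (\<Pi>\<^sub>E i\<in>I. W i). sum_add I E x y \<in> X)"
      then obtain W where W: "\<And>i. i \<in> I \<Longrightarrow> openin (vtop (E i)) (W i)" "\<And>i. i \<in> I \<Longrightarrow> \<zero>\<^bsub>E i\<^esub> \<in> W i"
        "\<And>y. y \<in> ?D \<Longrightarrow> y \<in> (\<Pi>\<^sub>E i\<in>I. W i) \<Longrightarrow> sum_add I E x y \<in> X" by auto
      let ?N = "\<lambda>i. {z \<in> carrier (E i). z \<ominus>\<^bsub>E i\<^esub> x i \<in> W i}"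
      show "\<exists>N. (\<forall>i\<in>I. openin (vtop (E i)) (N i) \<and> x i \<in> N i) \<and> ?D \<inter> (\<Pi>\<^sub>E i\<in>I. N i) \<subseteq> X"
      proof (intro exI[of _ ?N] conjI ballI subsetI)
        fix i assume i: "i \<in> I"
        interpret E: topological_vector_space K "E i" using E i by blast
        show "openin (vtop (E i)) (?N i)" using tvs_translate_open(2)[OF E W(1) xc] i by blast
        show "x i \<in> ?N i" using xc[OF i] W(2)[OF i] by (simp add: a_minus_def E.r_neg)
      next
        fix z assume z: "z \<in> ?D \<inter> (\<Pi>\<^sub>E i\<in>I. ?N i)"
        let ?y = "\<lambda>i\<in>I. z i \<ominus>\<^bsub>E i\<^esub> x i"
        have y: "z i \<ominus>\<^bsub>E i\<^esub> x i \<in> W i" "z i \<ominus>\<^bsub>E i\<^esub> x i \<in> carrier (E i)"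
            "x i \<oplus>\<^bsub>E i\<^esub> (z i \<ominus>\<^bsub>E i\<^esub> x i) = z i" "\<zero>\<^bsub>E i\<^esub> \<ominus>\<^bsub>E i\<^esub> \<zero>\<^bsub>E i\<^esub> = \<zero>\<^bsub>E i\<^esub>" if i: "i \<in> I" for i
        proof -
          interpret E: topological_vector_space K "E i" using E i by blast
          have zi: "z i \<in> carrier (E i)" using z i by (auto simp: PiE_iff)
          show "z i \<ominus>\<^bsub>E i\<^esub> x i \<in> W i" using z i by (auto simp: PiE_iff)
          show "z i \<ominus>\<^bsub>E i\<^esub> x i \<in> carrier (E i)" using zi xc[OF i] by simp
          show "x i \<oplus>\<^bsub>E i\<^esub> (z i \<ominus>\<^bsub>E i\<^esub> x i) = z i" using zi xc[OF i]
            by (simp add: a_minus_def E.a_lcomm[of "x i" "z i"] E.r_neg)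
          show "\<zero>\<^bsub>E i\<^esub> \<ominus>\<^bsub>E i\<^esub> \<zero>\<^bsub>E i\<^esub> = \<zero>\<^bsub>E i\<^esub>" by (simp add: a_minus_def E.r_neg)
        qed
        have "{i \<in> I. ?y i \<noteq> \<zero>\<^bsub>E i\<^esub>} \<subseteq> {i \<in> I. x i \<noteq> \<zero>\<^bsub>E i\<^esub>} \<union> {i \<in> I. z i \<noteq> \<zero>\<^bsub>E i\<^esub>}" using y(4) by auto
        then have "finite {i \<in> I. ?y i \<noteq> \<zero>\<^bsub>E i\<^esub>}"
          using z X x by (elim finite_subset) (auto simp: sum_carrier_def)
        then have "?y \<in> ?D" using y(2) by (auto simp: sum_carrier_def)
        moreover have "?y \<in> (\<Pi>\<^sub>E i\<in>I. W i)" using y(1) by auto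
        ultimately have "sum_add I E x ?y \<in> X" by (rule W(3))
        moreover have "sum_add I E x ?y = z" using z y(3) by (auto simp: sum_add_def PiE_iff extensional_def fun_eq_iff)
        ultimately show "z \<in> X" by simp
      qed
    }
    {
      assume "\<exists>N. (\<forall>i\<in>I. openin (vtop (E i)) (N i) \<and> x i \<in> N i) \<and> ?D \<inter> (\<Pi>\<^sub>E i\<in>I. N i) \<subseteq> X"
      then obtain N where N: "\<And>i. i \<in> I \<Longrightarrow> openin (vtop (E i)) (N i)" "\<And>i. i \<in> I \<Longrightarrow> x i \<in> N i"
        "?D \<inter> (\<Pi>\<^sub>E i\<in>I. N i) \<subseteq> X" by auto
      let ?W = "\<lambda>i. {z \<in> carrier (E i). x i \<oplus>\<^bsub>E i\<^esub> z \<in> N i}"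
      show "\<exists>W. (\<forall>i\<in>I. openin (vtop (E i)) (W i) \<and> \<zero>\<^bsub>E i\<^esub> \<in> W i) \<and>
        (\<forall>y \<in> ?D \<inter> (\<Pi>\<^sub>E i\<in>I. W i). sum_add I E x y \<in> X)"
      proof (intro exI[of _ ?W] conjI ballI)
        fix i assume i: "i \<in> I"
        interpret E: topological_vector_space K "E i" using E i by blast
        show "openin (vtop (E i)) (?W i)" using tvs_translate_open(1)[OF E N(1) xc] i by blast
        show "\<zero>\<^bsub>E i\<^esub> \<in> ?W i" using xc[OF i] N(2)[OF i] by simp
      next
        fix y assume y: "y \<in> ?D \<inter> (\<Pi>\<^sub>E i\<in>I. ?W i)"
        then have "sum_add I E x y \<in> ?D" using X x by (intro sum_add_closed E) auto
        moreover have "sum_add I E x y \<in> (\<Pi>\<^sub>E i\<in>I. N i)" using y by (auto simp: sum_add_def PiE_iff)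
        ultimately show "sum_add I E x y \<in> X" using N(3) by blast
      qed
    }
  qed
  then show ?thesis unfolding box_topology_def wbox_def
    by (intro arg_cong[where f = topology] ext conj_cong ball_cong refl)
qed

lemma box_sum_simps:
  "carrier (box_sum I E) = sum_carrier I E" "\<zero>\<^bsub>box_sum I E\<^esub> = (\<lambda>i\<in>I. \<zero>\<^bsub>E i\<^esub>)"
  "x \<oplus>\<^bsub>box_sum I E\<^esub> y = (\<lambda>i\<in>I. x i \<oplus>\<^bsub>E i\<^esub> y i)"
  "c \<odot>\<^bsub>box_sum I E\<^esub> x = (\<lambda>i\<in>I. c \<odot>\<^bsub>E i\<^esub> x i)"
  "vtop (box_sum I E) = box_topology I E"
  by (auto simp: box_sum_def sum_add_def)

text \<open>Continuity at the origin gives only some small ball of scalars. Since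
  \<open>c a = (c s) (s^-1 a)\<close>, one small nonzero \<open>s\<close> exchanges it for a ball of
  any prescribed radius, at the price of a smaller \<open>A\<close>.\<close>

lemma tvs_absorb:
  assumes E: "TVS E" and N: "openin (vtop E) N" "\<zero>\<^bsub>E\<^esub> \<in> N"
  shows "\<exists>A. openin (vtop E) A \<and> \<zero>\<^bsub>E\<^esub> \<in> A \<and> (\<forall>c\<in>carrier K. absval K c < r \<longrightarrow> (\<forall>a\<in>A. c \<odot>\<^bsub>E\<^esub> a \<in> N))"
proof -
  interpret E: topological_vector_space K E by fact
  have "openin (prod_topology (ktop K) (vtop E)) {p \<in> topspace (prod_topology (ktop K) (vtop E)). (\<lambda>(c, x). c \<odot>\<^bsub>E\<^esub> x) p \<in> N}"
    by (rule openin_continuous_map_preimage[OF E.continuous_smult N(1)])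
  moreover have "(\<zero>, \<zero>\<^bsub>E\<^esub>) \<in> {p \<in> topspace (prod_topology (ktop K) (vtop E)). (\<lambda>(c, x). c \<odot>\<^bsub>E\<^esub> x) p \<in> N}"
    using N by (simp add: E.topspace_vtop)
  ultimately obtain C A where CA: "openin (ktop K) C" "openin (vtop E) A" "\<zero> \<in> C" "\<zero>\<^bsub>E\<^esub> \<in> A"
    "C \<times> A \<subseteq> {p \<in> topspace (prod_topology (ktop K) (vtop E)). (\<lambda>(c, x). c \<odot>\<^bsub>E\<^esub> x) p \<in> N}"
    unfolding openin_prod_topology_alt by meson
  obtain d where d: "d > 0" "\<And>y. y \<in> carrier K \<Longrightarrow> absval K y < d \<Longrightarrow> y \<in> C"
  proof -
    obtain d where "d > 0" "\<forall>y\<in>carrier K. absval K (y \<ominus> \<zero>) < d \<longrightarrow> y \<in> C"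
      using CA(1,3) unfolding openin_ktop by blast
    then show ?thesis using that[of d] by (simp add: a_minus_def)
  qed
  \<comment> \<open>\<open>\<bar>r\<bar> + 1\<close> is positive and larger than \<open>r\<close>,
    whatever the sign of \<open>r\<close>.\<close>
  have "d / (\<bar>r\<bar> + 1) > 0" using d by simp
  then obtain s where s: "s \<in> carrier K" "s \<noteq> \<zero>" "absval K s < d / (\<bar>r\<bar> + 1)" by (rule small_scalar)
  let ?A = "{a \<in> carrier E. inv s \<odot>\<^bsub>E\<^esub> a \<in> A}"
  show ?thesis
  proof (intro exI[of _ ?A] conjI ballI impI)
    have "continuous_map (vtop E) (vtop E) (\<lambda>x. inv s \<odot>\<^bsub>E\<^esub> x)"
      using clinD(4)[OF clin_smult[OF E]] s by simp
    from openin_continuous_map_preimage[OF this CA(2)] show "openin (vtop E) ?A" by (simp add: E.topspace_vtop)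
    show "\<zero>\<^bsub>E\<^esub> \<in> ?A" using CA s by simp
    fix c a assume c: "c \<in> carrier K" "absval K c < r" and a: "a \<in> ?A"
    have "absval K (c \<otimes> s) \<le> (\<bar>r\<bar> + 1) * absval K s"
      using c s absval_nonneg by (simp add: absval_mult mult_right_mono)
    also have "\<dots> < d" using s(3) by (simp add: pos_less_divide_eq mult.commute)
    finally have "c \<otimes> s \<in> C" using d c s by simp
    moreover have "inv s \<odot>\<^bsub>E\<^esub> a \<in> A" using a by simp
    ultimately have "(c \<otimes> s) \<odot>\<^bsub>E\<^esub> (inv s \<odot>\<^bsub>E\<^esub> a) \<in> N" using CA(5) by auto
    moreover have "(c \<otimes> s) \<odot>\<^bsub>E\<^esub> (inv s \<odot>\<^bsub>E\<^esub> a) = c \<odot>\<^bsub>E\<^esub> a"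
      using c s a by (simp add: m_assoc flip: E.smult_assoc1)
    ultimately show "c \<odot>\<^bsub>E\<^esub> a \<in> N" by simp
  qed
qed

lemma prod_nbhd:
  assumes "continuous_map (prod_topology S T) Z f" "openin Z N" "f (x, y) \<in> N" "x \<in> topspace S" "y \<in> topspace T"
  shows "\<exists>A B. openin S A \<and> openin T B \<and> x \<in> A \<and> y \<in> B \<and> (\<forall>a\<in>A. \<forall>b\<in>B. f (a, b) \<in> N)"
proof -
  have "openin (prod_topology S T) {p \<in> topspace (prod_topology S T). f p \<in> N}"
    by (rule openin_continuous_map_preimage[OF assms(1,2)])
  moreover have "(x, y) \<in> {p \<in> topspace (prod_topology S T). f p \<in> N}" using assms by simp
  ultimately obtain A B where "openin S A" "openin T B" "x \<in> A" "y \<in> B" "A \<times> B \<subseteq> {p \<in> topspace (prod_topology S T). f p \<in> N}"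
    unfolding openin_prod_topology_alt by meson
  then show ?thesis by blast
qed

text \<open>Addition can be treated one coordinate at a time. Scalar multiplication cannot, as one
  neighbourhood of the scalar has to serve all coordinates; finite support saves it.\<close>

lemma tvs_box_sum:
  assumes E: "\<And>i. i \<in> I \<Longrightarrow> TVS (E i)" shows "TVS (box_sum I E)"
proof (rule tvs_intro)
  let ?D = "sum_carrier I E"
  note D = sum_carrier_PiE[OF E, of I]
  have mod: "module K (E i)" if "i \<in> I" for i using E[OF that] by (simp add: topological_vector_space_def)
  have ag: "abelian_group (E i)" if "i \<in> I" for i using mod[OF that] by (simp add: module_def)
  have am: "abelian_monoid (E i)" if "i \<in> I" for i using ag[OF that] by (simp add: abelian_group_def)
  have xc: "x i \<in> carrier (E i)" if "x \<in> ?D" "i \<in> I" for x i using that by (auto simp: sum_carrier_def PiE_iff)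
  have ext: "(\<lambda>i\<in>I. x i) = x" if "x \<in> ?D" for x
    using that by (auto simp: sum_carrier_def PiE_iff extensional_def fun_eq_iff)
  have add: "(\<lambda>i\<in>I. x i \<oplus>\<^bsub>E i\<^esub> y i) \<in> ?D" if "x \<in> ?D" "y \<in> ?D" for x y
    using sum_add_closed[OF E that] by (simp add: sum_add_def)
  have lin: "(\<lambda>i\<in>I. f i (x i)) \<in> ?D" if "x \<in> ?D" "\<And>i. i \<in> I \<Longrightarrow> f i \<zero>\<^bsub>E i\<^esub> = \<zero>\<^bsub>E i\<^esub>"
      "\<And>i y. i \<in> I \<Longrightarrow> y \<in> carrier (E i) \<Longrightarrow> f i y \<in> carrier (E i)" for x f
  proof -
    have "{i \<in> I. (\<lambda>i\<in>I. f i (x i)) i \<noteq> \<zero>\<^bsub>E i\<^esub>} \<subseteq> {i \<in> I. x i \<noteq> \<zero>\<^bsub>E i\<^esub>}" using that(2) by auto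
    then have "finite {i \<in> I. (\<lambda>i\<in>I. f i (x i)) i \<noteq> \<zero>\<^bsub>E i\<^esub>}"
      using that(1) by (elim finite_subset) (auto simp: sum_carrier_def)
    then show ?thesis using that xc by (auto simp: sum_carrier_def)
  qed
  have smult: "(\<lambda>i\<in>I. c \<odot>\<^bsub>E i\<^esub> x i) \<in> ?D" if "x \<in> ?D" "c \<in> carrier K" for x c
    by (rule lin[OF that(1)]) (simp_all add: that(2) module.smult_r_null[OF mod] module.smult_closed[OF mod])
  have neg: "(\<lambda>i\<in>I. \<ominus>\<^bsub>E i\<^esub> x i) \<in> ?D" if "x \<in> ?D" for x
  proof (rule lin[OF that])
    fix i assume i: "i \<in> I"
    interpret E: abelian_group "E i" by (rule ag[OF i])
    show "\<ominus>\<^bsub>E i\<^esub> \<zero>\<^bsub>E i\<^esub> = \<zero>\<^bsub>E i\<^esub>" by (rule E.minus_equality) auto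
  qed (rule abelian_group.a_inv_closed[OF ag])
  have zero: "(\<lambda>i\<in>I. \<zero>\<^bsub>E i\<^esub>) \<in> ?D" using am abelian_monoid.zero_closed by (fastforce simp: sum_carrier_def)
  have "abelian_group (box_sum I E)"
  proof (rule abelian_groupI, unfold box_sum_simps)
    fix x y z assume x: "x \<in> ?D" and y: "y \<in> ?D" and z: "z \<in> ?D"
    show "(\<lambda>i\<in>I. (\<lambda>i\<in>I. x i \<oplus>\<^bsub>E i\<^esub> y i) i \<oplus>\<^bsub>E i\<^esub> z i) = (\<lambda>i\<in>I. x i \<oplus>\<^bsub>E i\<^esub> (\<lambda>i\<in>I. y i \<oplus>\<^bsub>E i\<^esub> z i) i)"
      using x y z by (intro restrict_ext) (simp add: abelian_monoid.a_assoc[OF am] xc)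
  next
    fix x y assume x: "x \<in> ?D" and y: "y \<in> ?D"
    show "(\<lambda>i\<in>I. x i \<oplus>\<^bsub>E i\<^esub> y i) \<in> ?D" by (rule add[OF x y])
    show "(\<lambda>i\<in>I. x i \<oplus>\<^bsub>E i\<^esub> y i) = (\<lambda>i\<in>I. y i \<oplus>\<^bsub>E i\<^esub> x i)"
      using x y by (intro restrict_ext) (simp add: abelian_monoid.a_comm[OF am] xc)
  next
    fix x assume x: "x \<in> ?D"
    have "(\<lambda>i\<in>I. (\<lambda>i\<in>I. \<zero>\<^bsub>E i\<^esub>) i \<oplus>\<^bsub>E i\<^esub> x i) = (\<lambda>i\<in>I. x i)"
      using x by (intro restrict_ext) (simp add: abelian_monoid.l_zero[OF am] xc)
    then show "(\<lambda>i\<in>I. (\<lambda>i\<in>I. \<zero>\<^bsub>E i\<^esub>) i \<oplus>\<^bsub>E i\<^esub> x i) = x" using ext[OF x] by simp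
    show "\<exists>y\<in>?D. (\<lambda>i\<in>I. y i \<oplus>\<^bsub>E i\<^esub> x i) = (\<lambda>i\<in>I. \<zero>\<^bsub>E i\<^esub>)"
      using x by (intro bexI[OF _ neg[OF x]] restrict_ext) (simp add: abelian_group.l_neg[OF ag] xc)
  qed (rule zero)
  then show "module K (box_sum I E)"
  proof (rule moduleI[OF is_cring], unfold box_sum_simps)
    fix a b x assume a: "a \<in> carrier K" and b: "b \<in> carrier K" and x: "x \<in> ?D"
    show "(\<lambda>i\<in>I. (a \<oplus> b) \<odot>\<^bsub>E i\<^esub> x i) = (\<lambda>i\<in>I. (\<lambda>i\<in>I. a \<odot>\<^bsub>E i\<^esub> x i) i \<oplus>\<^bsub>E i\<^esub> (\<lambda>i\<in>I. b \<odot>\<^bsub>E i\<^esub> x i) i)"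
      "(\<lambda>i\<in>I. (a \<otimes> b) \<odot>\<^bsub>E i\<^esub> x i) = (\<lambda>i\<in>I. a \<odot>\<^bsub>E i\<^esub> (\<lambda>i\<in>I. b \<odot>\<^bsub>E i\<^esub> x i) i)"
      using a b x by (auto intro!: restrict_ext simp: module.smult_l_distr[OF mod] module.smult_assoc1[OF mod] xc)
  next
    fix a x y assume a: "a \<in> carrier K" and x: "x \<in> ?D" and y: "y \<in> ?D"
    show "(\<lambda>i\<in>I. a \<odot>\<^bsub>E i\<^esub> (\<lambda>i\<in>I. x i \<oplus>\<^bsub>E i\<^esub> y i) i) = (\<lambda>i\<in>I. (\<lambda>i\<in>I. a \<odot>\<^bsub>E i\<^esub> x i) i \<oplus>\<^bsub>E i\<^esub> (\<lambda>i\<in>I. a \<odot>\<^bsub>E i\<^esub> y i) i)"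
      using a x y by (auto intro!: restrict_ext simp: module.smult_r_distr[OF mod] xc)
  next
    fix a x assume a: "a \<in> carrier K" and x: "x \<in> ?D"
    show "(\<lambda>i\<in>I. a \<odot>\<^bsub>E i\<^esub> x i) \<in> ?D" by (rule smult[OF x a])
  next
    fix x assume x: "x \<in> ?D"
    have "(\<lambda>i\<in>I. \<one> \<odot>\<^bsub>E i\<^esub> x i) = (\<lambda>i\<in>I. x i)"
      using x by (intro restrict_ext) (simp add: module.smult_one[OF mod] xc)
    then show "(\<lambda>i\<in>I. \<one> \<odot>\<^bsub>E i\<^esub> x i) = x" using ext[OF x] by simp
  qed
  have v: "vtop (box_sum I E) = wbox I (\<lambda>i. vtop (E i)) ?D" using box_topology_eq[OF E] by (simp add: box_sum_simps)
  note ts = topspace_wbox[OF D]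
  show "topspace (vtop (box_sum I E)) = carrier (box_sum I E)" by (simp only: v ts box_sum_simps(1))
  show "Hausdorff_space (vtop (box_sum I E))"
    unfolding v by (rule Hausdorff_wbox[OF D topological_vector_space.Hausdorff_vtop[OF E]])
  show "continuous_map (prod_topology (vtop (box_sum I E)) (vtop (box_sum I E))) (vtop (box_sum I E))
     (\<lambda>(x, y). x \<oplus>\<^bsub>box_sum I E\<^esub> y)"
    unfolding v
  proof (rule continuous_into_wbox[OF D])
    fix z assume "z \<in> topspace (prod_topology (wbox I (\<lambda>i. vtop (E i)) ?D) (wbox I (\<lambda>i. vtop (E i)) ?D))"
    then obtain x y where z: "z = (x, y)" and xy: "x \<in> ?D" "y \<in> ?D" by (auto simp: ts)
    show "(case z of (x, y) \<Rightarrow> x \<oplus>\<^bsub>box_sum I E\<^esub> y) \<in> ?D" unfolding z box_sum_simps using add[OF xy] by simp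
    fix N assume "\<And>i. i \<in> I \<Longrightarrow> openin (vtop (E i)) (N i) \<and> (case z of (x, y) \<Rightarrow> x \<oplus>\<^bsub>box_sum I E\<^esub> y) i \<in> N i"
    then have N: "openin (vtop (E i)) (N i)" "x i \<oplus>\<^bsub>E i\<^esub> y i \<in> N i" if "i \<in> I" for i
      using that by (auto simp: z box_sum_simps)
    have "\<forall>i\<in>I. \<exists>AB. openin (vtop (E i)) (fst AB) \<and> openin (vtop (E i)) (snd AB) \<and> x i \<in> fst AB \<and> y i \<in> snd AB \<and>
       (\<forall>a\<in>fst AB. \<forall>b\<in>snd AB. a \<oplus>\<^bsub>E i\<^esub> b \<in> N i)"
    proof
      fix i assume i: "i \<in> I"
      interpret E: topological_vector_space K "E i" using E i by blast
      show "\<exists>AB. openin (vtop (E i)) (fst AB) \<and> openin (vtop (E i)) (snd AB) \<and> x i \<in> fst AB \<and> y i \<in> snd AB \<and>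
         (\<forall>a\<in>fst AB. \<forall>b\<in>snd AB. a \<oplus>\<^bsub>E i\<^esub> b \<in> N i)"
        using prod_nbhd[OF E.continuous_add N(1)[OF i], of "x i" "y i"] N(2)[OF i] xc xy i
        by (simp add: E.topspace_vtop)
    qed
    from bchoice[OF this] obtain AB where AB: "\<And>i. i \<in> I \<Longrightarrow> openin (vtop (E i)) (fst (AB i))"
      "\<And>i. i \<in> I \<Longrightarrow> openin (vtop (E i)) (snd (AB i))" "\<And>i. i \<in> I \<Longrightarrow> x i \<in> fst (AB i)" "\<And>i. i \<in> I \<Longrightarrow> y i \<in> snd (AB i)"
      "\<And>i a b. i \<in> I \<Longrightarrow> a \<in> fst (AB i) \<Longrightarrow> b \<in> snd (AB i) \<Longrightarrow> a \<oplus>\<^bsub>E i\<^esub> b \<in> N i" by blast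
    let ?A = "(?D \<inter> (\<Pi>\<^sub>E i\<in>I. fst (AB i))) \<times> (?D \<inter> (\<Pi>\<^sub>E i\<in>I. snd (AB i)))"
    show "\<exists>A. openin (prod_topology (wbox I (\<lambda>i. vtop (E i)) ?D) (wbox I (\<lambda>i. vtop (E i)) ?D)) A \<and> z \<in> A \<and>
        (\<forall>a\<in>A. \<forall>i\<in>I. (case a of (x, y) \<Rightarrow> x \<oplus>\<^bsub>box_sum I E\<^esub> y) i \<in> N i)"
    proof (intro exI[of _ ?A] conjI)
      show "openin (prod_topology (wbox I (\<lambda>i. vtop (E i)) ?D) (wbox I (\<lambda>i. vtop (E i)) ?D)) ?A"
        unfolding openin_prod_Times_iff by (intro disjI2 conjI openin_wboxI AB)
      show "z \<in> ?A" using z xy AB(3,4) by (auto simp: sum_carrier_def PiE_iff)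
    qed (use AB(5) in \<open>auto simp: box_sum_simps PiE_iff\<close>)
  qed
  show "continuous_map (prod_topology (ktop K) (vtop (box_sum I E))) (vtop (box_sum I E))
     (\<lambda>(x, y). x \<odot>\<^bsub>box_sum I E\<^esub> y)"
    unfolding v
  proof (rule continuous_into_wbox[OF D])
    fix z assume "z \<in> topspace (prod_topology (ktop K) (wbox I (\<lambda>i. vtop (E i)) ?D))"
    then obtain c x where z: "z = (c, x)" and cx: "c \<in> carrier K" "x \<in> ?D" by (auto simp: ts)
    show "(case z of (x, y) \<Rightarrow> x \<odot>\<^bsub>box_sum I E\<^esub> y) \<in> ?D" unfolding z box_sum_simps using smult cx by simp
    fix N assume "\<And>i. i \<in> I \<Longrightarrow> openin (vtop (E i)) (N i) \<and> (case z of (x, y) \<Rightarrow> x \<odot>\<^bsub>box_sum I E\<^esub> y) i \<in> N i"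
    then have N: "openin (vtop (E i)) (N i)" "c \<odot>\<^bsub>E i\<^esub> x i \<in> N i" if "i \<in> I" for i
      using that by (auto simp: z box_sum_simps)
    define J where "J = {i \<in> I. x i \<noteq> \<zero>\<^bsub>E i\<^esub>}"
    have J: "finite J" "J \<subseteq> I" using cx by (auto simp: J_def sum_carrier_def)
    \<comment> \<open>Where \<open>x\<close> vanishes, a neighbourhood of zero absorbs this whole
      ball by \<open>tvs_absorb\<close>. Thus all but finitely many coordinates impose the same
      condition \<open>B\<close> on the scalar, and the intersection \<open>C\<close> below is a
      finite one.\<close>
    define B where "B = {s \<in> carrier K. absval K s < absval K c + 1}"
    have B: "openin (ktop K) B" "c \<in> B" using openin_kball cx by (auto simp: B_def)
    have "\<forall>i\<in>I. \<exists>AB. openin (ktop K) (fst AB) \<and> openin (vtop (E i)) (snd AB) \<and> c \<in> fst AB \<and> x i \<in> snd AB \<and>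
       (\<forall>a\<in>fst AB. \<forall>b\<in>snd AB. a \<odot>\<^bsub>E i\<^esub> b \<in> N i) \<and> (i \<notin> J \<longrightarrow> fst AB = B)"
    proof
      fix i assume i: "i \<in> I"
      interpret E: topological_vector_space K "E i" using E i by blast
      show "\<exists>AB. openin (ktop K) (fst AB) \<and> openin (vtop (E i)) (snd AB) \<and> c \<in> fst AB \<and> x i \<in> snd AB \<and>
         (\<forall>a\<in>fst AB. \<forall>b\<in>snd AB. a \<odot>\<^bsub>E i\<^esub> b \<in> N i) \<and> (i \<notin> J \<longrightarrow> fst AB = B)"
      proof (cases "i \<in> J")
        case True
        then show ?thesis
          using prod_nbhd[OF E.continuous_smult N(1)[OF i], of c "x i"] N(2)[OF i] xc cx i
          by (simp add: E.topspace_vtop)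
      next
        case False
        then have x0: "x i = \<zero>\<^bsub>E i\<^esub>" using i by (simp add: J_def)
        then have "\<zero>\<^bsub>E i\<^esub> \<in> N i" using N(2)[OF i] cx by simp
        from tvs_absorb[OF E[OF i] N(1)[OF i] this, of "absval K c + 1"] obtain A where
          "openin (vtop (E i)) A" "\<zero>\<^bsub>E i\<^esub> \<in> A" "\<forall>s\<in>B. \<forall>a\<in>A. s \<odot>\<^bsub>E i\<^esub> a \<in> N i" unfolding B_def by auto
        then show ?thesis using B x0 by (intro exI[of _ "(B, A)"]) auto
      qed
    qed
    from bchoice[OF this] obtain AB where AB: "\<And>i. i \<in> I \<Longrightarrow> openin (ktop K) (fst (AB i))"
      "\<And>i. i \<in> I \<Longrightarrow> openin (vtop (E i)) (snd (AB i))" "\<And>i. i \<in> I \<Longrightarrow> c \<in> fst (AB i)" "\<And>i. i \<in> I \<Longrightarrow> x i \<in> snd (AB i)"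
      "\<And>i a b. i \<in> I \<Longrightarrow> a \<in> fst (AB i) \<Longrightarrow> b \<in> snd (AB i) \<Longrightarrow> a \<odot>\<^bsub>E i\<^esub> b \<in> N i"
      "\<And>i. i \<in> I - J \<Longrightarrow> fst (AB i) = B" by blast
    define C where "C = B \<inter> \<Inter>((\<lambda>i. fst (AB i)) ` J)"
    have C: "openin (ktop K) C"
    proof (cases "J = {}")
      case False then show ?thesis unfolding C_def using B J AB(1) by (intro openin_Int openin_Inter) auto
    qed (use B in \<open>simp add: C_def\<close>)
    let ?A = "C \<times> (?D \<inter> (\<Pi>\<^sub>E i\<in>I. snd (AB i)))"
    show "\<exists>A. openin (prod_topology (ktop K) (wbox I (\<lambda>i. vtop (E i)) ?D)) A \<and> z \<in> A \<and>
        (\<forall>a\<in>A. \<forall>i\<in>I. (case a of (x, y) \<Rightarrow> x \<odot>\<^bsub>box_sum I E\<^esub> y) i \<in> N i)"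
    proof (intro exI[of _ ?A] conjI)
      show "openin (prod_topology (ktop K) (wbox I (\<lambda>i. vtop (E i)) ?D)) ?A"
        unfolding openin_prod_Times_iff by (intro disjI2 conjI openin_wboxI AB C)
      show "z \<in> ?A" using z cx AB(3,4) B J by (auto simp: sum_carrier_def PiE_iff C_def)
      have "C \<subseteq> fst (AB i)" if "i \<in> I" for i using AB(6) that by (auto simp: C_def)
      then show "\<forall>a\<in>?A. \<forall>i\<in>I. (case a of (x, y) \<Rightarrow> x \<odot>\<^bsub>box_sum I E\<^esub> y) i \<in> N i"
        using AB(5) by (fastforce simp: box_sum_simps PiE_iff)
    qed
  qed
qed

end

section \<open>Box sums of smooth maps\<close>

text \<open>The difference quotients of \<open>(x\<^sub>i)\<^sub>i \<mapsto> (f\<^sub>i x\<^sub>i)\<^sub>i\<close> depend, besides the components \<open>x\<^sub>i\<close>, on scalars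
  which are common to all \<open>i\<close>. Continuity in these scalars has to be uniform in \<open>i\<close>. It follows from
  the homogeneity \<open>f\<^sub>i\<^sup>[\<^sup>1\<^sup>](x, y, t) = r f\<^sub>i\<^sup>[\<^sup>1\<^sup>](x, r\<^sup>-\<^sup>1 y, r t)\<close>: with \<open>r\<close> depending on \<open>i\<close>, the point \<open>(x, r\<^sup>-\<^sup>1 y, r t)\<close>
  can be moved into a given neighbourhood of \<open>0\<close> for all \<open>t\<close> in a ball. The set \<open>\<Sigma> i\<close> below consists of
  such rescalings, paired with their factors.\<close>

definition tproj :: "'i \<Rightarrow> ('i \<Rightarrow> 'e, 'k) itree \<Rightarrow> ('e, 'k) itree" where
  "tproj i = map_itree (\<lambda>x. x i) (\<lambda>t. t)"

lemma tproj_simps [simp]: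
  "tproj i (Base x) = Base (x i)" "tproj i (Br p q t) = Br (tproj i p) (tproj i q) t"
  by (simp_all add: tproj_def)

context valued_field begin

text \<open>The factors multiply because the homogeneities of successive stages compose. The bound
  on \<open>r\<close> keeps all factors in the unit ball, whose effect on a neighbourhood of zero
  can be absorbed once and for all.\<close>

definition rescaling_next ::
  "('k, ('e, 'k) itree) tvs \<Rightarrow> ((('e, 'k) itree \<Rightarrow> ('e, 'k) itree) \<times> 'k) set \<Rightarrow> ((('e, 'k) itree \<Rightarrow> ('e, 'k) itree) \<times> 'k) set"
  where "rescaling_next X S =
    {(\<lambda>p. Br (\<sigma> (bl p)) (inv r \<odot>\<^bsub>X\<^esub> \<sigma> (br p)) (r \<otimes> bs p), r \<otimes> c) | r \<sigma> c.
       (\<sigma>, c) \<in> S \<and> r \<in> carrier K \<and> r \<noteq> \<zero> \<and> absval K r \<le> 1}"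

text \<open>The order of quantifiers matters. \<open>J\<close> is fixed before the neighbourhoods
  \<open>N\<close>, so that one finite set of exceptional coordinates serves for all of them. One
  family \<open>s\<close> serves for finitely many points, because at the next stage both components
  of a tree \<open>Br x y t\<close> must be moved by the same rescaling.\<close>

definition rescalable ::
  "'i set \<Rightarrow> ('k, ('i \<Rightarrow> 'e, 'k) itree) tvs \<Rightarrow> ('i \<Rightarrow> ('k, ('e, 'k) itree) tvs)
    \<Rightarrow> ('i \<Rightarrow> ((('e, 'k) itree \<Rightarrow> ('e, 'k) itree) \<times> 'k) set) \<Rightarrow> bool" where
  "rescalable I X Y \<Sigma> \<longleftrightarrow> TVS X \<and> (\<forall>i\<in>I. TVS (Y i) \<and> clin X (Y i) (tproj i) \<and>
       (\<forall>(\<sigma>, c)\<in>\<Sigma> i. clin (Y i) (Y i) \<sigma> \<and> c \<in> carrier K \<and> absval K c \<le> 1)) \<and>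
     (\<forall>P. finite P \<and> P \<subseteq> carrier X \<longrightarrow> (\<exists>J. finite J \<and>
       (\<forall>N. (\<forall>i\<in>I. openin (vtop (Y i)) (N i) \<and> \<zero>\<^bsub>Y i\<^esub> \<in> N i) \<longrightarrow>
         (\<exists>s. (\<forall>i\<in>I. s i \<in> \<Sigma> i) \<and> (\<forall>p\<in>P. \<exists>W. openin (vtop X) W \<and> p \<in> W \<and>
            (\<forall>q\<in>W. \<forall>i\<in>I - J. fst (s i) (tproj i q) \<in> N i))))))"

lemma nx_zero_nbhd:
  assumes X: "TVS X" and N: "openin (vtop (nx K X)) N" "\<zero>\<^bsub>nx K X\<^esub> \<in> N"
  shows "\<exists>A e. openin (vtop X) A \<and> \<zero>\<^bsub>X\<^esub> \<in> A \<and> e > 0 \<and>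
     (\<forall>x\<in>A. \<forall>y\<in>A. \<forall>t\<in>carrier K. absval K t < e \<longrightarrow> Br x y t \<in> N)"
proof -
  interpret X: topological_vector_space K X by fact
  let ?P = "prod_topology (vtop X) (prod_topology (vtop X) (ktop K))"
  have "continuous_map ?P (vtop (nx K X)) (\<lambda>(x, y, t). Br x y t)"
    using homeomorphic_nx[OF X] unfolding homeomorphic_maps_def by simp
  from prod_nbhd[OF this N(1), of "\<zero>\<^bsub>X\<^esub>" "(\<zero>\<^bsub>X\<^esub>, \<zero>)"] N(2) obtain A B where
    A: "openin (vtop X) A" "\<zero>\<^bsub>X\<^esub> \<in> A" and B: "openin (prod_topology (vtop X) (ktop K)) B" "(\<zero>\<^bsub>X\<^esub>, \<zero>) \<in> B"
    and AB: "\<forall>a\<in>A. \<forall>b\<in>B. (case (a, b) of (x, y, t) \<Rightarrow> Br x y t) \<in> N"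
    by (auto simp: X.topspace_vtop)
  obtain C D where C: "openin (vtop X) C" "openin (ktop K) D" "\<zero>\<^bsub>X\<^esub> \<in> C" "\<zero> \<in> D" "C \<times> D \<subseteq> B"
    using B unfolding openin_prod_topology_alt by meson
  obtain e where "e > 0" "\<forall>y\<in>carrier K. absval K (y \<ominus> \<zero>) < e \<longrightarrow> y \<in> D"
    using C(2,4) unfolding openin_ktop by blast
  then have e: "e > 0" "\<And>y. y \<in> carrier K \<Longrightarrow> absval K y < e \<Longrightarrow> y \<in> D" by (auto simp: a_minus_def)
  have "Br x y t \<in> N" if "x \<in> A" "y \<in> C" "t \<in> D" for x y t
  proof -
    have "(y, t) \<in> B" using that C by blast
    with AB that show ?thesis by fastforce
  qed
  then show ?thesis using A C e by (intro exI[of _ "A \<inter> C"] exI[of _ e]) auto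
qed

text \<open>The rescalings of the previous stage move both components of the trees close to zero,
  and a factor \<open>r i\<close>, as small as coordinate \<open>i\<close> demands, takes care of
  the scalar. Dividing the second component by \<open>r i\<close> does no harm, since the
  neighbourhoods handed to the previous stage are chosen after \<open>r i\<close>.\<close>

lemma rescalable_next:
  assumes R: "rescalable I X Y \<Sigma>"
  shows "rescalable I (nx K X) (\<lambda>i. nx K (Y i)) (\<lambda>i. rescaling_next (Y i) (\<Sigma> i))"
proof -
  have X: "TVS X" and Y: "\<And>i. i \<in> I \<Longrightarrow> TVS (Y i)" and pr: "\<And>i. i \<in> I \<Longrightarrow> clin X (Y i) (tproj i)"
    and S: "\<And>i \<sigma> c. i \<in> I \<Longrightarrow> (\<sigma>, c) \<in> \<Sigma> i \<Longrightarrow> clin (Y i) (Y i) \<sigma> \<and> c \<in> carrier K \<and> absval K c \<le> 1"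
    using R unfolding rescalable_def by blast+
  have ex: "\<exists>J. finite J \<and> (\<forall>N. (\<forall>i\<in>I. openin (vtop (Y i)) (N i) \<and> \<zero>\<^bsub>Y i\<^esub> \<in> N i) \<longrightarrow>
         (\<exists>s. (\<forall>i\<in>I. s i \<in> \<Sigma> i) \<and> (\<forall>p\<in>P. \<exists>W. openin (vtop X) W \<and> p \<in> W \<and>
            (\<forall>q\<in>W. \<forall>i\<in>I - J. fst (s i) (tproj i q) \<in> N i))))" if "finite P" "P \<subseteq> carrier X" for P
    using R that unfolding rescalable_def by blast
  show ?thesis
    unfolding rescalable_def
  proof (intro conjI ballI allI impI)
    show "TVS (nx K X)" by (rule tvs_nx[OF X])
  next
    fix i assume i: "i \<in> I"
    note Yi = Y[OF i]
    show "TVS (nx K (Y i))" by (rule tvs_nx[OF Yi])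
    have "clin (nx K X) (nx K (Y i)) (\<lambda>p. Br (tproj i (bl p)) (tproj i (br p)) (bs p))"
      by (intro clin_nx_intro Yi clin_nx X clin_compose[OF _ pr[OF i]])
    then show "clin (nx K X) (nx K (Y i)) (tproj i)"
      by (rule clin_cong[OF _ tvs_nx[OF X]]) (auto elim!: nx_cases)
    fix s assume "s \<in> rescaling_next (Y i) (\<Sigma> i)"
    then obtain r \<sigma> c where s: "s = (\<lambda>p. Br (\<sigma> (bl p)) (inv r \<odot>\<^bsub>Y i\<^esub> \<sigma> (br p)) (r \<otimes> bs p), r \<otimes> c)"
      and r: "(\<sigma>, c) \<in> \<Sigma> i" "r \<in> carrier K" "r \<noteq> \<zero>" "absval K r \<le> 1"
      unfolding rescaling_next_def by blast
    have \<sigma>: "clin (Y i) (Y i) \<sigma>" and c: "c \<in> carrier K" "absval K c \<le> 1" using S[OF i r(1)] by auto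
    have "clin (nx K (Y i)) (nx K (Y i)) (\<lambda>p. Br (\<sigma> (bl p)) (inv r \<odot>\<^bsub>Y i\<^esub> \<sigma> (br p)) (r \<otimes> bs p))"
      using clin_compose[OF clin_nx(3)[OF Yi] clin_smult[OF tvs_scalar r(2)]] r
      by (intro clin_nx_intro Yi clin_nx clin_compose[OF _ \<sigma>] clin_compose[OF clin_compose[OF _ \<sigma>] clin_smult]) auto
    moreover have "absval K (r \<otimes> c) \<le> 1"
      using r c absval_nonneg by (simp add: absval_mult mult_le_one)
    ultimately show "case s of (\<sigma>, c) \<Rightarrow> clin (nx K (Y i)) (nx K (Y i)) \<sigma> \<and> c \<in> carrier K \<and> absval K c \<le> 1"
      using s r c by simp
  next
    fix P assume P: "finite P \<and> P \<subseteq> carrier (nx K X)"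
    have "bl p \<in> carrier X \<and> br p \<in> carrier X" if "p \<in> P" for p
    proof -
      have "p \<in> carrier (nx K X)" using that P by blast
      then show ?thesis by (rule nx_cases) simp
    qed
    then have sub: "bl ` P \<union> br ` P \<subseteq> carrier X" by blast
    have "finite (bl ` P \<union> br ` P)" using P by simp
    from ex[OF this sub] obtain J where J: "finite J" and Js:
      "\<forall>N. (\<forall>i\<in>I. openin (vtop (Y i)) (N i) \<and> \<zero>\<^bsub>Y i\<^esub> \<in> N i) \<longrightarrow>
         (\<exists>s. (\<forall>i\<in>I. s i \<in> \<Sigma> i) \<and> (\<forall>p\<in>bl ` P \<union> br ` P. \<exists>W. openin (vtop X) W \<and> p \<in> W \<and>
            (\<forall>q\<in>W. \<forall>i\<in>I - J. fst (s i) (tproj i q) \<in> N i)))" by (elim exE conjE)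
    \<comment> \<open>One bound for the scalars of all points of \<open>P\<close> and for all
      coordinates. It determines how small each \<open>r i\<close> has to be, and it cuts out the
      neighbourhoods \<open>V\<close> below.\<close>
    have "\<exists>C>0. \<forall>p\<in>P. absval K (bs p) < C"
    proof -
      have "finite ((\<lambda>p. absval K (bs p)) ` P)" using P by blast
      then obtain b where "\<And>a. a \<in> (\<lambda>p. absval K (bs p)) ` P \<Longrightarrow> a \<le> b" using bdd_above_finite bdd_above.E by metis
      then have "absval K (bs p) < \<bar>b\<bar> + 1" if "p \<in> P" for p using that by fastforce
      then show ?thesis by (intro exI[of _ "\<bar>b\<bar> + 1"]) auto
    qed
    then obtain C where C: "C > 0" "\<And>p. p \<in> P \<Longrightarrow> absval K (bs p) < C" by blast
    show "\<exists>J. finite J \<and> (\<forall>N. (\<forall>i\<in>I. openin (vtop (nx K (Y i))) (N i) \<and> \<zero>\<^bsub>nx K (Y i)\<^esub> \<in> N i) \<longrightarrow>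
         (\<exists>s. (\<forall>i\<in>I. s i \<in> rescaling_next (Y i) (\<Sigma> i)) \<and> (\<forall>p\<in>P. \<exists>W. openin (vtop (nx K X)) W \<and> p \<in> W \<and>
            (\<forall>q\<in>W. \<forall>i\<in>I - J. fst (s i) (tproj i q) \<in> N i))))"
    proof (intro exI[of _ J] conjI J allI impI)
      fix N assume N: "\<forall>i\<in>I. openin (vtop (nx K (Y i))) (N i) \<and> \<zero>\<^bsub>nx K (Y i)\<^esub> \<in> N i"
      have "\<forall>i\<in>I. \<exists>Ar. openin (vtop (Y i)) (fst Ar) \<and> \<zero>\<^bsub>Y i\<^esub> \<in> fst Ar \<and> snd Ar \<in> carrier K \<and> snd Ar \<noteq> \<zero> \<and>
         absval K (snd Ar) \<le> 1 \<and> (\<forall>x\<in>fst Ar. \<forall>y\<in>fst Ar. \<forall>t\<in>carrier K. absval K t < C \<longrightarrow> Br x y (snd Ar \<otimes> t) \<in> N i)"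
      proof
        fix i assume i: "i \<in> I"
        obtain A e where A: "openin (vtop (Y i)) A" "\<zero>\<^bsub>Y i\<^esub> \<in> A" "e > 0"
          "\<And>x y t. x \<in> A \<Longrightarrow> y \<in> A \<Longrightarrow> t \<in> carrier K \<Longrightarrow> absval K t < e \<Longrightarrow> Br x y t \<in> N i"
          using nx_zero_nbhd[OF Y[OF i]] N i by metis
        \<comment> \<open>Below 1 for the bound on the factors; below \<open>e / C\<close> so that
          multiplication by \<open>r\<close> takes the ball of radius \<open>C\<close> into the ball
          of radius \<open>e\<close>.\<close>
        have "min 1 (e / C) > 0" using A C by simp
        then obtain r where r: "r \<in> carrier K" "r \<noteq> \<zero>" "absval K r < min 1 (e / C)" by (rule small_scalar)
        have "absval K (r \<otimes> t) < e" if "t \<in> carrier K" "absval K t < C" for t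
        proof -
          have "absval K (r \<otimes> t) \<le> absval K r * C"
            using r that absval_nonneg[of r] by (simp add: absval_mult mult_left_mono)
          also have "\<dots> < e" using r(3) C(1) by (simp add: pos_less_divide_eq)
          finally show ?thesis .
        qed
        then show "\<exists>Ar. openin (vtop (Y i)) (fst Ar) \<and> \<zero>\<^bsub>Y i\<^esub> \<in> fst Ar \<and> snd Ar \<in> carrier K \<and> snd Ar \<noteq> \<zero> \<and>
         absval K (snd Ar) \<le> 1 \<and> (\<forall>x\<in>fst Ar. \<forall>y\<in>fst Ar. \<forall>t\<in>carrier K. absval K t < C \<longrightarrow> Br x y (snd Ar \<otimes> t) \<in> N i)"
          using A r by (intro exI[of _ "(A, r)"]) auto
      qed
      from bchoice[OF this] obtain Ar where Ar: "\<forall>i\<in>I. openin (vtop (Y i)) (fst (Ar i)) \<and> \<zero>\<^bsub>Y i\<^esub> \<in> fst (Ar i) \<and> snd (Ar i) \<in> carrier K \<and> snd (Ar i) \<noteq> \<zero> \<and>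
         absval K (snd (Ar i)) \<le> 1 \<and> (\<forall>x\<in>fst (Ar i). \<forall>y\<in>fst (Ar i). \<forall>t\<in>carrier K. absval K t < C \<longrightarrow> Br x y (snd (Ar i) \<otimes> t) \<in> N i)"
        by (elim exE)
      define A r where "A = (\<lambda>i. fst (Ar i))" and "r = (\<lambda>i. snd (Ar i))"
      have A: "openin (vtop (Y i)) (A i)" "\<zero>\<^bsub>Y i\<^esub> \<in> A i"
        and r: "r i \<in> carrier K" "r i \<noteq> \<zero>" "absval K (r i) \<le> 1" if "i \<in> I" for i
        using Ar that by (auto simp: A_def r_def)
      have ABr: "Br x y (r i \<otimes> t) \<in> N i" if "i \<in> I" "x \<in> A i" "y \<in> A i" "t \<in> carrier K" "absval K t < C" for i x y t
        using Ar that by (auto simp: A_def r_def)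
      \<comment> \<open>Rescaled elements must lie in \<open>A i\<close> as they are, when they
        occur as first component, and after division by \<open>r i\<close>, when they occur as
        second.\<close>
      define N' where "N' = (\<lambda>i. A i \<inter> {x \<in> carrier (Y i). inv (r i) \<odot>\<^bsub>Y i\<^esub> x \<in> A i})"
      have "openin (vtop (Y i)) (N' i) \<and> \<zero>\<^bsub>Y i\<^esub> \<in> N' i" if i: "i \<in> I" for i
      proof -
        interpret Y: topological_vector_space K "Y i" using Y i by blast
        have "continuous_map (vtop (Y i)) (vtop (Y i)) (\<lambda>x. inv (r i) \<odot>\<^bsub>Y i\<^esub> x)"
          using clinD(4)[OF clin_smult[OF Y[OF i]]] r[OF i] by simp
        from openin_continuous_map_preimage[OF this A(1)[OF i]]
        show ?thesis using A[OF i] r[OF i] by (auto simp: N'_def Y.topspace_vtop)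
      qed
      then have "\<forall>i\<in>I. openin (vtop (Y i)) (N' i) \<and> \<zero>\<^bsub>Y i\<^esub> \<in> N' i" by blast
      from Js[THEN spec, THEN mp, OF this] obtain s where s: "\<And>i. i \<in> I \<Longrightarrow> s i \<in> \<Sigma> i" and
        W: "\<forall>p\<in>bl ` P \<union> br ` P. \<exists>W. openin (vtop X) W \<and> p \<in> W \<and> (\<forall>q\<in>W. \<forall>i\<in>I - J. fst (s i) (tproj i q) \<in> N' i)" by blast
      let ?s = "\<lambda>i. (\<lambda>p. Br (fst (s i) (bl p)) (inv (r i) \<odot>\<^bsub>Y i\<^esub> fst (s i) (br p)) (r i \<otimes> bs p), r i \<otimes> snd (s i))"
      show "\<exists>s. (\<forall>i\<in>I. s i \<in> rescaling_next (Y i) (\<Sigma> i)) \<and> (\<forall>p\<in>P. \<exists>W. openin (vtop (nx K X)) W \<and> p \<in> W \<and>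
            (\<forall>q\<in>W. \<forall>i\<in>I - J. fst (s i) (tproj i q) \<in> N i))"
      proof (intro exI[of _ ?s] conjI ballI)
        fix i assume i: "i \<in> I"
        have "(fst (s i), snd (s i)) \<in> \<Sigma> i" using s[OF i] by simp
        then show "?s i \<in> rescaling_next (Y i) (\<Sigma> i)" unfolding rescaling_next_def using r[OF i] by blast
      next
        fix p assume p: "p \<in> P"
        obtain W1 where W1: "openin (vtop X) W1" "bl p \<in> W1" "\<forall>q\<in>W1. \<forall>i\<in>I - J. fst (s i) (tproj i q) \<in> N' i"
          using W p by blast
        obtain W2 where W2: "openin (vtop X) W2" "br p \<in> W2" "\<forall>q\<in>W2. \<forall>i\<in>I - J. fst (s i) (tproj i q) \<in> N' i"
          using W p by blast
        let ?C = "carrier (nx K X)" and ?B = "{t \<in> carrier K. absval K t < C}"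
        define V where "V = {p \<in> ?C. bl p \<in> W1} \<inter> {p \<in> ?C. br p \<in> W2} \<inter> {p \<in> ?C. bs p \<in> ?B}"
        have ts: "topspace (vtop (nx K X)) = ?C" by (rule topological_vector_space.topspace_vtop[OF tvs_nx[OF X]])
        have V: "openin (vtop (nx K X)) V" unfolding V_def ts[symmetric]
          using clin_nx[OF X, THEN clinD(4)] W1 W2 openin_kball
          by (intro openin_Int openin_continuous_map_preimage) auto
        show "\<exists>W. openin (vtop (nx K X)) W \<and> p \<in> W \<and> (\<forall>q\<in>W. \<forall>i\<in>I - J. fst (?s i) (tproj i q) \<in> N i)"
        proof (intro exI[of _ V] conjI V ballI)
          have "p \<in> ?C" using p P by blast
          then show "p \<in> V" using W1 W2 C(2)[OF p] by (auto simp: V_def elim!: nx_cases)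
          fix q i assume q: "q \<in> V" and i: "i \<in> I - J"
          then obtain x y t where "q = Br x y t" "x \<in> W1" "y \<in> W2" "t \<in> carrier K" "absval K t < C"
            by (auto simp: V_def elim!: nx_cases)
          moreover from this have "fst (s i) (tproj i x) \<in> N' i" "fst (s i) (tproj i y) \<in> N' i" using W1 W2 i by blast+
          ultimately show "fst (?s i) (tproj i q) \<in> N i" using ABr i by (simp add: N'_def)
        qed
      qed
    qed
  qed
qed

text \<open>The invariant for the coinduction. Its last clause is the homogeneity, which also asks
  that \<open>V i\<close> contain every point that a rescaling sends into it. \<open>J0\<close>
  collects the finitely many coordinates at which zero may be missing from the domain or not be
  taken to zero.\<close>

definition box_map where
  "box_map I F X Y U h V f \<Sigma> J0 \<longleftrightarrow> rescalable I X Y \<Sigma> \<and> finite J0 \<and>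
     U = {p \<in> carrier X. \<forall>i\<in>I. tproj i p \<in> V i} \<and> (\<forall>p\<in>U. h p = (\<lambda>i\<in>I. f i (tproj i p))) \<and>
     (\<forall>i\<in>I. Sm (Y i) (F i) (V i) (f i) \<and>
       (i \<notin> J0 \<longrightarrow> \<zero>\<^bsub>Y i\<^esub> \<in> V i \<and> f i \<zero>\<^bsub>Y i\<^esub> = \<zero>\<^bsub>F i\<^esub>) \<and>
       (\<forall>(\<sigma>, c)\<in>\<Sigma> i. \<forall>p\<in>carrier (Y i). \<sigma> p \<in> V i \<longrightarrow> p \<in> V i \<and> f i p = c \<odot>\<^bsub>F i\<^esub> f i (\<sigma> p)))"

text \<open>Outside a finite set of coordinates, homogeneity compares the value at \<open>q\<close>
  with the value at a rescaled point close to zero, and one neighbourhood of \<open>p\<close>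
  controls all these coordinates. The others are finitely many, so that ordinary continuity suffices
  for them.\<close>

lemma box_map_continuous:
  assumes B: "box_map I F X Y U h V f \<Sigma> J0" and U: "openin (vtop X) U"
    and F: "\<And>i. i \<in> I \<Longrightarrow> TVS (F i)"
  shows "continuous_map (subtopology (vtop X) U) (vtop (box_sum I F)) h"
proof -
  let ?D = "sum_carrier I F"
  have R: "rescalable I X Y \<Sigma>" and J0: "finite J0" and Ueq: "U = {p \<in> carrier X. \<forall>i\<in>I. tproj i p \<in> V i}"
    and h: "\<And>p. p \<in> U \<Longrightarrow> h p = (\<lambda>i\<in>I. f i (tproj i p))"
    and f: "\<And>i. i \<in> I \<Longrightarrow> Sm (Y i) (F i) (V i) (f i)"
    and z: "\<And>i. i \<in> I - J0 \<Longrightarrow> \<zero>\<^bsub>Y i\<^esub> \<in> V i" "\<And>i. i \<in> I - J0 \<Longrightarrow> f i \<zero>\<^bsub>Y i\<^esub> = \<zero>\<^bsub>F i\<^esub>"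
    and sc: "\<And>i \<sigma> c p. i \<in> I \<Longrightarrow> (\<sigma>, c) \<in> \<Sigma> i \<Longrightarrow> p \<in> carrier (Y i) \<Longrightarrow> \<sigma> p \<in> V i \<Longrightarrow> p \<in> V i \<and> f i p = c \<odot>\<^bsub>F i\<^esub> f i (\<sigma> p)"
    using B unfolding box_map_def by blast+
  have X: "TVS X" and Y: "\<And>i. i \<in> I \<Longrightarrow> TVS (Y i)" and pr: "\<And>i. i \<in> I \<Longrightarrow> clin X (Y i) (tproj i)"
    and S: "\<And>i \<sigma> c. i \<in> I \<Longrightarrow> (\<sigma>, c) \<in> \<Sigma> i \<Longrightarrow> clin (Y i) (Y i) \<sigma> \<and> c \<in> carrier K \<and> absval K c \<le> 1"
    using R unfolding rescalable_def by blast+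
  have ex: "\<exists>J. finite J \<and> J0 \<subseteq> J \<and> (\<forall>N. (\<forall>i\<in>I. openin (vtop (Y i)) (N i) \<and> \<zero>\<^bsub>Y i\<^esub> \<in> N i) \<longrightarrow>
         (\<exists>s W. (\<forall>i\<in>I. s i \<in> \<Sigma> i) \<and> openin (vtop X) W \<and> p \<in> W \<and>
            (\<forall>q\<in>W. \<forall>i\<in>I - J. fst (s i) (tproj i q) \<in> N i)))" if "p \<in> U" for p
  proof -
    have "finite {p} \<and> {p} \<subseteq> carrier X" using that Ueq by auto
    from R[unfolded rescalable_def, THEN conjunct2, THEN conjunct2, THEN spec, THEN mp, OF this]
    obtain J where J: "finite J" and Js: "\<forall>N. (\<forall>i\<in>I. openin (vtop (Y i)) (N i) \<and> \<zero>\<^bsub>Y i\<^esub> \<in> N i) \<longrightarrow>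
         (\<exists>s. (\<forall>i\<in>I. s i \<in> \<Sigma> i) \<and> (\<forall>p\<in>{p}. \<exists>W. openin (vtop X) W \<and> p \<in> W \<and>
            (\<forall>q\<in>W. \<forall>i\<in>I - J. fst (s i) (tproj i q) \<in> N i)))"
      by (elim exE conjE)
    show ?thesis
    proof (intro exI[of _ "J \<union> J0"] conjI allI impI)
      fix N assume "\<forall>i\<in>I. openin (vtop (Y i)) (N i) \<and> \<zero>\<^bsub>Y i\<^esub> \<in> N i"
      from Js[rule_format, OF this[rule_format]] obtain s W where
        "\<forall>i\<in>I. s i \<in> \<Sigma> i" "openin (vtop X) W" "p \<in> W" "\<forall>q\<in>W. \<forall>i\<in>I - J. fst (s i) (tproj i q) \<in> N i" by auto
      then show "\<exists>s W. (\<forall>i\<in>I. s i \<in> \<Sigma> i) \<and> openin (vtop X) W \<and> p \<in> W \<and>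
            (\<forall>q\<in>W. \<forall>i\<in>I - (J \<union> J0). fst (s i) (tproj i q) \<in> N i)" by blast
    qed (use J J0 in auto)
  qed
  \<comment> \<open>On a suitable \<open>M i\<close> around zero, all multiples of
    \<open>f i\<close> by factors from the unit ball lie in \<open>N i\<close>. A rescaling brings
    the argument into \<open>M i\<close>, and homogeneity returns the estimate to the original
    point.\<close>
  have near: "\<exists>W. openin (vtop X) W \<and> p \<in> W \<and> (\<forall>q\<in>W \<inter> U. \<forall>i\<in>I - J. f i (tproj i q) \<in> N i)"
    if Js: "\<forall>N. (\<forall>i\<in>I. openin (vtop (Y i)) (N i) \<and> \<zero>\<^bsub>Y i\<^esub> \<in> N i) \<longrightarrow>
         (\<exists>s W. (\<forall>i\<in>I. s i \<in> \<Sigma> i) \<and> openin (vtop X) W \<and> p \<in> W \<and>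
            (\<forall>q\<in>W. \<forall>i\<in>I - J. fst (s i) (tproj i q) \<in> N i))" and J: "J0 \<subseteq> J"
      and N: "\<And>i. i \<in> I - J \<Longrightarrow> openin (vtop (F i)) (N i) \<and> \<zero>\<^bsub>F i\<^esub> \<in> N i" for p J N
  proof -
    have "\<forall>i\<in>I. \<exists>M. openin (vtop (Y i)) M \<and> \<zero>\<^bsub>Y i\<^esub> \<in> M \<and> (i \<notin> J \<longrightarrow> M \<subseteq> V i \<and>
        (\<forall>q\<in>M. \<forall>c\<in>carrier K. absval K c \<le> 1 \<longrightarrow> c \<odot>\<^bsub>F i\<^esub> f i q \<in> N i))"
    proof
      fix i assume i: "i \<in> I"
      interpret Y: topological_vector_space K "Y i" using Y i by blast
      show "\<exists>M. openin (vtop (Y i)) M \<and> \<zero>\<^bsub>Y i\<^esub> \<in> M \<and> (i \<notin> J \<longrightarrow> M \<subseteq> V i \<and>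
        (\<forall>q\<in>M. \<forall>c\<in>carrier K. absval K c \<le> 1 \<longrightarrow> c \<odot>\<^bsub>F i\<^esub> f i q \<in> N i))"
      proof (cases "i \<in> J")
        case True
        then show ?thesis using openin_topspace[of "vtop (Y i)"] Y.topspace_vtop by auto
      next
        case False
        then have i': "i \<in> I - J" "i \<in> I - J0" using i J by auto
        \<comment> \<open>Radius 2, because the bound in \<open>tvs_absorb\<close> is strict whereas
          the factors satisfy \<open>absval K c \<le> 1\<close>.\<close>
        obtain Q where Q: "openin (vtop (F i)) Q" "\<zero>\<^bsub>F i\<^esub> \<in> Q"
          "\<forall>c\<in>carrier K. absval K c < 2 \<longrightarrow> (\<forall>a\<in>Q. c \<odot>\<^bsub>F i\<^esub> a \<in> N i)"
          using tvs_absorb[OF F[OF i], of "N i" 2] N[OF i'(1)] by blast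
        have Vo: "openin (vtop (Y i)) (V i)" by (rule SmD(3)[OF f[OF i]])
        have "topspace (subtopology (vtop (Y i)) (V i)) = V i" using openin_subset[OF Vo] by auto
        from openin_continuous_map_preimage[OF SmD(4)[OF f[OF i]] Q(1), unfolded this]
        have "openin (vtop (Y i)) {q \<in> V i. f i q \<in> Q}" using openin_open_subtopology[OF Vo] by blast
        then show ?thesis using z[OF i'(2)] Q by (intro exI[of _ "{q \<in> V i. f i q \<in> Q}"]) auto
      qed
    qed
    from bchoice[OF this] obtain M where M0: "\<forall>i\<in>I. openin (vtop (Y i)) (M i) \<and> \<zero>\<^bsub>Y i\<^esub> \<in> M i \<and> (i \<notin> J \<longrightarrow> M i \<subseteq> V i \<and>
        (\<forall>q\<in>M i. \<forall>c\<in>carrier K. absval K c \<le> 1 \<longrightarrow> c \<odot>\<^bsub>F i\<^esub> f i q \<in> N i))"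
      by (elim exE)
    have M: "openin (vtop (Y i)) (M i)" "\<zero>\<^bsub>Y i\<^esub> \<in> M i" if "i \<in> I" for i using M0 that by simp_all
    have M': "M i \<subseteq> V i" "q \<in> M i \<Longrightarrow> c \<in> carrier K \<Longrightarrow> absval K c \<le> 1 \<Longrightarrow> c \<odot>\<^bsub>F i\<^esub> f i q \<in> N i"
      if "i \<in> I - J" for i q c using M0 that by simp_all
    from M have "\<forall>i\<in>I. openin (vtop (Y i)) (M i) \<and> \<zero>\<^bsub>Y i\<^esub> \<in> M i" by simp
    from Js[rule_format, OF this[rule_format]] obtain s W where sW: "\<forall>i\<in>I. s i \<in> \<Sigma> i" "openin (vtop X) W" "p \<in> W"
      "\<forall>q\<in>W. \<forall>i\<in>I - J. fst (s i) (tproj i q) \<in> M i" by auto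
    show ?thesis
    proof (intro exI[of _ W] conjI sW ballI)
      fix q i assume q: "q \<in> W \<inter> U" and i: "i \<in> I - J"
      have s: "(fst (s i), snd (s i)) \<in> \<Sigma> i" using sW(1) i by auto
      have m: "fst (s i) (tproj i q) \<in> M i" using sW(4) q i by blast
      have "tproj i q \<in> carrier (Y i)" using clinD(1)[OF pr] i q Ueq by blast
      from sc[OF _ s this] have "f i (tproj i q) = snd (s i) \<odot>\<^bsub>F i\<^esub> f i (fst (s i) (tproj i q))"
        using i m M'(1)[OF i] by blast
      also have "\<dots> \<in> N i" using M'(2)[OF i m] S[OF _ s] i by blast
      finally show "f i (tproj i q) \<in> N i" .
    qed
  qed
  \<comment> \<open>This is why the value has finite support: \<open>near\<close> puts component
    \<open>i\<close> into every neighbourhood of zero, and the space is Hausdorff. As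
    \<open>J\<close> was fixed before \<open>N\<close>, the separating neighbourhood may be used for
    \<open>N\<close>.\<close>
  have fin: "f i (tproj i p) = \<zero>\<^bsub>F i\<^esub>" if p: "p \<in> U" and i: "i \<in> I - J" and J: "J0 \<subseteq> J" and
      Js: "\<forall>N. (\<forall>i\<in>I. openin (vtop (Y i)) (N i) \<and> \<zero>\<^bsub>Y i\<^esub> \<in> N i) \<longrightarrow>
         (\<exists>s W. (\<forall>i\<in>I. s i \<in> \<Sigma> i) \<and> openin (vtop X) W \<and> p \<in> W \<and>
            (\<forall>q\<in>W. \<forall>i\<in>I - J. fst (s i) (tproj i q) \<in> N i))" for p i J
  proof (rule ccontr)
    interpret Fi: topological_vector_space K "F i" using F i by blast
    assume ne: "f i (tproj i p) \<noteq> \<zero>\<^bsub>F i\<^esub>"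
    have "f i (tproj i p) \<in> carrier (F i)" using Sm_in_carrier[OF f] i p Ueq by blast
    then obtain A B where A: "openin (vtop (F i)) A" "openin (vtop (F i)) B" "f i (tproj i p) \<in> A" "\<zero>\<^bsub>F i\<^esub> \<in> B" "disjnt A B"
      using Fi.Hausdorff_vtop ne Fi.topspace_vtop Fi.zero_closed unfolding Hausdorff_space_def by metis
    let ?N = "\<lambda>j. if j = i then B else carrier (F j)"
    have "openin (vtop (F j)) (?N j) \<and> \<zero>\<^bsub>F j\<^esub> \<in> ?N j" if "j \<in> I - J" for j
    proof -
      interpret Fj: topological_vector_space K "F j" using F that by blast
      show ?thesis using A openin_topspace[of "vtop (F j)"] Fj.topspace_vtop by auto
    qed
    from near[OF Js J, of ?N, OF this] obtain W where "p \<in> W" "\<forall>q\<in>W \<inter> U. \<forall>j\<in>I - J. f j (tproj j q) \<in> ?N j" by blast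
    then have "f i (tproj i p) \<in> B" using p i by (metis IntI)
    then show False using A by (auto simp: disjnt_iff)
  qed
  have ts: "topspace (subtopology (vtop X) U) = U" using openin_subset[OF U] by auto
  note D = sum_carrier_PiE[OF F, of I]
  have v: "vtop (box_sum I F) = wbox I (\<lambda>i. vtop (F i)) ?D" using box_topology_eq[OF F] by (simp add: box_sum_simps)
  show ?thesis
    unfolding v
  proof (rule continuous_into_wbox[OF D], unfold ts)
    fix p assume p: "p \<in> U"
    from ex[OF p] obtain J where J: "finite J" "J0 \<subseteq> J" and Js: "\<forall>N. (\<forall>i\<in>I. openin (vtop (Y i)) (N i) \<and> \<zero>\<^bsub>Y i\<^esub> \<in> N i) \<longrightarrow>
         (\<exists>s W. (\<forall>i\<in>I. s i \<in> \<Sigma> i) \<and> openin (vtop X) W \<and> p \<in> W \<and>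
            (\<forall>q\<in>W. \<forall>i\<in>I - J. fst (s i) (tproj i q) \<in> N i))" by (elim exE conjE)
    have fp: "f i (tproj i p) = \<zero>\<^bsub>F i\<^esub>" if "i \<in> I - J" for i using fin[OF p that J(2) Js] .
    have "h p \<in> (\<Pi>\<^sub>E i\<in>I. carrier (F i))" using h[OF p] Sm_in_carrier[OF f] p Ueq by auto
    moreover have "{i \<in> I. h p i \<noteq> \<zero>\<^bsub>F i\<^esub>} \<subseteq> J" using fp h[OF p] by auto
    ultimately show "h p \<in> ?D" using J(1) by (auto simp: sum_carrier_def intro: finite_subset)
    fix N assume "\<And>i. i \<in> I \<Longrightarrow> openin (vtop (F i)) (N i) \<and> h p i \<in> N i"
    then have N: "openin (vtop (F i)) (N i)" "f i (tproj i p) \<in> N i" if "i \<in> I" for i using that h[OF p] by auto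
    have "openin (vtop (F i)) (N i) \<and> \<zero>\<^bsub>F i\<^esub> \<in> N i" if "i \<in> I - J" for i using N[of i] fp[OF that] that by auto
    from near[OF Js J(2) this] obtain W where W: "openin (vtop X) W" "p \<in> W"
      "\<forall>q\<in>W \<inter> U. \<forall>i\<in>I - J. f i (tproj i q) \<in> N i" by blast
    define A where "A = (\<lambda>i. {q \<in> U. f i (tproj i q) \<in> N i})"
    have A: "openin (vtop X) (A i)" if i: "i \<in> I" for i
    proof -
      have "continuous_map (subtopology (vtop X) U) (subtopology (vtop (Y i)) (V i)) (tproj i)"
        using clinD(4)[OF pr[OF i]] i Ueq by (auto simp: continuous_map_in_subtopology continuous_map_from_subtopology)
      from openin_continuous_map_preimage[OF continuous_map_compose[OF this SmD(4)[OF f[OF i]]] N(1)[OF i], unfolded ts]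
      show ?thesis using openin_open_subtopology[OF U] by (simp add: A_def o_def)
    qed
    \<comment> \<open>\<open>W\<close> handles the coordinates outside \<open>J\<close> together;
      those inside cost one open set \<open>A i\<close> each, and there are finitely many.\<close>
    define W' where "W' = (W \<inter> U) \<inter> \<Inter>(A ` (J \<inter> I))"
    have W': "openin (vtop X) W'"
    proof (cases "J \<inter> I = {}")
      case False then show ?thesis unfolding W'_def using W(1) U J A by (intro openin_Int openin_Inter) auto
    qed (use W U in \<open>auto simp: W'_def\<close>)
    show "\<exists>A. openin (subtopology (vtop X) U) A \<and> p \<in> A \<and> (\<forall>a\<in>A. \<forall>i\<in>I. h a i \<in> N i)"
    proof (intro exI[of _ W'] conjI ballI)
      show "openin (subtopology (vtop X) U) W'" using openin_open_subtopology[OF U] W' by (auto simp: W'_def)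
      show "p \<in> W'" using p W N(2) by (auto simp: W'_def A_def)
      fix a i assume a: "a \<in> W'" and i: "i \<in> I"
      then have aU: "a \<in> U" by (simp add: W'_def)
      show "h a i \<in> N i"
      proof (cases "i \<in> J")
        case True
        then have "a \<in> A i" using a i by (auto simp: W'_def)
        then show ?thesis using h[OF aU] i by (simp add: A_def)
      next
        case False
        then show ?thesis using W(3) a i h[OF aU] by (simp add: W'_def)
      qed
    qed
  qed
qed

text \<open>On the line of points \<open>(0, 0, s)\<close> the step from \<open>x\<close> to
  \<open>x + s y\<close> does not move, so the quotient vanishes for
  \<open>s \<noteq> \<zero>\<close> and by continuity at \<open>s = \<zero>\<close>. This hands the
  normalisation at zero on to the next stage.\<close>

lemma Sm_zero_step:
  assumes f: "Sm Y F V f" and z: "\<zero>\<^bsub>Y\<^esub> \<in> V" "f \<zero>\<^bsub>Y\<^esub> = \<zero>\<^bsub>F\<^esub>"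
    and g: "dstep Y F V f g" "Sm (nx K Y) F (nd K Y V) g"
  shows "\<zero>\<^bsub>nx K Y\<^esub> \<in> nd K Y V" "g \<zero>\<^bsub>nx K Y\<^esub> = \<zero>\<^bsub>F\<^esub>"
proof -
  note Y = SmD(1)[OF f] and F = SmD(2)[OF f]
  interpret Y: topological_vector_space K Y by (rule Y)
  interpret F: topological_vector_space K F by (rule F)
  show zn: "\<zero>\<^bsub>nx K Y\<^esub> \<in> nd K Y V" using z by simp
  have br: "continuous_map (ktop K) (vtop (nx K Y)) (\<lambda>s. Br \<zero>\<^bsub>Y\<^esub> \<zero>\<^bsub>Y\<^esub> s)"
  proof -
    have "continuous_map (ktop K) (vtop (prod_tvs Y (prod_tvs Y (scalar_tvs K)))) (\<lambda>s. (\<zero>\<^bsub>Y\<^esub>, \<zero>\<^bsub>Y\<^esub>, s))"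
      by (auto intro!: continuous_map_pairedI simp: Y.topspace_vtop)
    then have "continuous_map (ktop K) (vtop (nx K Y)) ((\<lambda>(x, y, t). Br x y t) \<circ> (\<lambda>s. (\<zero>\<^bsub>Y\<^esub>, \<zero>\<^bsub>Y\<^esub>, s)))"
      using homeomorphic_nx[OF Y] continuous_map_compose unfolding homeomorphic_maps_def by blast
    then show ?thesis by (simp add: o_def)
  qed
  have in_nd: "Br \<zero>\<^bsub>Y\<^esub> \<zero>\<^bsub>Y\<^esub> s \<in> nd K Y V" if "s \<in> carrier K" for s using z that by simp
  have "continuous_map (ktop K) (subtopology (vtop (nx K Y)) (nd K Y V)) (\<lambda>s. Br \<zero>\<^bsub>Y\<^esub> \<zero>\<^bsub>Y\<^esub> s)"
    using br in_nd by (auto simp: continuous_map_in_subtopology)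
  from continuous_map_compose[OF this SmD(4)[OF g(2)]]
  have c: "continuous_map (subtopology (ktop K) (carrier K)) (vtop F) (\<lambda>s. g (Br \<zero>\<^bsub>Y\<^esub> \<zero>\<^bsub>Y\<^esub> s))"
    by (simp add: o_def continuous_map_from_subtopology)
  have "g (Br \<zero>\<^bsub>Y\<^esub> \<zero>\<^bsub>Y\<^esub> \<zero>) = \<zero>\<^bsub>F\<^esub>"
  proof (rule vanishing_limit[OF F.Hausdorff_vtop _ _ c, of "\<lambda>_. \<zero>\<^bsub>F\<^esub>"])
    show "openin (ktop K) (carrier K)" using openin_topspace[of "ktop K"] by simp
    show "continuous_map (subtopology (ktop K) (carrier K)) (vtop F) (\<lambda>_. \<zero>\<^bsub>F\<^esub>)" by (simp add: F.topspace_vtop)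
    fix t assume t: "t \<in> carrier K" "t \<noteq> \<zero>"
    note d = dstepD[OF g(1) in_nd[OF t(1)]]
    have "\<zero>\<^bsub>F\<^esub> = \<zero>\<^bsub>F\<^esub> \<oplus>\<^bsub>F\<^esub> t \<odot>\<^bsub>F\<^esub> g (Br \<zero>\<^bsub>Y\<^esub> \<zero>\<^bsub>Y\<^esub> t)" using d(2) t(1) z(2) by simp
    moreover have "\<zero>\<^bsub>F\<^esub> = \<zero>\<^bsub>F\<^esub> \<oplus>\<^bsub>F\<^esub> t \<odot>\<^bsub>F\<^esub> \<zero>\<^bsub>F\<^esub>" using t by simp
    ultimately have "\<zero>\<^bsub>F\<^esub> \<oplus>\<^bsub>F\<^esub> t \<odot>\<^bsub>F\<^esub> g (Br \<zero>\<^bsub>Y\<^esub> \<zero>\<^bsub>Y\<^esub> t) = \<zero>\<^bsub>F\<^esub> \<oplus>\<^bsub>F\<^esub> t \<odot>\<^bsub>F\<^esub> \<zero>\<^bsub>F\<^esub>"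
      by (rule trans[OF sym])
    from tvs_cancel_step[OF F F.zero_closed d(1) F.zero_closed t this]
    show "g (Br \<zero>\<^bsub>Y\<^esub> \<zero>\<^bsub>Y\<^esub> t) = \<zero>\<^bsub>F\<^esub>" .
  qed simp
  then show "g \<zero>\<^bsub>nx K Y\<^esub> = \<zero>\<^bsub>F\<^esub>" by simp
qed

text \<open>In \<open>x + t y\<close> the factors \<open>r\<close> and \<open>r^-1\<close> cancel,
  so \<open>g\<close> at the rescaled point, multiplied by \<open>r \<otimes> c\<close>, is a
  continuous difference quotient of \<open>f\<close> too; uniqueness equates it with
  \<open>g p\<close>.\<close>

lemma Sm_rescale_step:
  assumes f: "Sm Y F V f" and \<sigma>: "clin Y Y \<sigma>" and c: "c \<in> carrier K" and r: "r \<in> carrier K" "r \<noteq> \<zero>"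
    and sc: "\<And>p. p \<in> carrier Y \<Longrightarrow> \<sigma> p \<in> V \<Longrightarrow> p \<in> V \<and> f p = c \<odot>\<^bsub>F\<^esub> f (\<sigma> p)"
    and g: "dstep Y F V f g" "Sm (nx K Y) F (nd K Y V) g"
    and p: "p \<in> carrier (nx K Y)" "Br (\<sigma> (bl p)) (inv r \<odot>\<^bsub>Y\<^esub> \<sigma> (br p)) (r \<otimes> bs p) \<in> nd K Y V"
  shows "p \<in> nd K Y V \<and> g p = (r \<otimes> c) \<odot>\<^bsub>F\<^esub> g (Br (\<sigma> (bl p)) (inv r \<odot>\<^bsub>Y\<^esub> \<sigma> (br p)) (r \<otimes> bs p))"
proof -
  note Y = SmD(1)[OF f] and F = SmD(2)[OF f] and Vo = SmD(3)[OF f]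
  interpret Y: topological_vector_space K Y by (rule Y)
  interpret F: topological_vector_space K F by (rule F)
  let ?\<tau> = "\<lambda>p. Br (\<sigma> (bl p)) (inv r \<odot>\<^bsub>Y\<^esub> \<sigma> (br p)) (r \<otimes> bs p)"
  have \<tau>: "clin (nx K Y) (nx K Y) ?\<tau>"
    using clin_compose[OF clin_nx(3)[OF Y] clin_smult[OF tvs_scalar r(1)]] r
    by (intro clin_nx_intro Y clin_nx clin_compose[OF _ \<sigma>] clin_compose[OF clin_compose[OF _ \<sigma>] clin_smult]) auto
  \<comment> \<open>The homogeneity of \<open>f\<close> is available only where
    \<open>\<sigma>\<close> takes values in \<open>V\<close>, so the two quotients are compared over
    this open subset.\<close>
  define V' where "V' = {p \<in> carrier Y. \<sigma> p \<in> V}"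
  have V': "openin (vtop Y) V'"
    using openin_continuous_map_preimage[OF clinD(4)[OF \<sigma>] Vo] by (simp add: V'_def Y.topspace_vtop)
  have V'V: "V' \<subseteq> V" using sc by (auto simp: V'_def)
  have eq: "\<sigma> x \<oplus>\<^bsub>Y\<^esub> (r \<otimes> t) \<odot>\<^bsub>Y\<^esub> (inv r \<odot>\<^bsub>Y\<^esub> \<sigma> y) = \<sigma> (x \<oplus>\<^bsub>Y\<^esub> t \<odot>\<^bsub>Y\<^esub> y)"
    if "x \<in> carrier Y" "y \<in> carrier Y" "t \<in> carrier K" for x y t
  proof -
    have "(r \<otimes> t) \<otimes> inv r = t" using r that m_comm[of r t] by (simp add: m_assoc)
    then have "(r \<otimes> t) \<odot>\<^bsub>Y\<^esub> (inv r \<odot>\<^bsub>Y\<^esub> \<sigma> y) = t \<odot>\<^bsub>Y\<^esub> \<sigma> y"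
      using r that clinD(1)[OF \<sigma>] by (simp flip: Y.smult_assoc1)
    then show ?thesis using clin_axpy[OF \<sigma> Y that] by simp
  qed
  have nd': "?\<tau> q \<in> nd K Y V \<longleftrightarrow> q \<in> nd K Y V'" if "q \<in> carrier (nx K Y)" for q
    using that r clinD(1)[OF \<sigma>] by (elim nx_cases) (auto simp: V'_def eq)
  have pV': "p \<in> nd K Y V'" using nd'[OF p(1)] p(2) by blast
  have sub: "nd K Y V' \<subseteq> nd K Y V" using V'V by (auto elim!: nd_cases)
  have \<tau>c: "?\<tau> q \<in> nd K Y V" "q \<in> carrier (nx K Y)" if "q \<in> nd K Y V'" for q
  proof -
    show "q \<in> carrier (nx K Y)" using that openin_carrier[OF Y V'] by (auto elim!: nd_cases)
    then show "?\<tau> q \<in> nd K Y V" using nd' that by blast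
  qed
  have "g p = (r \<otimes> c) \<odot>\<^bsub>F\<^esub> g (?\<tau> p)"
  proof (rule dstep_unique[OF Y F V', where f = f and g = g and h = "\<lambda>p. (r \<otimes> c) \<odot>\<^bsub>F\<^esub> g (?\<tau> p)"])
    show "f x \<in> carrier F" if "x \<in> V'" for x using Sm_in_carrier[OF f] that V'V by blast
    show "continuous_map (subtopology (vtop (nx K Y)) (nd K Y V')) (vtop F) g"
      using SmD(4)[OF g(2)] sub continuous_map_from_subtopology_mono by blast
    show "dstep Y F V' f g" using g(1) sub unfolding dstep_def by blast
    have "continuous_map (subtopology (vtop (nx K Y)) (nd K Y V')) (subtopology (vtop (nx K Y)) (nd K Y V)) ?\<tau>"
      using clinD(4)[OF \<tau>] \<tau>c by (auto simp: continuous_map_in_subtopology continuous_map_from_subtopology)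
    from continuous_map_compose[OF this SmD(4)[OF g(2)]]
    show "continuous_map (subtopology (vtop (nx K Y)) (nd K Y V')) (vtop F) (\<lambda>p. (r \<otimes> c) \<odot>\<^bsub>F\<^esub> g (?\<tau> p))"
      using r c by (intro tvs_cont_smult F) (simp_all add: o_def)
    show "dstep Y F V' f (\<lambda>p. (r \<otimes> c) \<odot>\<^bsub>F\<^esub> g (?\<tau> p))"
    proof (rule dstepI)
      fix x y t assume a: "x \<in> V'" "y \<in> carrier Y" "t \<in> carrier K" "x \<oplus>\<^bsub>Y\<^esub> t \<odot>\<^bsub>Y\<^esub> y \<in> V'"
      then have xc: "x \<in> carrier Y" and "Br x y t \<in> nd K Y V'" by (auto simp: V'_def)
      then have n: "Br (\<sigma> x) (inv r \<odot>\<^bsub>Y\<^esub> \<sigma> y) (r \<otimes> t) \<in> nd K Y V" using \<tau>c(1)[of "Br x y t"] by simp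
      note d = dstepD[OF g(1) n, unfolded eq[OF xc a(2,3)]]
      have fx: "f x = c \<odot>\<^bsub>F\<^esub> f (\<sigma> x)" "f (x \<oplus>\<^bsub>Y\<^esub> t \<odot>\<^bsub>Y\<^esub> y) = c \<odot>\<^bsub>F\<^esub> f (\<sigma> (x \<oplus>\<^bsub>Y\<^esub> t \<odot>\<^bsub>Y\<^esub> y))"
        using sc a xc by (auto simp: V'_def)
      have fc: "f (\<sigma> x) \<in> carrier F" using Sm_in_carrier[OF f] a by (auto simp: V'_def)
      have "c \<odot>\<^bsub>F\<^esub> ((r \<otimes> t) \<odot>\<^bsub>F\<^esub> w) = t \<odot>\<^bsub>F\<^esub> ((r \<otimes> c) \<odot>\<^bsub>F\<^esub> w)" if "w \<in> carrier F" for w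
      proof -
        have "c \<otimes> (r \<otimes> t) = t \<otimes> (r \<otimes> c)" using c r a by (simp add: m_ac)
        then show ?thesis using c r a that by (simp flip: F.smult_assoc1)
      qed
      then show "(r \<otimes> c) \<odot>\<^bsub>F\<^esub> g (?\<tau> (Br x y t)) \<in> carrier F \<and>
         f (x \<oplus>\<^bsub>Y\<^esub> t \<odot>\<^bsub>Y\<^esub> y) = f x \<oplus>\<^bsub>F\<^esub> t \<odot>\<^bsub>F\<^esub> ((r \<otimes> c) \<odot>\<^bsub>F\<^esub> g (?\<tau> (Br x y t)))"
        using d fx fc c r a by (simp add: F.smult_r_distr)
    qed
  qed (rule pV')
  then show ?thesis using pV' sub by blast
qed

text \<open>All clauses of \<open>box_map\<close> pass to the difference quotient formed in each
  coordinate: the supply of rescalings by \<open>rescalable_next\<close>, the value at zero by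
  \<open>Sm_zero_step\<close>, homogeneity by \<open>Sm_rescale_step\<close>. Continuity of the new
  map yields at the same time that its values have finite support.\<close>

lemma Sm_box_map:
  fixes X :: "('k, ('i \<Rightarrow> 'e, 'k) itree) tvs" and Y :: "'i \<Rightarrow> ('k, ('e, 'k) itree) tvs"
  assumes "box_map I F X Y U h V f \<Sigma> J0" "openin (vtop X) U" and F: "\<And>i. i \<in> I \<Longrightarrow> TVS (F i)"
  shows "Sm X (box_sum I F) U h"
proof (rule Sm_coinduct[where R = "\<lambda>X U h. \<exists>Y V f \<Sigma>. box_map I F X Y U h V f \<Sigma> J0"])
  show "\<exists>Y V f \<Sigma>. box_map I F X Y U h V f \<Sigma> J0" using assms(1) by blast
  show "TVS X" using assms(1) by (simp add: box_map_def rescalable_def)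
  fix X :: "('k, ('i \<Rightarrow> 'e, 'k) itree) tvs" and U h
  assume X: "TVS X" and U: "openin (vtop X) U" and "\<exists>Y V f \<Sigma>. box_map I F X Y U h V f \<Sigma> J0"
  then obtain Y V f \<Sigma> where B: "box_map I F X Y U h V f \<Sigma> J0" by blast
  have R: "rescalable I X Y \<Sigma>" and J0: "finite J0" and Ueq: "U = {p \<in> carrier X. \<forall>i\<in>I. tproj i p \<in> V i}"
    and h: "\<And>p. p \<in> U \<Longrightarrow> h p = (\<lambda>i\<in>I. f i (tproj i p))"
    and f: "\<And>i. i \<in> I \<Longrightarrow> Sm (Y i) (F i) (V i) (f i)"
    and z: "\<And>i. i \<in> I \<Longrightarrow> i \<notin> J0 \<Longrightarrow> \<zero>\<^bsub>Y i\<^esub> \<in> V i" "\<And>i. i \<in> I \<Longrightarrow> i \<notin> J0 \<Longrightarrow> f i \<zero>\<^bsub>Y i\<^esub> = \<zero>\<^bsub>F i\<^esub>"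
    and sc: "\<And>i \<sigma> c p. i \<in> I \<Longrightarrow> (\<sigma>, c) \<in> \<Sigma> i \<Longrightarrow> p \<in> carrier (Y i) \<Longrightarrow> \<sigma> p \<in> V i \<Longrightarrow> p \<in> V i \<and> f i p = c \<odot>\<^bsub>F i\<^esub> f i (\<sigma> p)"
    using B unfolding box_map_def by blast+
  have pr: "\<And>i. i \<in> I \<Longrightarrow> clin X (Y i) (tproj i)"
    and S: "\<And>i \<sigma> c. i \<in> I \<Longrightarrow> (\<sigma>, c) \<in> \<Sigma> i \<Longrightarrow> clin (Y i) (Y i) \<sigma> \<and> c \<in> carrier K \<and> absval K c \<le> 1"
    using R unfolding rescalable_def by blast+
  have "\<forall>i\<in>I. \<exists>g. dstep (Y i) (F i) (V i) (f i) g \<and> Sm (nx K (Y i)) (F i) (nd K (Y i) (V i)) g"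
  proof
    fix i assume "i \<in> I"
    from SmE[OF f[OF this]] show "\<exists>g. dstep (Y i) (F i) (V i) (f i) g \<and> Sm (nx K (Y i)) (F i) (nd K (Y i) (V i)) g" by blast
  qed
  from bchoice[OF this] obtain g where
    "\<forall>i\<in>I. dstep (Y i) (F i) (V i) (f i) (g i) \<and> Sm (nx K (Y i)) (F i) (nd K (Y i) (V i)) (g i)" by (elim exE)
  then have g: "\<And>i. i \<in> I \<Longrightarrow> dstep (Y i) (F i) (V i) (f i) (g i)"
     "\<And>i. i \<in> I \<Longrightarrow> Sm (nx K (Y i)) (F i) (nd K (Y i) (V i)) (g i)" by simp_all
  define h1 where "h1 = (\<lambda>p. \<lambda>i\<in>I. g i (tproj i p))"
  have pstep: "tproj i (x \<oplus>\<^bsub>X\<^esub> t \<odot>\<^bsub>X\<^esub> y) = tproj i x \<oplus>\<^bsub>Y i\<^esub> t \<odot>\<^bsub>Y i\<^esub> tproj i y"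
    if "i \<in> I" "x \<in> carrier X" "y \<in> carrier X" "t \<in> carrier K" for i x y t
    using clin_axpy[OF pr X] that by blast
  have B1: "box_map I F (nx K X) (\<lambda>i. nx K (Y i)) (nd K X U) h1 (\<lambda>i. nd K (Y i) (V i)) g
       (\<lambda>i. rescaling_next (Y i) (\<Sigma> i)) J0"
    unfolding box_map_def
  proof (intro conjI ballI impI)
    show "rescalable I (nx K X) (\<lambda>i. nx K (Y i)) (\<lambda>i. rescaling_next (Y i) (\<Sigma> i))" by (rule rescalable_next[OF R])
    show "finite J0" by (rule J0)
    interpret X: topological_vector_space K X by (rule X)
    have "Br x y t \<in> nd K X U \<longleftrightarrow> Br x y t \<in> {p \<in> carrier (nx K X). \<forall>i\<in>I. tproj i p \<in> nd K (Y i) (V i)}" for x y t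
      using clinD(1)[OF pr] pstep by (auto simp: Ueq)
    note * = this
    show "nd K X U = {p \<in> carrier (nx K X). \<forall>i\<in>I. tproj i p \<in> nd K (Y i) (V i)}"
    proof (rule Set.set_eqI)
      fix p show "p \<in> nd K X U \<longleftrightarrow> p \<in> {p \<in> carrier (nx K X). \<forall>i\<in>I. tproj i p \<in> nd K (Y i) (V i)}"
        using *[of "bl p" "br p" "bs p"] by (cases p) simp_all
    qed
    show "\<And>p. h1 p = (\<lambda>i\<in>I. g i (tproj i p))" by (simp add: h1_def)
  next
    fix i assume i: "i \<in> I"
    show "Sm (nx K (Y i)) (F i) (nd K (Y i) (V i)) (g i)" by (rule g(2)[OF i])
    show "\<zero>\<^bsub>nx K (Y i)\<^esub> \<in> nd K (Y i) (V i)" "g i \<zero>\<^bsub>nx K (Y i)\<^esub> = \<zero>\<^bsub>F i\<^esub>" if "i \<notin> J0"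
      using Sm_zero_step[OF f[OF i] z[OF i that] g[OF i]] by auto
    fix s assume "s \<in> rescaling_next (Y i) (\<Sigma> i)"
    then obtain r \<sigma> c where s: "s = (\<lambda>p. Br (\<sigma> (bl p)) (inv r \<odot>\<^bsub>Y i\<^esub> \<sigma> (br p)) (r \<otimes> bs p), r \<otimes> c)"
      and r: "(\<sigma>, c) \<in> \<Sigma> i" "r \<in> carrier K" "r \<noteq> \<zero>" "absval K r \<le> 1"
      unfolding rescaling_next_def by blast
    have \<sigma>: "clin (Y i) (Y i) \<sigma>" and c: "c \<in> carrier K" using S[OF i r(1)] by auto
    show "case s of (\<sigma>, c) \<Rightarrow> \<forall>p\<in>carrier (nx K (Y i)). \<sigma> p \<in> nd K (Y i) (V i) \<longrightarrow>
       p \<in> nd K (Y i) (V i) \<and> g i p = c \<odot>\<^bsub>F i\<^esub> g i (\<sigma> p)"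
      unfolding s prod.case
      using Sm_rescale_step[OF f[OF i] \<sigma> c r(2,3) sc[OF i r(1)] g[OF i]] by blast
  qed
  have c1: "continuous_map (subtopology (vtop (nx K X)) (nd K X U)) (vtop (box_sum I F)) h1"
    by (rule box_map_continuous[OF B1 openin_nd[OF X U] F])
  have "dstep X (box_sum I F) U h h1"
  proof (rule dstepI)
    fix x y t assume a: "x \<in> U" "y \<in> carrier X" "t \<in> carrier K" "x \<oplus>\<^bsub>X\<^esub> t \<odot>\<^bsub>X\<^esub> y \<in> U"
    then have n: "Br x y t \<in> nd K X U" by simp
    have xc: "x \<in> carrier X" using a Ueq by blast
    have "h1 (Br x y t) \<in> carrier (box_sum I F)"
      by (rule cont_openin_carrier[OF tvs_nx[OF X] tvs_box_sum[OF F] openin_nd[OF X U] c1 n])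
    moreover have "f i (tproj i (x \<oplus>\<^bsub>X\<^esub> t \<odot>\<^bsub>X\<^esub> y)) = f i (tproj i x) \<oplus>\<^bsub>F i\<^esub> t \<odot>\<^bsub>F i\<^esub> g i (tproj i (Br x y t))" if i: "i \<in> I" for i
    proof -
      have "Br (tproj i x) (tproj i y) t \<in> nd K (Y i) (V i)"
        using i a Ueq pstep[OF i xc a(2,3)] clinD(1)[OF pr[OF i]] by auto
      from dstepD(2)[OF g(1)[OF i] this] show ?thesis by (simp add: pstep[OF i xc a(2,3)])
    qed
    ultimately show "h1 (Br x y t) \<in> carrier (box_sum I F) \<and>
        h (x \<oplus>\<^bsub>X\<^esub> t \<odot>\<^bsub>X\<^esub> y) = h x \<oplus>\<^bsub>box_sum I F\<^esub> t \<odot>\<^bsub>box_sum I F\<^esub> h1 (Br x y t)"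
      using h a by (auto simp: box_sum_simps h1_def intro!: restrict_ext)
  qed
  with B1 box_map_continuous[OF B U F]
  show "continuous_map (subtopology (vtop X) U) (vtop (box_sum I F)) h \<and>
     (\<exists>g. dstep X (box_sum I F) U h g \<and> (\<exists>Y V f \<Sigma>. box_map I F (nx K X) Y (nd K X U) g V f \<Sigma> J0))"
    by blast
qed (use assms tvs_box_sum in auto)


lemma openin_carrier_self: "TVS E \<Longrightarrow> openin (vtop E) (carrier E)"
  using topological_vector_space.topspace_vtop openin_topspace by metis

lemma clin_coord:
  assumes E: "\<And>i. i \<in> I \<Longrightarrow> TVS (E i)" and i: "i \<in> I"
  shows "clin (box_sum I E) (E i) (\<lambda>x. x i)"
proof -
  interpret E: topological_vector_space K "E i" using E i by blast
  have v: "vtop (box_sum I E) = wbox I (\<lambda>i. vtop (E i)) (sum_carrier I E)"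
    using box_topology_eq[of I E, OF E] by (simp add: box_sum_simps)
  have ts: "topspace (vtop (box_sum I E)) = sum_carrier I E"
    unfolding v by (rule topspace_wbox[OF sum_carrier_PiE[of I E, OF E]])
  have "continuous_map (vtop (box_sum I E)) (vtop (E i)) (\<lambda>x. x i)"
    unfolding continuous_map_def ts
  proof (intro conjI allI impI)
    show "(\<lambda>x. x i) \<in> sum_carrier I E \<rightarrow> topspace (vtop (E i))"
      using i by (auto simp: sum_carrier_def E.topspace_vtop PiE_iff)
    fix N assume N: "openin (vtop (E i)) N"
    have "openin (vtop (E j)) (if j = i then N else carrier (E j))" if "j \<in> I" for j
      using N openin_carrier_self[OF E[OF that]] by auto
    then have "openin (wbox I (\<lambda>i. vtop (E i)) (sum_carrier I E))
        (sum_carrier I E \<inter> (\<Pi>\<^sub>E j\<in>I. if j = i then N else carrier (E j)))"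
      by (rule openin_wboxI)
    moreover have "sum_carrier I E \<inter> (\<Pi>\<^sub>E j\<in>I. if j = i then N else carrier (E j)) = {x \<in> sum_carrier I E. x i \<in> N}"
      using i by (auto simp: sum_carrier_def PiE_iff extensional_def split: if_splits)
    ultimately show "openin (vtop (box_sum I E)) {x \<in> sum_carrier I E. x i \<in> N}" unfolding v by simp
  qed
  then show ?thesis using i by (auto simp: clin_def box_sum_simps sum_carrier_def PiE_iff)
qed

text \<open>At the initial stage no scalars occur, and a point of the direct sum is already zero at
  almost all coordinates; so the identity with factor \<open>\<one>\<close> suffices as the only
  rescaling. Smaller ones arise from \<open>rescaling_next\<close>.\<close>

lemma smo_box:
  fixes E :: "'i \<Rightarrow> ('k, 'e) tvs" and F :: "'i \<Rightarrow> ('k, 'f) tvs"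
  assumes f: "\<And>i. i \<in> I \<Longrightarrow> smo (E i) (F i) (U i) (f i)" and J0: "finite J0"
    and z: "\<And>i. i \<in> I - J0 \<Longrightarrow> \<zero>\<^bsub>E i\<^esub> \<in> U i" "\<And>i. i \<in> I - J0 \<Longrightarrow> f i \<zero>\<^bsub>E i\<^esub> = \<zero>\<^bsub>F i\<^esub>"
  shows "smo (box_sum I E) (box_sum I F) (sum_carrier I E \<inter> (\<Pi>\<^sub>E i\<in>I. U i)) (\<lambda>x. \<lambda>i\<in>I. f i (x i))"
proof -
  note E = smoD(1)[OF f] and F = smoD(2)[OF f] and Uo = smoD(3)[OF f]
  let ?D = "sum_carrier I E" and ?h = "\<lambda>x. \<lambda>i\<in>I. f i (x i)"
  let ?U = "?D \<inter> (\<Pi>\<^sub>E i\<in>I. U i)"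
  note TS = tvs_box_sum[of I E, OF E]
  have v: "vtop (box_sum I E) = wbox I (\<lambda>i. vtop (E i)) ?D"
    using box_topology_eq[of I E, OF E] by (simp add: box_sum_simps)
  have oU: "openin (vtop (box_sum I E)) ?U" unfolding v by (rule openin_wboxI[OF Uo])
  have TB: "TVS (BT (box_sum I E))" by (intro tvs_image TS inj_Base)
  have TBE: "TVS (BT (E i))" if "i \<in> I" for i by (intro tvs_image E that inj_Base)
  have Bz: "\<zero>\<^bsub>BT (E i)\<^esub> = Base \<zero>\<^bsub>E i\<^esub>" for i by (simp add: image_tvs_simps inj_Base)
  have cB: "carrier (BT (box_sum I E)) = BU ?D" by (simp add: image_tvs_simps inj_Base box_sum_simps)
  have pr: "clin (BT (box_sum I E)) (BT (E i)) (tproj i)" if i: "i \<in> I" for i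
  proof (rule clin_cong[OF _ TB])
    show "clin (BT (box_sum I E)) (BT (E i)) (\<lambda>p. Base (inv_into UNIV Base p i))"
      by (rule clin_compose[OF clin_image(2)[OF TS inj_Base]
          clin_compose[OF clin_coord[of I E, OF E i] clin_image(1)[OF E[OF i] inj_Base]]])
  qed (auto simp: cB)
  have "rescalable I (BT (box_sum I E)) (\<lambda>i. BT (E i)) (\<lambda>i. {(\<lambda>p. p, \<one>)})"
    unfolding rescalable_def
  proof (intro conjI ballI allI impI)
    show "TVS (BT (box_sum I E))" by (rule TB)
    show "TVS (BT (E i))" "clin (BT (box_sum I E)) (BT (E i)) (tproj i)" if "i \<in> I" for i by (rule TBE[OF that], rule pr[OF that])
    show "case s of (\<sigma>, c) \<Rightarrow> clin (BT (E i)) (BT (E i)) \<sigma> \<and> c \<in> carrier K \<and> absval K c \<le> 1"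
      if "s \<in> {(\<lambda>p. p, \<one>)}" for s :: "(('e, 'k) itree \<Rightarrow> ('e, 'k) itree) \<times> 'k" and i using that clin_id by auto
    fix P assume P: "finite P \<and> P \<subseteq> carrier (BT (box_sum I E))"
    \<comment> \<open>Off the supports of the points in \<open>P\<close> their coordinates are zero
      and hence in every \<open>N i\<close>; this choice does not involve \<open>N\<close>, as
      \<open>rescalable\<close> demands.\<close>
    define J where "J = (\<Union>p\<in>P. {i \<in> I. inv_into UNIV Base p i \<noteq> \<zero>\<^bsub>E i\<^esub>})"
    have "finite {i \<in> I. inv_into UNIV Base p i \<noteq> \<zero>\<^bsub>E i\<^esub>}" if pP: "p \<in> P" for p
    proof -
      obtain x where "p = Base x" "x \<in> ?D" using P pP cB by blast
      then show ?thesis by (simp add: sum_carrier_def)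
    qed
    then have J: "finite J" using P by (auto simp: J_def)
    show "\<exists>J. finite J \<and> (\<forall>N. (\<forall>i\<in>I. openin (vtop (BT (E i))) (N i) \<and> \<zero>\<^bsub>BT (E i)\<^esub> \<in> N i) \<longrightarrow>
         (\<exists>s. (\<forall>i\<in>I. s i \<in> {(\<lambda>p. p, \<one>)}) \<and> (\<forall>p\<in>P. \<exists>W. openin (vtop (BT (box_sum I E))) W \<and> p \<in> W \<and>
            (\<forall>q\<in>W. \<forall>i\<in>I - J. fst (s i) (tproj i q) \<in> N i))))"
    proof (intro exI[of _ J] conjI J allI impI)
      fix N assume N: "\<forall>i\<in>I. openin (vtop (BT (E i))) (N i) \<and> \<zero>\<^bsub>BT (E i)\<^esub> \<in> N i"
      define N' where "N' = (\<lambda>i. if i \<in> J then carrier (E i) else {y \<in> carrier (E i). Base y \<in> N i})"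
      have "openin (vtop (E i)) (N' i)" if i: "i \<in> I" for i
        using openin_continuous_map_preimage[OF clinD(4)[OF clin_image(1)[OF E[OF i] inj_Base]], of "N i"] N i
          topological_vector_space.topspace_vtop[OF E[OF i]] openin_carrier_self[OF E[OF i]] by (simp add: N'_def)
      then have "openin (vtop (box_sum I E)) (?D \<inter> (\<Pi>\<^sub>E i\<in>I. N' i))" unfolding v by (rule openin_wboxI)
      then have W: "openin (vtop (BT (box_sum I E))) (BU (?D \<inter> (\<Pi>\<^sub>E i\<in>I. N' i)))" by (simp add: openin_Base_iff TS)
      show "\<exists>s. (\<forall>i\<in>I. s i \<in> {(\<lambda>p. p, \<one>)}) \<and> (\<forall>p\<in>P. \<exists>W. openin (vtop (BT (box_sum I E))) W \<and> p \<in> W \<and>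
            (\<forall>q\<in>W. \<forall>i\<in>I - J. fst (s i) (tproj i q) \<in> N i))"
      proof (intro exI[of _ "\<lambda>i. (\<lambda>p. p, \<one>)"] conjI ballI)
        fix p assume p: "p \<in> P"
        then obtain x where x: "p = Base x" "x \<in> ?D" using P cB by blast
        have "x i \<in> N' i" if i: "i \<in> I" for i
        proof (cases "i \<in> J")
          case False
          then have "x i = \<zero>\<^bsub>E i\<^esub>" using x p i by (auto simp: J_def)
          then show ?thesis using N i False x by (auto simp: N'_def Bz sum_carrier_def PiE_iff)
        qed (use x i in \<open>auto simp: N'_def sum_carrier_def PiE_iff\<close>)
        then have "p \<in> BU (?D \<inter> (\<Pi>\<^sub>E i\<in>I. N' i))" using x by (auto simp: sum_carrier_def PiE_iff)
        moreover have "fst (\<lambda>p. p, \<one>) (tproj i q) \<in> N i" if q: "q \<in> BU (?D \<inter> (\<Pi>\<^sub>E i\<in>I. N' i))" and i: "i \<in> I - J" for q i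
        proof -
          obtain y where "q = Base y" "y i \<in> N' i" using q i by (auto simp: PiE_iff)
          then show ?thesis using i by (simp add: N'_def)
        qed
        ultimately show "\<exists>W. openin (vtop (BT (box_sum I E))) W \<and> p \<in> W \<and>
            (\<forall>q\<in>W. \<forall>i\<in>I - J. fst (\<lambda>p. p, \<one>) (tproj i q) \<in> N i)"
          using W by (intro exI[of _ "BU (?D \<inter> (\<Pi>\<^sub>E i\<in>I. N' i))"] conjI ballI)
      qed simp
    qed
  qed
  then have "box_map I F (BT (box_sum I E)) (\<lambda>i. BT (E i)) (BU ?U) (tree_fun ?h) (\<lambda>i. BU (U i)) (\<lambda>i. tree_fun (f i))
      (\<lambda>i. {(\<lambda>p. p, \<one>)}) J0"
    unfolding box_map_def
  proof (intro conjI ballI impI)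
    show "BU ?U = {p \<in> carrier (BT (box_sum I E)). \<forall>i\<in>I. tproj i p \<in> BU (U i)}"
      by (auto simp: cB inj_image_mem_iff[OF inj_Base] sum_carrier_def PiE_iff)
    show "tree_fun ?h p = (\<lambda>i\<in>I. tree_fun (f i) (tproj i p))" if "p \<in> BU ?U" for p using that by auto
    fix i assume i: "i \<in> I"
    show "Sm (BT (E i)) (F i) (BU (U i)) (tree_fun (f i))" using f[OF i] by (simp add: smo_iff_Sm)
    show "\<zero>\<^bsub>BT (E i)\<^esub> \<in> BU (U i)" "tree_fun (f i) \<zero>\<^bsub>BT (E i)\<^esub> = \<zero>\<^bsub>F i\<^esub>" if "i \<notin> J0" using z i that by (auto simp: Bz)
    interpret F: topological_vector_space K "F i" by (rule F[OF i])
    have "tree_fun (f i) p \<in> carrier (F i)" if "p \<in> BU (U i)" for p using that smoD(6)[OF f[OF i]] by auto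
    then show "case s of (\<sigma>, c) \<Rightarrow> \<forall>p\<in>carrier (BT (E i)). \<sigma> p \<in> BU (U i) \<longrightarrow>
       p \<in> BU (U i) \<and> tree_fun (f i) p = c \<odot>\<^bsub>F i\<^esub> tree_fun (f i) (\<sigma> p)" if "s \<in> {(\<lambda>p. p, \<one>)}" for s using that by auto
  qed (assumption, rule J0)
  from Sm_box_map[OF this _ F] have "Sm (BT (box_sum I E)) (box_sum I F) (BU ?U) (tree_fun ?h)"
    using oU by (simp add: openin_Base_iff TS)
  then show ?thesis using TS tvs_box_sum[of I F, OF F] by (simp add: smo_iff_Sm)
qed

text \<open>\<open>smo_box\<close> concerns families of maps of one variable; to apply it to
  multiplications, a pair of families has to be turned into a family of pairs. For continuity, each
  \<open>N i\<close> contains a rectangle, and the sides of these rectangles form two boxes.\<close>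

lemma clin_zip:
  assumes E: "\<And>i. i \<in> I \<Longrightarrow> TVS (E i)" and F: "\<And>i. i \<in> I \<Longrightarrow> TVS (F i)"
  shows "clin (prod_tvs (box_sum I E) (box_sum I F)) (box_sum I (\<lambda>i. prod_tvs (E i) (F i))) (\<lambda>p. \<lambda>i\<in>I. (fst p i, snd p i))"
proof -
  let ?G = "\<lambda>i. prod_tvs (E i) (F i)"
  have G: "TVS (?G i)" if "i \<in> I" for i using tvs_prod E F that by blast
  let ?z = "\<lambda>p. \<lambda>i\<in>I. (fst p i, snd p i)"
  have zc: "?z (x, y) \<in> sum_carrier I ?G" if "x \<in> sum_carrier I E" "y \<in> sum_carrier I F" for x y
  proof -
    have "{i \<in> I. ?z (x, y) i \<noteq> \<zero>\<^bsub>?G i\<^esub>} \<subseteq> {i \<in> I. x i \<noteq> \<zero>\<^bsub>E i\<^esub>} \<union> {i \<in> I. y i \<noteq> \<zero>\<^bsub>F i\<^esub>}" by auto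
    then have "finite {i \<in> I. ?z (x, y) i \<noteq> \<zero>\<^bsub>?G i\<^esub>}" using that by (elim finite_subset) (auto simp: sum_carrier_def)
    then show ?thesis using that by (auto simp: sum_carrier_def PiE_iff)
  qed
  have vE: "vtop (box_sum I E) = wbox I (\<lambda>i. vtop (E i)) (sum_carrier I E)"
    and vF: "vtop (box_sum I F) = wbox I (\<lambda>i. vtop (F i)) (sum_carrier I F)"
    and vG: "vtop (box_sum I ?G) = wbox I (\<lambda>i. vtop (?G i)) (sum_carrier I ?G)"
    using box_topology_eq[of I E, OF E] box_topology_eq[of I F, OF F] box_topology_eq[of I ?G, OF G] by (simp_all add: box_sum_simps)
  have "continuous_map (prod_topology (vtop (box_sum I E)) (vtop (box_sum I F))) (vtop (box_sum I ?G)) ?z"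
    unfolding vG
  proof (rule continuous_into_wbox[OF sum_carrier_PiE[of I ?G, OF G]])
    fix p assume "p \<in> topspace (prod_topology (vtop (box_sum I E)) (vtop (box_sum I F)))"
    then obtain x y where p: "p = (x, y)" and xy: "x \<in> sum_carrier I E" "y \<in> sum_carrier I F"
      using topological_vector_space.topspace_vtop[OF tvs_box_sum[of I E, OF E]]
        topological_vector_space.topspace_vtop[OF tvs_box_sum[of I F, OF F]] by (auto simp: box_sum_simps)
    show "?z p \<in> sum_carrier I ?G" using zc xy p by simp
    fix N assume N: "\<And>i. i \<in> I \<Longrightarrow> openin (vtop (?G i)) (N i) \<and> ?z p i \<in> N i"
    have "\<forall>i\<in>I. \<exists>AB. openin (vtop (E i)) (fst AB) \<and> openin (vtop (F i)) (snd AB) \<and> x i \<in> fst AB \<and> y i \<in> snd AB \<and> fst AB \<times> snd AB \<subseteq> N i"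
    proof
      fix i assume i: "i \<in> I"
      from N[OF i] i p have "openin (prod_topology (vtop (E i)) (vtop (F i))) (N i)" "(x i, y i) \<in> N i" by auto
      then show "\<exists>AB. openin (vtop (E i)) (fst AB) \<and> openin (vtop (F i)) (snd AB) \<and> x i \<in> fst AB \<and> y i \<in> snd AB \<and> fst AB \<times> snd AB \<subseteq> N i"
        unfolding openin_prod_topology_alt by (metis fst_conv snd_conv)
    qed
    from bchoice[OF this] obtain AB where AB: "\<forall>i\<in>I. openin (vtop (E i)) (fst (AB i)) \<and> openin (vtop (F i)) (snd (AB i)) \<and>
       x i \<in> fst (AB i) \<and> y i \<in> snd (AB i) \<and> fst (AB i) \<times> snd (AB i) \<subseteq> N i" by (elim exE)
    let ?A = "(sum_carrier I E \<inter> (\<Pi>\<^sub>E i\<in>I. fst (AB i))) \<times> (sum_carrier I F \<inter> (\<Pi>\<^sub>E i\<in>I. snd (AB i)))"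
    show "\<exists>A. openin (prod_topology (vtop (box_sum I E)) (vtop (box_sum I F))) A \<and> p \<in> A \<and> (\<forall>a\<in>A. \<forall>i\<in>I. ?z a i \<in> N i)"
    proof (intro exI[of _ ?A] conjI)
      show "openin (prod_topology (vtop (box_sum I E)) (vtop (box_sum I F))) ?A"
        unfolding openin_prod_Times_iff vE vF using AB by (intro disjI2 conjI openin_wboxI) auto
      show "p \<in> ?A" using p xy AB by (auto simp: sum_carrier_def PiE_iff)
      show "\<forall>a\<in>?A. \<forall>i\<in>I. ?z a i \<in> N i"
      proof (intro ballI)
        fix a i assume "a \<in> ?A" and i: "i \<in> I"
        then have "(fst a i, snd a i) \<in> fst (AB i) \<times> snd (AB i)" by (auto simp: PiE_iff)
        then show "?z a i \<in> N i" using AB i by auto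
      qed
    qed
  qed
  then show ?thesis using zc by (auto simp: clin_def box_sum_simps intro!: restrict_ext)
qed

end

section \<open>Germs of smooth maps between manifolds\<close>

context valued_field begin

text \<open>Smoothness of the germ of \<open>f\<close> at \<open>p\<close>, tested in one pair of
  charts; by \<open>sat_charts\<close> any other pair would do. Continuity at \<open>p\<close> is
  part of the conclusion (\<open>sat_continuous\<close>), not of the definition.\<close>

definition sat :: "('k, 'e) tvs \<Rightarrow> ('m, 'e) mfd \<Rightarrow> ('k, 'f) tvs \<Rightarrow> ('n, 'f) mfd \<Rightarrow> ('m \<Rightarrow> 'n) \<Rightarrow> 'm \<Rightarrow> bool" where
  "sat E M F N f p \<longleftrightarrow> (\<exists>U \<phi> V \<psi> W. (U, \<phi>) \<in> atlas M \<and> (V, \<psi>) \<in> atlas N \<and>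
     openin (mtop M) W \<and> p \<in> W \<and> W \<subseteq> U \<and> f ` W \<subseteq> V \<and>
     smo E F (\<phi> ` W) (\<lambda>x. \<psi> (f (inv_into U \<phi> x))))"

abbreviation mfd :: "('k, 'e) tvs \<Rightarrow> ('m, 'e) mfd \<Rightarrow> bool" where
  "mfd E M \<equiv> manifold K E M"

lemma mfdD:
  assumes "mfd E M"
  shows "TVS E" "Hausdorff_space (mtop M)" "\<And>p. p \<in> topspace (mtop M) \<Longrightarrow> \<exists>U \<phi>. (U, \<phi>) \<in> atlas M \<and> p \<in> U"
    "atlas M = max_atlas K E (mtop M) (atlas M)"
proof -
  show "TVS E" "Hausdorff_space (mtop M)" "atlas M = max_atlas K E (mtop M) (atlas M)"
    using assms by (auto simp: manifold_def)
  fix p assume "p \<in> topspace (mtop M)"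
  then have "p \<in> (\<Union>c\<in>atlas M. fst c)" using assms by (simp add: manifold_def)
  then obtain c where "c \<in> atlas M" "p \<in> fst c" by blast
  then show "\<exists>U \<phi>. (U, \<phi>) \<in> atlas M \<and> p \<in> U" by (cases c) auto
qed

lemma top_chartD:
  assumes "top_chart E T (U, \<phi>)"
  shows "openin T U" "\<phi> \<in> extensional U" "openin (vtop E) (\<phi> ` U)"
    "inj_on \<phi> U" "continuous_map (subtopology T U) (vtop E) \<phi>"
    "continuous_map (subtopology (vtop E) (\<phi> ` U)) T (inv_into U \<phi>)"
    "\<And>W. openin T W \<Longrightarrow> W \<subseteq> U \<Longrightarrow> openin (vtop E) (\<phi> ` W)"
    "\<And>W. openin (vtop E) W \<Longrightarrow> openin T {p \<in> U. \<phi> p \<in> W}"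
proof -
  have 1: "openin T U" and 2: "\<phi> \<in> extensional U" and 3: "openin (vtop E) (\<phi> ` U)"
    and 4: "homeomorphic_map (subtopology T U) (subtopology (vtop E) (\<phi> ` U)) \<phi>"
    using assms by (auto simp: top_chart_def)
  show "openin T U" "\<phi> \<in> extensional U" "openin (vtop E) (\<phi> ` U)" by (fact 1 2 3)+
  have tU: "topspace (subtopology T U) = U" using openin_subset[OF 1] by auto
  have tV: "topspace (subtopology (vtop E) (\<phi> ` U)) = \<phi> ` U" using openin_subset[OF 3] by auto
  show inj: "inj_on \<phi> U" using homeomorphic_imp_injective_map[OF 4] tU by simp
  show c: "continuous_map (subtopology T U) (vtop E) \<phi>"
    using homeomorphic_imp_continuous_map[OF 4] by (simp add: continuous_map_in_subtopology)
  obtain g where g: "homeomorphic_maps (subtopology T U) (subtopology (vtop E) (\<phi> ` U)) \<phi> g"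
    using 4 homeomorphic_map_maps by blast
  have "continuous_map (subtopology (vtop E) (\<phi> ` U)) (subtopology T U) g" using g by (simp add: homeomorphic_maps_def)
  then have "continuous_map (subtopology (vtop E) (\<phi> ` U)) T g" by (simp add: continuous_map_in_subtopology)
  then show "continuous_map (subtopology (vtop E) (\<phi> ` U)) T (inv_into U \<phi>)"
  proof (rule continuous_map_eq)
    fix x assume "x \<in> topspace (subtopology (vtop E) (\<phi> ` U))"
    then have "x \<in> \<phi> ` U" unfolding tV .
    then obtain p where "p \<in> U" "x = \<phi> p" by blast
    moreover from this have "g (\<phi> p) = p" using g tU by (auto simp: homeomorphic_maps_def)
    ultimately show "g x = inv_into U \<phi> x" using inj by simp
  qed
  show "openin (vtop E) (\<phi> ` W)" if "openin T W" "W \<subseteq> U" for W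
  proof -
    have "openin (subtopology T U) W" using that 1 by (simp add: openin_open_subtopology)
    then have "openin (subtopology (vtop E) (\<phi> ` U)) (\<phi> ` W)"
      using homeomorphic_imp_open_map[OF 4] by (simp add: open_map_def)
    then show ?thesis using 3 openin_open_subtopology by blast
  qed
  show "openin T {p \<in> U. \<phi> p \<in> W}" if "openin (vtop E) W" for W
    using openin_continuous_map_preimage[OF c that, unfolded tU] 1 openin_open_subtopology by blast
qed

lemma mfd_chart:
  assumes "mfd E M" "(U, \<phi>) \<in> atlas M" shows "top_chart E (mtop M) (U, \<phi>)"
  using assms mfdD(4)[OF assms(1)] by (auto simp: max_atlas_def)

lemma compatible_iff:
  assumes "TVS E"
  shows "compatible K E (U, \<phi>) (V, \<psi>) \<longleftrightarrow> smo E E (\<phi> ` (U \<inter> V)) (\<lambda>x. \<psi> (inv_into U \<phi> x)) \<and>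
     smo E E (\<psi> ` (V \<inter> U)) (\<lambda>x. \<phi> (inv_into V \<psi> x))"
  using assms by (simp add: compatible_def smo_def transition_def transition_dom_def o_def)

lemma mfd_transition:
  assumes "mfd E M" "(U, \<phi>) \<in> atlas M" "(V, \<psi>) \<in> atlas M"
  shows "smo E E (\<phi> ` (U \<inter> V)) (\<lambda>x. \<psi> (inv_into U \<phi> x))"
proof -
  have "(U, \<phi>) \<in> max_atlas K E (mtop M) (atlas M)" using assms mfdD(4)[OF assms(1)] by simp
  then have "compatible K E (U, \<phi>) (V, \<psi>)" using assms(3) by (auto simp: max_atlas_def)
  then show ?thesis using compatible_iff[OF mfdD(1)[OF assms(1)]] by blast
qed

text \<open>In the new charts, \<open>f\<close> is the old expression with a transition map composed
  on either side, over the part where all four charts are available.\<close>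

lemma sat_charts:
  assumes M: "mfd E M" and N: "mfd F N" and f: "sat E M F N f p"
    and c: "(U, \<phi>) \<in> atlas M" "p \<in> U" and d: "(V, \<psi>) \<in> atlas N" "f p \<in> V"
  shows "\<exists>W. openin (mtop M) W \<and> p \<in> W \<and> W \<subseteq> U \<and> f ` W \<subseteq> V \<and>
     smo E F (\<phi> ` W) (\<lambda>x. \<psi> (f (inv_into U \<phi> x)))"
proof -
  obtain U0 \<phi>0 V0 \<psi>0 W0 where c0: "(U0, \<phi>0) \<in> atlas M" and d0: "(V0, \<psi>0) \<in> atlas N"
    and W0: "openin (mtop M) W0" "p \<in> W0" "W0 \<subseteq> U0" "f ` W0 \<subseteq> V0"
    and s0: "smo E F (\<phi>0 ` W0) (\<lambda>x. \<psi>0 (f (inv_into U0 \<phi>0 x)))"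
    using f unfolding sat_def by (elim exE conjE)
  note tc = top_chartD[OF mfd_chart[OF M c(1)]] and tc0 = top_chartD[OF mfd_chart[OF M c0]]
    and td = top_chartD[OF mfd_chart[OF N d(1)]] and td0 = top_chartD[OF mfd_chart[OF N d0]]
  define B where "B = \<psi>0 ` (V0 \<inter> V)"
  have B: "openin (vtop F) B" unfolding B_def using td td0 by (intro td0(7) openin_Int) auto
  \<comment> \<open>Continuity of \<open>f\<close> is not at hand here, so the neighbourhood on
    which \<open>f\<close> has values in \<open>V\<close> is cut out by means of the chart
    expression, which is continuous.\<close>
  define A where "A = {x \<in> \<phi>0 ` W0. \<psi>0 (f (inv_into U0 \<phi>0 x)) \<in> B}"
  have A: "openin (vtop E) A" unfolding A_def by (rule smo_openin_preimage[OF s0 B])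
  define W where "W = {q \<in> U0. \<phi>0 q \<in> A} \<inter> U"
  have W: "openin (mtop M) W" unfolding W_def by (intro openin_Int tc0(8) A tc(1))
  have Wiff: "q \<in> W \<longleftrightarrow> q \<in> W0 \<and> q \<in> U \<and> f q \<in> V" for q
  proof -
    have "\<phi>0 q \<in> A \<longleftrightarrow> q \<in> W0 \<and> f q \<in> V" if q: "q \<in> U0"
    proof -
      have "\<phi>0 q \<in> \<phi>0 ` W0 \<longleftrightarrow> q \<in> W0" using tc0(4) q W0(3) by (auto dest: inj_onD)
      moreover have "\<psi>0 (f q) \<in> B \<longleftrightarrow> f q \<in> V" if "q \<in> W0"
      proof -
        have "f q \<in> V0" using that W0 by blast
        then show ?thesis using td0(4) by (auto simp: B_def dest: inj_onD)
      qed
      ultimately show ?thesis using q tc0(4) by (auto simp: A_def)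
    qed
    then show ?thesis using W0(3) by (auto simp: W_def)
  qed
  show ?thesis
  proof (intro exI[of _ W] conjI)
    have WU: "W \<subseteq> U" "W \<subseteq> U0" "W \<subseteq> W0" "f ` W \<subseteq> V" using Wiff W0 by auto
    have "smo E F (\<phi> ` W) (\<lambda>x. \<psi> (inv_into V0 \<psi>0 (\<psi>0 (f (inv_into U0 \<phi>0 (\<phi>0 (inv_into U \<phi> x)))))))"
    proof (rule smo_compose[OF mfd_transition[OF N d0 d(1)]])
      have "smo E E (\<phi> ` W) (\<lambda>x. \<phi>0 (inv_into U \<phi> x))"
        by (rule smo_subset[OF mfd_transition[OF M c(1) c0]]) (use WU tc(7)[OF W] in auto)
      then show "smo E F (\<phi> ` W) (\<lambda>x. \<psi>0 (f (inv_into U0 \<phi>0 (\<phi>0 (inv_into U \<phi> x)))))"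
      proof (rule smo_compose[OF s0])
        fix x assume "x \<in> \<phi> ` W"
        then obtain q where q: "q \<in> W" "x = \<phi> q" by blast
        then have "inv_into U \<phi> x = q" using WU tc(4) by (simp add: subset_iff)
        then show "\<phi>0 (inv_into U \<phi> x) \<in> \<phi>0 ` W0" using q WU by auto
      qed
      show "\<psi>0 (f (inv_into U0 \<phi>0 (\<phi>0 (inv_into U \<phi> x)))) \<in> \<psi>0 ` (V0 \<inter> V)" if "x \<in> \<phi> ` W" for x
        using that WU tc(4) tc0(4) W0 by (auto simp: subset_iff)
    qed
    then show "smo E F (\<phi> ` W) (\<lambda>x. \<psi> (f (inv_into U \<phi> x)))"
    proof (rule smo_cong)
      fix x assume "x \<in> \<phi> ` W"
      then obtain q where q: "q \<in> W" "x = \<phi> q" by blast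
      then have "q \<in> U" "q \<in> U0" using WU by auto
      moreover have "f q \<in> V0" using q WU(3) W0(4) by blast
      moreover note calculation
      ultimately show "\<psi> (f (inv_into U \<phi> x)) = \<psi> (inv_into V0 \<psi>0 (\<psi>0 (f (inv_into U0 \<phi>0 (\<phi>0 (inv_into U \<phi> x))))))"
        using q tc(4) tc0(4) td0(4) by simp
    qed
    show "p \<in> W" using Wiff W0 c d by blast
  qed (use W Wiff in auto)
qed

lemma sat_restrict:
  assumes M: "mfd E M" and N: "mfd F N" and f: "sat E M F N f p"
    and c: "(U, \<phi>) \<in> atlas M" "p \<in> U" and d: "(V, \<psi>) \<in> atlas N" "f p \<in> V"
    and O: "openin (mtop M) W'" "p \<in> W'"
  shows "\<exists>W. openin (mtop M) W \<and> p \<in> W \<and> W \<subseteq> U \<and> W \<subseteq> W' \<and> f ` W \<subseteq> V \<and>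
     smo E F (\<phi> ` W) (\<lambda>x. \<psi> (f (inv_into U \<phi> x)))"
proof -
  obtain W where W: "openin (mtop M) W" "p \<in> W" "W \<subseteq> U" "f ` W \<subseteq> V" "smo E F (\<phi> ` W) (\<lambda>x. \<psi> (f (inv_into U \<phi> x)))"
    using sat_charts[OF M N f c d] by blast
  have o: "openin (mtop M) (W \<inter> W')" using W O by blast
  have "smo E F (\<phi> ` (W \<inter> W')) (\<lambda>x. \<psi> (f (inv_into U \<phi> x)))"
    by (rule smo_subset[OF W(5) top_chartD(7)[OF mfd_chart[OF M c(1)] o]]) (use W in auto)
  then show ?thesis using o W O by (intro exI[of _ "W \<inter> W'"]) auto
qed

lemma sat_continuous:
  assumes M: "mfd E M" and N: "mfd F N" and f: "sat E M F N f p" and B: "openin (mtop N) B" "f p \<in> B"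
  shows "\<exists>W. openin (mtop M) W \<and> p \<in> W \<and> f ` W \<subseteq> B"
proof -
  obtain U \<phi> V \<psi> W where c: "(U, \<phi>) \<in> atlas M" and d: "(V, \<psi>) \<in> atlas N"
    and W: "openin (mtop M) W" "p \<in> W" "W \<subseteq> U" "f ` W \<subseteq> V"
    and s: "smo E F (\<phi> ` W) (\<lambda>x. \<psi> (f (inv_into U \<phi> x)))"
    using f unfolding sat_def by (elim exE conjE)
  note tc = top_chartD[OF mfd_chart[OF M c]] and td = top_chartD[OF mfd_chart[OF N d]]
  have B': "openin (vtop F) (\<psi> ` (V \<inter> B))" by (intro td(7) openin_Int td(1) B) auto
  let ?A = "{x \<in> \<phi> ` W. \<psi> (f (inv_into U \<phi> x)) \<in> \<psi> ` (V \<inter> B)}"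
  have "openin (mtop M) {q \<in> U. \<phi> q \<in> ?A}" by (rule tc(8)[OF smo_openin_preimage[OF s B']])
  moreover have "{q \<in> U. \<phi> q \<in> ?A} = {q \<in> W. f q \<in> B}"
  proof -
    have 1: "\<phi> q \<in> \<phi> ` W \<longleftrightarrow> q \<in> W" if "q \<in> U" for q using tc(4) that W(3) by (auto dest: inj_onD)
    have 2: "\<psi> (f q) \<in> \<psi> ` (V \<inter> B) \<longleftrightarrow> f q \<in> B" if "q \<in> W" for q
    proof -
      have "f q \<in> V" using that W by blast
      then show ?thesis using td(4) by (auto dest: inj_onD)
    qed
    have "\<phi> q \<in> ?A \<longleftrightarrow> q \<in> W \<and> f q \<in> B" if "q \<in> U" for q
      using 1[OF that] 2[of q] inv_into_f_f[OF tc(4) that] by auto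
    then show ?thesis using W(3) by blast
  qed
  ultimately show ?thesis using W B by (intro exI[of _ "{q \<in> W. f q \<in> B}"]) auto
qed

lemma sat_topspace:
  assumes "mfd E M" "mfd F N" "sat E M F N f p"
  shows "p \<in> topspace (mtop M)" "f p \<in> topspace (mtop N)"
proof -
  obtain U \<phi> V \<psi> W where "(V, \<psi>) \<in> atlas N" "openin (mtop M) W" "p \<in> W" "f ` W \<subseteq> V"
    using assms(3) unfolding sat_def by (elim exE conjE)
  then show "p \<in> topspace (mtop M)" "f p \<in> topspace (mtop N)"
    using top_chartD(1)[OF mfd_chart[OF assms(2)]] openin_subset by blast+
qed

text \<open>From germs back to full chart domains, the point is that smoothness is a local property
  (\<open>smo_local\<close>). From here on, maps between manifolds are treated one point at a
  time.\<close>

lemma smooth_map_iff_sat: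
  assumes M: "mfd E M" and N: "mfd F N"
  shows "smooth_map K E M F N f \<longleftrightarrow> (\<forall>p\<in>topspace (mtop M). sat E M F N f p)"
proof
  assume s: "smooth_map K E M F N f"
  show "\<forall>p\<in>topspace (mtop M). sat E M F N f p"
  proof
    fix p assume p: "p \<in> topspace (mtop M)"
    have fc: "continuous_map (mtop M) (mtop N) f" using s by (simp add: smooth_map_def)
    then have fp: "f p \<in> topspace (mtop N)" using p by (auto simp: continuous_map_def)
    obtain U \<phi> where c: "(U, \<phi>) \<in> atlas M" "p \<in> U" using mfdD(3)[OF M p] by blast
    obtain V \<psi> where d: "(V, \<psi>) \<in> atlas N" "f p \<in> V" using mfdD(3)[OF N fp] by blast
    note tc = top_chartD[OF mfd_chart[OF M c(1)]] and td = top_chartD[OF mfd_chart[OF N d(1)]]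
    have "openin (mtop M) (U \<inter> {q \<in> topspace (mtop M). f q \<in> V})"
      by (intro openin_Int tc(1) openin_continuous_map_preimage[OF fc td(1)])
    moreover have "U \<inter> {q \<in> topspace (mtop M). f q \<in> V} = U \<inter> f -` V" using openin_subset[OF tc(1)] by auto
    ultimately have o: "openin (mtop M) (U \<inter> f -` V)" by simp
    have "smooth_on K E F (\<phi> ` (U \<inter> f -` V)) (\<psi> \<circ> f \<circ> inv_into U \<phi>)"
      using s c(1) d(1) unfolding smooth_map_def by blast
    then have "smo E F (\<phi> ` (U \<inter> f -` V)) (\<lambda>x. \<psi> (f (inv_into U \<phi> x)))"
      using mfdD(1)[OF M] mfdD(1)[OF N] by (simp add: smo_def o_def)
    then show "sat E M F N f p" unfolding sat_def using c d o
      by (intro exI[of _ U] exI[of _ \<phi>] exI[of _ V] exI[of _ \<psi>] exI[of _ "U \<inter> f -` V"]) auto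
  qed
next
  assume s: "\<forall>p\<in>topspace (mtop M). sat E M F N f p"
  show "smooth_map K E M F N f"
    unfolding smooth_map_def
  proof (intro conjI ballI)
    show "continuous_map (mtop M) (mtop N) f"
      unfolding continuous_map_def
    proof (intro conjI allI impI)
      show "f \<in> topspace (mtop M) \<rightarrow> topspace (mtop N)" using s sat_topspace[OF M N] by blast
      fix B assume B: "openin (mtop N) B"
      show "openin (mtop M) {x \<in> topspace (mtop M). f x \<in> B}"
      proof (subst openin_subopen, intro ballI)
        fix p assume p: "p \<in> {x \<in> topspace (mtop M). f x \<in> B}"
        then obtain W where "openin (mtop M) W" "p \<in> W" "f ` W \<subseteq> B" using sat_continuous[OF M N _ B, of f p] s by blast
        then show "\<exists>T. openin (mtop M) T \<and> p \<in> T \<and> T \<subseteq> {x \<in> topspace (mtop M). f x \<in> B}"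
          using openin_subset by blast
      qed
    qed
    have "smo E F (\<phi> ` (U \<inter> f -` V)) (\<lambda>x. \<psi> (f (inv_into U \<phi> x)))"
      if c': "(U, \<phi>) \<in> atlas M" and d': "(V, \<psi>) \<in> atlas N" for U \<phi> V \<psi>
    proof (rule smo_local[OF mfdD(1)[OF M] mfdD(1)[OF N]])
      fix x assume "x \<in> \<phi> ` (U \<inter> f -` V)"
      then obtain p where p: "x = \<phi> p" "p \<in> U" "f p \<in> V" by blast
      then have "p \<in> topspace (mtop M)" using top_chartD(1)[OF mfd_chart[OF M c']] openin_subset by blast
      then have "sat E M F N f p" using s by blast
      from sat_charts[OF M N this c' p(2) d' p(3)]
      obtain W where "p \<in> W" "W \<subseteq> U" "f ` W \<subseteq> V" "smo E F (\<phi> ` W) (\<lambda>x. \<psi> (f (inv_into U \<phi> x)))" by blast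
      moreover from this have "W \<subseteq> U \<inter> f -` V" by blast
      then have "\<phi> ` W \<subseteq> \<phi> ` (U \<inter> f -` V)" by (rule image_mono)
      ultimately show "\<exists>Na. x \<in> Na \<and> Na \<subseteq> \<phi> ` (U \<inter> f -` V) \<and> smo E F Na (\<lambda>x. \<psi> (f (inv_into U \<phi> x)))"
        using p by (intro exI[of _ "\<phi> ` W"] conjI) simp_all
    qed
    then show "case c of (U, \<phi>) \<Rightarrow> \<forall>(V, \<psi>)\<in>atlas N. smooth_on K E F (\<phi> ` (U \<inter> f -` V)) (\<psi> \<circ> f \<circ> inv_into U \<phi>)"
      if "c \<in> atlas M" for c using that by (auto simp: smo_def o_def)
  qed
qed

lemma sat_compose:
  assumes M: "mfd E M" and N: "mfd F N" and P: "mfd G P"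
    and g: "sat F N G P g (f p)" and f: "sat E M F N f p"
  shows "sat E M G P (\<lambda>x. g (f x)) p"
proof -
  obtain U \<phi> where c: "(U, \<phi>) \<in> atlas M" "p \<in> U" using mfdD(3)[OF M sat_topspace(1)[OF M N f]] by blast
  obtain V \<psi> where d: "(V, \<psi>) \<in> atlas N" "f p \<in> V" using mfdD(3)[OF N sat_topspace(2)[OF M N f]] by blast
  obtain X \<theta> where e: "(X, \<theta>) \<in> atlas P" "g (f p) \<in> X" using mfdD(3)[OF P sat_topspace(2)[OF N P g]] by blast
  note tc = top_chartD[OF mfd_chart[OF M c(1)]] and td = top_chartD[OF mfd_chart[OF N d(1)]]
  obtain W2 where W2: "openin (mtop N) W2" "f p \<in> W2" "W2 \<subseteq> V" "g ` W2 \<subseteq> X"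
    "smo F G (\<psi> ` W2) (\<lambda>x. \<theta> (g (inv_into V \<psi> x)))" using sat_charts[OF N P g d e] by blast
  obtain W1 where W1: "openin (mtop M) W1" "p \<in> W1" "f ` W1 \<subseteq> W2" using sat_continuous[OF M N f W2(1,2)] by blast
  obtain W where W: "openin (mtop M) W" "p \<in> W" "W \<subseteq> U" "W \<subseteq> W1" "f ` W \<subseteq> V"
    "smo E F (\<phi> ` W) (\<lambda>x. \<psi> (f (inv_into U \<phi> x)))" using sat_restrict[OF M N f c d W1(1,2)] by blast
  have fW: "f q \<in> W2" "inv_into V \<psi> (\<psi> (f q)) = f q" "inv_into U \<phi> (\<phi> q) = q" if "q \<in> W" for q
    using that W W1 W2 tc(4) td(4) by (auto simp: subset_iff image_subset_iff)
  have "smo E G (\<phi> ` W) (\<lambda>x. \<theta> (g (inv_into V \<psi> (\<psi> (f (inv_into U \<phi> x))))))"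
    by (rule smo_compose[OF W2(5) W(6)]) (use fW in auto)
  then have "smo E G (\<phi> ` W) (\<lambda>x. \<theta> (g (f (inv_into U \<phi> x))))"
    by (rule smo_cong) (use fW in auto)
  then show ?thesis unfolding sat_def using c e W W2 fW
    by (intro exI[of _ U] exI[of _ \<phi>] exI[of _ X] exI[of _ \<theta>] exI[of _ W]) auto
qed

lemma sat_cong:
  assumes M: "mfd E M" and N: "mfd F N" and f: "sat E M F N f p"
    and W: "openin (mtop M) W'" "p \<in> W'" "\<And>q. q \<in> W' \<Longrightarrow> g q = f q"
  shows "sat E M F N g p"
proof -
  obtain U \<phi> where c: "(U, \<phi>) \<in> atlas M" "p \<in> U" using mfdD(3)[OF M sat_topspace(1)[OF M N f]] by blast
  obtain V \<psi> where d: "(V, \<psi>) \<in> atlas N" "f p \<in> V" using mfdD(3)[OF N sat_topspace(2)[OF M N f]] by blast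
  note tc = top_chartD[OF mfd_chart[OF M c(1)]]
  obtain W where W1: "openin (mtop M) W" "p \<in> W" "W \<subseteq> U" "W \<subseteq> W'" "f ` W \<subseteq> V"
    "smo E F (\<phi> ` W) (\<lambda>x. \<psi> (f (inv_into U \<phi> x)))" using sat_restrict[OF M N f c d W(1,2)] by blast
  have gf: "g q = f q" "inv_into U \<phi> (\<phi> q) = q" if "q \<in> W" for q using that W(3) W1(3,4) tc(4) by (auto simp: subset_iff)
  have "smo E F (\<phi> ` W) (\<lambda>x. \<psi> (g (inv_into U \<phi> x)))"
    by (rule smo_cong[OF W1(6)]) (use gf in auto)
  moreover have "g ` W \<subseteq> V" using W1(5) gf(1) by auto
  ultimately show ?thesis unfolding sat_def using c d W1
    by (intro exI[of _ U] exI[of _ \<phi>] exI[of _ V] exI[of _ \<psi>] exI[of _ W]) auto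
qed

lemma sat_chart:
  assumes M: "mfd E M" and c: "(U, \<phi>) \<in> atlas M" "p \<in> U" and d: "(V, \<psi>) \<in> atlas N"
    and W: "openin (mtop M) W" "p \<in> W" "W \<subseteq> U" "f ` W \<subseteq> V" and s: "smo E F (\<phi> ` W) (\<lambda>x. \<psi> (f (inv_into U \<phi> x)))"
  shows "sat E M F N f p"
  using assms unfolding sat_def by (intro exI[of _ U] exI[of _ \<phi>] exI[of _ V] exI[of _ \<psi>] exI[of _ W]) auto

lemma sat_id:
  assumes M: "mfd E M" and p: "p \<in> topspace (mtop M)" shows "sat E M E M (\<lambda>x. x) p"
proof -
  obtain U \<phi> where c: "(U, \<phi>) \<in> atlas M" "p \<in> U" using mfdD(3)[OF M p] by blast
  note tc = top_chartD[OF mfd_chart[OF M c(1)]]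
  show ?thesis
    by (rule sat_chart[OF M c c(1) tc(1) c(2)]) (use mfd_transition[OF M c(1) c(1)] in auto)
qed

lemma sat_const:
  assumes M: "mfd E M" and N: "mfd F N" and p: "p \<in> topspace (mtop M)" "a \<in> topspace (mtop N)"
  shows "sat E M F N (\<lambda>_. a) p"
proof -
  obtain U \<phi> where c: "(U, \<phi>) \<in> atlas M" "p \<in> U" using mfdD(3)[OF M p(1)] by blast
  obtain V \<psi> where d: "(V, \<psi>) \<in> atlas N" "a \<in> V" using mfdD(3)[OF N p(2)] by blast
  note tc = top_chartD[OF mfd_chart[OF M c(1)]] and td = top_chartD[OF mfd_chart[OF N d(1)]]
  have "\<psi> a \<in> carrier F" using openin_carrier[OF mfdD(1)[OF N] td(3)] d by blast
  then have "smo E F (\<phi> ` U) (\<lambda>_. \<psi> a)" by (intro smo_const mfdD(1)[OF M] mfdD(1)[OF N] tc(3))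
  then show ?thesis by (intro sat_chart[OF M c d(1) tc(1) c(2)]) (use d in auto)
qed


section \<open>Maximal atlases, open submanifolds, vector spaces and products as manifolds\<close>

lemma top_chartI:
  assumes "openin T U" "\<phi> \<in> extensional U" "openin (vtop E) (\<phi> ` U)"
    "continuous_map (subtopology T U) (vtop E) \<phi>"
    "continuous_map (subtopology (vtop E) (\<phi> ` U)) T g" "\<And>p. p \<in> U \<Longrightarrow> g (\<phi> p) = p"
  shows "top_chart E T (U, \<phi>)"
proof -
  have tU: "topspace (subtopology T U) = U" using openin_subset[OF assms(1)] by auto
  have "homeomorphic_maps (subtopology T U) (subtopology (vtop E) (\<phi> ` U)) \<phi> g"
    unfolding homeomorphic_maps_def using assms(4,5,6) openin_subset[OF assms(1)]
    by (auto simp: continuous_map_in_subtopology)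
  then have "homeomorphic_map (subtopology T U) (subtopology (vtop E) (\<phi> ` U)) \<phi>"
    using homeomorphic_maps_map by blast
  then show ?thesis using assms by (simp add: top_chart_def)
qed

text \<open>Near any point, the transition between two charts compatible with \<open>A\<close>
  factors through a chart of \<open>A\<close>; as smoothness is local, the two charts are compatible
  with each other.\<close>

lemma mfd_max_atlas:
  assumes E: "TVS E" and H: "Hausdorff_space T" and A: "\<And>c. c \<in> A \<Longrightarrow> top_chart E T c"
    and co: "\<And>c d. c \<in> A \<Longrightarrow> d \<in> A \<Longrightarrow> compatible K E c d" and cov: "(\<Union>c\<in>A. fst c) = topspace T"
  shows "mfd E \<lparr>mtop = T, atlas = max_atlas K E T A\<rparr>" "A \<subseteq> max_atlas K E T A"
proof -
  show sub: "A \<subseteq> max_atlas K E T A" using A co by (auto simp: max_atlas_def)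
  have half: "smo E E (\<phi> ` (U \<inter> U')) (\<lambda>x. \<phi>' (inv_into U \<phi> x))"
    if c: "(U, \<phi>) \<in> max_atlas K E T A" and c': "(U', \<phi>') \<in> max_atlas K E T A" for U \<phi> U' \<phi>'
  proof (rule smo_local[OF E E])
    fix x assume "x \<in> \<phi> ` (U \<inter> U')"
    then obtain p where p: "x = \<phi> p" "p \<in> U" "p \<in> U'" by blast
    have tc: "top_chart E T (U, \<phi>)" and tc': "top_chart E T (U', \<phi>')" using c c' by (auto simp: max_atlas_def)
    note tcD = top_chartD[OF tc] and tcD' = top_chartD[OF tc']
    have "p \<in> topspace T" using openin_subset[OF tcD(1)] p by blast
    then have "p \<in> (\<Union>c\<in>A. fst c)" using cov by simp
    then obtain d where "d \<in> A" "p \<in> fst d" by blast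
    then obtain V \<psi> where d: "(V, \<psi>) \<in> A" "p \<in> V" by (cases d) auto
    note tdD = top_chartD[OF A[OF d(1)]]
    have "compatible K E (U, \<phi>) (V, \<psi>)" "compatible K E (U', \<phi>') (V, \<psi>)"
      using c c' d by (auto simp: max_atlas_def)
    then have s: "smo E E (\<phi> ` (U \<inter> V)) (\<lambda>x. \<psi> (inv_into U \<phi> x))" "smo E E (\<psi> ` (V \<inter> U')) (\<lambda>x. \<phi>' (inv_into V \<psi> x))"
      by (simp_all add: compatible_iff[OF E])
    let ?W = "\<phi> ` (U \<inter> U' \<inter> V)"
    have W: "openin (vtop E) ?W" using tcD(1) tcD'(1) tdD(1) by (intro tcD(7) openin_Int) auto
    have eq: "inv_into U \<phi> (\<phi> q) = q" "inv_into V \<psi> (\<psi> q) = q" if "q \<in> U \<inter> U' \<inter> V" for q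
      using that tcD(4) tdD(4) by auto
    have "smo E E ?W (\<lambda>x. \<phi>' (inv_into V \<psi> (\<psi> (inv_into U \<phi> x))))"
    proof (rule smo_compose[OF s(2)])
      show "smo E E ?W (\<lambda>x. \<psi> (inv_into U \<phi> x))" by (rule smo_subset[OF s(1) W]) blast
      show "\<And>x. x \<in> ?W \<Longrightarrow> \<psi> (inv_into U \<phi> x) \<in> \<psi> ` (V \<inter> U')" using eq by auto
    qed
    then have "smo E E ?W (\<lambda>x. \<phi>' (inv_into U \<phi> x))" by (rule smo_cong) (use eq in auto)
    then show "\<exists>N. x \<in> N \<and> N \<subseteq> \<phi> ` (U \<inter> U') \<and> smo E E N (\<lambda>x. \<phi>' (inv_into U \<phi> x))"
      using p d by (intro exI[of _ ?W]) auto
  qed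
  have "max_atlas K E T A = max_atlas K E T (max_atlas K E T A)"
  proof (rule Set.equalityI)
    have "compatible K E c d" if "c \<in> max_atlas K E T A" "d \<in> max_atlas K E T A" for c d
      using that half by (cases c; cases d) (auto simp: compatible_iff[OF E])
    then show "max_atlas K E T A \<subseteq> max_atlas K E T (max_atlas K E T A)"
      by (auto simp: max_atlas_def)
    show "max_atlas K E T (max_atlas K E T A) \<subseteq> max_atlas K E T A"
      using sub by (auto simp: max_atlas_def)
  qed
  moreover have "(\<Union>c\<in>max_atlas K E T A. fst c) = topspace T"
  proof (rule Set.equalityI)
    have "fst c \<subseteq> topspace T" if "c \<in> max_atlas K E T A" for c
      using that openin_subset[of T "fst c"] by (cases c) (auto simp: max_atlas_def top_chart_def)
    then show "(\<Union>c\<in>max_atlas K E T A. fst c) \<subseteq> topspace T" by blast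
    show "topspace T \<subseteq> (\<Union>c\<in>max_atlas K E T A. fst c)" using cov sub by blast
  qed
  ultimately show "mfd E \<lparr>mtop = T, atlas = max_atlas K E T A\<rparr>" using E H by (simp add: manifold_def)
qed

lemma atlasI:
  assumes M: "mfd E M" and t: "top_chart E (mtop M) (U, \<phi>)"
    and s: "\<And>V \<psi>. (V, \<psi>) \<in> atlas M \<Longrightarrow> smo E E (\<phi> ` (U \<inter> V)) (\<lambda>x. \<psi> (inv_into U \<phi> x)) \<and>
       smo E E (\<psi> ` (V \<inter> U)) (\<lambda>x. \<phi> (inv_into V \<psi> x))"
  shows "(U, \<phi>) \<in> atlas M"
proof -
  have "compatible K E (U, \<phi>) d" if "d \<in> atlas M" for d
    using s that by (cases d) (simp add: compatible_iff[OF mfdD(1)[OF M]])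
  then have "(U, \<phi>) \<in> max_atlas K E (mtop M) (atlas M)" using t by (simp add: max_atlas_def)
  then show ?thesis using mfdD(4)[OF M] by simp
qed

text \<open>It is the maximality of the atlas that admits restricted charts; small charts inside a
  given open set come from here.\<close>

lemma chart_restrict:
  assumes M: "mfd E M" and c: "(U, \<phi>) \<in> atlas M" and W: "openin (mtop M) W" "W \<subseteq> U"
  shows "(W, restrict \<phi> W) \<in> atlas M"
proof (rule atlasI[OF M])
  note tc = top_chartD[OF mfd_chart[OF M c]]
  have im: "restrict \<phi> W ` W = \<phi> ` W" by auto
  have inv: "inv_into W (restrict \<phi> W) x = inv_into U \<phi> x" if x: "x \<in> \<phi> ` W" for x
  proof -
    obtain p where p: "p \<in> W" "x = \<phi> p" using x by blast
    have "inj_on (restrict \<phi> W) W" using tc(4) W(2) by (auto simp: inj_on_def)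
    then have "inv_into W (restrict \<phi> W) (restrict \<phi> W p) = p" using p(1) by (rule inv_into_f_f)
    then show ?thesis using p tc(4) W(2) by (auto simp: subset_iff)
  qed
  show "top_chart E (mtop M) (W, restrict \<phi> W)"
  proof (rule top_chartI)
    show "openin (mtop M) W" by (rule W)
    show "openin (vtop E) (restrict \<phi> W ` W)" unfolding im by (rule tc(7)[OF W])
    have "continuous_map (subtopology (mtop M) W) (vtop E) \<phi>"
      using continuous_map_from_subtopology_mono[OF tc(5) W(2)] .
    then show "continuous_map (subtopology (mtop M) W) (vtop E) (restrict \<phi> W)"
      by (rule continuous_map_eq) auto
    show "continuous_map (subtopology (vtop E) (restrict \<phi> W ` W)) (mtop M) (inv_into U \<phi>)"
      unfolding im using continuous_map_from_subtopology_mono[OF tc(6)] W(2) by (simp add: image_mono)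
    show "inv_into U \<phi> (restrict \<phi> W p) = p" if "p \<in> W" for p using that tc(4) W(2) by (auto simp: subset_iff)
  qed auto
  fix V \<psi> assume d: "(V, \<psi>) \<in> atlas M"
  note td = top_chartD[OF mfd_chart[OF M d]]
  have o: "openin (mtop M) (W \<inter> V)" using W(1) td(1) by blast
  have 1: "smo E E (\<phi> ` (W \<inter> V)) (\<lambda>x. \<psi> (inv_into U \<phi> x))"
    by (rule smo_subset[OF mfd_transition[OF M c d]]) (use W(2) o tc(7) in auto)
  have 2: "smo E E (\<psi> ` (V \<inter> W)) (\<lambda>x. \<phi> (inv_into V \<psi> x))"
    by (rule smo_subset[OF mfd_transition[OF M d c]]) (use W(2) o td(7) in \<open>auto simp: Int_commute\<close>)
  have "restrict \<phi> W ` (W \<inter> V) = \<phi> ` (W \<inter> V)" by auto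
  moreover have "smo E E (\<phi> ` (W \<inter> V)) (\<lambda>x. \<psi> (inv_into W (restrict \<phi> W) x))"
    by (rule smo_cong[OF 1]) (use inv in auto)
  moreover have "smo E E (\<psi> ` (V \<inter> W)) (\<lambda>x. restrict \<phi> W (inv_into V \<psi> x))"
    by (rule smo_cong[OF 2]) (use td(4) in auto)
  ultimately show "smo E E (restrict \<phi> W ` (W \<inter> V)) (\<lambda>x. \<psi> (inv_into W (restrict \<phi> W) x)) \<and>
       smo E E (\<psi> ` (V \<inter> W)) (\<lambda>x. restrict \<phi> W (inv_into V \<psi> x))" by simp
qed

lemma chart_at_within:
  assumes M: "mfd E M" and p: "p \<in> W" "openin (mtop M) W"
  shows "\<exists>U \<phi>. (U, \<phi>) \<in> atlas M \<and> p \<in> U \<and> U \<subseteq> W"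
proof -
  obtain U \<phi> where c: "(U, \<phi>) \<in> atlas M" "p \<in> U" using mfdD(3)[OF M] p openin_subset by blast
  have "openin (mtop M) (U \<inter> W)" using top_chartD(1)[OF mfd_chart[OF M c(1)]] p by blast
  from chart_restrict[OF M c(1) this] show ?thesis using c p by blast
qed

lemma top_chart_subtopology:
  assumes "openin T W" "U \<subseteq> W"
  shows "top_chart E (subtopology T W) (U, \<phi>) \<longleftrightarrow> top_chart E T (U, \<phi>)"
proof -
  have "subtopology (subtopology T W) U = subtopology T U" using assms(2) by (simp add: subtopology_subtopology inf.absorb2)
  then show ?thesis using assms by (simp add: top_chart_def openin_open_subtopology)
qed

lemma open_submfd_simps [simp]:
  "mtop (open_submfd M W) = subtopology (mtop M) W" "atlas (open_submfd M W) = {c \<in> atlas M. fst c \<subseteq> W}"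
  by (auto simp: open_submfd_def)

lemma topspace_open_submfd: "openin (mtop M) W \<Longrightarrow> topspace (mtop (open_submfd M W)) = W"
  using openin_subset by fastforce

lemma mfd_open:
  assumes M: "mfd E M" and W: "openin (mtop M) W" shows "mfd E (open_submfd M W)"
proof -
  let ?A = "{c \<in> atlas M. fst c \<subseteq> W}" and ?T = "subtopology (mtop M) W"
  note E = mfdD(1)[OF M]
  have cov: "(\<Union>c\<in>?A. fst c) = topspace ?T"
  proof (rule Set.equalityI)
    show "topspace ?T \<subseteq> (\<Union>c\<in>?A. fst c)" using chart_at_within[OF M _ W] by fastforce
    show "(\<Union>c\<in>?A. fst c) \<subseteq> topspace ?T"
    proof
      fix p assume "p \<in> (\<Union>c\<in>?A. fst c)"
      then obtain U \<phi> where c: "(U, \<phi>) \<in> atlas M" "U \<subseteq> W" "p \<in> U" by auto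
      show "p \<in> topspace ?T" using openin_subset[OF top_chartD(1)[OF mfd_chart[OF M c(1)]]] c by auto
    qed
  qed
  have "?A = max_atlas K E ?T ?A"
  proof (rule Set.set_eqI)
    fix c :: "('b, 'a) chart"
    obtain U \<phi> where c: "c = (U, \<phi>)" by (cases c)
    show "c \<in> ?A \<longleftrightarrow> c \<in> max_atlas K E ?T ?A"
    proof
      assume a: "c \<in> ?A"
      then have "top_chart E ?T c" using mfd_chart[OF M, of U \<phi>] top_chart_subtopology[OF W, of U E \<phi>] by (simp add: c)
      moreover have "c \<in> max_atlas K E (mtop M) (atlas M)" using a mfdD(4)[OF M] by simp
      ultimately show "c \<in> max_atlas K E ?T ?A" by (simp add: max_atlas_def)
    next
      assume a: "c \<in> max_atlas K E ?T ?A"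
      then have t': "top_chart E ?T (U, \<phi>)" and co: "\<And>d. d \<in> ?A \<Longrightarrow> compatible K E (U, \<phi>) d" by (auto simp: max_atlas_def c)
      have UW: "U \<subseteq> W" using top_chartD(1)[OF t'] openin_subset by fastforce
      have t: "top_chart E (mtop M) (U, \<phi>)" using t' top_chart_subtopology[OF W UW] by blast
      have "(U, \<phi>) \<in> atlas M"
      proof (rule atlasI[OF M t])
        fix V \<psi> assume d: "(V, \<psi>) \<in> atlas M"
        note td = top_chartD[OF mfd_chart[OF M d]] and tc = top_chartD[OF t]
        have o: "openin (mtop M) (V \<inter> W)" using td(1) W by blast
        \<comment> \<open>A chart of \<open>M\<close> may leave \<open>W\<close>, while
          compatibility is known only for charts inside \<open>W\<close>. Its restriction is one of
          these and has the same overlap with \<open>U\<close>, because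
          \<open>U \<subseteq> W\<close>.\<close>
        have "(V \<inter> W, restrict \<psi> (V \<inter> W)) \<in> ?A" using chart_restrict[OF M d o] by auto
        from co[OF this] have 1: "smo E E (\<phi> ` (U \<inter> (V \<inter> W))) (\<lambda>x. restrict \<psi> (V \<inter> W) (inv_into U \<phi> x))"
          and 2: "smo E E (restrict \<psi> (V \<inter> W) ` ((V \<inter> W) \<inter> U)) (\<lambda>x. \<phi> (inv_into (V \<inter> W) (restrict \<psi> (V \<inter> W)) x))"
          by (simp_all add: compatible_iff[OF E])
        have e: "U \<inter> (V \<inter> W) = U \<inter> V" "(V \<inter> W) \<inter> U = V \<inter> U" "restrict \<psi> (V \<inter> W) ` (V \<inter> U) = \<psi> ` (V \<inter> U)"
          using UW by auto
        have inj: "inj_on (restrict \<psi> (V \<inter> W)) (V \<inter> W)" using td(4) by (auto simp: inj_on_def)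
        have iv: "inv_into (V \<inter> W) (restrict \<psi> (V \<inter> W)) (\<psi> p) = p" if "p \<in> V \<inter> U" for p
          using inv_into_f_f[OF inj, of p] that UW by auto
        have "smo E E (\<phi> ` (U \<inter> V)) (\<lambda>x. \<psi> (inv_into U \<phi> x))"
          by (rule smo_cong[OF 1[unfolded e]]) (use tc(4) UW in auto)
        moreover have "smo E E (\<psi> ` (V \<inter> U)) (\<lambda>x. \<phi> (inv_into V \<psi> x))"
          by (rule smo_cong[OF 2[unfolded e]]) (use iv td(4) in auto)
        ultimately show "smo E E (\<phi> ` (U \<inter> V)) (\<lambda>x. \<psi> (inv_into U \<phi> x)) \<and> smo E E (\<psi> ` (V \<inter> U)) (\<lambda>x. \<phi> (inv_into V \<psi> x))" ..
      qed
      then show "c \<in> ?A" using c UW by simp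
    qed
  qed
  then show ?thesis using E mfdD(2)[OF M] cov by (simp add: manifold_def Hausdorff_space_subtopology)
qed

lemma sat_open_dom:
  assumes M: "mfd E M" and N: "mfd F N" and W: "openin (mtop M) W" "p \<in> W"
  shows "sat E (open_submfd M W) F N f p \<longleftrightarrow> sat E M F N f p"
proof
  assume "sat E (open_submfd M W) F N f p"
  then obtain U \<phi> V \<psi> Q where *: "(U, \<phi>) \<in> atlas M" "(V, \<psi>) \<in> atlas N" "openin (subtopology (mtop M) W) Q"
    "p \<in> Q" "Q \<subseteq> U" "f ` Q \<subseteq> V" "smo E F (\<phi> ` Q) (\<lambda>x. \<psi> (f (inv_into U \<phi> x)))"
    unfolding sat_def by auto
  have "openin (mtop M) Q" using *(3) W(1) openin_open_subtopology by blast
  then show "sat E M F N f p" unfolding sat_def using *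
    by (intro exI[of _ U] exI[of _ \<phi>] exI[of _ V] exI[of _ \<psi>] exI[of _ Q]) auto
next
  assume s: "sat E M F N f p"
  obtain U \<phi> where c: "(U, \<phi>) \<in> atlas M" "p \<in> U" "U \<subseteq> W" using chart_at_within[OF M W(2,1)] by blast
  obtain V \<psi> where d: "(V, \<psi>) \<in> atlas N" "f p \<in> V" using mfdD(3)[OF N sat_topspace(2)[OF M N s]] by blast
  obtain Q where "openin (mtop M) Q" "p \<in> Q" "Q \<subseteq> U" "f ` Q \<subseteq> V" "smo E F (\<phi> ` Q) (\<lambda>x. \<psi> (f (inv_into U \<phi> x)))"
    using sat_charts[OF M N s c(1,2) d] by blast
  then show "sat E (open_submfd M W) F N f p" unfolding sat_def using c d W
    by (intro exI[of _ U] exI[of _ \<phi>] exI[of _ V] exI[of _ \<psi>] exI[of _ Q]) (auto simp: openin_open_subtopology)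
qed

lemma sat_open_cod:
  assumes M: "mfd E M" and N: "mfd F N" and W: "openin (mtop N) W" "f p \<in> W"
  shows "sat E M F (open_submfd N W) f p \<longleftrightarrow> sat E M F N f p"
proof
  assume "sat E M F (open_submfd N W) f p"
  then obtain U \<phi> V \<psi> Q where *: "(U, \<phi>) \<in> atlas M" "(V, \<psi>) \<in> atlas N" "openin (mtop M) Q"
    "p \<in> Q" "Q \<subseteq> U" "f ` Q \<subseteq> V" "smo E F (\<phi> ` Q) (\<lambda>x. \<psi> (f (inv_into U \<phi> x)))"
    unfolding sat_def by auto
  then show "sat E M F N f p" unfolding sat_def
    by (intro exI[of _ U] exI[of _ \<phi>] exI[of _ V] exI[of _ \<psi>] exI[of _ Q]) auto
next
  assume s: "sat E M F N f p"
  obtain U \<phi> where c: "(U, \<phi>) \<in> atlas M" "p \<in> U" using mfdD(3)[OF M sat_topspace(1)[OF M N s]] by blast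
  obtain V \<psi> where d: "(V, \<psi>) \<in> atlas N" "f p \<in> V" "V \<subseteq> W" using chart_at_within[OF N W(2,1)] by blast
  obtain Q where "openin (mtop M) Q" "p \<in> Q" "Q \<subseteq> U" "f ` Q \<subseteq> V" "smo E F (\<phi> ` Q) (\<lambda>x. \<psi> (f (inv_into U \<phi> x)))"
    using sat_charts[OF M N s c d(1,2)] by blast
  then show "sat E M F (open_submfd N W) f p" unfolding sat_def using c d
    by (intro exI[of _ U] exI[of _ \<phi>] exI[of _ V] exI[of _ \<psi>] exI[of _ Q]) auto
qed

text \<open>Takes the open submanifolds out of the statement, so that both \<open>chart_into\<close>
  and the requirement on the product structure become conditions on germs.\<close>

lemma diffeomorphism_iff:
  assumes M: "mfd E M" and N: "mfd F N" and U: "openin (mtop M) U" and V: "openin (mtop N) V"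
  shows "diffeomorphism K E (open_submfd M U) F (open_submfd N V) f \<longleftrightarrow> bij_betw f U V \<and>
     (\<forall>p\<in>U. sat E M F N f p) \<and> (\<forall>q\<in>V. sat F N E M (inv_into U f) q)"
proof -
  note tU = topspace_open_submfd[OF U] and tV = topspace_open_submfd[OF V]
  have 1: "sat E (open_submfd M U) F (open_submfd N V) f p \<longleftrightarrow> sat E M F N f p" if "p \<in> U" "bij_betw f U V" for p
    using sat_open_dom[OF M mfd_open[OF N V] U that(1), of f] sat_open_cod[OF M N V, of f p] that bij_betwE by fastforce
  have 2: "sat F (open_submfd N V) E (open_submfd M U) (inv_into U f) q \<longleftrightarrow> sat F N E M (inv_into U f) q"
    if "q \<in> V" "bij_betw f U V" for q
    using sat_open_dom[OF N mfd_open[OF M U] V that(1), of "inv_into U f"] sat_open_cod[OF N M U, of "inv_into U f" q]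
      that bij_betwE[OF bij_betw_inv_into[OF that(2)]] by fastforce
  show ?thesis
    unfolding diffeomorphism_def smooth_map_iff_sat[OF mfd_open[OF M U] mfd_open[OF N V]]
      smooth_map_iff_sat[OF mfd_open[OF N V] mfd_open[OF M U]] tU tV
    using 1 2 by blast
qed

lemma mfd_tvs:
  assumes E: "TVS E" shows "mfd E (tvs_mfd K E)" "(carrier E, \<lambda>x\<in>carrier E. x) \<in> atlas (tvs_mfd K E)"
proof -
  let ?c = "(carrier E, \<lambda>x\<in>carrier E. x)"
  note o = openin_carrier_self[OF E]
  interpret E: topological_vector_space K E by (rule E)
  have im: "(\<lambda>x\<in>carrier E. x) ` carrier E = carrier E" by auto
  have "inj_on (\<lambda>x\<in>carrier E. x) (carrier E)" by (auto simp: inj_on_def)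
  then have iv: "inv_into (carrier E) (\<lambda>x\<in>carrier E. x) x = x" if "x \<in> carrier E" for x
    using inv_into_f_f[of "\<lambda>x\<in>carrier E. x" "carrier E" x] that by simp
  have t: "top_chart E (vtop E) ?c"
  proof (rule top_chartI)
    have "continuous_map (subtopology (vtop E) (carrier E)) (vtop E) (\<lambda>x. x)" by (simp add: continuous_map_from_subtopology)
    then show "continuous_map (subtopology (vtop E) (carrier E)) (vtop E) (\<lambda>x\<in>carrier E. x)" by (rule continuous_map_eq) auto
    show "continuous_map (subtopology (vtop E) ((\<lambda>x\<in>carrier E. x) ` carrier E)) (vtop E) (\<lambda>x. x)"
      by (simp add: continuous_map_from_subtopology)
  qed (use o in auto)
  have "smo E E (carrier E) (\<lambda>x. (\<lambda>x\<in>carrier E. x) (inv_into (carrier E) (\<lambda>x\<in>carrier E. x) x))"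
    by (rule smo_cong[OF smo_id[OF E o]]) (simp add: iv)
  then have "compatible K E ?c ?c" by (simp add: compatible_iff[OF E])
  with mfd_max_atlas[OF E E.Hausdorff_vtop, of "{?c}"] t
  show "mfd E (tvs_mfd K E)" "?c \<in> atlas (tvs_mfd K E)" by (auto simp: tvs_mfd_def E.topspace_vtop)
qed

lemma mtop_tvs [simp]: "mtop (tvs_mfd K E) = vtop E"
  by (simp add: tvs_mfd_def)

lemma inv_restrict_id: "x \<in> A \<Longrightarrow> inv_into A (\<lambda>x\<in>A. x) x = x"
  using inv_into_f_f[of "\<lambda>x\<in>A. x" A x] by (simp add: inj_on_def)

text \<open>Together with \<open>sat_imp_smo\<close>, this is the passage between smooth maps of
  vector spaces and germs; it reads a map in the identity charts.\<close>

lemma smo_imp_sat: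
  assumes s: "smo E F U f" and p: "p \<in> U" shows "sat E (tvs_mfd K E) F (tvs_mfd K F) f p"
proof -
  note E = smoD(1)[OF s] and F = smoD(2)[OF s]
  have Uc: "U \<subseteq> carrier E" by (rule openin_carrier[OF E smoD(3)[OF s]])
  have "(\<lambda>x\<in>carrier E. x) ` U = U" using Uc by (auto simp: subset_iff image_iff)
  moreover have "smo E F U (\<lambda>x. (\<lambda>x\<in>carrier F. x) (f (inv_into (carrier E) (\<lambda>x\<in>carrier E. x) x)))"
    by (rule smo_cong[OF s]) (use Uc smoD(6)[OF s] in \<open>auto simp: inv_restrict_id\<close>)
  ultimately show ?thesis
    by (intro sat_chart[OF mfd_tvs(1)[OF E] mfd_tvs(2)[OF E] _ mfd_tvs(2)[OF F], of p U])
      (use p Uc smoD(3,6)[OF s] in auto)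
qed

lemma sat_imp_smo:
  assumes E: "TVS E" and F: "TVS F" and U: "openin (vtop E) U" and s: "\<And>p. p \<in> U \<Longrightarrow> sat E (tvs_mfd K E) F (tvs_mfd K F) f p"
  shows "smo E F U f"
proof (rule smo_local[OF E F])
  fix p assume p: "p \<in> U"
  have Uc: "U \<subseteq> carrier E" by (rule openin_carrier[OF E U])
  have "f p \<in> carrier F" using sat_topspace(2)[OF mfd_tvs(1)[OF E] mfd_tvs(1)[OF F] s[OF p]]
    topological_vector_space.topspace_vtop[OF F] by simp
  from sat_restrict[OF mfd_tvs(1)[OF E] mfd_tvs(1)[OF F] s[OF p] mfd_tvs(2)[OF E] _ mfd_tvs(2)[OF F] this, of U]
  obtain W where W: "openin (vtop E) W" "p \<in> W" "W \<subseteq> U" "f ` W \<subseteq> carrier F"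
    "smo E F ((\<lambda>x\<in>carrier E. x) ` W) (\<lambda>x. (\<lambda>x\<in>carrier F. x) (f (inv_into (carrier E) (\<lambda>x\<in>carrier E. x) x)))"
    using p U Uc by auto
  have "(\<lambda>x\<in>carrier E. x) ` W = W" using W Uc by (auto simp: subset_iff image_iff)
  with W(5) have "smo E F W (\<lambda>x. (\<lambda>x\<in>carrier F. x) (f (inv_into (carrier E) (\<lambda>x\<in>carrier E. x) x)))" by simp
  then have "smo E F W f" by (rule smo_cong) (use W Uc in \<open>auto simp: inv_restrict_id subset_iff\<close>)
  then show "\<exists>N. p \<in> N \<and> N \<subseteq> U \<and> smo E F N f" using W by blast
qed

lemma sat_chart_map:
  assumes M: "mfd E M" and c: "(U, \<phi>) \<in> atlas M" "p \<in> U"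
  shows "sat E M E (tvs_mfd K E) \<phi> p"
proof -
  note E = mfdD(1)[OF M] and tc = top_chartD[OF mfd_chart[OF M c(1)]]
  have im: "\<phi> ` U \<subseteq> carrier E" using openin_carrier[OF E tc(3)] .
  have "smo E E (\<phi> ` U) (\<lambda>x. (\<lambda>x\<in>carrier E. x) (\<phi> (inv_into U \<phi> x)))"
    by (rule smo_cong[OF smo_id[OF E tc(3)]]) (use im tc(4) in auto)
  then show ?thesis by (intro sat_chart[OF M c mfd_tvs(2)[OF E] tc(1) c(2)]) (use im in auto)
qed

lemma sat_chart_inv:
  assumes M: "mfd E M" and c: "(U, \<phi>) \<in> atlas M" "x \<in> \<phi> ` U"
  shows "sat E (tvs_mfd K E) E M (inv_into U \<phi>) x"
proof -
  note E = mfdD(1)[OF M] and tc = top_chartD[OF mfd_chart[OF M c(1)]]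
  have im: "\<phi> ` U \<subseteq> carrier E" using openin_carrier[OF E tc(3)] .
  have "(\<lambda>x\<in>carrier E. x) ` (\<phi> ` U) = \<phi> ` U" using im by (auto simp: subset_iff image_iff)
  moreover have "smo E E (\<phi> ` U) (\<lambda>x. \<phi> (inv_into U \<phi> (inv_into (carrier E) (\<lambda>x\<in>carrier E. x) x)))"
    by (rule smo_cong[OF smo_id[OF E tc(3)]]) (use im tc(4) in \<open>auto simp: inv_restrict_id subset_iff image_iff\<close>)
  ultimately show ?thesis
    by (intro sat_chart[OF mfd_tvs(1)[OF E] mfd_tvs(2)[OF E] _ c(1), of x "\<phi> ` U"])
      (use im c tc(3,4) in \<open>auto simp: subset_iff\<close>)
qed

lemma smo_prod_map:
  assumes f: "smo E E' A f" and g: "smo F F' B g"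
  shows "smo (prod_tvs E F) (prod_tvs E' F') (A \<times> B) (\<lambda>p. (f (fst p), g (snd p)))"
proof -
  note E = smoD(1)[OF f] and F = smoD(1)[OF g]
  have o: "openin (vtop (prod_tvs E F)) (A \<times> B)"
    using smoD(3)[OF f] smoD(3)[OF g] by (simp add: openin_prod_Times_iff)
  show ?thesis
    by (intro smo_pair smo_compose[OF f] smo_compose[OF g] smo_clin clin_fst clin_snd tvs_prod E F o) auto
qed

lemma mfd_prod:
  assumes M: "mfd E M" and N: "mfd F N"
  shows "mfd (prod_tvs E F) (prod_mfd K E M F N)"
    "\<And>U \<phi> V \<psi>. (U, \<phi>) \<in> atlas M \<Longrightarrow> (V, \<psi>) \<in> atlas N \<Longrightarrow>
       (U \<times> V, \<lambda>(x, y)\<in>U \<times> V. (\<phi> x, \<psi> y)) \<in> atlas (prod_mfd K E M F N)"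
    "\<And>U \<phi> V \<psi> a b. (U, \<phi>) \<in> atlas M \<Longrightarrow> (V, \<psi>) \<in> atlas N \<Longrightarrow> a \<in> U \<Longrightarrow> b \<in> V \<Longrightarrow>
       inv_into (U \<times> V) (\<lambda>(x, y)\<in>U \<times> V. (\<phi> x, \<psi> y)) (\<phi> a, \<psi> b) = (a, b)"
proof -
  let ?T = "prod_topology (mtop M) (mtop N)" and ?E = "prod_tvs E F"
  let ?p = "\<lambda>U \<phi> V \<psi>. (\<lambda>(x, y)\<in>U \<times> V. (\<phi> x, \<psi> y))"
  let ?A = "{(U \<times> V, ?p U \<phi> V \<psi>) | U \<phi> V \<psi>. (U, \<phi>) \<in> atlas M \<and> (V, \<psi>) \<in> atlas N}"
  note E = mfdD(1)[OF M] and F = mfdD(1)[OF N]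
  have iv: "inv_into (U \<times> V) (?p U \<phi> V \<psi>) (\<phi> a, \<psi> b) = (a, b)"
    if "(U, \<phi>) \<in> atlas M" "(V, \<psi>) \<in> atlas N" "a \<in> U" "b \<in> V" for U \<phi> V \<psi> a b
  proof -
    have "inj_on (?p U \<phi> V \<psi>) (U \<times> V)"
      using top_chartD(4)[OF mfd_chart[OF M that(1)]] top_chartD(4)[OF mfd_chart[OF N that(2)]] by (auto simp: inj_on_def)
    from inv_into_f_f[OF this, of "(a, b)"] show ?thesis using that by simp
  qed
  have im: "?p U \<phi> V \<psi> ` (A \<times> B) = \<phi> ` A \<times> \<psi> ` B" if "A \<subseteq> U" "B \<subseteq> V" for U \<phi> V \<psi> A B
    using that by (force simp: image_iff)
  have top: "top_chart ?E ?T (U \<times> V, ?p U \<phi> V \<psi>)" if c: "(U, \<phi>) \<in> atlas M" and d: "(V, \<psi>) \<in> atlas N" for U \<phi> V \<psi>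
  proof (rule top_chartI)
    note tc = top_chartD[OF mfd_chart[OF M c]] and td = top_chartD[OF mfd_chart[OF N d]]
    show "openin ?T (U \<times> V)" using tc td by (simp add: openin_prod_Times_iff)
    show "openin (vtop ?E) (?p U \<phi> V \<psi> ` (U \<times> V))" unfolding im[OF subset_refl subset_refl]
      using tc(3) td(3) by (simp add: openin_prod_Times_iff)
    have "continuous_map (subtopology ?T (U \<times> V)) (vtop ?E) (\<lambda>z. (\<phi> (fst z), \<psi> (snd z)))"
      unfolding prod_tvs_simps subtopology_Times
      by (intro continuous_map_pairedI continuous_map_compose[OF continuous_map_fst tc(5), unfolded o_def]
         continuous_map_compose[OF continuous_map_snd td(5), unfolded o_def])
    then show "continuous_map (subtopology ?T (U \<times> V)) (vtop ?E) (?p U \<phi> V \<psi>)"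
      by (rule continuous_map_eq) auto
    show "continuous_map (subtopology (vtop ?E) (?p U \<phi> V \<psi> ` (U \<times> V))) ?T (\<lambda>z. (inv_into U \<phi> (fst z), inv_into V \<psi> (snd z)))"
      unfolding prod_tvs_simps im[OF subset_refl subset_refl] subtopology_Times
      by (intro continuous_map_pairedI continuous_map_compose[OF continuous_map_fst tc(6), unfolded o_def]
         continuous_map_compose[OF continuous_map_snd td(6), unfolded o_def])
    show "\<And>p. p \<in> U \<times> V \<Longrightarrow> (inv_into U \<phi> (fst (?p U \<phi> V \<psi> p)), inv_into V \<psi> (snd (?p U \<phi> V \<psi> p))) = p"
      using tc(4) td(4) by auto
  qed auto
  have half: "smo ?E ?E (?p U \<phi> V \<psi> ` ((U \<times> V) \<inter> (U' \<times> V'))) (\<lambda>x. ?p U' \<phi>' V' \<psi>' (inv_into (U \<times> V) (?p U \<phi> V \<psi>) x))"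
    if c: "(U, \<phi>) \<in> atlas M" and d: "(V, \<psi>) \<in> atlas N" and c': "(U', \<phi>') \<in> atlas M" and d': "(V', \<psi>') \<in> atlas N"
    for U \<phi> V \<psi> U' \<phi>' V' \<psi>'
  proof -
    note tc = top_chartD[OF mfd_chart[OF M c]] and td = top_chartD[OF mfd_chart[OF N d]]
    have e: "?p U \<phi> V \<psi> ` ((U \<times> V) \<inter> (U' \<times> V')) = \<phi> ` (U \<inter> U') \<times> \<psi> ` (V \<inter> V')"
      unfolding Times_Int_Times by (rule im) auto
    show ?thesis unfolding e
    proof (rule smo_cong[OF smo_prod_map[OF mfd_transition[OF M c c'] mfd_transition[OF N d d']]])
      fix z assume "z \<in> \<phi> ` (U \<inter> U') \<times> \<psi> ` (V \<inter> V')"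
      then obtain a b where "z = (\<phi> a, \<psi> b)" "a \<in> U" "a \<in> U'" "b \<in> V" "b \<in> V'" by blast
      then show "?p U' \<phi>' V' \<psi>' (inv_into (U \<times> V) (?p U \<phi> V \<psi>) z) = (\<phi>' (inv_into U \<phi> (fst z)), \<psi>' (inv_into V \<psi> (snd z)))"
        using iv[OF c d] tc(4) td(4) by simp
    qed
  qed
  have cov: "(\<Union>c\<in>?A. fst c) = topspace ?T"
  proof (rule Set.equalityI)
    show "(\<Union>c\<in>?A. fst c) \<subseteq> topspace ?T"
    proof
      fix z assume "z \<in> (\<Union>c\<in>?A. fst c)"
      then obtain U \<phi> V \<psi> where c: "(U, \<phi>) \<in> atlas M" "(V, \<psi>) \<in> atlas N" "z \<in> U \<times> V" by auto
      then show "z \<in> topspace ?T" using openin_subset[OF top_chartD(1)[OF top[OF c(1,2)]]] by blast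
    qed
    show "topspace ?T \<subseteq> (\<Union>c\<in>?A. fst c)"
    proof
      fix z assume "z \<in> topspace ?T"
      then have z: "fst z \<in> topspace (mtop M)" "snd z \<in> topspace (mtop N)" by auto
      obtain U \<phi> where "(U, \<phi>) \<in> atlas M" "fst z \<in> U" using mfdD(3)[OF M z(1)] by blast
      moreover obtain V \<psi> where "(V, \<psi>) \<in> atlas N" "snd z \<in> V" using mfdD(3)[OF N z(2)] by blast
      moreover note calculation
      ultimately have "(U \<times> V, ?p U \<phi> V \<psi>) \<in> ?A" "z \<in> fst (U \<times> V, ?p U \<phi> V \<psi>)" by (auto simp: mem_Times_iff)
      then show "z \<in> (\<Union>c\<in>?A. fst c)" by (rule UN_I)
    qed
  qed
  have H: "Hausdorff_space ?T" using mfdD(2)[OF M] mfdD(2)[OF N] by (simp add: Hausdorff_space_prod_topology)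
  have t: "top_chart ?E ?T c" if "c \<in> ?A" for c using that top by blast
  have co: "compatible K ?E c d" if c: "c \<in> ?A" and d: "d \<in> ?A" for c d
  proof -
    obtain U \<phi> V \<psi> where c: "c = (U \<times> V, ?p U \<phi> V \<psi>)" "(U, \<phi>) \<in> atlas M" "(V, \<psi>) \<in> atlas N" using c by blast
    obtain U' \<phi>' V' \<psi>' where d: "d = (U' \<times> V', ?p U' \<phi>' V' \<psi>')" "(U', \<phi>') \<in> atlas M" "(V', \<psi>') \<in> atlas N" using d by blast
    show ?thesis unfolding c(1) d(1) compatible_iff[OF tvs_prod[OF E F]] using half c d by blast
  qed
  note m = mfd_max_atlas[OF tvs_prod[OF E F] H t co cov]
  show "mfd (prod_tvs E F) (prod_mfd K E M F N)" using m(1) by (simp add: prod_mfd_def)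
  show "(U \<times> V, ?p U \<phi> V \<psi>) \<in> atlas (prod_mfd K E M F N)" if "(U, \<phi>) \<in> atlas M" "(V, \<psi>) \<in> atlas N" for U \<phi> V \<psi>
  proof -
    have "(U \<times> V, ?p U \<phi> V \<psi>) \<in> ?A" using that by blast
    from subsetD[OF m(2) this] show ?thesis by (simp add: prod_mfd_def)
  qed
  show "inv_into (U \<times> V) (?p U \<phi> V \<psi>) (\<phi> a, \<psi> b) = (a, b)"
    if "(U, \<phi>) \<in> atlas M" "(V, \<psi>) \<in> atlas N" "a \<in> U" "b \<in> V" for U \<phi> V \<psi> a b by (rule iv[OF that])
qed

lemma mtop_prod [simp]: "mtop (prod_mfd K E M F N) = prod_topology (mtop M) (mtop N)"
  by (simp add: prod_mfd_def)

lemma sat_pair: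
  assumes P: "mfd G P" and M: "mfd E M" and N: "mfd F N" and f: "sat G P E M f p" and g: "sat G P F N g p"
  shows "sat G P (prod_tvs E F) (prod_mfd K E M F N) (\<lambda>x. (f x, g x)) p"
proof -
  obtain U \<phi> where c: "(U, \<phi>) \<in> atlas P" "p \<in> U" using mfdD(3)[OF P sat_topspace(1)[OF P M f]] by blast
  obtain V \<psi> where d: "(V, \<psi>) \<in> atlas M" "f p \<in> V" using mfdD(3)[OF M sat_topspace(2)[OF P M f]] by blast
  obtain X \<theta> where e: "(X, \<theta>) \<in> atlas N" "g p \<in> X" using mfdD(3)[OF N sat_topspace(2)[OF P N g]] by blast
  obtain W where W: "openin (mtop P) W" "p \<in> W" "W \<subseteq> U" "f ` W \<subseteq> V" "smo G E (\<phi> ` W) (\<lambda>x. \<psi> (f (inv_into U \<phi> x)))"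
    using sat_charts[OF P M f c d] by blast
  obtain W' where W': "openin (mtop P) W'" "p \<in> W'" "W' \<subseteq> U" "W' \<subseteq> W" "g ` W' \<subseteq> X" "smo G F (\<phi> ` W') (\<lambda>x. \<theta> (g (inv_into U \<phi> x)))"
    using sat_restrict[OF P N g c e W(1,2)] by blast
  note tc = top_chartD[OF mfd_chart[OF P c(1)]]
  have fg: "f q \<in> V" "g q \<in> X" "inv_into U \<phi> (\<phi> q) = q" if "q \<in> W'" for q using that W W' tc(4) by (auto simp: subset_iff)
  have "smo G E (\<phi> ` W') (\<lambda>x. \<psi> (f (inv_into U \<phi> x)))"
    by (rule smo_subset[OF W(5) tc(7)[OF W'(1,3)]]) (use W'(4) in auto)
  from smo_pair[OF this W'(6)]
  have "smo G (prod_tvs E F) (\<phi> ` W') (\<lambda>x. (\<lambda>(x, y)\<in>V \<times> X. (\<psi> x, \<theta> y)) (f (inv_into U \<phi> x), g (inv_into U \<phi> x)))"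
    by (rule smo_cong) (use fg in auto)
  then show ?thesis
    by (intro sat_chart[OF P c mfd_prod(2)[OF M N d(1) e(1)] W'(1,2,3)]) (use fg in auto)
qed

lemma sat_fst_snd:
  assumes M: "mfd E M" and N: "mfd F N" and p: "p \<in> topspace (mtop M)" "q \<in> topspace (mtop N)"
  shows "sat (prod_tvs E F) (prod_mfd K E M F N) E M fst (p, q)"
    "sat (prod_tvs E F) (prod_mfd K E M F N) F N snd (p, q)"
proof -
  obtain U \<phi> where c: "(U, \<phi>) \<in> atlas M" "p \<in> U" using mfdD(3)[OF M p(1)] by blast
  obtain V \<psi> where d: "(V, \<psi>) \<in> atlas N" "q \<in> V" using mfdD(3)[OF N p(2)] by blast
  note E = mfdD(1)[OF M] and F = mfdD(1)[OF N]
  note tc = top_chartD[OF mfd_chart[OF M c(1)]] and td = top_chartD[OF mfd_chart[OF N d(1)]]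
  note P = mfd_prod(1)[OF M N] and pc = mfd_prod(2)[OF M N c(1) d(1)]
  note tp = top_chartD[OF mfd_chart[OF P pc]]
  have im: "(\<lambda>(x, y)\<in>U \<times> V. (\<phi> x, \<psi> y)) ` (U \<times> V) = \<phi> ` U \<times> \<psi> ` V" by (force simp: image_iff)
  have o: "openin (vtop (prod_tvs E F)) (\<phi> ` U \<times> \<psi> ` V)" using tp(3) unfolding im .
  let ?i = "inv_into (U \<times> V) (\<lambda>(x, y)\<in>U \<times> V. (\<phi> x, \<psi> y))"
  have "smo (prod_tvs E F) E (\<phi> ` U \<times> \<psi> ` V) (\<lambda>x. \<phi> (fst (?i x)))"
    by (rule smo_cong[OF smo_clin[OF clin_fst tvs_prod[OF E F] E o]]) (use mfd_prod(3)[OF M N c(1) d(1)] in auto)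
  then show "sat (prod_tvs E F) (prod_mfd K E M F N) E M fst (p, q)"
    by (intro sat_chart[OF P pc _ c(1) tp(1)]) (use c d im in auto)
  have "smo (prod_tvs E F) F (\<phi> ` U \<times> \<psi> ` V) (\<lambda>x. \<psi> (snd (?i x)))"
    by (rule smo_cong[OF smo_clin[OF clin_snd tvs_prod[OF E F] F o]]) (use mfd_prod(3)[OF M N c(1) d(1)] in auto)
  then show "sat (prod_tvs E F) (prod_mfd K E M F N) F N snd (p, q)"
    by (intro sat_chart[OF P pc _ d(1) tp(1)]) (use c d im in auto)
qed

text \<open>The product of two spaces carries an atlas generated by products of charts and one
  generated by the identity chart. \<open>sat_pair\<close> ends in the former, and the identity map
  leads smoothly to the latter.\<close>

lemma sat_pair_tvs:
  assumes P: "mfd G P" and E: "TVS E" and F: "TVS F"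
    and f: "sat G P E (tvs_mfd K E) f p" and g: "sat G P F (tvs_mfd K F) g p"
  shows "sat G P (prod_tvs E F) (tvs_mfd K (prod_tvs E F)) (\<lambda>x. (f x, g x)) p"
proof -
  note TE = mfd_tvs(1)[OF E] and TF = mfd_tvs(1)[OF F] and EF = tvs_prod[OF E F]
  note Pr = mfd_prod(1)[OF TE TF] and TEF = mfd_tvs(1)[OF EF]
  note c = mfd_prod(2)[OF TE TF mfd_tvs(2)[OF E] mfd_tvs(2)[OF F]] and inv = mfd_prod(3)[OF TE TF mfd_tvs(2)[OF E] mfd_tvs(2)[OF F]]
  let ?C = "carrier E \<times> carrier F" and ?\<phi> = "\<lambda>(x, y)\<in>carrier E \<times> carrier F. ((\<lambda>x\<in>carrier E. x) x, (\<lambda>x\<in>carrier F. x) y)"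
  have fp: "f p \<in> carrier E" "g p \<in> carrier F"
    using sat_topspace(2)[OF P TE f] sat_topspace(2)[OF P TF g] topological_vector_space.topspace_vtop[OF E]
      topological_vector_space.topspace_vtop[OF F] by simp_all
  have im: "?\<phi> ` ?C = ?C" by (force simp: image_iff)
  have iv: "inv_into ?C ?\<phi> (x, y) = (x, y)" if "x \<in> carrier E" "y \<in> carrier F" for x y
    using inv[OF that] that by simp
  have "sat (prod_tvs E F) (prod_mfd K E (tvs_mfd K E) F (tvs_mfd K F)) (prod_tvs E F) (tvs_mfd K (prod_tvs E F)) (\<lambda>x. x) (f p, g p)"
  proof (rule sat_chart[OF Pr c _ mfd_tvs(2)[OF EF]])
    show "openin (mtop (prod_mfd K E (tvs_mfd K E) F (tvs_mfd K F))) ?C"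
      using openin_carrier_self[OF E] openin_carrier_self[OF F] by (simp add: openin_prod_Times_iff)
    have o: "openin (vtop (prod_tvs E F)) ?C" using openin_carrier_self[OF EF] by simp
    show "smo (prod_tvs E F) (prod_tvs E F) (?\<phi> ` ?C) (\<lambda>x. (\<lambda>x\<in>carrier (prod_tvs E F). x) (inv_into ?C ?\<phi> x))"
      unfolding im
    proof (rule smo_cong[OF smo_id[OF EF o]])
      fix z assume "z \<in> ?C"
      then obtain x y where z: "z = (x, y)" "x \<in> carrier E" "y \<in> carrier F" by blast
      show "(\<lambda>x\<in>carrier (prod_tvs E F). x) (inv_into ?C ?\<phi> z) = z" unfolding z(1) iv[OF z(2,3)] using z by simp
    qed
  qed (use fp in auto)
  from sat_compose[OF P Pr TEF this sat_pair[OF P TE TF f g]] show ?thesis .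
qed

end

section \<open>Differentials and tangent spaces\<close>

context valued_field begin

abbreviation dqv where "dqv E \<equiv> vtop (prod_tvs E (prod_tvs E (scalar_tvs K)))"

lemma smo_Pi: "smo E F U f \<Longrightarrow> f \<in> U \<rightarrow> carrier F"
  by (rule funcsetI) (rule smoD(6))

lemma mem_dq_dom: "(x, y, t) \<in> dq_dom K E U \<longleftrightarrow> x \<in> U \<and> y \<in> carrier E \<and> t \<in> carrier K \<and> x \<oplus>\<^bsub>E\<^esub> t \<odot>\<^bsub>E\<^esub> y \<in> U"
  by (simp add: dq_dom_def)

lemma topspace_dqv: "TVS E \<Longrightarrow> topspace (dqv E) = carrier E \<times> carrier E \<times> carrier K"
  using topological_vector_space.topspace_vtop[of K E] by simp

lemma topspace_dq_dom:
  assumes "TVS E" "U \<subseteq> carrier E" shows "topspace (subtopology (dqv E) (dq_dom K E U)) = dq_dom K E U"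
  unfolding topspace_subtopology topspace_dqv[OF assms(1)] using assms(2) by (auto simp: dq_dom_def)

lemma dq_zero_mem:
  assumes "TVS E" "U \<subseteq> carrier E" "x \<in> U" "y \<in> carrier E" shows "(x, y, \<zero>) \<in> dq_dom K E U"
proof -
  interpret E: topological_vector_space K E by fact
  show ?thesis using assms by (auto simp: mem_dq_dom)
qed

lemma is_dqD:
  assumes E: "TVS E" and F: "TVS F" and U: "U \<subseteq> carrier E" and f: "f \<in> U \<rightarrow> carrier F"
    and d: "is_dq K E F U f g" and m: "(x, y, t) \<in> dq_dom K E U"
  shows "g (x, y, t) \<in> carrier F" "f (x \<oplus>\<^bsub>E\<^esub> t \<odot>\<^bsub>E\<^esub> y) = f x \<oplus>\<^bsub>F\<^esub> t \<odot>\<^bsub>F\<^esub> g (x, y, t)"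
proof -
  interpret E: topological_vector_space K E by fact
  interpret F: topological_vector_space K F by fact
  have c: "continuous_map (subtopology (dqv E) (dq_dom K E U)) (vtop F) g" using d by (simp add: is_dq_def)
  then show gc: "g (x, y, t) \<in> carrier F"
    using m topspace_dq_dom[OF E U] F.topspace_vtop by (auto simp: continuous_map_def Pi_iff)
  show "f (x \<oplus>\<^bsub>E\<^esub> t \<odot>\<^bsub>E\<^esub> y) = f x \<oplus>\<^bsub>F\<^esub> t \<odot>\<^bsub>F\<^esub> g (x, y, t)"
  proof (cases "t = \<zero>")
    case True
    then show ?thesis using m U gc funcset_mem[OF f] by (auto simp: mem_dq_dom subset_iff)
  next
    case False
    have "g (x, y, t) = inv t \<odot>\<^bsub>F\<^esub> (f (x \<oplus>\<^bsub>E\<^esub> t \<odot>\<^bsub>E\<^esub> y) \<ominus>\<^bsub>F\<^esub> f x)"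
      using d m False unfolding is_dq_def by fast
    then show ?thesis using step_iff[OF F funcset_mem[OF f] funcset_mem[OF f] gc, of x "x \<oplus>\<^bsub>E\<^esub> t \<odot>\<^bsub>E\<^esub> y" t] m False
      by (simp add: mem_dq_dom)
  qed
qed

lemma is_dqI:
  assumes E: "TVS E" and F: "TVS F" and U: "U \<subseteq> carrier E" and f: "f \<in> U \<rightarrow> carrier F"
    and c: "continuous_map (subtopology (dqv E) (dq_dom K E U)) (vtop F) g"
    and s: "\<And>x y t. (x, y, t) \<in> dq_dom K E U \<Longrightarrow> f (x \<oplus>\<^bsub>E\<^esub> t \<odot>\<^bsub>E\<^esub> y) = f x \<oplus>\<^bsub>F\<^esub> t \<odot>\<^bsub>F\<^esub> g (x, y, t)"
  shows "is_dq K E F U f g"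
proof -
  interpret F: topological_vector_space K F by fact
  have "g (x, y, t) = inv t \<odot>\<^bsub>F\<^esub> (f (x \<oplus>\<^bsub>E\<^esub> t \<odot>\<^bsub>E\<^esub> y) \<ominus>\<^bsub>F\<^esub> f x)" if m: "(x, y, t) \<in> dq_dom K E U" and t: "t \<noteq> \<zero>" for x y t
  proof -
    have gc: "g (x, y, t) \<in> carrier F"
      using c m topspace_dq_dom[OF E U] F.topspace_vtop by (auto simp: continuous_map_def Pi_iff)
    show ?thesis using step_iff[OF F funcset_mem[OF f] funcset_mem[OF f] gc, of x "x \<oplus>\<^bsub>E\<^esub> t \<odot>\<^bsub>E\<^esub> y" t] m t s[OF m]
      by (simp add: mem_dq_dom)
  qed
  then show ?thesis using c by (auto simp: is_dq_def)
qed

lemma is_dq_cong: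
  assumes "is_dq K E F U f g" "\<And>x. x \<in> U \<Longrightarrow> f' x = f x" shows "is_dq K E F U f' g"
  using assms unfolding is_dq_def by (auto simp: mem_dq_dom)

lemma dq_line:
  assumes E: "TVS E" and c: "continuous_map (subtopology (dqv E) (dq_dom K E U)) Z g"
    and a: "continuous_map T (vtop E) a" "continuous_map T (vtop E) b" "continuous_map T (ktop K) r"
    and m: "\<And>t. t \<in> topspace T \<Longrightarrow> (a t, b t, r t) \<in> dq_dom K E U"
  shows "continuous_map T Z (\<lambda>t. g (a t, b t, r t))"
proof -
  have "continuous_map T (subtopology (dqv E) (dq_dom K E U)) (\<lambda>t. (a t, b t, r t))"
    using a m by (auto simp: continuous_map_in_subtopology intro!: continuous_map_pairedI)
  from continuous_map_compose[OF this c] show ?thesis by (simp add: o_def)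
qed

text \<open>The common pattern of the proofs below: an identity multiplied by \<open>t\<close> is
  divided by \<open>t \<noteq> \<zero>\<close> and then passed to the limit. In the applications
  \<open>w t\<close> is the value of the map at the base point.\<close>

lemma dq_limit:
  assumes E: "TVS E" and F: "TVS F" and A: "openin (ktop K) A" "\<zero> \<in> A"
    and f: "continuous_map (subtopology (ktop K) A) (vtop F) f" and g: "continuous_map (subtopology (ktop K) A) (vtop F) g"
    and w: "\<And>t. t \<in> A \<Longrightarrow> w t \<in> carrier F"
    and eq: "\<And>t. t \<in> A \<Longrightarrow> w t \<oplus>\<^bsub>F\<^esub> t \<odot>\<^bsub>F\<^esub> f t = w t \<oplus>\<^bsub>F\<^esub> t \<odot>\<^bsub>F\<^esub> g t"
  shows "f \<zero> = g \<zero>"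
proof (rule vanishing_limit[OF topological_vector_space.Hausdorff_vtop[OF F] A f g])
  fix t assume t: "t \<in> A" "t \<noteq> \<zero>"
  have ts: "topspace (subtopology (ktop K) A) = A" using openin_subset[OF A(1)] by auto
  have "f t \<in> carrier F" "g t \<in> carrier F"
    using continuous_map_image_subset_topspace[OF f] continuous_map_image_subset_topspace[OF g] t ts
      topological_vector_space.topspace_vtop[OF F] by auto
  moreover have "t \<in> carrier K" using openin_subset[OF A(1)] t by auto
  ultimately show "f t = g t" using tvs_cancel_step[OF F w[OF t(1)]] t eq by blast
qed

text \<open>The uniqueness argument again, on \<open>E\<close> itself: \<open>dq\<close>, and with
  it the tangent space, refers to triples instead of trees.\<close>

lemma is_dq_unique:
  assumes E: "TVS E" and F: "TVS F" and Uo: "openin (vtop E) U" and f: "f \<in> U \<rightarrow> carrier F"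
    and g: "is_dq K E F U f g" and h: "is_dq K E F U f h" and m: "(x, y, t) \<in> dq_dom K E U"
  shows "g (x, y, t) = h (x, y, t)"
proof -
  interpret E: topological_vector_space K E by fact
  note U = openin_carrier[OF E Uo]
  note dg = is_dqD[OF E F U f g] and dh = is_dqD[OF E F U f h]
  have xy: "x \<in> U" "x \<in> carrier E" "y \<in> carrier E" "t \<in> carrier K" using m U by (auto simp: mem_dq_dom)
  show ?thesis
  proof (cases "t = \<zero>")
    case False
    then show ?thesis using tvs_cancel_step[OF F funcset_mem[OF f xy(1)] dg(1)[OF m] dh(1)[OF m] xy(4)] dg(2)[OF m] dh(2)[OF m] by simp
  next
    case True
    define A where "A = {s \<in> carrier K. x \<oplus>\<^bsub>E\<^esub> s \<odot>\<^bsub>E\<^esub> y \<in> U}"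
    have "continuous_map (ktop K) (vtop E) (\<lambda>s. x \<oplus>\<^bsub>E\<^esub> s \<odot>\<^bsub>E\<^esub> y)"
      using xy by (intro tvs_cont_add tvs_cont_smult E) (auto simp: E.topspace_vtop)
    from openin_continuous_map_preimage[OF this Uo] have A: "openin (ktop K) A" by (simp add: A_def)
    have A0: "\<zero> \<in> A" using xy by (simp add: A_def)
    have mA: "(x, y, s) \<in> dq_dom K E U" if "s \<in> A" for s using that xy by (simp add: A_def mem_dq_dom)
    have gc: "continuous_map (subtopology (dqv E) (dq_dom K E U)) (vtop F) g"
      and hc: "continuous_map (subtopology (dqv E) (dq_dom K E U)) (vtop F) h" using g h by (auto simp: is_dq_def)
    have line: "continuous_map (subtopology (ktop K) A) (vtop F) (\<lambda>s. k (x, y, s))"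
      if "continuous_map (subtopology (dqv E) (dq_dom K E U)) (vtop F) k" for k
      by (rule dq_line[OF E that]) (use xy mA in \<open>auto simp: E.topspace_vtop continuous_map_from_subtopology\<close>)
    have "g (x, y, \<zero>) = h (x, y, \<zero>)"
      by (rule dq_limit[OF E F A A0 line[OF gc] line[OF hc], of "\<lambda>_. f x"])
        (use funcset_mem[OF f xy(1)] in \<open>simp_all add: dg(2)[OF mA, symmetric] dh(2)[OF mA, symmetric]\<close>)
    then show ?thesis using True by simp
  qed
qed

text \<open>A quotient found on trees is pulled back along
  \<open>(x, y, t) \<mapsto> Br (Base x) (Base y) t\<close>; since a quotient exists, the chosen
  \<open>dq\<close> is one.\<close>

lemma smo_dq:
  assumes f: "smo E F U f" shows "is_dq K E F U f (dq K E F U f)"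
proof -
  note E = smoD(1)[OF f] and F = smoD(2)[OF f] and Uo = smoD(3)[OF f]
  note U = openin_carrier[OF E Uo]
  interpret B: topological_vector_space K "BT E" by (intro tvs_image E inj_Base)
  have S: "Sm (BT E) F (BU U) (tree_fun f)" using f by (simp add: smo_iff_Sm)
  obtain g where g: "dstep (BT E) F (BU U) (tree_fun f) g" "Sm (nx K (BT E)) F (nd K (BT E) (BU U)) g" using SmE[OF S] .
  let ?j = "\<lambda>(x, y, t). Br (Base x) (Base y) t"
  have j: "clin (prod_tvs E (prod_tvs E (scalar_tvs K))) (nx K (BT E)) (\<lambda>p. Br (Base (fst p)) (Base (fst (snd p))) (snd (snd p)))"
    by (intro clin_nx_intro tvs_image E inj_Base clin_compose[OF clin_fst clin_image(1)] clin_compose[OF clin_snd clin_snd]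
      clin_compose[OF clin_compose[OF clin_snd clin_fst] clin_image(1)])
  have jm: "Br (Base x) (Base y) t \<in> nd K (BT E) (BU U)" if "(x, y, t) \<in> dq_dom K E U" for x y t
    using that by (auto simp: mem_dq_dom image_tvs_simps inj_Base)
  have "continuous_map (subtopology (dqv E) (dq_dom K E U)) (subtopology (vtop (nx K (BT E))) (nd K (BT E) (BU U)))
      (\<lambda>p. Br (Base (fst p)) (Base (fst (snd p))) (snd (snd p)))"
    using clinD(4)[OF j] jm by (auto simp: continuous_map_in_subtopology continuous_map_from_subtopology)
  from continuous_map_compose[OF this SmD(4)[OF g(2)]]
  have c: "continuous_map (subtopology (dqv E) (dq_dom K E U)) (vtop F) (\<lambda>p. g (?j p))"
    by (simp add: o_def case_prod_unfold)
  have "is_dq K E F U f (\<lambda>p. g (?j p))"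
  proof (rule is_dqI[OF E F U smo_Pi[OF f] c])
    fix x y t assume m: "(x, y, t) \<in> dq_dom K E U"
    from dstepD(2)[OF g(1) jm[OF m]] show "f (x \<oplus>\<^bsub>E\<^esub> t \<odot>\<^bsub>E\<^esub> y) = f x \<oplus>\<^bsub>F\<^esub> t \<odot>\<^bsub>F\<^esub> g (?j (x, y, t))"
      using m by (simp add: image_tvs_simps inj_Base)
  qed
  then show ?thesis unfolding dq_def by (rule someI[of "is_dq K E F U f"])
qed

lemma dq_eqI:
  assumes f: "smo E F U f" and "is_dq K E F U f g" "(x, y, t) \<in> dq_dom K E U"
  shows "dq K E F U f (x, y, t) = g (x, y, t)"
  by (rule is_dq_unique[OF smoD(1-3)[OF f] smo_Pi[OF f] smo_dq[OF f] assms(2,3)])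

text \<open>The right-hand side is continuous and satisfies the equation of a quotient of
  \<open>h\<close>, so uniqueness applies.\<close>

lemma dq_compose:
  assumes f: "smo E F U f" and g: "smo F G V g" and fV: "\<And>x. x \<in> U \<Longrightarrow> f x \<in> V"
    and h: "\<And>x. x \<in> U \<Longrightarrow> h x = g (f x)" and m: "(x, y, t) \<in> dq_dom K E U"
  shows "dq K E G U h (x, y, t) = dq K F G V g (f x, dq K E F U f (x, y, t), t)"
proof -
  note E = smoD(1)[OF f] and F = smoD(2)[OF f] and G = smoD(2)[OF g]
  note U = openin_carrier[OF E smoD(3)[OF f]] and V = openin_carrier[OF F smoD(3)[OF g]]
  note df = is_dqD[OF E F U smo_Pi[OF f] smo_dq[OF f]] and dg = is_dqD[OF F G V smo_Pi[OF g] smo_dq[OF g]]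
  have sh: "smo E G U h" by (rule smo_cong[OF smo_compose[OF g f fV] h])
  have mV: "(f x, dq K E F U f (x, y, t), t) \<in> dq_dom K F V" if "(x, y, t) \<in> dq_dom K E U" for x y t
    using that df[OF that] fV by (auto simp: mem_dq_dom simp flip: df(2)[OF that])
  let ?k = "\<lambda>p. dq K F G V g (f (fst p), dq K E F U f p, snd (snd p))"
  have "continuous_map (subtopology (dqv E) (dq_dom K E U)) (vtop G) ?k"
  proof (rule dq_line[OF F])
    show "continuous_map (subtopology (dqv F) (dq_dom K F V)) (vtop G) (dq K F G V g)"
      using smo_dq[OF g] by (simp add: is_dq_def)
    show "continuous_map (subtopology (dqv E) (dq_dom K E U)) (vtop F) (dq K E F U f)"
      using smo_dq[OF f] by (simp add: is_dq_def)
    have "continuous_map (subtopology (dqv E) (dq_dom K E U)) (subtopology (vtop E) U) fst"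
      by (auto simp: continuous_map_in_subtopology continuous_map_from_subtopology continuous_map_fst mem_dq_dom)
    from continuous_map_compose[OF this smoD(4)[OF f]]
    show "continuous_map (subtopology (dqv E) (dq_dom K E U)) (vtop F) (\<lambda>p. f (fst p))" by (simp add: o_def)
    show "continuous_map (subtopology (dqv E) (dq_dom K E U)) (ktop K) (\<lambda>p. snd (snd p))"
      using clinD(4)[OF clin_compose[OF clin_snd clin_snd], of E E "scalar_tvs K"] by (simp add: continuous_map_from_subtopology)
    show "(f (fst p), dq K E F U f p, snd (snd p)) \<in> dq_dom K F V"
      if "p \<in> topspace (subtopology (dqv E) (dq_dom K E U))" for p
      using that mV unfolding topspace_dq_dom[OF E U] by (cases p) auto
  qed
  then have "is_dq K E G U h ?k"
    by (rule is_dqI[OF E G U smo_Pi[OF sh]])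
      (use df(2) dg(2)[OF mV] h in \<open>auto simp: mem_dq_dom\<close>)
  from dq_eqI[OF sh this m] show ?thesis by simp
qed

lemma dq_subset:
  assumes f: "smo E F U f" and V: "openin (vtop E) V" "V \<subseteq> U" and h: "\<And>x. x \<in> V \<Longrightarrow> h x = f x"
    and m: "(x, y, t) \<in> dq_dom K E V"
  shows "dq K E F V h (x, y, t) = dq K E F U f (x, y, t)"
proof (rule dq_eqI[OF smo_cong[OF smo_subset[OF f V] h] is_dq_cong[OF _ h] m])
  have "dq_dom K E V \<subseteq> dq_dom K E U" using V(2) by (auto simp: dq_dom_def)
  then show "is_dq K E F V f (dq K E F U f)"
    using smo_dq[OF f] continuous_map_from_subtopology_mono unfolding is_dq_def by blast
qed auto

lemma dq_id:
  assumes E: "TVS E" and U: "openin (vtop E) U" and h: "\<And>x. x \<in> U \<Longrightarrow> h x = x" and m: "(x, y, t) \<in> dq_dom K E U"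
  shows "dq K E E U h (x, y, t) = y"
proof -
  have "is_dq K E E U (\<lambda>x. x) (\<lambda>p. fst (snd p))"
  proof (rule is_dqI[OF E E openin_carrier[OF E U]])
    show "continuous_map (subtopology (dqv E) (dq_dom K E U)) (vtop E) (\<lambda>p. fst (snd p))"
      using clinD(4)[OF clin_compose[OF clin_snd clin_fst], of E E "scalar_tvs K"] by (simp add: continuous_map_from_subtopology)
  qed (use openin_carrier[OF E U] in auto)
  from dq_eqI[OF smo_cong[OF smo_id[OF E U] h] is_dq_cong[OF this h] m] show ?thesis by simp
qed

text \<open>For small \<open>s\<close>, a step along \<open>y + z\<close> is a step along
  \<open>y\<close> followed by one along \<open>z\<close> from \<open>x + s y\<close>; likewise
  \<open>s (c y) = (s c) y\<close>. The resulting identities between quotients hold before the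
  limit, and at \<open>s = \<zero>\<close> they become additivity and homogeneity.\<close>

lemma clin_dq:
  assumes f: "smo E F U f" and x: "x \<in> U" shows "clin E F (\<lambda>y. dq K E F U f (x, y, \<zero>))"
proof -
  note E = smoD(1)[OF f] and F = smoD(2)[OF f] and Uo = smoD(3)[OF f]
  interpret E: topological_vector_space K E by (rule E)
  interpret F: topological_vector_space K F by (rule F)
  note U = openin_carrier[OF E Uo]
  have xc: "x \<in> carrier E" using x U by blast
  let ?g = "dq K E F U f"
  note d = is_dqD[OF E F U smo_Pi[OF f] smo_dq[OF f]]
  have gc: "continuous_map (subtopology (dqv E) (dq_dom K E U)) (vtop F) ?g"
    using smo_dq[OF f] by (simp add: is_dq_def)
  have m0: "(x, y, \<zero>) \<in> dq_dom K E U" if "y \<in> carrier E" for y using dq_zero_mem[OF E U x that] .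
  have "continuous_map (vtop E) (vtop F) (\<lambda>y. ?g (x, y, \<zero>))"
    by (rule dq_line[OF E gc]) (use xc m0 in \<open>auto simp: E.topspace_vtop\<close>)
  moreover have "?g (x, y \<oplus>\<^bsub>E\<^esub> z, \<zero>) = ?g (x, y, \<zero>) \<oplus>\<^bsub>F\<^esub> ?g (x, z, \<zero>)" if y: "y \<in> carrier E" and z: "z \<in> carrier E" for y z
  proof -
    \<comment> \<open>The scalars for which both the intermediate point and the endpoint stay in
      \<open>U\<close>.\<close>
    define A where "A = {s \<in> carrier K. x \<oplus>\<^bsub>E\<^esub> s \<odot>\<^bsub>E\<^esub> y \<in> U} \<inter> {s \<in> carrier K. x \<oplus>\<^bsub>E\<^esub> s \<odot>\<^bsub>E\<^esub> (y \<oplus>\<^bsub>E\<^esub> z) \<in> U}"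
    have lin: "continuous_map (ktop K) (vtop E) (\<lambda>s. x \<oplus>\<^bsub>E\<^esub> s \<odot>\<^bsub>E\<^esub> w)" if "w \<in> carrier E" for w
      using xc that by (intro tvs_cont_add tvs_cont_smult E) (auto simp: E.topspace_vtop)
    have A: "openin (ktop K) A"
      using openin_continuous_map_preimage[OF lin Uo, of y] openin_continuous_map_preimage[OF lin Uo, of "y \<oplus>\<^bsub>E\<^esub> z"] y z
      by (simp add: A_def openin_Int)
    have A0: "\<zero> \<in> A" using xc x y z by (simp add: A_def)
    have ts: "topspace (subtopology (ktop K) A) = A" using openin_subset[OF A] by auto
    have e: "x \<oplus>\<^bsub>E\<^esub> s \<odot>\<^bsub>E\<^esub> y \<oplus>\<^bsub>E\<^esub> s \<odot>\<^bsub>E\<^esub> z = x \<oplus>\<^bsub>E\<^esub> s \<odot>\<^bsub>E\<^esub> (y \<oplus>\<^bsub>E\<^esub> z)" if "s \<in> carrier K" for s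
      using xc y z that by (simp add: E.smult_r_distr E.a_assoc)
    have mA: "(x, y, s) \<in> dq_dom K E U" "(x, y \<oplus>\<^bsub>E\<^esub> z, s) \<in> dq_dom K E U"
      "(x \<oplus>\<^bsub>E\<^esub> s \<odot>\<^bsub>E\<^esub> y, z, s) \<in> dq_dom K E U" if "s \<in> A" for s
      using that x y z e[of s] by (auto simp: A_def mem_dq_dom)
    have "?g (x, y \<oplus>\<^bsub>E\<^esub> z, \<zero>) = ?g (x, y, \<zero>) \<oplus>\<^bsub>F\<^esub> ?g (x \<oplus>\<^bsub>E\<^esub> \<zero> \<odot>\<^bsub>E\<^esub> y, z, \<zero>)"
    proof (rule dq_limit[OF E F A A0, where w = "\<lambda>_. f x" and f = "\<lambda>s. ?g (x, y \<oplus>\<^bsub>E\<^esub> z, s)"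
        and g = "\<lambda>s. ?g (x, y, s) \<oplus>\<^bsub>F\<^esub> ?g (x \<oplus>\<^bsub>E\<^esub> s \<odot>\<^bsub>E\<^esub> y, z, s)"])
      show "continuous_map (subtopology (ktop K) A) (vtop F) (\<lambda>s. ?g (x, y \<oplus>\<^bsub>E\<^esub> z, s))"
        by (rule dq_line[OF E gc]) (use xc y z mA ts in \<open>auto simp: E.topspace_vtop continuous_map_from_subtopology\<close>)
      show "continuous_map (subtopology (ktop K) A) (vtop F) (\<lambda>s. ?g (x, y, s) \<oplus>\<^bsub>F\<^esub> ?g (x \<oplus>\<^bsub>E\<^esub> s \<odot>\<^bsub>E\<^esub> y, z, s))"
      proof (rule tvs_cont_add[OF F])
        show "continuous_map (subtopology (ktop K) A) (vtop F) (\<lambda>s. ?g (x, y, s))"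
          by (rule dq_line[OF E gc]) (use xc y z mA ts in \<open>auto simp: E.topspace_vtop continuous_map_from_subtopology\<close>)
        show "continuous_map (subtopology (ktop K) A) (vtop F) (\<lambda>s. ?g (x \<oplus>\<^bsub>E\<^esub> s \<odot>\<^bsub>E\<^esub> y, z, s))"
          by (rule dq_line[OF E gc]) (use xc y z mA ts lin[OF y] in \<open>auto simp: E.topspace_vtop continuous_map_from_subtopology\<close>)
      qed
      show "f x \<in> carrier F" by (rule smoD(6)[OF f x])
      fix s assume s: "s \<in> A"
      then have sc: "s \<in> carrier K" by (simp add: A_def)
      note g1 = d[OF mA(1)[OF s]] and g2 = d[OF mA(2)[OF s]] and g3 = d[OF mA(3)[OF s]]
      show "f x \<oplus>\<^bsub>F\<^esub> s \<odot>\<^bsub>F\<^esub> ?g (x, y \<oplus>\<^bsub>E\<^esub> z, s) =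
        f x \<oplus>\<^bsub>F\<^esub> s \<odot>\<^bsub>F\<^esub> (?g (x, y, s) \<oplus>\<^bsub>F\<^esub> ?g (x \<oplus>\<^bsub>E\<^esub> s \<odot>\<^bsub>E\<^esub> y, z, s))"
        unfolding g2(2)[symmetric] e[OF sc, symmetric] g3(2) g1(2)
        using g1(1) g3(1) smoD(6)[OF f x] sc by (simp add: F.smult_r_distr F.a_assoc)
    qed
    then show ?thesis using xc y by simp
  qed
  moreover have "?g (x, c \<odot>\<^bsub>E\<^esub> y, \<zero>) = c \<odot>\<^bsub>F\<^esub> ?g (x, y, \<zero>)" if c: "c \<in> carrier K" and y: "y \<in> carrier E" for c y
  proof -
    define A where "A = {s \<in> carrier K. x \<oplus>\<^bsub>E\<^esub> s \<odot>\<^bsub>E\<^esub> (c \<odot>\<^bsub>E\<^esub> y) \<in> U}"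
    have lin: "continuous_map (ktop K) (vtop E) (\<lambda>s. x \<oplus>\<^bsub>E\<^esub> s \<odot>\<^bsub>E\<^esub> w)" if "w \<in> carrier E" for w
      using xc that by (intro tvs_cont_add tvs_cont_smult E) (auto simp: E.topspace_vtop)
    have A: "openin (ktop K) A"
      using openin_continuous_map_preimage[OF lin Uo, of "c \<odot>\<^bsub>E\<^esub> y"] y c by (simp add: A_def)
    have A0: "\<zero> \<in> A" using xc x y c by (simp add: A_def)
    have ts: "topspace (subtopology (ktop K) A) = A" using openin_subset[OF A] by auto
    have e: "x \<oplus>\<^bsub>E\<^esub> s \<odot>\<^bsub>E\<^esub> (c \<odot>\<^bsub>E\<^esub> y) = x \<oplus>\<^bsub>E\<^esub> (s \<otimes> c) \<odot>\<^bsub>E\<^esub> y" if "s \<in> carrier K" for s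
      using that c y by (simp add: E.smult_assoc1)
    have mA: "(x, c \<odot>\<^bsub>E\<^esub> y, s) \<in> dq_dom K E U" "(x, y, s \<otimes> c) \<in> dq_dom K E U" if "s \<in> A" for s
      using that x y c e[of s] by (auto simp: A_def mem_dq_dom)
    have "?g (x, c \<odot>\<^bsub>E\<^esub> y, \<zero>) = c \<odot>\<^bsub>F\<^esub> ?g (x, y, \<zero> \<otimes> c)"
    proof (rule dq_limit[OF E F A A0, where w = "\<lambda>_. f x" and f = "\<lambda>s. ?g (x, c \<odot>\<^bsub>E\<^esub> y, s)"
        and g = "\<lambda>s. c \<odot>\<^bsub>F\<^esub> ?g (x, y, s \<otimes> c)"])
      show "continuous_map (subtopology (ktop K) A) (vtop F) (\<lambda>s. ?g (x, c \<odot>\<^bsub>E\<^esub> y, s))"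
        by (rule dq_line[OF E gc]) (use xc y c mA ts in \<open>auto simp: E.topspace_vtop continuous_map_from_subtopology\<close>)
      have "continuous_map (subtopology (ktop K) A) (ktop K) (\<lambda>s. s \<otimes> c)"
        using c by (intro kcont_mult) (auto simp: continuous_map_from_subtopology)
      then have "continuous_map (subtopology (ktop K) A) (vtop F) (\<lambda>s. ?g (x, y, s \<otimes> c))"
        by (intro dq_line[OF E gc]) (use xc y c mA ts in \<open>auto simp: E.topspace_vtop\<close>)
      then show "continuous_map (subtopology (ktop K) A) (vtop F) (\<lambda>s. c \<odot>\<^bsub>F\<^esub> ?g (x, y, s \<otimes> c))"
        using c by (intro tvs_cont_smult F) auto
      show "f x \<in> carrier F" by (rule smoD(6)[OF f x])
      fix s assume s: "s \<in> A"
      then have sc: "s \<in> carrier K" by (simp add: A_def)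
      note g1 = d[OF mA(1)[OF s]] and g2 = d[OF mA(2)[OF s]]
      show "f x \<oplus>\<^bsub>F\<^esub> s \<odot>\<^bsub>F\<^esub> ?g (x, c \<odot>\<^bsub>E\<^esub> y, s) = f x \<oplus>\<^bsub>F\<^esub> s \<odot>\<^bsub>F\<^esub> (c \<odot>\<^bsub>F\<^esub> ?g (x, y, s \<otimes> c))"
        unfolding g1(2)[symmetric] e[OF sc] g2(2) using g2(1) sc c by (simp add: F.smult_assoc1)
    qed
    then show ?thesis using c by simp
  qed
  moreover have "(\<lambda>y. ?g (x, y, \<zero>)) \<in> carrier E \<rightarrow> carrier F" using d(1)[OF m0] by blast
  ultimately show ?thesis by (auto simp: clin_def)
qed

text \<open>By the chain rule the differentials of the transition maps form a cocycle, so a tangent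
  vector is determined by its entry at one chart, and every vector of \<open>E\<close> occurs there.
  The other entries depend continuously on that one, which makes the evaluation a
  homeomorphism.\<close>

lemma tangent_space_iso:
  assumes M: "mfd E M" and p: "p \<in> topspace (mtop M)"
  shows "TVS (tangent_space K E M p) \<and> (\<exists>\<iota> e. clin E (tangent_space K E M p) \<iota> \<and> clin (tangent_space K E M p) E e \<and>
     (\<forall>y\<in>carrier E. e (\<iota> y) = y) \<and> (\<forall>v\<in>carrier (tangent_space K E M p). \<iota> (e v) = v))"
proof -
  let ?L = "tangent_space K E M p" and ?C = "charts_at M p"
  note E = mfdD(1)[OF M]
  interpret E: topological_vector_space K E by (rule E)
  define D where "D = (\<lambda>c d y. dq K E E (transition_dom c d) (transition c d) (snd c p, y, \<zero>))"
  have tr: "smo E E (transition_dom c d) (transition c d)" if "c \<in> ?C" "d \<in> ?C" for c d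
    using that mfd_transition[OF M] by (cases c; cases d) (auto simp: charts_at_def transition_dom_def transition_def o_def)
  have pm: "snd c p \<in> transition_dom c d" if "c \<in> ?C" "d \<in> ?C" for c d
    using that by (auto simp: charts_at_def transition_dom_def)
  have cl: "clin E E (D c d)" if "c \<in> ?C" "d \<in> ?C" for c d
    unfolding D_def by (rule clin_dq[OF tr[OF that] pm[OF that]])
  note Dc = clinD(1)[OF cl]
  have iv: "inv_into (fst c) (snd c) (snd c q) = q" if "c \<in> ?C" "q \<in> fst c" for c q
    using that top_chartD(4)[OF mfd_chart[OF M]] by (cases c) (auto simp: charts_at_def)
  have comp: "D d e (D c d y) = D c e y" if c: "c \<in> ?C" and d: "d \<in> ?C" and e: "e \<in> ?C" and y: "y \<in> carrier E" for c d e y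
  proof -
    \<comment> \<open>The chain rule is applied where all three charts are defined;
      \<open>dq_subset\<close> identifies the differentials there with those on the larger
      transition domains.\<close>
    let ?W = "snd c ` (fst c \<inter> fst d \<inter> fst e)"
    have "openin (mtop M) (fst c \<inter> fst d \<inter> fst e)"
      using c d e top_chartD(1)[OF mfd_chart[OF M]] by (cases c; cases d; cases e) (auto simp: charts_at_def intro!: openin_Int)
    then have W: "openin (vtop E) ?W" using top_chartD(7)[OF mfd_chart[OF M, of "fst c" "snd c"]] c by (auto simp: charts_at_def)
    have Wc: "?W \<subseteq> carrier E" by (rule openin_carrier[OF E W])
    have pW: "snd c p \<in> ?W" using c d e by (auto simp: charts_at_def)
    have sub: "?W \<subseteq> transition_dom c d" "?W \<subseteq> transition_dom c e" by (auto simp: transition_dom_def)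
    have s: "smo E E ?W (transition c d)" by (rule smo_subset[OF tr[OF c d] W sub(1)])
    have val: "transition c d (snd c q) = snd d q" "transition d e (snd d q) = snd e q" "transition c e (snd c q) = snd e q"
      if "q \<in> fst c \<inter> fst d \<inter> fst e" for q using that iv c d by (auto simp: transition_def)
    have m: "(snd c p, y, \<zero>) \<in> dq_dom K E ?W" by (rule dq_zero_mem[OF E Wc pW y])
    have "dq K E E ?W (transition c e) (snd c p, y, \<zero>) =
        dq K E E (transition_dom d e) (transition d e) (transition c d (snd c p), dq K E E ?W (transition c d) (snd c p, y, \<zero>), \<zero>)"
      by (rule dq_compose[OF s tr[OF d e] _ _ m]) (use val in \<open>auto simp: transition_dom_def\<close>)
    moreover have "dq K E E ?W (transition c e) (snd c p, y, \<zero>) = D c e y"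
      unfolding D_def by (rule dq_subset[OF tr[OF c e] W sub(2) _ m]) auto
    moreover have "dq K E E ?W (transition c d) (snd c p, y, \<zero>) = D c d y"
      unfolding D_def by (rule dq_subset[OF tr[OF c d] W sub(1) _ m]) auto
    moreover have "transition c d (snd c p) = snd d p" using val(1)[of p] c d e by (auto simp: charts_at_def)
    ultimately show ?thesis by (simp add: D_def)
  qed
  have Did: "D c c y = y" if c: "c \<in> ?C" and y: "y \<in> carrier E" for c y
  proof -
    have o: "openin (vtop E) (transition_dom c c)" by (rule smoD(3)[OF tr[OF c c]])
    show ?thesis unfolding D_def
      by (rule dq_id[OF E o _ dq_zero_mem[OF E openin_carrier[OF E o] pm[OF c c] y]])
        (use iv[OF c] in \<open>auto simp: transition_def transition_dom_def\<close>)
  qed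
  have car: "carrier ?L = {v \<in> ?C \<rightarrow>\<^sub>E carrier E. \<forall>c\<in>?C. \<forall>d\<in>?C. v d = D c d (v c)}"
    by (simp add: tangent_space_def tangent_carrier_def D_def)
  have memL: "(\<lambda>c\<in>?C. g c) \<in> carrier ?L" if g: "\<And>c. c \<in> ?C \<Longrightarrow> g c \<in> carrier E"
    and gD: "\<And>c d. c \<in> ?C \<Longrightarrow> d \<in> ?C \<Longrightarrow> g d = D c d (g c)" for g
    unfolding car
  proof (intro CollectI conjI ballI)
    show "(\<lambda>c\<in>?C. g c) \<in> ?C \<rightarrow>\<^sub>E carrier E" using g by (simp add: restrict_PiE_iff)
    fix c d assume cd: "c \<in> ?C" "d \<in> ?C"
    show "(\<lambda>c\<in>?C. g c) d = D c d ((\<lambda>c\<in>?C. g c) c)"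
      unfolding restrict_apply'[OF cd(1)] restrict_apply'[OF cd(2)] by (rule gD[OF cd])
  qed
  obtain U0 \<phi>0 where "(U0, \<phi>0) \<in> atlas M" "p \<in> U0" using mfdD(3)[OF M p] by blast
  then have c0: "(U0, \<phi>0) \<in> ?C" by (simp add: charts_at_def)
  define c0 where "c0 = (U0, \<phi>0)"
  have c0: "c0 \<in> ?C" using c0 by (simp add: c0_def)
  \<comment> \<open>The inverse of the evaluation at \<open>c0\<close>: its entry at
    \<open>c\<close> is forced by the transformation rule, and \<open>comp\<close> shows that the
    entries fit together.\<close>
  define \<iota> where "\<iota> = (\<lambda>y. \<lambda>c\<in>?C. D c0 c y)"
  have \<iota>c: "\<iota> y \<in> carrier ?L" if y: "y \<in> carrier E" for y
    unfolding \<iota>_def by (rule memL) (use Dc[OF c0 _ y] comp[OF c0 _ _ y] in simp_all)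
  have ev_\<iota>: "\<iota> y c0 = y" if "y \<in> carrier E" for y using Did[OF c0 that] c0 by (simp add: \<iota>_def)
  have \<iota>_ev: "\<iota> (v c0) = v" if v: "v \<in> carrier ?L" for v
  proof
    fix c
    have vC: "v \<in> ?C \<rightarrow>\<^sub>E carrier E" and vD: "\<forall>c\<in>?C. \<forall>d\<in>?C. v d = D c d (v c)"
      using CollectD[OF v[unfolded car]] by (rule conjunct1, rule conjunct2)
    show "\<iota> (v c0) c = v c"
    proof (cases "c \<in> ?C")
      case True
      then have "v c = D c0 c (v c0)" using vD c0 by blast
      then show ?thesis using True by (simp add: \<iota>_def)
    next
      case False
      then show ?thesis using PiE_arb[OF vC False] by (simp add: \<iota>_def)
    qed
  qed
  have evc: "v c \<in> carrier E" if "v \<in> carrier ?L" "c \<in> ?C" for v c using that unfolding car by blast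
  have vL: "vtop ?L = subtopology (product_topology (\<lambda>c. vtop E) ?C) (carrier ?L)"
    by (simp add: tangent_space_def)
  have tsL: "topspace (vtop ?L) = carrier ?L"
  proof -
    have "carrier ?L \<subseteq> (\<Pi>\<^sub>E c\<in>?C. carrier E)" unfolding car by blast
    then show ?thesis unfolding vL by (simp add: E.topspace_vtop inf.absorb2)
  qed
  have ce: "continuous_map (vtop ?L) (vtop E) (\<lambda>v. v c0)"
    unfolding vL using c0 by (intro continuous_map_from_subtopology continuous_map_product_projection)
  have c\<iota>: "continuous_map (vtop E) (vtop ?L) \<iota>"
    unfolding vL continuous_map_in_subtopology
  proof
    show "continuous_map (vtop E) (product_topology (\<lambda>c. vtop E) ?C) \<iota>"
      unfolding continuous_map_componentwise
    proof (intro conjI ballI)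
      show "\<iota> ` topspace (vtop E) \<subseteq> extensional ?C" by (auto simp: \<iota>_def)
      fix c assume c: "c \<in> ?C"
      show "continuous_map (vtop E) (vtop E) (\<lambda>x. \<iota> x c)" using clinD(4)[OF cl[OF c0 c]] c by (simp add: \<iota>_def)
    qed
    show "\<iota> \<in> topspace (vtop E) \<rightarrow> carrier ?L" using \<iota>c by (simp add: E.topspace_vtop)
  qed
  have addL: "v \<oplus>\<^bsub>?L\<^esub> w = (\<lambda>c\<in>?C. v c \<oplus>\<^bsub>E\<^esub> w c)" "a \<odot>\<^bsub>?L\<^esub> v = (\<lambda>c\<in>?C. a \<odot>\<^bsub>E\<^esub> v c)" "\<zero>\<^bsub>?L\<^esub> = (\<lambda>c\<in>?C. \<zero>\<^bsub>E\<^esub>)" for v w a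
    by (simp_all add: tangent_space_def)
  have addc: "v \<oplus>\<^bsub>?L\<^esub> w \<in> carrier ?L" if v: "v \<in> carrier ?L" and w: "w \<in> carrier ?L" for v w
  proof -
    have "v d \<oplus>\<^bsub>E\<^esub> w d = D c d (v c \<oplus>\<^bsub>E\<^esub> w c)" if "c \<in> ?C" "d \<in> ?C" for c d
    proof -
      have "v d = D c d (v c)" "w d = D c d (w c)" using v w that unfolding car by blast+
      then show ?thesis using clinD(2)[OF cl[OF that] evc[OF v that(1)] evc[OF w that(1)]] by metis
    qed
    moreover have "v c \<oplus>\<^bsub>E\<^esub> w c \<in> carrier E" if "c \<in> ?C" for c using evc[OF v that] evc[OF w that] by simp
    ultimately show ?thesis unfolding addL by (rule memL[rotated])
  qed
  have smc: "a \<odot>\<^bsub>?L\<^esub> v \<in> carrier ?L" if a: "a \<in> carrier K" and v: "v \<in> carrier ?L" for a v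
  proof -
    have "a \<odot>\<^bsub>E\<^esub> v d = D c d (a \<odot>\<^bsub>E\<^esub> v c)" if "c \<in> ?C" "d \<in> ?C" for c d
    proof -
      have "v d = D c d (v c)" using v that unfolding car by blast
      then show ?thesis using clinD(3)[OF cl[OF that] a evc[OF v that(1)]] by metis
    qed
    moreover have "a \<odot>\<^bsub>E\<^esub> v c \<in> carrier E" if "c \<in> ?C" for c using evc[OF v that] a by simp
    ultimately show ?thesis unfolding addL by (rule memL[rotated])
  qed
  have zc: "\<zero>\<^bsub>?L\<^esub> \<in> carrier ?L"
    unfolding addL by (rule memL) (use clin_zero[OF cl E E] in simp_all)
  have bij: "bij_betw (\<lambda>v. v c0) (carrier ?L) (carrier E)"
    by (rule bij_betw_byWitness[of _ \<iota>]) (use \<iota>_ev ev_\<iota> \<iota>c evc[OF _ c0] in auto)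
  have hm: "homeomorphic_maps (vtop ?L) (vtop E) (\<lambda>v. v c0) \<iota>"
    using ce c\<iota> \<iota>_ev ev_\<iota> by (simp add: homeomorphic_maps_def tsL E.topspace_vtop)
  have TL: "TVS ?L"
  proof (rule tvs_transport[OF E bij zc])
    show "homeomorphic_map (vtop ?L) (vtop E) (\<lambda>v. v c0)" using hm homeomorphic_maps_map by blast
  qed (use c0 tsL addc smc in \<open>auto simp: addL\<close>)
  have ce': "clin ?L E (\<lambda>v. v c0)" using ce evc[OF _ c0] c0 by (auto simp: clin_def addL)
  have "clin E ?L \<iota>"
    unfolding clin_def
  proof (intro conjI ballI c\<iota>)
    show "\<iota> \<in> carrier E \<rightarrow> carrier ?L" using \<iota>c by blast
    show "\<iota> (x \<oplus>\<^bsub>E\<^esub> y) = \<iota> x \<oplus>\<^bsub>?L\<^esub> \<iota> y" if "x \<in> carrier E" "y \<in> carrier E" for x y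
      using clinD(2)[OF cl[OF c0] that] by (auto simp: \<iota>_def addL intro!: restrict_ext)
    show "\<iota> (a \<odot>\<^bsub>E\<^esub> x) = a \<odot>\<^bsub>?L\<^esub> \<iota> x" if "a \<in> carrier K" "x \<in> carrier E" for a x
      using clinD(3)[OF cl[OF c0] that] by (auto simp: \<iota>_def addL intro!: restrict_ext)
  qed
  then show ?thesis using TL ce' ev_\<iota> \<iota>_ev by blast
qed

end

section \<open>Weak direct products of Lie groups\<close>

context valued_field begin

section \<open>Charts into tangent spaces, translations, equality of manifold structures\<close>

lemma chart_into_iff:
  assumes M: "mfd E M" and L: "TVS L"
  shows "chart_into K E M L U V \<kappa> \<longleftrightarrow> openin (mtop M) U \<and> openin (vtop L) V \<and> bij_betw \<kappa> U V \<and>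
     (\<forall>p\<in>U. sat E M L (tvs_mfd K L) \<kappa> p) \<and> (\<forall>x\<in>V. sat L (tvs_mfd K L) E M (inv_into U \<kappa>) x)"
  using diffeomorphism_iff[OF M mfd_tvs(1)[OF L], of U V \<kappa>] by (auto simp: chart_into_def)

lemma chart_intoD:
  assumes M: "mfd E M" and L: "TVS L" and c: "chart_into K E M L U V \<kappa>"
  shows "openin (mtop M) U" "openin (vtop L) V" "\<And>p. p \<in> U \<Longrightarrow> \<kappa> p \<in> V" "\<And>x. x \<in> V \<Longrightarrow> inv_into U \<kappa> x \<in> U"
    "\<And>p. p \<in> U \<Longrightarrow> inv_into U \<kappa> (\<kappa> p) = p" "\<And>x. x \<in> V \<Longrightarrow> \<kappa> (inv_into U \<kappa> x) = x"
    "\<And>p. p \<in> U \<Longrightarrow> sat E M L (tvs_mfd K L) \<kappa> p" "\<And>x. x \<in> V \<Longrightarrow> sat L (tvs_mfd K L) E M (inv_into U \<kappa>) x"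
    "V \<subseteq> carrier L"
proof -
  have b: "bij_betw \<kappa> U V" using c chart_into_iff[OF M L] by blast
  show "openin (mtop M) U" and o: "openin (vtop L) V" and "\<And>p. p \<in> U \<Longrightarrow> sat E M L (tvs_mfd K L) \<kappa> p"
    "\<And>x. x \<in> V \<Longrightarrow> sat L (tvs_mfd K L) E M (inv_into U \<kappa>) x" using c chart_into_iff[OF M L] by blast+
  show "V \<subseteq> carrier L" by (rule openin_carrier[OF L o])
  show "\<And>p. p \<in> U \<Longrightarrow> \<kappa> p \<in> V" using b by (rule bij_betw_apply)
  show "\<And>x. x \<in> V \<Longrightarrow> inv_into U \<kappa> x \<in> U" using bij_betw_inv_into[OF b] by (rule bij_betw_apply)
  show "\<And>p. p \<in> U \<Longrightarrow> inv_into U \<kappa> (\<kappa> p) = p" using b by (rule bij_betw_inv_into_left)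
  show "\<And>x. x \<in> V \<Longrightarrow> \<kappa> (inv_into U \<kappa> x) = x" using b by (rule bij_betw_inv_into_right)
qed

text \<open>Any chart at \<open>p\<close> will do, after subtraction of its value at
  \<open>p\<close> and composition with the isomorphism \<open>\<iota>\<close>; the subtraction
  takes care of the normalisation at \<open>p\<close>.\<close>

lemma chart_into_exists:
  assumes M: "mfd E M" and p: "p \<in> topspace (mtop M)" and L: "TVS L"
    and \<iota>: "clin E L \<iota>" and e: "clin L E e" and inv: "\<And>y. y \<in> carrier E \<Longrightarrow> e (\<iota> y) = y" "\<And>v. v \<in> carrier L \<Longrightarrow> \<iota> (e v) = v"
  shows "\<exists>U V \<kappa>. chart_into K E M L U V \<kappa> \<and> p \<in> U \<and> \<kappa> p = \<zero>\<^bsub>L\<^esub>"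
proof -
  note E = mfdD(1)[OF M] and T = mfd_tvs(1)[OF L]
  interpret E: topological_vector_space K E by (rule E)
  interpret L: topological_vector_space K L by (rule L)
  obtain U \<phi> where c: "(U, \<phi>) \<in> atlas M" "p \<in> U" using mfdD(3)[OF M p] by blast
  note tc = top_chartD[OF mfd_chart[OF M c(1)]]
  note TE = mfd_tvs(1)[OF E]
  have \<phi>c: "\<phi> q \<in> carrier E" if "q \<in> U" for q using openin_carrier[OF E tc(3)] that by blast
  define \<kappa> where "\<kappa> = (\<lambda>q. \<iota> (\<phi> q \<ominus>\<^bsub>E\<^esub> \<phi> p))"
  define V where "V = {x \<in> carrier L. e x \<oplus>\<^bsub>E\<^esub> \<phi> p \<in> \<phi> ` U}"
  have s1: "smo E L (carrier E) (\<lambda>y. \<iota> (y \<ominus>\<^bsub>E\<^esub> \<phi> p))"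
    by (rule smo_compose[OF smo_clin[OF \<iota> E L openin_carrier_self[OF E]]
       smo_minus[OF smo_id smo_const]]) (use \<phi>c[OF c(2)] E openin_carrier_self[OF E] in auto)
  have s2: "smo L E (carrier L) (\<lambda>x. e x \<oplus>\<^bsub>E\<^esub> \<phi> p)"
    by (rule smo_add[OF smo_clin[OF e L E] smo_const]) (use \<phi>c[OF c(2)] L E openin_carrier_self[OF L] in auto)
  have V: "openin (vtop L) V" unfolding V_def by (rule smo_openin_preimage[OF s2 tc(3)])
  have add_minus: "(y \<ominus>\<^bsub>E\<^esub> a) \<oplus>\<^bsub>E\<^esub> a = y" "(y \<oplus>\<^bsub>E\<^esub> a) \<ominus>\<^bsub>E\<^esub> a = y" if "y \<in> carrier E" "a \<in> carrier E" for y a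
    using that by (simp_all add: a_minus_def E.a_assoc E.l_neg E.r_neg)
  define \<kappa>' where "\<kappa>' = (\<lambda>x. inv_into U \<phi> (e x \<oplus>\<^bsub>E\<^esub> \<phi> p))"
  have 1: "\<kappa> q \<in> V" "\<kappa>' (\<kappa> q) = q" if q: "q \<in> U" for q
  proof -
    have "e (\<kappa> q) \<oplus>\<^bsub>E\<^esub> \<phi> p = \<phi> q" using \<phi>c[OF q] \<phi>c[OF c(2)] by (simp add: \<kappa>_def inv(1) add_minus)
    then show "\<kappa> q \<in> V" "\<kappa>' (\<kappa> q) = q"
      using q \<phi>c[OF q] \<phi>c[OF c(2)] clinD(1)[OF \<iota>] tc(4) by (auto simp: V_def \<kappa>'_def \<kappa>_def)
  qed
  have 2: "\<kappa>' x \<in> U" "\<kappa> (\<kappa>' x) = x" if x: "x \<in> V" for x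
  proof -
    obtain q where q: "q \<in> U" "e x \<oplus>\<^bsub>E\<^esub> \<phi> p = \<phi> q" and xc: "x \<in> carrier L" using x by (auto simp: V_def)
    then have k: "\<kappa>' x = q" using tc(4) by (simp add: \<kappa>'_def)
    then show "\<kappa>' x \<in> U" using q by simp
    have "\<phi> q \<ominus>\<^bsub>E\<^esub> \<phi> p = e x" using q(2)[symmetric] clinD(1)[OF e xc] \<phi>c[OF c(2)] by (simp add: add_minus)
    then show "\<kappa> (\<kappa>' x) = x" using k inv(2)[OF xc] by (simp add: \<kappa>_def)
  qed
  have b: "bij_betw \<kappa> U V" by (rule bij_betw_byWitness[of _ \<kappa>']) (use 1 2 in auto)
  have inv_eq: "inv_into U \<kappa> x = \<kappa>' x" if "x \<in> V" for x
    using inv_into_f_f[OF bij_betw_imp_inj_on[OF b] 2(1)[OF that]] 2(2)[OF that] by simp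
  have "sat E M L (tvs_mfd K L) \<kappa> q" if q: "q \<in> U" for q
    unfolding \<kappa>_def
    by (rule sat_compose[OF M TE T smo_imp_sat[OF s1 \<phi>c[OF q]] sat_chart_map[OF M c(1) q]])
  moreover have "sat L (tvs_mfd K L) E M (inv_into U \<kappa>) x" if x: "x \<in> V" for x
  proof (rule sat_cong[OF T M _ _ x])
    have xc: "x \<in> carrier L" "e x \<oplus>\<^bsub>E\<^esub> \<phi> p \<in> \<phi> ` U" using x by (auto simp: V_def)
    show "sat L (tvs_mfd K L) E M \<kappa>' x" unfolding \<kappa>'_def
      by (rule sat_compose[OF T TE M sat_chart_inv[OF M c(1) xc(2)] smo_imp_sat[OF s2 xc(1)]])
    show "openin (mtop (tvs_mfd K L)) V" using V by simp
  qed (rule inv_eq)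
  moreover have "\<kappa> p = \<zero>\<^bsub>L\<^esub>"
    using \<phi>c[OF c(2)] clin_zero[OF \<iota> E L] by (simp add: \<kappa>_def a_minus_def E.r_neg)
  ultimately have "chart_into K E M L U V \<kappa>" "\<kappa> p = \<zero>\<^bsub>L\<^esub>"
    using tc(1) V b by (simp_all add: chart_into_iff[OF M L])
  then show ?thesis using c(2) by (intro exI conjI)
qed

text \<open>Converts germs into smooth maps between vector spaces on an explicit open domain, which
  is the form required by \<open>smo_box\<close>.\<close>

lemma chart_into_smo:
  assumes M: "mfd E M" and L: "TVS L" and c: "chart_into K E M L U V \<kappa>"
    and F: "TVS F" and A: "openin (vtop F) A" and f: "\<And>z. z \<in> A \<Longrightarrow> sat F (tvs_mfd K F) E M f z"
  shows "smo F L {z \<in> A. f z \<in> U} (\<lambda>z. \<kappa> (f z))"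
proof (rule sat_imp_smo[OF F L])
  note T = mfd_tvs(1)[OF F] and d = chart_intoD[OF M L c]
  show "openin (vtop F) {z \<in> A. f z \<in> U}"
  proof (subst openin_subopen, intro ballI)
    fix z assume z: "z \<in> {z \<in> A. f z \<in> U}"
    obtain W where "openin (vtop F) W" "z \<in> W" "f ` W \<subseteq> U"
      using sat_continuous[OF T M f[of z] d(1)] z by auto
    then show "\<exists>T. openin (vtop F) T \<and> z \<in> T \<and> T \<subseteq> {z \<in> A. f z \<in> U}"
      using z A by (intro exI[of _ "W \<inter> A"]) auto
  qed
  show "sat F (tvs_mfd K F) L (tvs_mfd K L) (\<lambda>z. \<kappa> (f z)) z" if "z \<in> {z \<in> A. f z \<in> U}" for z
    using that by (intro sat_compose[OF T M mfd_tvs(1)[OF L] d(7) f]) auto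
qed

lemma lie_groupD:
  assumes "lie_group K E G M"
  shows "group G" "mfd E M" "topspace (mtop M) = carrier G"
    "\<And>a b. a \<in> carrier G \<Longrightarrow> b \<in> carrier G \<Longrightarrow>
       sat (prod_tvs E E) (prod_mfd K E M E M) E M (\<lambda>(x, y). x \<otimes>\<^bsub>G\<^esub> y) (a, b)"
    "\<And>a. a \<in> carrier G \<Longrightarrow> sat E M E M (\<lambda>x. inv\<^bsub>G\<^esub> x) a"
proof -
  show "group G" and M: "mfd E M" and t: "topspace (mtop M) = carrier G" using assms by (auto simp: lie_group_def)
  show "sat (prod_tvs E E) (prod_mfd K E M E M) E M (\<lambda>(x, y). x \<otimes>\<^bsub>G\<^esub> y) (a, b)"
    if "a \<in> carrier G" "b \<in> carrier G" for a b
    using assms smooth_map_iff_sat[OF mfd_prod(1)[OF M M] M] that t by (auto simp: lie_group_def)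
  show "sat E M E M (\<lambda>x. inv\<^bsub>G\<^esub> x) a" if "a \<in> carrier G" for a
    using assms smooth_map_iff_sat[OF M M] that t by (auto simp: lie_group_def)
qed

lemma lie_group_translation:
  assumes G: "lie_group K E G M" and g: "g \<in> carrier G" and p: "p \<in> carrier G"
  shows "sat E M E M (\<lambda>x. g \<otimes>\<^bsub>G\<^esub> x) p"
proof -
  note M = lie_groupD(2)[OF G] and ts = lie_groupD(3)[OF G]
  have "sat E M (prod_tvs E E) (prod_mfd K E M E M) (\<lambda>x. (g, x)) p"
    by (rule sat_pair[OF M M M sat_const sat_id]) (use M g p ts in auto)
  from sat_compose[OF M mfd_prod(1)[OF M M] M lie_groupD(4)[OF G g p] this] show ?thesis by simp
qed

text \<open>Smoothness of the identity in both directions gives equal topologies and makes every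
  chart of one structure compatible with all charts of the other, hence a member of its maximal
  atlas.\<close>

lemma mfd_eqI:
  fixes S S' :: "('m, 'e) mfd"
  assumes S: "mfd E S" and S': "mfd E S'" and ts: "topspace (mtop S) = topspace (mtop S')"
    and i: "\<And>p. p \<in> topspace (mtop S) \<Longrightarrow> sat E S E S' (\<lambda>x. x) p" "\<And>p. p \<in> topspace (mtop S) \<Longrightarrow> sat E S' E S (\<lambda>x. x) p"
  shows "S = S'"
proof -
  have s: "smooth_map K E S E S' (\<lambda>x. x)" "smooth_map K E S' E S (\<lambda>x. x)"
    using i ts by (simp_all add: smooth_map_iff_sat[OF S S'] smooth_map_iff_sat[OF S' S])
  have op: "openin (mtop A) X" if "smooth_map K E A E B (\<lambda>x. x)" "topspace (mtop A) = topspace (mtop B)" "openin (mtop B) X"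
    for A B :: "('m, 'e) mfd" and X
  proof -
    have "continuous_map (mtop A) (mtop B) (\<lambda>x. x)" using that(1) by (simp add: smooth_map_def)
    from openin_continuous_map_preimage[OF this that(3)] have "openin (mtop A) {x \<in> topspace (mtop A). x \<in> X}" .
    moreover have "{x \<in> topspace (mtop A). x \<in> X} = X" using openin_subset[OF that(3)] that(2) by auto
    ultimately show ?thesis by simp
  qed
  have T: "mtop S = mtop S'" unfolding topology_eq using op[OF s(1) ts] op[OF s(2) ts[symmetric]] by blast
  have sub: "atlas A \<subseteq> atlas B" if A: "mfd E A" and B: "mfd E B" and AB: "smooth_map K E A E B (\<lambda>x. x)" and BA: "smooth_map K E B E A (\<lambda>x. x)"
    and T: "mtop A = mtop B" for A B :: "('m, 'e) mfd"
  proof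
    fix c assume c: "c \<in> atlas A"
    obtain U \<phi> where c': "c = (U, \<phi>)" by (cases c)
    have "(U, \<phi>) \<in> atlas B"
    proof (rule atlasI[OF B])
      show "top_chart E (mtop B) (U, \<phi>)" using mfd_chart[OF A] c c' T by simp
      fix V \<psi> assume d: "(V, \<psi>) \<in> atlas B"
      have "smooth_on K E E (\<phi> ` (U \<inter> (\<lambda>x. x) -` V)) (\<psi> \<circ> (\<lambda>x. x) \<circ> inv_into U \<phi>)"
        using AB c d unfolding smooth_map_def c' by blast
      moreover have "smooth_on K E E (\<psi> ` (V \<inter> (\<lambda>x. x) -` U)) (\<phi> \<circ> (\<lambda>x. x) \<circ> inv_into V \<psi>)"
        using BA c d unfolding smooth_map_def c' by blast
      ultimately show "smo E E (\<phi> ` (U \<inter> V)) (\<lambda>x. \<psi> (inv_into U \<phi> x)) \<and> smo E E (\<psi> ` (V \<inter> U)) (\<lambda>x. \<phi> (inv_into V \<psi> x))"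
        using mfdD(1)[OF A] by (simp add: smo_def o_def)
    qed
    then show "c \<in> atlas B" by (simp add: c')
  qed
  have "atlas S = atlas S'" using sub[OF S S' s T] sub[OF S' S s(2,1) T[symmetric]] by blast
  then show ?thesis using T by simp
qed

end

section \<open>The manifold structure on the weak direct product\<close>

locale lie_group_family = valued_field K for K :: "'k vfield" (structure) +
  fixes I :: "'i set" and G :: "'i \<Rightarrow> 'g monoid" and E :: "'i \<Rightarrow> ('k, 'e) tvs" and M :: "'i \<Rightarrow> ('g, 'e) mfd"
  assumes lie: "i \<in> I \<Longrightarrow> lie_group K (E i) (G i) (M i)"
begin

definition L :: "'i \<Rightarrow> ('k, ('g, 'e) tangent) tvs" where "L i = lie_alg K (E i) (G i) (M i)"

definition BL :: "('k, 'i \<Rightarrow> ('g, 'e) tangent) tvs" where "BL = box_sum I L"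

definition H :: "('i \<Rightarrow> 'g) monoid" where "H = sum_group I G"

lemmas grp = lie_groupD(1)[OF lie] and mf = lie_groupD(2)[OF lie] and tsM = lie_groupD(3)[OF lie]

lemma one_M: "i \<in> I \<Longrightarrow> \<one>\<^bsub>G i\<^esub> \<in> topspace (mtop (M i))"
  using tsM group.is_monoid[OF grp] monoid.one_closed by fastforce

lemma tvs_L:
  assumes "i \<in> I" shows "TVS (L i)"
  unfolding L_def lie_alg_def by (rule conjunct1[OF tangent_space_iso[OF mf[OF assms] one_M[OF assms]]])

lemma tvs_BL: "TVS BL"
  unfolding BL_def by (rule tvs_box_sum) (rule tvs_L)

lemma carrier_BL: "carrier BL = sum_carrier I L"
  by (simp add: BL_def box_sum_simps)

lemma vtop_BL: "vtop BL = wbox I (\<lambda>i. vtop (L i)) (sum_carrier I L)"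
  unfolding BL_def using box_topology_eq[of I L, OF tvs_L] by (simp add: box_sum_simps)

lemma group_H: "group H"
  unfolding H_def by (rule sum_group) (rule grp)

lemma carrier_H: "carrier H = {x \<in> \<Pi>\<^sub>E i\<in>I. carrier (G i). finite {i \<in> I. x i \<noteq> \<one>\<^bsub>G i\<^esub>}}"
  unfolding H_def by (rule carrier_sum_group) (rule grp)

lemma chart_exists:
  assumes "i \<in> I" "p \<in> carrier (G i)"
  shows "\<exists>U V \<kappa>. chart_into K (E i) (M i) (L i) U V \<kappa> \<and> p \<in> U \<and> \<kappa> p = \<zero>\<^bsub>L i\<^esub>"
proof -
  from conjunct2[OF tangent_space_iso[OF mf[OF assms(1)] one_M[OF assms(1)]]]
  obtain \<iota> e where 1: "clin (E i) (L i) \<iota>" "clin (L i) (E i) e" and 2: "\<forall>y\<in>carrier (E i). e (\<iota> y) = y" "\<forall>v\<in>carrier (L i). \<iota> (e v) = v"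
    unfolding L_def lie_alg_def by (elim exE conjE)
  have "p \<in> topspace (mtop (M i))" using tsM[OF assms(1)] assms(2) by simp
  then show ?thesis by (rule chart_into_exists[OF mf[OF assms(1)] _ tvs_L[OF assms(1)] 1 bspec[OF 2(1)] bspec[OF 2(2)]])
qed

text \<open>The exceptions are what makes box charts cover the group: at the finitely many
  coordinates where an element differs from \<open>\<one>\<close>, a chart around that coordinate is
  used, and it may miss \<open>\<one>\<close>.\<close>

definition adm where
  "adm U V \<kappa> \<longleftrightarrow> (\<forall>i\<in>I. chart_into K (E i) (M i) (L i) (U i) (V i) (\<kappa> i)) \<and>
     finite {i \<in> I. \<not> (\<one>\<^bsub>G i\<^esub> \<in> U i \<and> \<kappa> i \<one>\<^bsub>G i\<^esub> = \<zero>\<^bsub>L i\<^esub>)}"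

definition dom where "dom U = carrier H \<inter> (\<Pi>\<^sub>E i\<in>I. U i)"

text \<open>Restricted to \<open>dom U\<close> because charts are extensional; on
  \<open>img V\<close> its inverse is \<open>param\<close>, the map of the theorem
  (\<open>inv_cmap\<close>).\<close>

definition cmap where "cmap U \<kappa> = (\<lambda>g\<in>dom U. \<lambda>i\<in>I. \<kappa> i (g i))"

definition img where "img V = carrier BL \<inter> (\<Pi>\<^sub>E i\<in>I. V i)"

definition param where "param U \<kappa> x = (\<lambda>i\<in>I. inv_into (U i) (\<kappa> i) (x i))"

definition T0 where "T0 = wbox I (\<lambda>i. mtop (M i)) (carrier H)"

definition A0 where "A0 = {(dom U, cmap U \<kappa>) | U V \<kappa>. adm U V \<kappa>}"

definition S0 where "S0 = \<lparr>mtop = T0, atlas = max_atlas K BL T0 A0\<rparr>"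

lemma H_PiE: "carrier H \<subseteq> (\<Pi>\<^sub>E i\<in>I. topspace (mtop (M i)))"
proof -
  have "(\<Pi>\<^sub>E i\<in>I. topspace (mtop (M i))) = (\<Pi>\<^sub>E i\<in>I. carrier (G i))" by (rule PiE_cong) (rule tsM)
  then show ?thesis by (auto simp: carrier_H)
qed

lemma topspace_T0: "topspace T0 = carrier H"
  unfolding T0_def by (rule topspace_wbox[OF H_PiE])

lemma admD:
  assumes "adm U V \<kappa>"
  shows "\<And>i. i \<in> I \<Longrightarrow> chart_into K (E i) (M i) (L i) (U i) (V i) (\<kappa> i)"
    "finite {i \<in> I. \<not> (\<one>\<^bsub>G i\<^esub> \<in> U i \<and> \<kappa> i \<one>\<^bsub>G i\<^esub> = \<zero>\<^bsub>L i\<^esub>)}"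
  using assms by (auto simp: adm_def)

lemma chartD:
  assumes a: "adm U V \<kappa>" and i: "i \<in> I"
  shows "openin (mtop (M i)) (U i)" "openin (vtop (L i)) (V i)"
    "\<And>p. p \<in> U i \<Longrightarrow> \<kappa> i p \<in> V i" "\<And>x. x \<in> V i \<Longrightarrow> inv_into (U i) (\<kappa> i) x \<in> U i"
    "\<And>p. p \<in> U i \<Longrightarrow> inv_into (U i) (\<kappa> i) (\<kappa> i p) = p" "\<And>x. x \<in> V i \<Longrightarrow> \<kappa> i (inv_into (U i) (\<kappa> i) x) = x"
    "\<And>p. p \<in> U i \<Longrightarrow> sat (E i) (M i) (L i) (tvs_mfd K (L i)) (\<kappa> i) p"
    "\<And>x. x \<in> V i \<Longrightarrow> sat (L i) (tvs_mfd K (L i)) (E i) (M i) (inv_into (U i) (\<kappa> i)) x"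
    "V i \<subseteq> carrier (L i)"
  using chart_intoD[OF mf[OF i] tvs_L[OF i] admD(1)[OF a i]] by simp_all

text \<open>At all but finitely many indices \<open>\<kappa> i\<close> and its inverse exchange
  \<open>\<one>\<close> and zero, so a family has finite support as a group element exactly if its
  image has finite support as a vector.\<close>

lemma adm_maps:
  assumes a: "adm U V \<kappa>"
  shows "\<And>g. g \<in> dom U \<Longrightarrow> (\<lambda>i\<in>I. \<kappa> i (g i)) \<in> img V" "\<And>x. x \<in> img V \<Longrightarrow> param U \<kappa> x \<in> dom U"
    "\<And>g. g \<in> dom U \<Longrightarrow> param U \<kappa> (cmap U \<kappa> g) = g" "\<And>x. x \<in> img V \<Longrightarrow> cmap U \<kappa> (param U \<kappa> x) = x"
    "cmap U \<kappa> ` dom U = img V"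
proof -
  let ?J = "{i \<in> I. \<not> (\<one>\<^bsub>G i\<^esub> \<in> U i \<and> \<kappa> i \<one>\<^bsub>G i\<^esub> = \<zero>\<^bsub>L i\<^esub>)}"
  note d = chartD[OF a] and J = admD(2)[OF a]
  show 1: "(\<lambda>i\<in>I. \<kappa> i (g i)) \<in> img V" if g: "g \<in> dom U" for g
  proof -
    have gU: "g i \<in> U i" if "i \<in> I" for i using g that by (auto simp: dom_def PiE_iff)
    have "{i \<in> I. (\<lambda>i\<in>I. \<kappa> i (g i)) i \<noteq> \<zero>\<^bsub>L i\<^esub>} \<subseteq> ?J \<union> {i \<in> I. g i \<noteq> \<one>\<^bsub>G i\<^esub>}" by auto
    moreover have "finite {i \<in> I. g i \<noteq> \<one>\<^bsub>G i\<^esub>}" using g by (simp add: dom_def carrier_H)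
    ultimately have "finite {i \<in> I. (\<lambda>i\<in>I. \<kappa> i (g i)) i \<noteq> \<zero>\<^bsub>L i\<^esub>}" using J by (meson finite_UnI finite_subset)
    then show ?thesis using d(3)[OF _ gU] d(9) by (auto simp: img_def carrier_BL sum_carrier_def)
  qed
  show 2: "param U \<kappa> x \<in> dom U" if x: "x \<in> img V" for x
  proof -
    have xV: "x i \<in> V i" if "i \<in> I" for i using x that by (auto simp: img_def PiE_iff)
    have "{i \<in> I. param U \<kappa> x i \<noteq> \<one>\<^bsub>G i\<^esub>} \<subseteq> ?J \<union> {i \<in> I. x i \<noteq> \<zero>\<^bsub>L i\<^esub>}"
    proof (rule subsetI, rule ccontr)
      fix i assume i: "i \<in> {i \<in> I. param U \<kappa> x i \<noteq> \<one>\<^bsub>G i\<^esub>}" and n: "i \<notin> ?J \<union> {i \<in> I. x i \<noteq> \<zero>\<^bsub>L i\<^esub>}"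
      then have "x i = \<kappa> i \<one>\<^bsub>G i\<^esub>" "\<one>\<^bsub>G i\<^esub> \<in> U i" "i \<in> I" by auto
      then have "param U \<kappa> x i = \<one>\<^bsub>G i\<^esub>" using d(5) by (simp add: param_def)
      then show False using i by simp
    qed
    moreover have "finite {i \<in> I. x i \<noteq> \<zero>\<^bsub>L i\<^esub>}" using x by (simp add: img_def carrier_BL sum_carrier_def)
    ultimately have f: "finite {i \<in> I. param U \<kappa> x i \<noteq> \<one>\<^bsub>G i\<^esub>}" using J by (meson finite_UnI finite_subset)
    have u: "param U \<kappa> x i \<in> U i" if "i \<in> I" for i using d(4)[OF that xV[OF that]] that by (simp add: param_def)
    moreover have "U i \<subseteq> carrier (G i)" if "i \<in> I" for i using openin_subset[OF d(1)[OF that]] tsM[OF that] by simp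
    ultimately show ?thesis using f by (auto simp: dom_def carrier_H PiE_iff param_def)
  qed
  show 3: "param U \<kappa> (cmap U \<kappa> g) = g" if g: "g \<in> dom U" for g
  proof
    have gE: "g \<in> (\<Pi>\<^sub>E i\<in>I. U i)" using g by (simp add: dom_def)
    fix i show "param U \<kappa> (cmap U \<kappa> g) i = g i"
    proof (cases "i \<in> I")
      case True
      then show ?thesis using g d(5)[OF True PiE_mem[OF gE True]] by (simp add: param_def cmap_def)
    qed (use PiE_arb[OF gE] in \<open>simp add: param_def\<close>)
  qed
  show 4: "cmap U \<kappa> (param U \<kappa> x) = x" if x: "x \<in> img V" for x
  proof
    have xE: "x \<in> (\<Pi>\<^sub>E i\<in>I. V i)" using x by (simp add: img_def)
    fix i show "cmap U \<kappa> (param U \<kappa> x) i = x i"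
    proof (cases "i \<in> I")
      case True
      then show ?thesis using 2[OF x] d(6)[OF True PiE_mem[OF xE True]] by (simp add: param_def cmap_def)
    qed (use PiE_arb[OF xE] 2[OF x] in \<open>simp add: cmap_def\<close>)
  qed
  have cg: "cmap U \<kappa> g = (\<lambda>i\<in>I. \<kappa> i (g i))" if "g \<in> dom U" for g using that by (simp add: cmap_def)
  show "cmap U \<kappa> ` dom U = img V"
  proof (intro Set.equalityI subsetI)
    fix x assume "x \<in> cmap U \<kappa> ` dom U"
    then show "x \<in> img V" using 1 cg by auto
  next
    fix x assume "x \<in> img V"
    then show "x \<in> cmap U \<kappa> ` dom U" using 2 4 by (metis image_eqI)
  qed
qed

lemma sat_cont_map:
  assumes M: "mfd A X" and N: "mfd B Y" and U: "openin (mtop X) U" and s: "\<And>p. p \<in> U \<Longrightarrow> sat A X B Y f p"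
  shows "continuous_map (subtopology (mtop X) U) (mtop Y) f"
proof (rule continuous_map_local[OF U])
  fix p assume p: "p \<in> U"
  have "smooth_map K A (open_submfd X U) B Y f"
    unfolding smooth_map_iff_sat[OF mfd_open[OF M U] N] topspace_open_submfd[OF U]
    using s sat_open_dom[OF M N U] by blast
  then have "continuous_map (subtopology (mtop X) U) (mtop Y) f" by (simp add: smooth_map_def)
  then show "\<exists>W. openin (mtop X) W \<and> p \<in> W \<and> W \<subseteq> U \<and> continuous_map (subtopology (mtop X) W) (mtop Y) f"
    using U p by blast
qed

lemma adm_top_chart:
  assumes a: "adm U V \<kappa>" shows "top_chart BL T0 (dom U, cmap U \<kappa>)"
proof (rule top_chartI)
  note d = chartD[OF a] and m = adm_maps[OF a]
  show "openin T0 (dom U)" unfolding T0_def dom_def by (rule openin_wboxI) (rule d(1))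
  show "cmap U \<kappa> \<in> extensional (dom U)" by (simp add: cmap_def)
  show "openin (vtop BL) (cmap U \<kappa> ` dom U)" unfolding m(5) img_def vtop_BL carrier_BL by (rule openin_wboxI) (rule d(2))
  have "continuous_map (subtopology T0 (dom U)) (vtop BL) (\<lambda>g. \<lambda>i\<in>I. \<kappa> i (g i))"
    unfolding T0_def vtop_BL dom_def
  proof (rule continuous_wbox_map[OF H_PiE sum_carrier_PiE[of I L, OF tvs_L] d(1)])
    show "continuous_map (subtopology (mtop (M i)) (U i)) (vtop (L i)) (\<kappa> i)" if "i \<in> I" for i
      using sat_cont_map[OF mf[OF that] mfd_tvs(1)[OF tvs_L[OF that]] d(1)[OF that] d(7)[OF that]] by simp
    show "(\<lambda>i\<in>I. \<kappa> i (x i)) \<in> sum_carrier I L" if "x \<in> carrier H" "x \<in> (\<Pi>\<^sub>E i\<in>I. U i)" for x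
      using m(1)[of x] that by (simp add: dom_def img_def carrier_BL)
  qed
  then show "continuous_map (subtopology T0 (dom U)) (vtop BL) (cmap U \<kappa>)"
    by (rule continuous_map_eq) (simp add: cmap_def)
  show "continuous_map (subtopology (vtop BL) (cmap U \<kappa> ` dom U)) T0 (param U \<kappa>)"
    unfolding m(5) T0_def vtop_BL img_def carrier_BL param_def
  proof (rule continuous_wbox_map[OF sum_carrier_PiE[of I L, OF tvs_L] H_PiE d(2)])
    show "continuous_map (subtopology (vtop (L i)) (V i)) (mtop (M i)) (inv_into (U i) (\<kappa> i))" if "i \<in> I" for i
      using sat_cont_map[OF mfd_tvs(1)[OF tvs_L[OF that]] mf[OF that] _ d(8)[OF that]] d(2)[OF that] by simp
    show "(\<lambda>i\<in>I. inv_into (U i) (\<kappa> i) (x i)) \<in> carrier H" if "x \<in> sum_carrier I L" "x \<in> (\<Pi>\<^sub>E i\<in>I. V i)" for x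
      using m(2)[of x] that by (simp add: dom_def img_def carrier_BL param_def)
  qed
qed (rule adm_maps(3)[OF a])

lemma inv_cmap:
  assumes a: "adm U V \<kappa>" and x: "x \<in> img V" shows "inv_into (dom U) (cmap U \<kappa>) x = param U \<kappa> x"
  using inv_into_f_f[OF top_chartD(4)[OF adm_top_chart[OF a]] adm_maps(2)[OF a x]] adm_maps(4)[OF a x] by simp

text \<open>The transition is the box sum of the transitions in the factors; these fix zero except
  at indices exceptional for one of the two families.\<close>

lemma adm_transition:
  assumes a: "adm U V \<kappa>" and b: "adm U' V' \<kappa>'"
  shows "smo BL BL (cmap U \<kappa> ` (dom U \<inter> dom U')) (\<lambda>x. cmap U' \<kappa>' (inv_into (dom U) (cmap U \<kappa>) x))"
proof -
  note d = chartD[OF a] and m = adm_maps[OF a] and m' = adm_maps[OF b]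
  let ?J = "{i \<in> I. \<not> (\<one>\<^bsub>G i\<^esub> \<in> U i \<and> \<kappa> i \<one>\<^bsub>G i\<^esub> = \<zero>\<^bsub>L i\<^esub>)} \<union> {i \<in> I. \<not> (\<one>\<^bsub>G i\<^esub> \<in> U' i \<and> \<kappa>' i \<one>\<^bsub>G i\<^esub> = \<zero>\<^bsub>L i\<^esub>)}"
  let ?W = "\<lambda>i. {x \<in> V i. inv_into (U i) (\<kappa> i) x \<in> U' i}"
  have "smo BL BL (sum_carrier I L \<inter> (\<Pi>\<^sub>E i\<in>I. ?W i)) (\<lambda>x. \<lambda>i\<in>I. \<kappa>' i (inv_into (U i) (\<kappa> i) (x i)))"
    unfolding BL_def
  proof (rule smo_box[where ?J0.0 = ?J])
    fix i assume i: "i \<in> I"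
    show "smo (L i) (L i) (?W i) (\<lambda>x. \<kappa>' i (inv_into (U i) (\<kappa> i) x))"
      by (rule chart_into_smo[OF mf[OF i] tvs_L[OF i] admD(1)[OF b i] tvs_L[OF i] d(2)[OF i] d(8)[OF i]])
  next
    show "finite ?J" using admD(2)[OF a] admD(2)[OF b] by blast
    fix i assume i: "i \<in> I - ?J"
    then have *: "i \<in> I" "\<one>\<^bsub>G i\<^esub> \<in> U i" "\<kappa> i \<one>\<^bsub>G i\<^esub> = \<zero>\<^bsub>L i\<^esub>" "\<one>\<^bsub>G i\<^esub> \<in> U' i" "\<kappa>' i \<one>\<^bsub>G i\<^esub> = \<zero>\<^bsub>L i\<^esub>" by auto
    have iv: "inv_into (U i) (\<kappa> i) \<zero>\<^bsub>L i\<^esub> = \<one>\<^bsub>G i\<^esub>" using d(5)[OF *(1,2)] *(3) by simp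
    have "\<zero>\<^bsub>L i\<^esub> \<in> V i" using d(3)[OF *(1,2)] *(3) by simp
    then show "\<zero>\<^bsub>L i\<^esub> \<in> ?W i" using iv * by simp
    show "\<kappa>' i (inv_into (U i) (\<kappa> i) \<zero>\<^bsub>L i\<^esub>) = \<zero>\<^bsub>L i\<^esub>" using iv * by simp
  qed
  moreover have "cmap U \<kappa> ` (dom U \<inter> dom U') = sum_carrier I L \<inter> (\<Pi>\<^sub>E i\<in>I. ?W i)" (is "_ = ?R")
  proof (intro Set.equalityI subsetI)
    fix x assume "x \<in> cmap U \<kappa> ` (dom U \<inter> dom U')"
    then obtain g where g: "g \<in> dom U" "g \<in> dom U'" "x = (\<lambda>i\<in>I. \<kappa> i (g i))" by (auto simp: cmap_def)
    have "x \<in> img V" using m(1)[OF g(1)] g(3) by simp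
    moreover have "inv_into (U i) (\<kappa> i) (x i) \<in> U' i" if "i \<in> I" for i
      using g that d(5)[OF that, of "g i"] by (auto simp: dom_def PiE_iff)
    ultimately show "x \<in> ?R" by (auto simp: img_def carrier_BL PiE_iff)
  next
    fix x assume x: "x \<in> ?R"
    then have xV: "x \<in> img V" by (auto simp: img_def carrier_BL PiE_iff)
    have "param U \<kappa> x \<in> dom U'" using m(2)[OF xV] x by (auto simp: dom_def PiE_iff param_def)
    then show "x \<in> cmap U \<kappa> ` (dom U \<inter> dom U')" using m(2,4)[OF xV] by (metis IntI image_eqI)
  qed
  ultimately have s: "smo BL BL (cmap U \<kappa> ` (dom U \<inter> dom U')) (\<lambda>x. \<lambda>i\<in>I. \<kappa>' i (inv_into (U i) (\<kappa> i) (x i)))" by simp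
  show ?thesis
  proof (rule smo_cong[OF s])
    fix x assume "x \<in> cmap U \<kappa> ` (dom U \<inter> dom U')"
    then obtain g where g: "g \<in> dom U" "g \<in> dom U'" "x = cmap U \<kappa> g" by blast
    have "x \<in> img V" using m(5) g by blast
    from inv_cmap[OF a this] have e1: "inv_into (dom U) (cmap U \<kappa>) x = param U \<kappa> x" .
    have "param U \<kappa> x = g" using m(3)[OF g(1)] g(3) by simp
    then have "param U \<kappa> x \<in> dom U'" using g(2) by simp
    then have e2: "cmap U' \<kappa>' (param U \<kappa> x) = (\<lambda>i\<in>I. \<kappa>' i (param U \<kappa> x i))" by (simp add: cmap_def)
    have e3: "(\<lambda>i\<in>I. \<kappa>' i (param U \<kappa> x i)) = (\<lambda>i\<in>I. \<kappa>' i (inv_into (U i) (\<kappa> i) (x i)))"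
      by (rule restrict_ext) (simp add: param_def)
    show "cmap U' \<kappa>' (inv_into (dom U) (cmap U \<kappa>) x) = (\<lambda>i\<in>I. \<kappa>' i (inv_into (U i) (\<kappa> i) (x i)))"
      unfolding e1 e2 e3 ..
  qed
qed

lemma standard_charts:
  shows "\<exists>U V \<kappa>. \<forall>i\<in>I. chart_into K (E i) (M i) (L i) (U i) (V i) (\<kappa> i) \<and> \<one>\<^bsub>G i\<^esub> \<in> U i \<and> \<kappa> i \<one>\<^bsub>G i\<^esub> = \<zero>\<^bsub>L i\<^esub>"
proof -
  have "\<forall>i\<in>I. \<exists>c. chart_into K (E i) (M i) (L i) (fst c) (fst (snd c)) (snd (snd c)) \<and> \<one>\<^bsub>G i\<^esub> \<in> fst c \<and> snd (snd c) \<one>\<^bsub>G i\<^esub> = \<zero>\<^bsub>L i\<^esub>"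
  proof
    fix i assume i: "i \<in> I"
    have "\<one>\<^bsub>G i\<^esub> \<in> carrier (G i)" using one_M[OF i] tsM[OF i] by simp
    from chart_exists[OF i this]
    show "\<exists>c. chart_into K (E i) (M i) (L i) (fst c) (fst (snd c)) (snd (snd c)) \<and> \<one>\<^bsub>G i\<^esub> \<in> fst c \<and> snd (snd c) \<one>\<^bsub>G i\<^esub> = \<zero>\<^bsub>L i\<^esub>"
      by auto
  qed
  from bchoice[OF this] obtain c where "\<forall>i\<in>I. chart_into K (E i) (M i) (L i) (fst (c i)) (fst (snd (c i))) (snd (snd (c i))) \<and>
     \<one>\<^bsub>G i\<^esub> \<in> fst (c i) \<and> snd (snd (c i)) \<one>\<^bsub>G i\<^esub> = \<zero>\<^bsub>L i\<^esub>" by (elim exE)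
  then show ?thesis by (intro exI[of _ "\<lambda>i. fst (c i)"] exI[of _ "\<lambda>i. fst (snd (c i))"] exI[of _ "\<lambda>i. snd (snd (c i))"])
qed

text \<open>Where \<open>g i\<close> is \<open>\<one>\<close> the chart is the standard one. With
  the same standard charts used for several elements, their box charts agree at almost all indices,
  which the treatment of the group operations depends on.\<close>

lemma adm_at:
  assumes st: "\<forall>i\<in>I. chart_into K (E i) (M i) (L i) (U0 i) (V0 i) (\<kappa>0 i) \<and> \<one>\<^bsub>G i\<^esub> \<in> U0 i \<and> \<kappa>0 i \<one>\<^bsub>G i\<^esub> = \<zero>\<^bsub>L i\<^esub>"
    and g: "g \<in> carrier H"
  shows "\<exists>U V \<kappa>. adm U V \<kappa> \<and> g \<in> dom U \<and> (\<forall>i\<in>I. g i = \<one>\<^bsub>G i\<^esub> \<longrightarrow> U i = U0 i \<and> V i = V0 i \<and> \<kappa> i = \<kappa>0 i)"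
proof -
  have gc: "g i \<in> carrier (G i)" if "i \<in> I" for i using g that by (auto simp: carrier_H PiE_iff)
  have "\<forall>i\<in>I. \<exists>c. chart_into K (E i) (M i) (L i) (fst c) (fst (snd c)) (snd (snd c)) \<and> g i \<in> fst c \<and>
     (g i = \<one>\<^bsub>G i\<^esub> \<longrightarrow> fst c = U0 i \<and> fst (snd c) = V0 i \<and> snd (snd c) = \<kappa>0 i)"
  proof
    fix i assume i: "i \<in> I"
    show "\<exists>c. chart_into K (E i) (M i) (L i) (fst c) (fst (snd c)) (snd (snd c)) \<and> g i \<in> fst c \<and>
       (g i = \<one>\<^bsub>G i\<^esub> \<longrightarrow> fst c = U0 i \<and> fst (snd c) = V0 i \<and> snd (snd c) = \<kappa>0 i)"
    proof (cases "g i = \<one>\<^bsub>G i\<^esub>")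
      case True
      then show ?thesis using st i by (intro exI[of _ "(U0 i, V0 i, \<kappa>0 i)"]) simp
    next
      case False
      then show ?thesis using chart_exists[OF i gc[OF i]] by auto
    qed
  qed
  from bchoice[OF this] obtain c where c: "\<forall>i\<in>I. chart_into K (E i) (M i) (L i) (fst (c i)) (fst (snd (c i))) (snd (snd (c i))) \<and> g i \<in> fst (c i) \<and>
     (g i = \<one>\<^bsub>G i\<^esub> \<longrightarrow> fst (c i) = U0 i \<and> fst (snd (c i)) = V0 i \<and> snd (snd (c i)) = \<kappa>0 i)" by (elim exE)
  let ?U = "\<lambda>i. fst (c i)" and ?V = "\<lambda>i. fst (snd (c i))" and ?\<kappa> = "\<lambda>i. snd (snd (c i))"
  have "{i \<in> I. \<not> (\<one>\<^bsub>G i\<^esub> \<in> ?U i \<and> ?\<kappa> i \<one>\<^bsub>G i\<^esub> = \<zero>\<^bsub>L i\<^esub>)} \<subseteq> {i \<in> I. g i \<noteq> \<one>\<^bsub>G i\<^esub>}" using c st by auto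
  moreover have "finite {i \<in> I. g i \<noteq> \<one>\<^bsub>G i\<^esub>}" using g by (simp add: carrier_H)
  ultimately have "adm ?U ?V ?\<kappa>" unfolding adm_def using c finite_subset by blast
  moreover have "g \<in> dom ?U" using g c by (auto simp: dom_def carrier_H PiE_iff)
  ultimately show ?thesis using c by (intro exI[of _ ?U] exI[of _ ?V] exI[of _ ?\<kappa>]) auto
qed

lemma mfd_S0: "mfd BL S0" "A0 \<subseteq> atlas S0"
proof -
  have H: "Hausdorff_space T0" unfolding T0_def by (rule Hausdorff_wbox[OF H_PiE mfdD(2)[OF mf]])
  have t: "top_chart BL T0 c" if "c \<in> A0" for c using that adm_top_chart by (auto simp: A0_def)
  have co: "compatible K BL c d" if "c \<in> A0" "d \<in> A0" for c d
    using that adm_transition by (auto simp: A0_def compatible_iff[OF tvs_BL])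
  obtain U0 V0 \<kappa>0 where st: "\<forall>i\<in>I. chart_into K (E i) (M i) (L i) (U0 i) (V0 i) (\<kappa>0 i) \<and> \<one>\<^bsub>G i\<^esub> \<in> U0 i \<and> \<kappa>0 i \<one>\<^bsub>G i\<^esub> = \<zero>\<^bsub>L i\<^esub>"
    using standard_charts by (elim exE)
  have cov: "(\<Union>c\<in>A0. fst c) = topspace T0"
  proof (intro Set.equalityI subsetI)
    fix g assume "g \<in> (\<Union>c\<in>A0. fst c)"
    then show "g \<in> topspace T0" unfolding topspace_T0 by (auto simp: A0_def dom_def)
  next
    fix g assume "g \<in> topspace T0"
    then have "g \<in> carrier H" unfolding topspace_T0 .
    from adm_at[OF st this] obtain U V \<kappa> where "adm U V \<kappa>" "g \<in> dom U" by blast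
    then have "(dom U, cmap U \<kappa>) \<in> A0" "g \<in> fst (dom U, cmap U \<kappa>)" by (auto simp: A0_def)
    then show "g \<in> (\<Union>c\<in>A0. fst c)" by (rule UN_I)
  qed
  note m = mfd_max_atlas[OF tvs_BL H t co cov]
  show "mfd BL S0" using m(1) by (simp add: S0_def)
  show "A0 \<subseteq> atlas S0" using m(2) by (simp add: S0_def)
qed

lemma topspace_S0: "topspace (mtop S0) = carrier H"
  by (simp add: S0_def topspace_T0)

lemma adm_S0:
  assumes a: "adm U V \<kappa>"
  shows "openin (mtop S0) (dom U)" "\<And>g. g \<in> dom U \<Longrightarrow> sat BL S0 BL (tvs_mfd K BL) (cmap U \<kappa>) g"
    "openin (vtop BL) (img V)" "\<And>x. x \<in> img V \<Longrightarrow> sat BL (tvs_mfd K BL) BL S0 (param U \<kappa>) x"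
proof -
  have c: "(dom U, cmap U \<kappa>) \<in> atlas S0" using mfd_S0(2) a by (auto simp: A0_def)
  note tc = top_chartD[OF adm_top_chart[OF a]]
  show "openin (mtop S0) (dom U)" using tc(1) by (simp add: S0_def)
  show "\<And>g. g \<in> dom U \<Longrightarrow> sat BL S0 BL (tvs_mfd K BL) (cmap U \<kappa>) g" by (rule sat_chart_map[OF mfd_S0(1) c])
  show o: "openin (vtop BL) (img V)" using tc(3) adm_maps(5)[OF a] by simp
  show "sat BL (tvs_mfd K BL) BL S0 (param U \<kappa>) x" if x: "x \<in> img V" for x
    by (rule sat_cong[OF mfd_tvs(1)[OF tvs_BL] mfd_S0(1) sat_chart_inv[OF mfd_S0(1) c] _ x])
      (use x o adm_maps(5)[OF a] inv_cmap[OF a] in auto)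
qed


section \<open>Smoothness of the group operations\<close>

lemma H_simps:
  "g \<in> carrier H \<Longrightarrow> i \<in> I \<Longrightarrow> g i \<in> carrier (G i)" "a \<otimes>\<^bsub>H\<^esub> b = (\<lambda>i\<in>I. a i \<otimes>\<^bsub>G i\<^esub> b i)"
  "\<one>\<^bsub>H\<^esub> = (\<lambda>i\<in>I. \<one>\<^bsub>G i\<^esub>)"
  by (auto simp: carrier_H PiE_iff) (simp_all add: H_def)

lemma inv_H:
  assumes "g \<in> carrier H" shows "inv\<^bsub>H\<^esub> g = (\<lambda>i\<in>I. inv\<^bsub>G i\<^esub> (g i))"
  using inv_sum_group[of I G g] grp assms by (simp add: H_def)

text \<open>For a germ into \<open>S0\<close> it suffices to exhibit a smooth germ \<open>w\<close>
  of its coordinates in one box chart.\<close>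

lemma sat_into_S0:
  assumes P: "mfd A P" and a: "adm U V \<kappa>"
    and w: "sat A P BL (tvs_mfd K BL) w p" "w p \<in> img V"
    and W: "openin (mtop P) W" "p \<in> W" "\<And>q. q \<in> W \<Longrightarrow> f q = param U \<kappa> (w q)"
  shows "sat A P BL S0 f p"
  by (rule sat_cong[OF P mfd_S0(1) sat_compose[OF P mfd_tvs(1)[OF tvs_BL] mfd_S0(1) adm_S0(4)[OF a w(2)] w(1)] W])

text \<open>In box charts around \<open>g\<close>, \<open>h\<close> and their product,
  multiplication is the box sum of the multiplications \<open>\<mu> i\<close> of the factors. At
  almost all indices both \<open>g i\<close> and \<open>h i\<close> are \<open>\<one>\<close>, all
  three charts are the standard one, and \<open>1 \<cdot> 1 = 1\<close> says that the chart
  expression takes zero to zero, as \<open>smo_box\<close> demands.\<close>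

lemma sat_mult_S0:
  assumes g: "g \<in> carrier H" and h: "h \<in> carrier H"
  shows "sat (prod_tvs BL BL) (prod_mfd K BL S0 BL S0) BL S0 (\<lambda>(x, y). x \<otimes>\<^bsub>H\<^esub> y) (g, h)"
proof -
  interpret H: group H by (rule group_H)
  obtain U0 V0 \<kappa>0 where st: "\<forall>i\<in>I. chart_into K (E i) (M i) (L i) (U0 i) (V0 i) (\<kappa>0 i) \<and> \<one>\<^bsub>G i\<^esub> \<in> U0 i \<and> \<kappa>0 i \<one>\<^bsub>G i\<^esub> = \<zero>\<^bsub>L i\<^esub>"
    using standard_charts by (elim exE)
  obtain U V \<kappa> where a: "adm U V \<kappa>" "g \<in> dom U" "\<forall>i\<in>I. g i = \<one>\<^bsub>G i\<^esub> \<longrightarrow> U i = U0 i \<and> V i = V0 i \<and> \<kappa> i = \<kappa>0 i"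
    using adm_at[OF st g] by (elim exE conjE)
  obtain U' V' \<kappa>' where b: "adm U' V' \<kappa>'" "h \<in> dom U'" "\<forall>i\<in>I. h i = \<one>\<^bsub>G i\<^esub> \<longrightarrow> U' i = U0 i \<and> V' i = V0 i \<and> \<kappa>' i = \<kappa>0 i"
    using adm_at[OF st h] by (elim exE conjE)
  have gh: "g \<otimes>\<^bsub>H\<^esub> h \<in> carrier H" using g h by simp
  obtain X Y \<theta> where c: "adm X Y \<theta>" "g \<otimes>\<^bsub>H\<^esub> h \<in> dom X" "\<forall>i\<in>I. (g \<otimes>\<^bsub>H\<^esub> h) i = \<one>\<^bsub>G i\<^esub> \<longrightarrow> X i = U0 i \<and> Y i = V0 i \<and> \<theta> i = \<kappa>0 i"
    using adm_at[OF st gh] by (elim exE conjE)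
  note da = chartD[OF a(1)] and db = chartD[OF b(1)] and dc = chartD[OF c(1)]
  define \<mu> where "\<mu> = (\<lambda>i z. inv_into (U i) (\<kappa> i) (fst z) \<otimes>\<^bsub>G i\<^esub> inv_into (U' i) (\<kappa>' i) (snd z))"
  \<comment> \<open>A product of elements of the chart domains \<open>U i\<close> and
    \<open>U' i\<close> may leave \<open>X i\<close>, so the expression is considered only on the
    pairs for which it does not.\<close>
  define Z where "Z = (\<lambda>i. {z \<in> V i \<times> V' i. \<mu> i z \<in> X i})"
  let ?LL = "\<lambda>i. prod_tvs (L i) (L i)" and ?P = "prod_mfd K BL S0 BL S0"
  define B where "B = (\<lambda>z. \<lambda>i\<in>I. \<theta> i (\<mu> i (z i)))"
  have LL: "TVS (?LL i)" if "i \<in> I" for i using tvs_prod tvs_L that by blast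
  have "smo (box_sum I ?LL) (box_sum I L) (sum_carrier I ?LL \<inter> (\<Pi>\<^sub>E i\<in>I. Z i)) (\<lambda>z. \<lambda>i\<in>I. \<theta> i (\<mu> i (z i)))"
  proof (rule smo_box[where ?J0.0 = "{i \<in> I. g i \<noteq> \<one>\<^bsub>G i\<^esub>} \<union> {i \<in> I. h i \<noteq> \<one>\<^bsub>G i\<^esub>}"])
    fix i assume i: "i \<in> I"
    note T = mfd_tvs(1)[OF LL[OF i]] and TL = mfd_tvs(1)[OF tvs_L[OF i]] and Mi = mf[OF i]
    show "smo (?LL i) (L i) (Z i) (\<lambda>z. \<theta> i (\<mu> i z))"
      unfolding Z_def
    proof (rule chart_into_smo[OF Mi tvs_L[OF i] admD(1)[OF c(1) i] LL[OF i]])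
      show o: "openin (vtop (?LL i)) (V i \<times> V' i)" using da(2)[OF i] db(2)[OF i] by (simp add: openin_prod_Times_iff)
      fix z assume z: "z \<in> V i \<times> V' i"
      then have z1: "fst z \<in> V i" "snd z \<in> V' i" by auto
      have zc: "z \<in> carrier (?LL i)" using openin_carrier[OF LL[OF i] o] z by blast
      note oc = openin_carrier_self[OF LL[OF i]]
      have f1: "sat (?LL i) (tvs_mfd K (?LL i)) (E i) (M i) (\<lambda>z. inv_into (U i) (\<kappa> i) (fst z)) z"
        by (rule sat_compose[OF T TL Mi da(8)[OF i z1(1)] smo_imp_sat[OF smo_clin[OF clin_fst LL[OF i] tvs_L[OF i] oc] zc]])
      have f2: "sat (?LL i) (tvs_mfd K (?LL i)) (E i) (M i) (\<lambda>z. inv_into (U' i) (\<kappa>' i) (snd z)) z"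
        by (rule sat_compose[OF T TL Mi db(8)[OF i z1(2)] smo_imp_sat[OF smo_clin[OF clin_snd LL[OF i] tvs_L[OF i] oc] zc]])
      have cc: "inv_into (U i) (\<kappa> i) (fst z) \<in> carrier (G i)" "inv_into (U' i) (\<kappa>' i) (snd z) \<in> carrier (G i)"
        using sat_topspace(2)[OF T Mi f1] sat_topspace(2)[OF T Mi f2] tsM[OF i] by simp_all
      from sat_compose[OF T mfd_prod(1)[OF Mi Mi] Mi lie_groupD(4)[OF lie[OF i] cc] sat_pair[OF T Mi Mi f1 f2]]
      show "sat (?LL i) (tvs_mfd K (?LL i)) (E i) (M i) (\<mu> i) z" by (simp add: \<mu>_def)
    qed
  next
    show "finite ({i \<in> I. g i \<noteq> \<one>\<^bsub>G i\<^esub>} \<union> {i \<in> I. h i \<noteq> \<one>\<^bsub>G i\<^esub>})" using g h by (simp add: carrier_H)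
    fix i assume "i \<in> I - ({i \<in> I. g i \<noteq> \<one>\<^bsub>G i\<^esub>} \<union> {i \<in> I. h i \<noteq> \<one>\<^bsub>G i\<^esub>})"
    then have i: "i \<in> I" and g1: "g i = \<one>\<^bsub>G i\<^esub>" and h1: "h i = \<one>\<^bsub>G i\<^esub>" by auto
    interpret Gi: group "G i" by (rule grp[OF i])
    have "(g \<otimes>\<^bsub>H\<^esub> h) i = \<one>\<^bsub>G i\<^esub>" using i g1 h1 by (simp add: H_simps)
    then have e: "X i = U0 i" "\<theta> i = \<kappa>0 i" "U i = U0 i" "V i = V0 i" "\<kappa> i = \<kappa>0 i" "U' i = U0 i" "V' i = V0 i" "\<kappa>' i = \<kappa>0 i"
      using a(3) b(3) c(3) i g1 h1 by auto
    have s: "\<one>\<^bsub>G i\<^esub> \<in> U0 i" "\<kappa>0 i \<one>\<^bsub>G i\<^esub> = \<zero>\<^bsub>L i\<^esub>" using st i by auto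
    have iv: "inv_into (U0 i) (\<kappa>0 i) \<zero>\<^bsub>L i\<^esub> = \<one>\<^bsub>G i\<^esub>" "\<zero>\<^bsub>L i\<^esub> \<in> V0 i"
      using da(5)[OF i, of "\<one>\<^bsub>G i\<^esub>"] da(3)[OF i, of "\<one>\<^bsub>G i\<^esub>"] s e by simp_all
    show "\<zero>\<^bsub>?LL i\<^esub> \<in> Z i" "\<theta> i (\<mu> i \<zero>\<^bsub>?LL i\<^esub>) = \<zero>\<^bsub>L i\<^esub>" using iv s by (simp_all add: Z_def \<mu>_def e)
  qed
  then have sB: "smo (box_sum I ?LL) BL (sum_carrier I ?LL \<inter> (\<Pi>\<^sub>E i\<in>I. Z i)) B" by (simp add: BL_def B_def)
  define zp where "zp = (\<lambda>q. \<lambda>i\<in>I. (cmap U \<kappa> (fst q) i, cmap U' \<kappa>' (snd q) i))"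
  note PP = mfd_prod(1)[OF mfd_S0(1) mfd_S0(1)] and TB = mfd_tvs(1)[OF tvs_BL]
  have tLL: "TVS (box_sum I ?LL)" by (rule tvs_box_sum[OF LL])
  note TLL = mfd_tvs(1)[OF tLL] and TP = mfd_tvs(1)[OF tvs_prod[OF tvs_BL tvs_BL]]
  have gS: "g \<in> topspace (mtop S0)" "h \<in> topspace (mtop S0)" using g h by (simp_all add: topspace_S0)
  have cf: "sat (prod_tvs BL BL) ?P BL (tvs_mfd K BL) (\<lambda>q. cmap U \<kappa> (fst q)) (g, h)"
    by (rule sat_compose[OF PP mfd_S0(1) TB _ sat_fst_snd(1)[OF mfd_S0(1) mfd_S0(1) gS]]) (use adm_S0(2)[OF a(1,2)] in simp)
  have cs: "sat (prod_tvs BL BL) ?P BL (tvs_mfd K BL) (\<lambda>q. cmap U' \<kappa>' (snd q)) (g, h)"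
    by (rule sat_compose[OF PP mfd_S0(1) TB _ sat_fst_snd(2)[OF mfd_S0(1) mfd_S0(1) gS]]) (use adm_S0(2)[OF b(1,2)] in simp)
  have "sat (prod_tvs BL BL) ?P (box_sum I ?LL) (tvs_mfd K (box_sum I ?LL))
      (\<lambda>q. (\<lambda>p. \<lambda>i\<in>I. (fst p i, snd p i)) (cmap U \<kappa> (fst q), cmap U' \<kappa>' (snd q))) (g, h)"
  proof (rule sat_compose[OF PP TP TLL _ sat_pair_tvs[OF PP tvs_BL tvs_BL cf cs]])
    have z: "clin (prod_tvs BL BL) (box_sum I ?LL) (\<lambda>p. \<lambda>i\<in>I. (fst p i, snd p i))"
      unfolding BL_def by (rule clin_zip[of I L L, OF tvs_L tvs_L])
    have "(cmap U \<kappa> g, cmap U' \<kappa>' h) \<in> carrier (prod_tvs BL BL)"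
      using adm_maps(5)[OF a(1)] adm_maps(5)[OF b(1)] a(2) b(2) by (auto simp: img_def)
    then show "sat (prod_tvs BL BL) (tvs_mfd K (prod_tvs BL BL)) (box_sum I ?LL) (tvs_mfd K (box_sum I ?LL))
        (\<lambda>p. \<lambda>i\<in>I. (fst p i, snd p i)) (cmap U \<kappa> (fst (g, h)), cmap U' \<kappa>' (snd (g, h)))"
      by (intro smo_imp_sat[OF smo_clin[OF z tvs_prod[OF tvs_BL tvs_BL] tLL openin_carrier_self[OF tvs_prod[OF tvs_BL tvs_BL]]]]) simp
  qed
  then have szp: "sat (prod_tvs BL BL) ?P (box_sum I ?LL) (tvs_mfd K (box_sum I ?LL)) zp (g, h)"
    by (simp add: zp_def)
  have zpi: "zp (x, y) i = (\<kappa> i (x i), \<kappa>' i (y i))" "\<mu> i (zp (x, y) i) = x i \<otimes>\<^bsub>G i\<^esub> y i"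
    if "x \<in> dom U" "y \<in> dom U'" "i \<in> I" for x y i
  proof -
    show z: "zp (x, y) i = (\<kappa> i (x i), \<kappa>' i (y i))" using that by (simp add: zp_def cmap_def)
    have "x i \<in> U i" "y i \<in> U' i" using that by (auto simp: dom_def PiE_iff)
    then show "\<mu> i (zp (x, y) i) = x i \<otimes>\<^bsub>G i\<^esub> y i" using da(5) db(5) that(3) by (simp add: z \<mu>_def)
  qed
  have zZ: "zp (g, h) \<in> sum_carrier I ?LL \<inter> (\<Pi>\<^sub>E i\<in>I. Z i)"
  proof
    show "zp (g, h) \<in> sum_carrier I ?LL" using sat_topspace(2)[OF PP TLL szp]
      topological_vector_space.topspace_vtop[OF tLL] by (simp add: box_sum_simps)
    have "zp (g, h) i \<in> Z i" if i: "i \<in> I" for i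
    proof -
      have "g i \<in> U i" "h i \<in> U' i" "(g \<otimes>\<^bsub>H\<^esub> h) i \<in> X i" using a(2) b(2) c(2) i by (auto simp: dom_def PiE_iff)
      then show ?thesis using zpi[OF a(2) b(2) i] da(3)[OF i] db(3)[OF i] i by (simp add: Z_def H_simps)
    qed
    then show "zp (g, h) \<in> (\<Pi>\<^sub>E i\<in>I. Z i)" by (simp add: zp_def)
  qed
  have Bz: "B (zp (x, y)) = (\<lambda>i\<in>I. \<theta> i ((x \<otimes>\<^bsub>H\<^esub> y) i))" if "x \<in> dom U" "y \<in> dom U'" for x y
    unfolding B_def by (rule restrict_ext) (simp only: zpi(2)[OF that] H_simps(2) restrict_apply if_True)
  have sw: "sat (prod_tvs BL BL) ?P BL (tvs_mfd K BL) (\<lambda>q. B (zp q)) (g, h)"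
    by (rule sat_compose[OF PP TLL TB smo_imp_sat[OF sB zZ] szp])
  have oZ: "openin (mtop (tvs_mfd K (box_sum I ?LL))) (sum_carrier I ?LL \<inter> (\<Pi>\<^sub>E i\<in>I. Z i))" using smoD(3)[OF sB] by simp
  \<comment> \<open>Products near \<open>(g, h)\<close> have to stay in the chart domains
    \<open>X i\<close> at all indices at once; this comes from the continuity of \<open>zp\<close>
    for the box topology.\<close>
  obtain W where W: "openin (mtop ?P) W" "(g, h) \<in> W" "zp ` W \<subseteq> sum_carrier I ?LL \<inter> (\<Pi>\<^sub>E i\<in>I. Z i)"
    using sat_continuous[OF PP TLL szp oZ zZ] by blast
  show ?thesis
  proof (rule sat_into_S0[OF PP c(1) sw])
    show "B (zp (g, h)) \<in> img Y" unfolding Bz[OF a(2) b(2)] by (rule adm_maps(1)[OF c(1,2)])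
    show "openin (mtop ?P) (W \<inter> dom U \<times> dom U')" using W(1) adm_S0(1)[OF a(1)] adm_S0(1)[OF b(1)]
      by (simp add: openin_Int openin_prod_Times_iff)
    show "(g, h) \<in> W \<inter> dom U \<times> dom U'" using W a b by simp
    fix q assume q: "q \<in> W \<inter> dom U \<times> dom U'"
    obtain x y where xy: "q = (x, y)" "x \<in> dom U" "y \<in> dom U'" using q by (cases q) auto
    have "(x \<otimes>\<^bsub>H\<^esub> y) i \<in> X i" if i: "i \<in> I" for i
    proof -
      have "zp q \<in> (\<Pi>\<^sub>E i\<in>I. Z i)" using W(3) q by blast
      then have "\<mu> i (zp (x, y) i) \<in> X i" using i xy(1) by (auto simp: Z_def PiE_iff)
      then show ?thesis using zpi(2)[OF xy(2,3) i] i by (simp add: H_simps)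
    qed
    then have "param X \<theta> (\<lambda>i\<in>I. \<theta> i ((x \<otimes>\<^bsub>H\<^esub> y) i)) = (\<lambda>i\<in>I. (x \<otimes>\<^bsub>H\<^esub> y) i)"
      unfolding param_def by (intro restrict_ext) (simp add: dc(5))
    then show "(case q of (x, y) \<Rightarrow> x \<otimes>\<^bsub>H\<^esub> y) = param X \<theta> (B (zp q))"
      unfolding xy(1) Bz[OF xy(2,3)] by (simp add: H_simps(2) cong: restrict_cong)
  qed
qed

text \<open>The argument for multiplication with a single variable: charts around \<open>g\<close>
  and its inverse coincide with the standard one wherever \<open>g i\<close> is
  \<open>\<one>\<close>.\<close>

lemma sat_inv_S0:
  assumes g: "g \<in> carrier H" shows "sat BL S0 BL S0 (\<lambda>x. inv\<^bsub>H\<^esub> x) g"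
proof -
  interpret H: group H by (rule group_H)
  obtain U0 V0 \<kappa>0 where st: "\<forall>i\<in>I. chart_into K (E i) (M i) (L i) (U0 i) (V0 i) (\<kappa>0 i) \<and> \<one>\<^bsub>G i\<^esub> \<in> U0 i \<and> \<kappa>0 i \<one>\<^bsub>G i\<^esub> = \<zero>\<^bsub>L i\<^esub>"
    using standard_charts by (elim exE)
  obtain U V \<kappa> where a: "adm U V \<kappa>" "g \<in> dom U" "\<forall>i\<in>I. g i = \<one>\<^bsub>G i\<^esub> \<longrightarrow> U i = U0 i \<and> V i = V0 i \<and> \<kappa> i = \<kappa>0 i"
    using adm_at[OF st g] by (elim exE conjE)
  have gi: "inv\<^bsub>H\<^esub> g \<in> carrier H" using g by simp
  obtain X Y \<theta> where c: "adm X Y \<theta>" "inv\<^bsub>H\<^esub> g \<in> dom X" "\<forall>i\<in>I. (inv\<^bsub>H\<^esub> g) i = \<one>\<^bsub>G i\<^esub> \<longrightarrow> X i = U0 i \<and> Y i = V0 i \<and> \<theta> i = \<kappa>0 i"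
    using adm_at[OF st gi] by (elim exE conjE)
  note da = chartD[OF a(1)] and dc = chartD[OF c(1)]
  define \<mu> where "\<mu> = (\<lambda>i z. inv\<^bsub>G i\<^esub> (inv_into (U i) (\<kappa> i) z))"
  define Z where "Z = (\<lambda>i. {z \<in> V i. \<mu> i z \<in> X i})"
  define B where "B = (\<lambda>z. \<lambda>i\<in>I. \<theta> i (\<mu> i (z i)))"
  have "smo (box_sum I L) (box_sum I L) (sum_carrier I L \<inter> (\<Pi>\<^sub>E i\<in>I. Z i)) (\<lambda>z. \<lambda>i\<in>I. \<theta> i (\<mu> i (z i)))"
  proof (rule smo_box[where ?J0.0 = "{i \<in> I. g i \<noteq> \<one>\<^bsub>G i\<^esub>}"])
    fix i assume i: "i \<in> I"
    note TL = mfd_tvs(1)[OF tvs_L[OF i]] and Mi = mf[OF i]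
    show "smo (L i) (L i) (Z i) (\<lambda>z. \<theta> i (\<mu> i z))"
      unfolding Z_def
    proof (rule chart_into_smo[OF Mi tvs_L[OF i] admD(1)[OF c(1) i] tvs_L[OF i] da(2)[OF i]])
      fix z assume z: "z \<in> V i"
      have "inv_into (U i) (\<kappa> i) z \<in> carrier (G i)"
        using sat_topspace(2)[OF TL Mi da(8)[OF i z]] tsM[OF i] by simp
      from sat_compose[OF TL Mi Mi lie_groupD(5)[OF lie[OF i] this] da(8)[OF i z]]
      show "sat (L i) (tvs_mfd K (L i)) (E i) (M i) (\<mu> i) z" by (simp add: \<mu>_def)
    qed
  next
    show "finite {i \<in> I. g i \<noteq> \<one>\<^bsub>G i\<^esub>}" using g by (simp add: carrier_H)
    fix i assume "i \<in> I - {i \<in> I. g i \<noteq> \<one>\<^bsub>G i\<^esub>}"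
    then have i: "i \<in> I" and g1: "g i = \<one>\<^bsub>G i\<^esub>" by auto
    interpret Gi: group "G i" by (rule grp[OF i])
    have "(inv\<^bsub>H\<^esub> g) i = \<one>\<^bsub>G i\<^esub>" using i g1 by (simp add: inv_H[OF g])
    then have e: "X i = U0 i" "\<theta> i = \<kappa>0 i" "U i = U0 i" "V i = V0 i" "\<kappa> i = \<kappa>0 i" using a(3) c(3) i g1 by auto
    have s: "\<one>\<^bsub>G i\<^esub> \<in> U0 i" "\<kappa>0 i \<one>\<^bsub>G i\<^esub> = \<zero>\<^bsub>L i\<^esub>" using st i by auto
    have iv: "inv_into (U0 i) (\<kappa>0 i) \<zero>\<^bsub>L i\<^esub> = \<one>\<^bsub>G i\<^esub>" "\<zero>\<^bsub>L i\<^esub> \<in> V0 i"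
      using da(5)[OF i, of "\<one>\<^bsub>G i\<^esub>"] da(3)[OF i, of "\<one>\<^bsub>G i\<^esub>"] s e by simp_all
    show "\<zero>\<^bsub>L i\<^esub> \<in> Z i" "\<theta> i (\<mu> i \<zero>\<^bsub>L i\<^esub>) = \<zero>\<^bsub>L i\<^esub>" using iv s by (simp_all add: Z_def \<mu>_def e)
  qed
  then have sB: "smo BL BL (sum_carrier I L \<inter> (\<Pi>\<^sub>E i\<in>I. Z i)) B" by (simp add: BL_def B_def)
  note TB = mfd_tvs(1)[OF tvs_BL]
  have ci: "\<mu> i (cmap U \<kappa> x i) = (inv\<^bsub>H\<^esub> x) i" if "x \<in> dom U" "i \<in> I" for x i
  proof -
    have "x i \<in> U i" "x \<in> carrier H" using that by (auto simp: dom_def PiE_iff)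
    then show ?thesis using da(5) that by (simp add: \<mu>_def cmap_def inv_H)
  qed
  have zZ: "cmap U \<kappa> g \<in> sum_carrier I L \<inter> (\<Pi>\<^sub>E i\<in>I. Z i)"
  proof -
    have "cmap U \<kappa> g \<in> img V" using adm_maps(5)[OF a(1)] a(2) by blast
    moreover have "\<mu> i (cmap U \<kappa> g i) \<in> X i" if "i \<in> I" for i
      using ci[OF a(2) that] c(2) that by (auto simp: dom_def PiE_iff)
    ultimately show ?thesis by (auto simp: img_def carrier_BL Z_def PiE_iff)
  qed
  have Bz: "B (cmap U \<kappa> x) = (\<lambda>i\<in>I. \<theta> i ((inv\<^bsub>H\<^esub> x) i))" if "x \<in> dom U" for x
    unfolding B_def by (rule restrict_ext) (simp add: ci[OF that])
  note sc = adm_S0(2)[OF a(1,2)]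
  have sw: "sat BL S0 BL (tvs_mfd K BL) (\<lambda>q. B (cmap U \<kappa> q)) g"
    by (rule sat_compose[OF mfd_S0(1) TB TB smo_imp_sat[OF sB zZ] sc])
  have oZ: "openin (mtop (tvs_mfd K BL)) (sum_carrier I L \<inter> (\<Pi>\<^sub>E i\<in>I. Z i))" using smoD(3)[OF sB] by simp
  obtain W where W: "openin (mtop S0) W" "g \<in> W" "cmap U \<kappa> ` W \<subseteq> sum_carrier I L \<inter> (\<Pi>\<^sub>E i\<in>I. Z i)"
    using sat_continuous[where f = "cmap U \<kappa>" and p = g, OF mfd_S0(1) TB sc oZ zZ] by blast
  show ?thesis
  proof (rule sat_into_S0[OF mfd_S0(1) c(1) sw])
    show "B (cmap U \<kappa> g) \<in> img Y" unfolding Bz[OF a(2)] by (rule adm_maps(1)[OF c(1,2)])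
    show "openin (mtop S0) (W \<inter> dom U)" using W(1) adm_S0(1)[OF a(1)] by blast
    show "g \<in> W \<inter> dom U" using W a by simp
    fix x assume x: "x \<in> W \<inter> dom U"
    have "(inv\<^bsub>H\<^esub> x) i \<in> X i" if i: "i \<in> I" for i
    proof -
      have "cmap U \<kappa> x \<in> (\<Pi>\<^sub>E i\<in>I. Z i)" using W(3) x by blast
      then have "\<mu> i (cmap U \<kappa> x i) \<in> X i" using i by (auto simp: Z_def PiE_iff)
      then show ?thesis using ci[OF _ i] x by simp
    qed
    then have "param X \<theta> (\<lambda>i\<in>I. \<theta> i ((inv\<^bsub>H\<^esub> x) i)) = (\<lambda>i\<in>I. (inv\<^bsub>H\<^esub> x) i)"
      unfolding param_def by (intro restrict_ext) (simp add: dc(5))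
    moreover have "x \<in> dom U" "x \<in> carrier H" using x by (auto simp: dom_def)
    ultimately show "inv\<^bsub>H\<^esub> x = param X \<theta> (B (cmap U \<kappa> x))" by (simp add: Bz inv_H cong: restrict_cong)
  qed
qed

lemma lie_group_S0: "lie_group K BL H S0"
  unfolding lie_group_def smooth_map_iff_sat[OF mfd_S0(1) mfd_S0(1)]
    smooth_map_iff_sat[OF mfd_prod(1)[OF mfd_S0(1) mfd_S0(1)] mfd_S0(1)]
  using group_H mfd_S0(1) topspace_S0 sat_mult_S0 sat_inv_S0 by auto

section \<open>Existence and uniqueness of the adapted structure\<close>

definition adapted where
  "adapted S U V \<kappa> \<longleftrightarrow> (\<forall>i\<in>I. chart_into K (E i) (M i) (L i) (U i) (V i) (\<kappa> i) \<and>
     \<one>\<^bsub>G i\<^esub> \<in> U i \<and> \<kappa> i \<one>\<^bsub>G i\<^esub> = \<zero>\<^bsub>L i\<^esub>) \<and>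
     (\<exists>W. openin (mtop S) W \<and>
        diffeomorphism K BL (open_submfd (tvs_mfd K BL) (img V)) BL (open_submfd S W) (param U \<kappa>))"

lemma adm_standard:
  assumes "\<forall>i\<in>I. chart_into K (E i) (M i) (L i) (U i) (V i) (\<kappa> i) \<and> \<one>\<^bsub>G i\<^esub> \<in> U i \<and> \<kappa> i \<one>\<^bsub>G i\<^esub> = \<zero>\<^bsub>L i\<^esub>"
  shows "adm U V \<kappa>"
proof -
  have e: "{i \<in> I. \<not> (\<one>\<^bsub>G i\<^esub> \<in> U i \<and> \<kappa> i \<one>\<^bsub>G i\<^esub> = \<zero>\<^bsub>L i\<^esub>)} = {}" using assms by auto
  show ?thesis unfolding adm_def e using assms by simp
qed

lemma adm_bij:
  assumes a: "adm U V \<kappa>" shows "bij_betw (param U \<kappa>) (img V) (dom U)"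
    "\<And>g. g \<in> dom U \<Longrightarrow> inv_into (img V) (param U \<kappa>) g = cmap U \<kappa> g"
proof -
  note m = adm_maps[OF a]
  show b: "bij_betw (param U \<kappa>) (img V) (dom U)"
    by (rule bij_betw_byWitness[of _ "cmap U \<kappa>"]) (use m in auto)
  show "inv_into (img V) (param U \<kappa>) g = cmap U \<kappa> g" if g: "g \<in> dom U" for g
    using inv_into_f_f[OF bij_betw_imp_inj_on[OF b], of "cmap U \<kappa> g"] m(3)[OF g] m(5) g by auto
qed

text \<open>For standard charts at every index, \<open>dom U\<close> itself serves as the open set
  \<open>W\<close>, and \<open>param\<close> is the inverse of a chart of \<open>S0\<close>.\<close>

lemma adapted_S0: "\<exists>U V \<kappa>. adapted S0 U V \<kappa>"
proof -
  obtain U V \<kappa> where st: "\<forall>i\<in>I. chart_into K (E i) (M i) (L i) (U i) (V i) (\<kappa> i) \<and> \<one>\<^bsub>G i\<^esub> \<in> U i \<and> \<kappa> i \<one>\<^bsub>G i\<^esub> = \<zero>\<^bsub>L i\<^esub>"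
    using standard_charts by (elim exE)
  have a: "adm U V \<kappa>" by (rule adm_standard[OF st])
  note s = adm_S0[OF a] and TB = mfd_tvs(1)[OF tvs_BL]
  have "sat BL S0 BL (tvs_mfd K BL) (inv_into (img V) (param U \<kappa>)) g" if "g \<in> dom U" for g
    by (rule sat_cong[OF mfd_S0(1) TB s(2)[OF that] s(1) that adm_bij(2)[OF a]])
  then have "diffeomorphism K BL (open_submfd (tvs_mfd K BL) (img V)) BL (open_submfd S0 (dom U)) (param U \<kappa>)"
    using diffeomorphism_iff[OF TB mfd_S0(1) _ s(1), of "img V" "param U \<kappa>"] s(3,4) adm_bij(1)[OF a] by simp
  then show ?thesis unfolding adapted_def using st s(1) by blast
qed

text \<open>All families of charts around the identities belong to the atlas of \<open>S0\<close>, so it suffices to compare a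
  given structure with \<open>S0\<close>: near the identity by the chart which it is adapted to, and then
  everywhere by translations.\<close>

lemma adapted_unique:
  assumes S: "lie_group K BL H S" and ad: "adapted S U V \<kappa>"
  shows "S = S0"
proof -
  interpret H: group H by (rule group_H)
  note mS = lie_groupD(2)[OF S] and tS = lie_groupD(3)[OF S] and TB = mfd_tvs(1)[OF tvs_BL]
  have st: "\<forall>i\<in>I. chart_into K (E i) (M i) (L i) (U i) (V i) (\<kappa> i) \<and> \<one>\<^bsub>G i\<^esub> \<in> U i \<and> \<kappa> i \<one>\<^bsub>G i\<^esub> = \<zero>\<^bsub>L i\<^esub>"
    using ad by (simp add: adapted_def)
  have a: "adm U V \<kappa>" by (rule adm_standard[OF st])
  note s = adm_S0[OF a] and m = adm_maps[OF a]
  obtain W where W: "openin (mtop S) W"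
    and df: "diffeomorphism K BL (open_submfd (tvs_mfd K BL) (img V)) BL (open_submfd S W) (param U \<kappa>)"
    using ad unfolding adapted_def by (elim conjE exE)
  have oV: "openin (mtop (tvs_mfd K BL)) (img V)" using s(3) by simp
  have d: "bij_betw (param U \<kappa>) (img V) W" "\<And>x. x \<in> img V \<Longrightarrow> sat BL (tvs_mfd K BL) BL S (param U \<kappa>) x"
    "\<And>g. g \<in> W \<Longrightarrow> sat BL S BL (tvs_mfd K BL) (inv_into (img V) (param U \<kappa>)) g"
    using df diffeomorphism_iff[OF TB mS oV W] by auto
  \<comment> \<open>The open set is forced, being the image of \<open>img V\<close> under
    \<open>param\<close>.\<close>
  have WU: "W = dom U" using d(1) adm_bij(1)[OF a] by (auto simp: bij_betw_def)
  have one: "\<one>\<^bsub>H\<^esub> \<in> dom U"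
  proof -
    have "\<one>\<^bsub>H\<^esub> \<in> (\<Pi>\<^sub>E i\<in>I. U i)" using st by (auto simp: H_simps)
    then show ?thesis by (simp add: dom_def)
  qed
  have c1: "cmap U \<kappa> \<one>\<^bsub>H\<^esub> \<in> img V" using m(5) one by blast
  \<comment> \<open>Near the identity element, the identity map is \<open>param\<close> after its
    own inverse: the inverse is smooth from \<open>S\<close> by adaptedness, and
    \<open>param\<close> is smooth into \<open>S0\<close> by construction. For \<open>i2\<close> the
    two structures change roles.\<close>
  have i1: "sat BL S BL S0 (\<lambda>x. x) \<one>\<^bsub>H\<^esub>"
  proof (rule sat_cong[OF mS mfd_S0(1) sat_compose[OF mS TB mfd_S0(1) _ d(3)]])
    show "sat BL (tvs_mfd K BL) BL S0 (param U \<kappa>) (inv_into (img V) (param U \<kappa>) \<one>\<^bsub>H\<^esub>)"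
      unfolding adm_bij(2)[OF a one] by (rule s(4)[OF c1])
    show "openin (mtop S) W" by (rule W)
    show "\<And>q. q \<in> W \<Longrightarrow> q = param U \<kappa> (inv_into (img V) (param U \<kappa>) q)"
      using bij_betw_inv_into_right[OF d(1)] by simp
  qed (use WU one in auto)
  have i2: "sat BL S0 BL S (\<lambda>x. x) \<one>\<^bsub>H\<^esub>"
  proof (rule sat_cong[OF mfd_S0(1) mS sat_compose[OF mfd_S0(1) TB mS d(2)[OF c1] s(2)[OF one]] s(1) one])
    show "\<And>q. q \<in> dom U \<Longrightarrow> q = param U \<kappa> (cmap U \<kappa> q)" using m(3) by simp
  qed
  \<comment> \<open>Write \<open>x\<close> as \<open>g (g^-1 x)\<close>: translate to the identity
    element within \<open>A\<close>, pass to \<open>B\<close> there, and translate back within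
    \<open>B\<close>. Only translations of the two Lie groups and the germ at \<open>\<one>\<close>
    occur.\<close>
  have transl: "sat BL A BL B (\<lambda>x. x) g"
    if A: "lie_group K BL H A" and B: "lie_group K BL H B" and i: "sat BL A BL B (\<lambda>x. x) \<one>\<^bsub>H\<^esub>" and g: "g \<in> carrier H" for A B g
  proof -
    note mA = lie_groupD(2)[OF A] and mB = lie_groupD(2)[OF B]
    have l: "inv\<^bsub>H\<^esub> g \<otimes>\<^bsub>H\<^esub> g = \<one>\<^bsub>H\<^esub>" using g by simp
    have 1: "sat BL A BL B (\<lambda>x. inv\<^bsub>H\<^esub> g \<otimes>\<^bsub>H\<^esub> x) g"
      by (rule sat_compose[OF mA mA mB _ lie_group_translation[OF A H.inv_closed[OF g] g]]) (use i l in simp)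
    have 2: "sat BL A BL B (\<lambda>x. g \<otimes>\<^bsub>H\<^esub> (inv\<^bsub>H\<^esub> g \<otimes>\<^bsub>H\<^esub> x)) g"
      by (rule sat_compose[OF mA mB mB _ 1]) (use lie_group_translation[OF B g H.one_closed] l in simp)
    show ?thesis
    proof (rule sat_cong[OF mA mB 2])
      show "openin (mtop A) (carrier H)" using openin_topspace[of "mtop A"] lie_groupD(3)[OF A] by simp
      show "\<And>q. q \<in> carrier H \<Longrightarrow> q = g \<otimes>\<^bsub>H\<^esub> (inv\<^bsub>H\<^esub> g \<otimes>\<^bsub>H\<^esub> q)" using g by (simp flip: H.m_assoc)
    qed (rule g)
  qed
  show ?thesis
    by (rule mfd_eqI[OF mS mfd_S0(1)])
      (use tS topspace_S0 transl[OF S lie_group_S0 i1] transl[OF lie_group_S0 S i2] in auto)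
qed

end

theorem proposition7p1:
  fixes K :: "'k vfield"
    and I :: "'i set"
    and G :: "'i \<Rightarrow> 'g monoid"
    and E :: "'i \<Rightarrow> ('k, 'e) tvs"
    and M :: "'i \<Rightarrow> ('g, 'e) mfd"
  assumes "valued_field K"
    and "\<And>i. i \<in> I \<Longrightarrow> lie_group K (E i) (G i) (M i)"
  shows "let L = (\<lambda>i. lie_alg K (E i) (G i) (M i)) in
    \<exists>!S :: ('i \<Rightarrow> 'g, 'i \<Rightarrow> ('g, 'e) tangent) mfd.
    lie_group K (box_sum I L) (sum_group I G) S \<and>
    (\<exists>U V \<kappa>.
       (\<forall>i\<in>I. chart_into K (E i) (M i) (L i) (U i) (V i) (\<kappa> i) \<and>
          \<one>\<^bsub>G i\<^esub> \<in> U i \<and> \<kappa> i \<one>\<^bsub>G i\<^esub> = \<zero>\<^bsub>L i\<^esub>) \<and>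
       (\<exists>W. openin (mtop S) W \<and>
          diffeomorphism K
            (box_sum I L)
            (open_submfd (tvs_mfd K (box_sum I L))
               (carrier (box_sum I L) \<inter> (\<Pi>\<^sub>E i\<in>I. V i)))
            (box_sum I L)
            (open_submfd S W)
            (\<lambda>x. \<lambda>i\<in>I. inv_into (U i) (\<kappa> i) (x i))))"
proof -
  interpret F: lie_group_family K I G E M
    using assms by (simp add: lie_group_family_def lie_group_family_axioms_def)
  have L: "F.L = (\<lambda>i. lie_alg K (E i) (G i) (M i))" by (simp add: F.L_def fun_eq_iff)
  have "\<exists>!S. lie_group K F.BL F.H S \<and> (\<exists>U V \<kappa>. F.adapted S U V \<kappa>)"
    using F.lie_group_S0 F.adapted_S0 F.adapted_unique by (intro ex1I[of _ F.S0]) blast+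
  then show ?thesis
    unfolding Let_def F.adapted_def F.BL_def F.H_def F.img_def F.param_def L .
qed

end
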